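(* Let $P$ be a Hopf algebra over a field $k$, and let $(F^n,\bar{\mathrm{d}})_{n\ge0}$ be a cochain complex of left $P$-comodules whose differential $\bar{\mathrm{d}}:F^n\to F^{n+1}$ is a left $P$-comodule map. Suppose additionally that each $F^n$ has a left $P$-action $P\otimes F^n\to F^n$ which is a left $P$-comodule map. Then there is a spectral sequence beginning with $E_2^{n,m}=H^n_c(P;H^m(F^*,\bar{\mathrm{d}}))$ which converges to $H^s({}^{coP}F,\bar{\mathrm{d}})$.
   Context: All vector spaces and tensor products are over the field $k$. Here $H^m(F^*,\bar{\mathrm{d}})$ carries the left $P$-coaction induced from $F^m$. For a left $P$-comodule $E$ with coaction $\lambda$, ${}^{coP}E=\{e\in E:\lambda(e)=1_P\otimes e\}$, and $({}^{coP}F,\bar{\mathrm{d}})$ is the complex of the ${}^{coP}F^n$. The domain $P\otimes F^n$ of the action carries the tensor product coaction, so the compatibility condition reads $\lambda(p.f)=p_{(1)}f_{[-1]}\otimes p_{(2)}.f_{[0]}$, where $\lambda(f)=f_{[-1]}\otimes f_{[0]}$ and $\Delta(p)=p_{(1)}\otimes p_{(2)}$. No compatibility between the action and $\bar{\mathrm{d}}$ is assumed. Hopf cochain cohomology: for a left $P$-comodule $F$, let $D^n=P^{\otimes n+1}\otimes F$ ($n\ge0$) with the tensor product left coaction, and $$\mathrm{d}(p_0\otimes\cdots\otimes p_n\otimes f)=\sum_{i=0}^{n+1}(-1)^i\,p_0\otimes\cdots\otimes p_{i-1}\otimes1\otimes p_i\otimes\cdots\otimes p_n\otimes f.$$ Then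 $\mathrm{d}$ is $P$-covariant with $\mathrm{d}^2=0$, and $H^n_c(P;F)$ is the cohomology of the complex of coinvariants $({}^{coP}D^n,\mathrm{d})$. Spectral sequences: a spectral sequence (of degree $\ge2$) is a collection of bigraded vector spaces $E_r^{n,m}$, $r\ge2$ (zero if $n<0$ or $m<0$), with differentials $D_r:E_r^{n,m}\to E_r^{n+r,m+1-r}$, $D_r\circ D_r=0$, such that $E_{r+1}^{n,m}$ is isomorphic to the cohomology of $(E_r,D_r)$ at $(n,m)$. For fixed $(n,m)$ the $E_r^{n,m}$ stabilise for large $r$ to $E_\infty^{n,m}$. It converges to $H^*$ if $\bigoplus_{i}E_\infty^{i,s-i}\cong H^s$ for all $s$. *)

theory Defs
  imports "HOL-Algebra.Module" "HOL-Algebra.QuotRing"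
begin

section \<open>Linear algebra over a ring record\<close>

text \<open>
  Vector spaces over a field \<open>K\<close> are \<^locale>\<open>module\<close>s over \<open>K\<close>.  The fields \<^const>\<open>mult\<close> and
  \<^const>\<open>one\<close> of a module record carry no meaning and are left undefined in constructions.
\<close>

definition linear_maps ::
  "('k, 'a) ring_scheme \<Rightarrow> ('k, 'v, 'b) module_scheme \<Rightarrow> ('k, 'w, 'c) module_scheme \<Rightarrow> ('v \<Rightarrow> 'w) set"
  where "linear_maps K V W = {f \<in> carrier V \<rightarrow> carrier W.
     (\<forall>x\<in>carrier V. \<forall>y\<in>carrier V. f (x \<oplus>\<^bsub>V\<^esub> y) = f x \<oplus>\<^bsub>W\<^esub> f y) \<and>
     (\<forall>a\<in>carrier K. \<forall>x\<in>carrier V. f (a \<odot>\<^bsub>V\<^esub> x) = a \<odot>\<^bsub>W\<^esub> f x)}"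

definition linearly_isomorphic ::
  "('k, 'a) ring_scheme \<Rightarrow> ('k, 'v, 'b) module_scheme \<Rightarrow> ('k, 'w, 'c) module_scheme \<Rightarrow> bool"
  where "linearly_isomorphic K V W \<longleftrightarrow>
     (\<exists>f \<in> linear_maps K V W. bij_betw f (carrier V) (carrier W))"

definition linear_span :: "('k, 'a) ring_scheme \<Rightarrow> ('k, 'v, 'b) module_scheme \<Rightarrow> 'v set \<Rightarrow> 'v set"
  where "linear_span K V S = \<Inter>{N. submodule N K V \<and> S \<subseteq> N}"

text \<open>
  As in \<^const>\<open>FactRing\<close>, the elements of the quotient are the cosets.  The scalar multiple of a
  coset is not the pointwise one, which would be wrong for the scalar zero.
\<close>

definition quotient_module :: "('k, 'v, 'b) module_scheme \<Rightarrow> 'v set \<Rightarrow> ('k, 'v set) module"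
  where "quotient_module V N =
     \<lparr>carrier = a_rcosets\<^bsub>V\<^esub> N, mult = undefined, one = undefined,
      zero = N, add = (<+>\<^bsub>V\<^esub>), smult = (\<lambda>a C. \<Union>x\<in>C. N +>\<^bsub>V\<^esub> (a \<odot>\<^bsub>V\<^esub> x))\<rparr>"

definition direct_sum :: "('i \<Rightarrow> ('k, 'v, 'b) module_scheme) \<Rightarrow> ('k, 'i \<Rightarrow> 'v) module"
  where "direct_sum V =
     \<lparr>carrier = {x. (\<forall>i. x i \<in> carrier (V i)) \<and> finite {i. x i \<noteq> \<zero>\<^bsub>V i\<^esub>}},
      mult = undefined, one = undefined,
      zero = (\<lambda>i. \<zero>\<^bsub>V i\<^esub>), add = (\<lambda>x y i. x i \<oplus>\<^bsub>V i\<^esub> y i), smult = (\<lambda>a x i. a \<odot>\<^bsub>V i\<^esub> x i)\<rparr>"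

definition free_module :: "('k, 'a) ring_scheme \<Rightarrow> 'x set \<Rightarrow> ('k, 'x \<Rightarrow> 'k) module"
  where "free_module K X =
     \<lparr>carrier = {c. range c \<subseteq> carrier K \<and> {x. c x \<noteq> \<zero>\<^bsub>K\<^esub>} \<subseteq> X \<and> finite {x. c x \<noteq> \<zero>\<^bsub>K\<^esub>}},
      mult = undefined, one = undefined,
      zero = (\<lambda>x. \<zero>\<^bsub>K\<^esub>), add = (\<lambda>c d x. c x \<oplus>\<^bsub>K\<^esub> d x), smult = (\<lambda>a c x. a \<otimes>\<^bsub>K\<^esub> c x)\<rparr>"

definition basis_vector :: "('k, 'a) ring_scheme \<Rightarrow> 'x \<Rightarrow> 'x \<Rightarrow> 'k"
  where "basis_vector K x = (\<lambda>y. if y = x then \<one>\<^bsub>K\<^esub> else \<zero>\<^bsub>K\<^esub>)"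


section \<open>The tensor products \<open>P\<^sup>\<otimes>\<^sup>n \<otimes> V\<close>\<close>

text \<open>
  The tensor product of \<open>n\<close> copies of \<open>P\<close> and one copy of \<open>V\<close> is the free module on
  \<open>P\<^sup>n \<times> V\<close> modulo multilinearity.  The tuple in \<open>P\<^sup>n\<close> is a list of length \<open>n\<close>, so that the type
  of the tensor product does not depend on \<open>n\<close>.  In particular \<open>P \<otimes> P\<close> is
  \<open>tensor K P 1 P\<close> and \<open>P \<otimes> V\<close> is \<open>tensor K P 1 V\<close>.
\<close>

definition tuples ::
  "('k, 'p, 'b) module_scheme \<Rightarrow> nat \<Rightarrow> ('k, 'v, 'c) module_scheme \<Rightarrow> ('p list \<times> 'v) set"
  where "tuples P n V = {(ps, v). length ps = n \<and> set ps \<subseteq> carrier P \<and> v \<in> carrier V}"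

abbreviation free_tuples ::
  "('k, 'a) ring_scheme \<Rightarrow> ('k, 'p, 'b) module_scheme \<Rightarrow> nat \<Rightarrow> ('k, 'v, 'c) module_scheme
     \<Rightarrow> ('k, 'p list \<times> 'v \<Rightarrow> 'k) module"
  where "free_tuples K P n V \<equiv> free_module K (tuples P n V)"

definition multilinear_relations ::
  "('k, 'a) ring_scheme \<Rightarrow> ('k, 'p, 'b) module_scheme \<Rightarrow> nat \<Rightarrow> ('k, 'v, 'c) module_scheme
     \<Rightarrow> ('p list \<times> 'v \<Rightarrow> 'k) set"
  where "multilinear_relations K P n V =
    (let M = free_tuples K P n V; e = basis_vector K in
      {e (ps[i := p \<oplus>\<^bsub>P\<^esub> q], v) \<ominus>\<^bsub>M\<^esub> (e (ps[i := p], v) \<oplus>\<^bsub>M\<^esub> e (ps[i := q], v)) | ps v i p q.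
          (ps, v) \<in> tuples P n V \<and> i < n \<and> p \<in> carrier P \<and> q \<in> carrier P} \<union>
      {e (ps[i := a \<odot>\<^bsub>P\<^esub> p], v) \<ominus>\<^bsub>M\<^esub> (a \<odot>\<^bsub>M\<^esub> e (ps[i := p], v)) | ps v i a p.
          (ps, v) \<in> tuples P n V \<and> i < n \<and> a \<in> carrier K \<and> p \<in> carrier P} \<union>
      {e (ps, v \<oplus>\<^bsub>V\<^esub> w) \<ominus>\<^bsub>M\<^esub> (e (ps, v) \<oplus>\<^bsub>M\<^esub> e (ps, w)) | ps v w.
          (ps, v) \<in> tuples P n V \<and> w \<in> carrier V} \<union>
      {e (ps, a \<odot>\<^bsub>V\<^esub> v) \<ominus>\<^bsub>M\<^esub> (a \<odot>\<^bsub>M\<^esub> e (ps, v)) | ps v a.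
          (ps, v) \<in> tuples P n V \<and> a \<in> carrier K})"

definition null_tensors ::
  "('k, 'a) ring_scheme \<Rightarrow> ('k, 'p, 'b) module_scheme \<Rightarrow> nat \<Rightarrow> ('k, 'v, 'c) module_scheme
     \<Rightarrow> ('p list \<times> 'v \<Rightarrow> 'k) set"
  where "null_tensors K P n V =
    linear_span K (free_tuples K P n V) (multilinear_relations K P n V)"

definition tensor ::
  "('k, 'a) ring_scheme \<Rightarrow> ('k, 'p, 'b) module_scheme \<Rightarrow> nat \<Rightarrow> ('k, 'v, 'c) module_scheme
     \<Rightarrow> ('k, ('p list \<times> 'v \<Rightarrow> 'k) set) module"
  where "tensor K P n V = quotient_module (free_tuples K P n V) (null_tensors K P n V)"

text \<open>\<open>pure_tensor K P V [p\<^sub>1, \<dots>, p\<^sub>n] v\<close> is \<open>p\<^sub>1 \<otimes> \<cdots> \<otimes> p\<^sub>n \<otimes> v\<close>.\<close>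

definition pure_tensor ::
  "('k, 'a) ring_scheme \<Rightarrow> ('k, 'p, 'b) module_scheme \<Rightarrow> ('k, 'v, 'c) module_scheme
     \<Rightarrow> 'p list \<Rightarrow> 'v \<Rightarrow> ('p list \<times> 'v \<Rightarrow> 'k) set"
  where "pure_tensor K P V ps v =
    null_tensors K P (length ps) V +>\<^bsub>free_tuples K P (length ps) V\<^esub> basis_vector K (ps, v)"

text \<open>
  For a multilinear map \<open>\<phi>\<close> into \<open>W\<close>, \<open>tensor_lift K W \<phi>\<close> is the induced linear map on the tensor
  product: it writes the argument as some linear combination of pure tensors and replaces each
  \<open>p\<^sub>1 \<otimes> \<cdots> \<otimes> p\<^sub>n \<otimes> v\<close> by \<open>\<phi> [p\<^sub>1, \<dots>, p\<^sub>n] v\<close>.  Multilinearity of \<open>\<phi>\<close> makes the result independent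
  of the chosen representation.
\<close>

definition tensor_lift ::
  "('k, 'a) ring_scheme \<Rightarrow> ('k, 'w, 'b) module_scheme \<Rightarrow> ('p list \<Rightarrow> 'v \<Rightarrow> 'w)
     \<Rightarrow> ('p list \<times> 'v \<Rightarrow> 'k) set \<Rightarrow> 'w"
  where "tensor_lift K W \<phi> t =
    (let c = (SOME c. c \<in> t)
     in \<Oplus>\<^bsub>W\<^esub>x\<in>{x. c x \<noteq> \<zero>\<^bsub>K\<^esub>}. c x \<odot>\<^bsub>W\<^esub> \<phi> (fst x) (snd x))"

text \<open>
  Sweedler notation: for \<open>t \<in> P \<otimes> V\<close> written as \<open>t\<^sub>1 \<otimes> t\<^sub>2\<close> with summation understood,
  \<open>sweedler K W t \<phi>\<close> is \<open>\<phi> t\<^sub>1 t\<^sub>2 \<in> W\<close>, summation understood.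
\<close>

definition sweedler ::
  "('k, 'a) ring_scheme \<Rightarrow> ('k, 'w, 'b) module_scheme \<Rightarrow> ('p list \<times> 'v \<Rightarrow> 'k) set
     \<Rightarrow> ('p \<Rightarrow> 'v \<Rightarrow> 'w) \<Rightarrow> 'w"
  where "sweedler K W t \<phi> = tensor_lift K W (\<lambda>ps v. \<phi> (hd ps) v) t"

text \<open>The map \<open>id \<otimes> g : P \<otimes> V \<rightarrow> P \<otimes> W\<close>.\<close>

definition id_tensor ::
  "('k, 'a) ring_scheme \<Rightarrow> ('k, 'p, 'b) module_scheme \<Rightarrow> ('k, 'w, 'c) module_scheme
     \<Rightarrow> ('v \<Rightarrow> 'w) \<Rightarrow> ('p list \<times> 'v \<Rightarrow> 'k) set \<Rightarrow> ('p list \<times> 'w \<Rightarrow> 'k) set"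
  where "id_tensor K P W g t = sweedler K (tensor K P 1 W) t (\<lambda>p v. pure_tensor K P W [p] (g v))"


section \<open>Hopf algebras and their comodules\<close>

record ('k, 'p) hopf_structure = "('k, 'p) module" +
  comult :: "'p \<Rightarrow> ('p list \<times> 'p \<Rightarrow> 'k) set"
  counit :: "'p \<Rightarrow> 'k"
  antipode :: "'p \<Rightarrow> 'p"

definition ground_module :: "('k, 'a) ring_scheme \<Rightarrow> ('k, 'k) module"
  where "ground_module K =
     \<lparr>carrier = carrier K, mult = mult K, one = \<one>\<^bsub>K\<^esub>, zero = \<zero>\<^bsub>K\<^esub>,
      add = add K, smult = mult K\<rparr>"

locale hopf_algebra = K: field K + P: ring P + module K P
  for K :: "('k, 'a) ring_scheme" (structure)
  and P :: "('k, 'p, 'b) hopf_structure_scheme" (structure) +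
  assumes smult_mult_left: "\<lbrakk>a \<in> carrier K; p \<in> carrier P; q \<in> carrier P\<rbrakk> \<Longrightarrow>
      (a \<odot>\<^bsub>P\<^esub> p) \<otimes>\<^bsub>P\<^esub> q = a \<odot>\<^bsub>P\<^esub> (p \<otimes>\<^bsub>P\<^esub> q)"
    and smult_mult_right: "\<lbrakk>a \<in> carrier K; p \<in> carrier P; q \<in> carrier P\<rbrakk> \<Longrightarrow>
      p \<otimes>\<^bsub>P\<^esub> (a \<odot>\<^bsub>P\<^esub> q) = a \<odot>\<^bsub>P\<^esub> (p \<otimes>\<^bsub>P\<^esub> q)"
    and comult_linear: "comult P \<in> linear_maps K P (tensor K P 1 P)"
    and counit_linear: "counit P \<in> linear_maps K P (ground_module K)"
    and antipode_linear: "antipode P \<in> linear_maps K P P"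
    and comult_coassoc: "p \<in> carrier P \<Longrightarrow>
      sweedler K (tensor K P 2 P) (comult P p) (\<lambda>a b.
        sweedler K (tensor K P 2 P) (comult P a) (\<lambda>a1 a2. pure_tensor K P P [a1, a2] b)) =
      sweedler K (tensor K P 2 P) (comult P p) (\<lambda>a b.
        sweedler K (tensor K P 2 P) (comult P b) (\<lambda>b1 b2. pure_tensor K P P [a, b1] b2))"
    and counit_left: "p \<in> carrier P \<Longrightarrow>
      sweedler K P (comult P p) (\<lambda>a b. counit P a \<odot>\<^bsub>P\<^esub> b) = p"
    and counit_right: "p \<in> carrier P \<Longrightarrow>
      sweedler K P (comult P p) (\<lambda>a b. counit P b \<odot>\<^bsub>P\<^esub> a) = p"
    and comult_one: "comult P \<one>\<^bsub>P\<^esub> = pure_tensor K P P [\<one>\<^bsub>P\<^esub>] \<one>\<^bsub>P\<^esub>"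
    and comult_mult: "\<lbrakk>p \<in> carrier P; q \<in> carrier P\<rbrakk> \<Longrightarrow>
      comult P (p \<otimes>\<^bsub>P\<^esub> q) =
      sweedler K (tensor K P 1 P) (comult P p) (\<lambda>p1 p2.
        sweedler K (tensor K P 1 P) (comult P q) (\<lambda>q1 q2.
          pure_tensor K P P [p1 \<otimes>\<^bsub>P\<^esub> q1] (p2 \<otimes>\<^bsub>P\<^esub> q2)))"
    and counit_one: "counit P \<one>\<^bsub>P\<^esub> = \<one>\<^bsub>K\<^esub>"
    and counit_mult: "\<lbrakk>p \<in> carrier P; q \<in> carrier P\<rbrakk> \<Longrightarrow>
      counit P (p \<otimes>\<^bsub>P\<^esub> q) = counit P p \<otimes>\<^bsub>K\<^esub> counit P q"
    and antipode_left: "p \<in> carrier P \<Longrightarrow>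
      sweedler K P (comult P p) (\<lambda>a b. antipode P a \<otimes>\<^bsub>P\<^esub> b) = counit P p \<odot>\<^bsub>P\<^esub> \<one>\<^bsub>P\<^esub>"
    and antipode_right: "p \<in> carrier P \<Longrightarrow>
      sweedler K P (comult P p) (\<lambda>a b. a \<otimes>\<^bsub>P\<^esub> antipode P b) = counit P p \<odot>\<^bsub>P\<^esub> \<one>\<^bsub>P\<^esub>"

definition left_comodule ::
  "('k, 'a) ring_scheme \<Rightarrow> ('k, 'p, 'b) hopf_structure_scheme \<Rightarrow> ('k, 'v, 'c) module_scheme
     \<Rightarrow> ('v \<Rightarrow> ('p list \<times> 'v \<Rightarrow> 'k) set) \<Rightarrow> bool"
  where "left_comodule K P V \<rho>V \<longleftrightarrow>
    module K V \<and> \<rho>V \<in> linear_maps K V (tensor K P 1 V) \<and>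
    (\<forall>v\<in>carrier V.
      sweedler K (tensor K P 2 V) (\<rho>V v) (\<lambda>p w.
        sweedler K (tensor K P 2 V) (comult P p) (\<lambda>p1 p2. pure_tensor K P V [p1, p2] w)) =
      sweedler K (tensor K P 2 V) (\<rho>V v) (\<lambda>p w.
        sweedler K (tensor K P 2 V) (\<rho>V w) (\<lambda>q u. pure_tensor K P V [p, q] u))) \<and>
    (\<forall>v\<in>carrier V. sweedler K V (\<rho>V v) (\<lambda>p w. counit P p \<odot>\<^bsub>V\<^esub> w) = v)"

definition comodule_map ::
  "('k, 'a) ring_scheme \<Rightarrow> ('k, 'p, 'b) hopf_structure_scheme
     \<Rightarrow> ('k, 'v, 'c) module_scheme \<Rightarrow> ('v \<Rightarrow> ('p list \<times> 'v \<Rightarrow> 'k) set)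
     \<Rightarrow> ('k, 'w, 'd) module_scheme \<Rightarrow> ('w \<Rightarrow> ('p list \<times> 'w \<Rightarrow> 'k) set) \<Rightarrow> ('v \<Rightarrow> 'w) \<Rightarrow> bool"
  where "comodule_map K P V \<rho>V W \<rho>W g \<longleftrightarrow>
    g \<in> linear_maps K V W \<and> (\<forall>v\<in>carrier V. \<rho>W (g v) = id_tensor K P W g (\<rho>V v))"

definition coinvariants ::
  "('k, 'a) ring_scheme \<Rightarrow> ('k, 'p, 'b) hopf_structure_scheme \<Rightarrow> ('k, 'v, 'c) module_scheme
     \<Rightarrow> ('v \<Rightarrow> ('p list \<times> 'v \<Rightarrow> 'k) set) \<Rightarrow> ('k, 'v, 'c) module_scheme"
  where "coinvariants K P V \<rho>V =
    V\<lparr>carrier := {v \<in> carrier V. \<rho>V v = pure_tensor K P V [\<one>\<^bsub>P\<^esub>] v}\<rparr>"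

text \<open>
  \<open>sweedler_tuple K P W \<rho>V [p\<^sub>1, \<dots>, p\<^sub>n] v \<Phi>\<close> is
  \<open>\<Phi> (p\<^sub>1\<^sub>(\<^sub>1\<^sub>) \<cdots> p\<^sub>n\<^sub>(\<^sub>1\<^sub>) v\<^sub>[\<^sub>-\<^sub>1\<^sub>]) [p\<^sub>1\<^sub>(\<^sub>2\<^sub>), \<dots>, p\<^sub>n\<^sub>(\<^sub>2\<^sub>)] v\<^sub>[\<^sub>0\<^sub>] \<in> W\<close>, summation understood.
\<close>

primrec sweedler_tuple ::
  "('k, 'a) ring_scheme \<Rightarrow> ('k, 'p, 'b) hopf_structure_scheme \<Rightarrow> ('k, 'w, 'c) module_scheme
     \<Rightarrow> ('v \<Rightarrow> ('p list \<times> 'v \<Rightarrow> 'k) set) \<Rightarrow> 'p list \<Rightarrow> 'v \<Rightarrow> ('p \<Rightarrow> 'p list \<Rightarrow> 'v \<Rightarrow> 'w) \<Rightarrow> 'w"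
  where
    "sweedler_tuple K P W \<rho>V [] v \<Phi> = sweedler K W (\<rho>V v) (\<lambda>q u. \<Phi> q [] u)"
  | "sweedler_tuple K P W \<rho>V (p # ps) v \<Phi> =
       sweedler K W (comult P p) (\<lambda>p1 p2.
         sweedler_tuple K P W \<rho>V ps v (\<lambda>q qs u. \<Phi> (p1 \<otimes>\<^bsub>P\<^esub> q) (p2 # qs) u))"

text \<open>The tensor product coaction on \<open>P\<^sup>\<otimes>\<^sup>n \<otimes> V\<close>, with values in \<open>P \<otimes> (P\<^sup>\<otimes>\<^sup>n \<otimes> V)\<close>.\<close>

definition tensor_coaction ::
  "('k, 'a) ring_scheme \<Rightarrow> ('k, 'p, 'b) hopf_structure_scheme \<Rightarrow> nat \<Rightarrow> ('k, 'v, 'c) module_scheme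
     \<Rightarrow> ('v \<Rightarrow> ('p list \<times> 'v \<Rightarrow> 'k) set) \<Rightarrow> ('p list \<times> 'v \<Rightarrow> 'k) set
     \<Rightarrow> ('p list \<times> ('p list \<times> 'v \<Rightarrow> 'k) set \<Rightarrow> 'k) set"
  where "tensor_coaction K P n V \<rho>V =
    (let D = tensor K P n V; W = tensor K P 1 D in
      tensor_lift K W (\<lambda>ps v.
        sweedler_tuple K P W \<rho>V ps v (\<lambda>q qs u. pure_tensor K P D [q] (pure_tensor K P V qs u))))"

text \<open>A left action as a linear map \<open>P \<otimes> V \<rightarrow> V\<close>.\<close>

definition left_action ::
  "('k, 'a) ring_scheme \<Rightarrow> ('k, 'p, 'b) module_scheme \<Rightarrow> ('k, 'v, 'c) module_scheme
     \<Rightarrow> (('p list \<times> 'v \<Rightarrow> 'k) set \<Rightarrow> 'v) \<Rightarrow> bool"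
  where "left_action K P V act \<longleftrightarrow>
    act \<in> linear_maps K (tensor K P 1 V) V \<and>
    (\<forall>v\<in>carrier V. act (pure_tensor K P V [\<one>\<^bsub>P\<^esub>] v) = v) \<and>
    (\<forall>p\<in>carrier P. \<forall>q\<in>carrier P. \<forall>v\<in>carrier V.
      act (pure_tensor K P V [p \<otimes>\<^bsub>P\<^esub> q] v) =
      act (pure_tensor K P V [p] (act (pure_tensor K P V [q] v))))"


section \<open>Cohomology\<close>

definition cocycles :: "(nat \<Rightarrow> ('k, 'v, 'b) module_scheme) \<Rightarrow> (nat \<Rightarrow> 'v \<Rightarrow> 'v) \<Rightarrow> nat \<Rightarrow> 'v set"
  where "cocycles C d n = a_kernel (C n) (C (Suc n)) (d n)"

definition coboundaries :: "(nat \<Rightarrow> ('k, 'v, 'b) module_scheme) \<Rightarrow> (nat \<Rightarrow> 'v \<Rightarrow> 'v) \<Rightarrow> nat \<Rightarrow> 'v set"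
  where "coboundaries C d n =
    (case n of 0 \<Rightarrow> {\<zero>\<^bsub>C 0\<^esub>} | Suc m \<Rightarrow> d m ` carrier (C m))"

definition cohomology ::
  "(nat \<Rightarrow> ('k, 'v, 'b) module_scheme) \<Rightarrow> (nat \<Rightarrow> 'v \<Rightarrow> 'v) \<Rightarrow> nat \<Rightarrow> ('k, 'v set) module"
  where "cohomology C d n =
    quotient_module ((C n)\<lparr>carrier := cocycles C d n\<rparr>) (coboundaries C d n)"

text \<open>
  The coaction induced on the cohomology of a complex of comodules.  For a cocycle \<open>z\<close>, \<open>\<rho>C n z\<close>
  lies in the image of the (injective) map \<open>P \<otimes> Z \<rightarrow> P \<otimes> C\<^sup>n\<close>, where \<open>Z\<close> are the cocycles;
  the class of \<open>z\<close> goes to the image under \<open>P \<otimes> Z \<rightarrow> P \<otimes> H\<^sup>n\<close> of the preimage of \<open>\<rho>C n z\<close>.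
\<close>

definition cohomology_coaction ::
  "('k, 'a) ring_scheme \<Rightarrow> ('k, 'p, 'b) hopf_structure_scheme \<Rightarrow> (nat \<Rightarrow> ('k, 'v, 'c) module_scheme)
     \<Rightarrow> (nat \<Rightarrow> 'v \<Rightarrow> ('p list \<times> 'v \<Rightarrow> 'k) set) \<Rightarrow> (nat \<Rightarrow> 'v \<Rightarrow> 'v) \<Rightarrow> nat
     \<Rightarrow> 'v set \<Rightarrow> ('p list \<times> 'v set \<Rightarrow> 'k) set"
  where "cohomology_coaction K P C \<rho>C d n h =
    (let Z = (C n)\<lparr>carrier := cocycles C d n\<rparr>; B = coboundaries C d n in
      THE t. \<exists>z\<in>h. \<exists>y\<in>carrier (tensor K P 1 Z).
        id_tensor K P (C n) (\<lambda>z. z) y = \<rho>C n z \<and>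
        t = id_tensor K P (cohomology C d n) (\<lambda>z. B +>\<^bsub>C n\<^esub> z) y)"

text \<open>The complex \<open>D\<^sup>n = P\<^sup>\<otimes>\<^sup>n\<^sup>+\<^sup>1 \<otimes> V\<close> and its cohomology of coinvariants.\<close>

definition hopf_differential ::
  "('k, 'a) ring_scheme \<Rightarrow> ('k, 'p, 'b) hopf_structure_scheme \<Rightarrow> ('k, 'v, 'c) module_scheme \<Rightarrow> nat
     \<Rightarrow> ('p list \<times> 'v \<Rightarrow> 'k) set \<Rightarrow> ('p list \<times> 'v \<Rightarrow> 'k) set"
  where "hopf_differential K P V n =
    (let D' = tensor K P (n + 2) V in
      tensor_lift K D' (\<lambda>ps v.
        \<Oplus>\<^bsub>D'\<^esub>i\<in>{0..n + 1}. ((\<ominus>\<^bsub>K\<^esub> \<one>\<^bsub>K\<^esub>) [^]\<^bsub>K\<^esub> i) \<odot>\<^bsub>D'\<^esub>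
          pure_tensor K P V (take i ps @ \<one>\<^bsub>P\<^esub> # drop i ps) v))"

definition hopf_cohomology ::
  "('k, 'a) ring_scheme \<Rightarrow> ('k, 'p, 'b) hopf_structure_scheme \<Rightarrow> ('k, 'v, 'c) module_scheme
     \<Rightarrow> ('v \<Rightarrow> ('p list \<times> 'v \<Rightarrow> 'k) set) \<Rightarrow> nat \<Rightarrow> ('k, ('p list \<times> 'v \<Rightarrow> 'k) set set) module"
  where "hopf_cohomology K P V \<rho>V =
    cohomology
      (\<lambda>n. coinvariants K P (tensor K P (n + 1) V) (tensor_coaction K P (n + 1) V \<rho>V))
      (hopf_differential K P V)"


section \<open>Spectral sequences\<close>

text \<open>Pages of index below 2 are irrelevant; \<open>D r n m\<close> is \<open>D\<^sub>r\<close> on \<open>E\<^sub>r\<^sup>n\<^sup>,\<^sup>m\<close>.\<close>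

definition spectral_sequence ::
  "('k, 'a) ring_scheme \<Rightarrow> (nat \<Rightarrow> int \<Rightarrow> int \<Rightarrow> ('k, 'e, 'b) module_scheme)
     \<Rightarrow> (nat \<Rightarrow> int \<Rightarrow> int \<Rightarrow> 'e \<Rightarrow> 'e) \<Rightarrow> bool"
  where "spectral_sequence K E D \<longleftrightarrow>
    (\<forall>r\<ge>2. \<forall>n m.
      module K (E r n m) \<and>
      (n < 0 \<or> m < 0 \<longrightarrow> carrier (E r n m) = {\<zero>\<^bsub>E r n m\<^esub>}) \<and>
      D r n m \<in> linear_maps K (E r n m) (E r (n + int r) (m + 1 - int r)) \<and>
      (\<forall>x\<in>carrier (E r n m). D r (n + int r) (m + 1 - int r) (D r n m x) =
        \<zero>\<^bsub>E r (n + int r + int r) (m + 1 - int r + 1 - int r)\<^esub>) \<and>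
      linearly_isomorphic K (E (Suc r) n m)
        (quotient_module
          ((E r n m)\<lparr>carrier := a_kernel (E r n m) (E r (n + int r) (m + 1 - int r)) (D r n m)\<rparr>)
          (D r (n - int r) (m - 1 + int r) ` carrier (E r (n - int r) (m - 1 + int r)))))"

definition limit_page ::
  "('k, 'a) ring_scheme \<Rightarrow> (nat \<Rightarrow> int \<Rightarrow> int \<Rightarrow> ('k, 'e, 'b) module_scheme)
     \<Rightarrow> (int \<Rightarrow> int \<Rightarrow> ('k, 'e, 'b) module_scheme) \<Rightarrow> bool"
  where "limit_page K E Einf \<longleftrightarrow>
    (\<forall>n m. module K (Einf n m) \<and> (\<exists>R. \<forall>r\<ge>R. linearly_isomorphic K (E r n m) (Einf n m)))"

definition converges_to ::
  "('k, 'a) ring_scheme \<Rightarrow> (nat \<Rightarrow> int \<Rightarrow> int \<Rightarrow> ('k, 'e, 'b) module_scheme)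
     \<Rightarrow> (nat \<Rightarrow> ('k, 'h, 'c) module_scheme) \<Rightarrow> bool"
  where "converges_to K E H \<longleftrightarrow>
    (\<exists>Einf. limit_page K E Einf \<and>
      (\<forall>s. linearly_isomorphic K (direct_sum (\<lambda>i. Einf i (int s - i))) (H s)))"

end

theory Submission
  imports Defs
begin

text \<open>
  Consider the double complex of the coinvariants of \<open>P\<^sup>\<otimes>\<^sup>n\<^sup>+\<^sup>1 \<otimes> F\<^sup>m\<close>, with horizontal differential \<open>d\<close> and
  vertical differential \<open>dbar\<close>. The covariant action of \<open>P\<close> on \<open>F\<^sup>m\<close> contracts each row equivariantly,
  so the rows are exact except in column zero, where the kernel is the space of coinvariants of \<open>F\<^sup>m\<close>;
  hence the total cohomology is that of the complex of coinvariants of \<open>F\<close>. On the other hand the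
  antipode identifies the coinvariants of \<open>P \<otimes> X\<close> with \<open>X\<close>, naturally in linear maps compatible with the
  coactions, so passing to the coinvariants of \<open>P\<^sup>\<otimes>\<^sup>n\<^sup>+\<^sup>1 \<otimes> _\<close> is exact and the vertical cohomology consists of
  the coinvariants of \<open>P\<^sup>\<otimes>\<^sup>n\<^sup>+\<^sup>1 \<otimes> H\<^sup>m(F)\<close>. The spectral sequence is that of the filtration by columns; since
  subspaces have complements, every page is realised as a subspace of the second one.
\<close>

section \<open>Linear algebra over a field\<close>

text \<open>The obstacle is that the available splittings are only linear: a projection of
  \<open>F m\<close> onto its cocycles, or a section of the passage to cohomology, is in general not
  a comodule map. The compatibility lemmas are therefore stated for triples
  \<open>h : U -> W\<close>, \<open>f : U -> V\<close>, \<open>g : V -> W\<close> such that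
  \<open>\<rho>W (h u)\<close> is the image of \<open>\<rho>V (f u)\<close> under
  \<open>id \<otimes> g\<close>. Such triples exist with \<open>f\<close> a linear section, and
  \<open>tiota\<close> carries them over to coinvariants. That the values of \<open>tiota\<close>
  are coinvariant usually rests on the antipode reversing the comultiplication. Here it follows from
  an injectivity argument that uses the two antipode laws directly. The pages are subspaces because
  one type has to serve all \<open>r\<close>, whereas iterated quotients would change it, and
  because the second page has to be equal, not just isomorphic, to the Hopf cohomology. Tensor
  identities are proved by recursion on the number of factors \<open>P\<close>, so the list-based
  coaction and differential are each replaced by a recursive version.\<close>

lemma (in abelian_group) minus_eq_zero_iff:
  assumes "x \<in> carrier G" "y \<in> carrier G"
  shows "x \<ominus> y = \<zero> \<longleftrightarrow> x = y"
proof
  assume "x \<ominus> y = \<zero>"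
  then have "x = \<ominus> (\<ominus> y)" using assms by (intro minus_equality[symmetric]) (simp_all add: a_minus_def)
  then show "x = y" using assms by simp
next
  assume "x = y" then show "x \<ominus> y = \<zero>" using assms by (simp add: a_minus_def r_neg)
qed

lemma (in abelian_group) minus_self [simp]: "x \<in> carrier G \<Longrightarrow> x \<ominus> x = \<zero>"
  by (simp add: minus_eq_zero_iff)

lemma (in abelian_group) minus_zero_right [simp]: "x \<in> carrier G \<Longrightarrow> x \<ominus> \<zero> = x"
  using local.add.inv_one by (simp add: a_minus_def a_inv_def)

lemma (in abelian_group) minus_add_cancel:
  assumes "x \<in> carrier G" "y \<in> carrier G"
  shows "x \<ominus> y \<oplus> y = x"
  using assms by (simp add: a_minus_def a_assoc l_neg)

lemma (in abelian_group) minus_add_minus: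
  assumes "x \<in> carrier G" "y \<in> carrier G" "z \<in> carrier G"
  shows "x \<ominus> y \<oplus> (y \<ominus> z) = x \<ominus> z"
  using assms by (simp add: a_minus_def a_assoc r_neg1 r_neg2)

context field
begin

abbreviation "lin \<equiv> linear_maps R"

text \<open>Negatives are multiples by \<open>\<ominus> \<one>\<close>, and zero is the multiple by
  \<open>\<zero>\<close> of any member, so the subgroup axioms inside \<open>submodule\<close>
  follow from closure under sums and scalars.\<close>

lemma submodule_iff:
  assumes "module R V"
  shows "submodule N R V \<longleftrightarrow> N \<subseteq> carrier V \<and> \<zero>\<^bsub>V\<^esub> \<in> N \<and> (\<forall>x\<in>N. \<forall>y\<in>N. x \<oplus>\<^bsub>V\<^esub> y \<in> N) \<and>
    (\<forall>a\<in>carrier R. \<forall>x\<in>N. a \<odot>\<^bsub>V\<^esub> x \<in> N)"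
proof -
  interpret V: module R V by fact
  show ?thesis
  proof (intro iffI conjI)
    assume N: "submodule N R V"
    show "N \<subseteq> carrier V" "\<forall>x\<in>N. \<forall>y\<in>N. x \<oplus>\<^bsub>V\<^esub> y \<in> N" "\<forall>a\<in>carrier R. \<forall>x\<in>N. a \<odot>\<^bsub>V\<^esub> x \<in> N"
      using V.submoduleE[OF N] by auto
    then show "\<zero>\<^bsub>V\<^esub> \<in> N"
      using V.submoduleE(2)[OF N] V.smult_l_null zero_closed by (metis ex_in_conv subsetD)
  next
    assume N: "N \<subseteq> carrier V \<and> \<zero>\<^bsub>V\<^esub> \<in> N \<and> (\<forall>x\<in>N. \<forall>y\<in>N. x \<oplus>\<^bsub>V\<^esub> y \<in> N) \<and>
      (\<forall>a\<in>carrier R. \<forall>x\<in>N. a \<odot>\<^bsub>V\<^esub> x \<in> N)"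
    have "\<ominus>\<^bsub>V\<^esub> x \<in> N" if "x \<in> N" for x
    proof -
      have "x \<in> carrier V" using N that by auto
      then have "\<ominus>\<^bsub>V\<^esub> x = (\<ominus> \<one>) \<odot>\<^bsub>V\<^esub> x" by (simp add: V.smult_l_minus)
      then show ?thesis using N that by auto
    qed
    then show "submodule N R V" using N by (intro V.submoduleI) auto
  qed
qed

lemma submoduleI':
  assumes "module R V" "N \<subseteq> carrier V" "\<zero>\<^bsub>V\<^esub> \<in> N"
    "\<And>x y. \<lbrakk>x \<in> N; y \<in> N\<rbrakk> \<Longrightarrow> x \<oplus>\<^bsub>V\<^esub> y \<in> N" "\<And>a x. \<lbrakk>a \<in> carrier R; x \<in> N\<rbrakk> \<Longrightarrow> a \<odot>\<^bsub>V\<^esub> x \<in> N"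
  shows "submodule N R V"
  unfolding submodule_iff[OF assms(1)] using assms(2-) by auto

lemma submoduleD:
  assumes "module R V" "submodule N R V"
  shows "x \<in> N \<Longrightarrow> x \<in> carrier V" "\<zero>\<^bsub>V\<^esub> \<in> N" "\<lbrakk>x \<in> N; y \<in> N\<rbrakk> \<Longrightarrow> x \<oplus>\<^bsub>V\<^esub> y \<in> N"
    "\<lbrakk>a \<in> carrier R; x \<in> N\<rbrakk> \<Longrightarrow> a \<odot>\<^bsub>V\<^esub> x \<in> N" "x \<in> N \<Longrightarrow> \<ominus>\<^bsub>V\<^esub> x \<in> N"
    "\<lbrakk>x \<in> N; y \<in> N\<rbrakk> \<Longrightarrow> x \<ominus>\<^bsub>V\<^esub> y \<in> N"
  using assms(2)[unfolded submodule_iff[OF assms(1)]] module.submoduleE(3)[OF assms]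
  by (auto simp: a_minus_def)

lemma module_submodule:
  assumes "module R V" "submodule N R V"
  shows "module R (V\<lparr>carrier := N\<rparr>)"
  using submodule.submodule_is_module assms by blast

lemma linearI:
  assumes "\<And>x. x \<in> carrier V \<Longrightarrow> f x \<in> carrier W"
    "\<And>x y. \<lbrakk>x \<in> carrier V; y \<in> carrier V\<rbrakk> \<Longrightarrow> f (x \<oplus>\<^bsub>V\<^esub> y) = f x \<oplus>\<^bsub>W\<^esub> f y"
    "\<And>a x. \<lbrakk>a \<in> carrier R; x \<in> carrier V\<rbrakk> \<Longrightarrow> f (a \<odot>\<^bsub>V\<^esub> x) = a \<odot>\<^bsub>W\<^esub> f x"
  shows "f \<in> lin V W"
  using assms by (auto simp: linear_maps_def)

lemma linearD:
  assumes "f \<in> lin V W"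
  shows "x \<in> carrier V \<Longrightarrow> f x \<in> carrier W"
    "\<lbrakk>x \<in> carrier V; y \<in> carrier V\<rbrakk> \<Longrightarrow> f (x \<oplus>\<^bsub>V\<^esub> y) = f x \<oplus>\<^bsub>W\<^esub> f y"
    "\<lbrakk>a \<in> carrier R; x \<in> carrier V\<rbrakk> \<Longrightarrow> f (a \<odot>\<^bsub>V\<^esub> x) = a \<odot>\<^bsub>W\<^esub> f x"
  using assms by (auto simp: linear_maps_def)

lemma linear_zero:
  assumes "module R V" "module R W" "f \<in> lin V W"
  shows "f \<zero>\<^bsub>V\<^esub> = \<zero>\<^bsub>W\<^esub>"
proof -
  interpret V: module R V by fact
  interpret W: module R W by fact
  have "f (\<zero> \<odot>\<^bsub>V\<^esub> \<zero>\<^bsub>V\<^esub>) = \<zero> \<odot>\<^bsub>W\<^esub> f \<zero>\<^bsub>V\<^esub>" by (rule linearD(3)[OF assms(3)]) auto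
  then show ?thesis using linearD(1)[OF assms(3), of "\<zero>\<^bsub>V\<^esub>"] by simp
qed

lemma linear_uminus:
  assumes "module R V" "module R W" "f \<in> lin V W" "x \<in> carrier V"
  shows "f (\<ominus>\<^bsub>V\<^esub> x) = \<ominus>\<^bsub>W\<^esub> f x"
proof -
  interpret V: module R V by fact
  interpret W: module R W by fact
  have "f ((\<ominus> \<one>) \<odot>\<^bsub>V\<^esub> x) = (\<ominus> \<one>) \<odot>\<^bsub>W\<^esub> f x" using linearD[OF assms(3)] assms(4) by simp
  then show ?thesis using linearD(1)[OF assms(3,4)] assms(4)
    by (simp add: V.smult_l_minus W.smult_l_minus)
qed

lemma linear_minus:
  assumes "module R V" "module R W" "f \<in> lin V W" "x \<in> carrier V" "y \<in> carrier V"
  shows "f (x \<ominus>\<^bsub>V\<^esub> y) = f x \<ominus>\<^bsub>W\<^esub> f y"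
proof -
  interpret V: module R V by fact
  show ?thesis using linear_uminus[OF assms(1-3,5)] linearD(2)[OF assms(3)] assms(4,5)
    by (simp add: a_minus_def)
qed

lemma linear_finsum:
  assumes "module R V" "module R W" "f \<in> lin V W" "finite A" "g \<in> A \<rightarrow> carrier V"
  shows "f (\<Oplus>\<^bsub>V\<^esub>i\<in>A. g i) = (\<Oplus>\<^bsub>W\<^esub>i\<in>A. f (g i))"
  using assms(4,5)
proof (induction A)
  case empty
  interpret V: module R V by fact
  interpret W: module R W by fact
  show ?case using linear_zero[OF assms(1-3)] by (simp)
next
  case (insert a A)
  interpret V: module R V by fact
  interpret W: module R W by fact
  have "g \<in> A \<rightarrow> carrier V" "g a \<in> carrier V" using insert by auto
  moreover have "(\<lambda>i. f (g i)) \<in> A \<rightarrow> carrier W" "f (g a) \<in> carrier W"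
    using calculation linearD(1)[OF assms(3)] by auto
  ultimately show ?case using insert linearD(2)[OF assms(3)] by simp
qed

lemma linear_id: "(\<lambda>x. x) \<in> lin V V"
  by (auto intro: linearI)

lemma linear_comp:
  assumes "g \<in> lin V W" "f \<in> lin U V"
  shows "(\<lambda>x. g (f x)) \<in> lin U W"
  using linearD[OF assms(1)] linearD[OF assms(2)] by (auto intro: linearI)

lemma linear_const_zero:
  assumes "module R W" shows "(\<lambda>x. \<zero>\<^bsub>W\<^esub>) \<in> lin V W"
proof -
  interpret W: module R W by fact
  show ?thesis by (auto intro: linearI)
qed

lemma linear_add:
  assumes "module R W" "f \<in> lin V W" "g \<in> lin V W"
  shows "(\<lambda>x. f x \<oplus>\<^bsub>W\<^esub> g x) \<in> lin V W"
proof -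
  interpret W: module R W by fact
  show ?thesis using linearD[OF assms(2)] linearD[OF assms(3)]
    by (auto intro!: linearI simp: W.a_ac W.smult_r_distr)
qed

lemma linear_smult:
  assumes "module R W" "f \<in> lin V W" "a \<in> carrier R"
  shows "(\<lambda>x. a \<odot>\<^bsub>W\<^esub> f x) \<in> lin V W"
proof -
  interpret W: module R W by fact
  have "a \<odot>\<^bsub>W\<^esub> (b \<odot>\<^bsub>W\<^esub> y) = b \<odot>\<^bsub>W\<^esub> (a \<odot>\<^bsub>W\<^esub> y)" if "b \<in> carrier R" "y \<in> carrier W" for b y
    using that assms(3) by (simp add: W.smult_assoc1[symmetric] m_comm)
  then show ?thesis using linearD[OF assms(2)] assms(3)
    by (auto intro!: linearI simp: W.smult_r_distr)
qed

lemma linear_minus_fun: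
  assumes "module R W" "f \<in> lin V W" "g \<in> lin V W"
  shows "(\<lambda>x. f x \<ominus>\<^bsub>W\<^esub> g x) \<in> lin V W"
proof -
  interpret W: module R W by fact
  show ?thesis using linearD[OF assms(2)] linearD[OF assms(3)]
    by (auto intro!: linearI simp: a_minus_def W.minus_add W.a_ac W.smult_r_distr W.smult_r_minus)
qed

text \<open>Linearity only sees values on the carrier. Maps defined by \<open>THE\<close> or through
  a chosen representative can thus be exchanged for explicit formulas.\<close>

lemma linear_cong:
  assumes "module R V" "\<And>x. x \<in> carrier V \<Longrightarrow> f x = g x"
  shows "f \<in> lin V W \<longleftrightarrow> g \<in> lin V W"
proof -
  interpret V: module R V by fact
  show ?thesis using assms(2) unfolding linear_maps_def by (auto simp: Pi_iff)
qed

lemma linear_restrict: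
  assumes "f \<in> lin V W" "N \<subseteq> carrier V" "\<And>x. x \<in> N \<Longrightarrow> f x \<in> M"
  shows "f \<in> lin (V\<lparr>carrier := N\<rparr>) (W\<lparr>carrier := M\<rparr>)"
  using linearD[OF assms(1)] assms(2,3) by (intro linearI) (simp_all add: subset_iff)

lemma linear_restrict_dom:
  assumes "f \<in> lin V W" "N \<subseteq> carrier V"
  shows "f \<in> lin (V\<lparr>carrier := N\<rparr>) W"
  using linearD[OF assms(1)] assms(2) by (intro linearI) (simp_all add: subset_iff)

lemma submodule_image:
  assumes "module R V" "module R W" "f \<in> lin V W" "submodule N R V"
  shows "submodule (f ` N) R W"
proof -
  note N = submoduleD[OF assms(1,4)] and f = linearD[OF assms(3)]
  show ?thesis
  proof (rule submoduleI'[OF assms(2)])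
    show "f ` N \<subseteq> carrier W" using N f by auto
    show "\<zero>\<^bsub>W\<^esub> \<in> f ` N" using N(2) linear_zero[OF assms(1-3)] by (metis imageI)
    fix x y assume "x \<in> f ` N" "y \<in> f ` N"
    then show "x \<oplus>\<^bsub>W\<^esub> y \<in> f ` N" using f(2) N(1,3) by (auto simp: image_iff) (metis)
  next
    fix a x assume "x \<in> f ` N" "a \<in> carrier R"
    then show "a \<odot>\<^bsub>W\<^esub> x \<in> f ` N" using f(3) N(1,4) by (auto simp: image_iff) (metis)
  qed
qed

lemma submodule_vimage:
  assumes "module R V" "module R W" "f \<in> lin V W" "submodule N R W"
  shows "submodule {x \<in> carrier V. f x \<in> N} R V"
proof -
  interpret V: module R V by fact
  note f = linearD[OF assms(3)] linear_zero[OF assms(1-3)]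
  show ?thesis using assms(4) unfolding submodule_iff[OF assms(1)] submodule_iff[OF assms(2)]
    by (auto simp: f)
qed

lemma submodule_zero:
  assumes "module R V" shows "submodule {\<zero>\<^bsub>V\<^esub>} R V"
proof -
  interpret V: module R V by fact
  show ?thesis by (intro submoduleI'[OF assms]) auto
qed

lemma submodule_carrier:
  assumes "module R V" shows "submodule (carrier V) R V"
  using module.carrier_is_submodule[OF assms] .

lemma submodule_kernel:
  assumes "module R V" "module R W" "f \<in> lin V W"
  shows "submodule {x \<in> carrier V. f x = \<zero>\<^bsub>W\<^esub>} R V"
  using submodule_vimage[OF assms submodule_zero[OF assms(2)]] unfolding singleton_iff .

lemma submodule_Int:
  assumes "module R V" "submodule N R V" "submodule M R V"
  shows "submodule (N \<inter> M) R V"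
  using assms(2,3) unfolding submodule_iff[OF assms(1)] by auto

lemma submodule_restrict:
  assumes "module R V" "submodule N R V" "submodule M R V" "M \<subseteq> N"
  shows "submodule M R (V\<lparr>carrier := N\<rparr>)"
  using assms(3,4) unfolding submodule_iff[OF assms(1)] submodule_iff[OF module_submodule[OF assms(1,2)]]
  by auto

text \<open>The module axioms are identities together with the existence of negatives, and both are
  inherited along a surjection that respects the operations. Quotients obtain their structure in
  this way.\<close>

lemma module_of_surjection:
  assumes "module R V" "f ` carrier V = carrier W" "f \<zero>\<^bsub>V\<^esub> = \<zero>\<^bsub>W\<^esub>"
    "\<And>x y. \<lbrakk>x \<in> carrier V; y \<in> carrier V\<rbrakk> \<Longrightarrow> f (x \<oplus>\<^bsub>V\<^esub> y) = f x \<oplus>\<^bsub>W\<^esub> f y"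
    "\<And>a x. \<lbrakk>a \<in> carrier R; x \<in> carrier V\<rbrakk> \<Longrightarrow> f (a \<odot>\<^bsub>V\<^esub> x) = a \<odot>\<^bsub>W\<^esub> f x"
  shows "module R W"
proof -
  interpret V: module R V by fact
  have s: "\<exists>x. x \<in> carrier V \<and> w = f x" if "w \<in> carrier W" for w
    using that unfolding assms(2)[symmetric] by blast
  have c: "f x \<in> carrier W" if "x \<in> carrier V" for x
    using that unfolding assms(2)[symmetric] by blast
  note h = assms(4,5)[symmetric]
  have z: "\<zero>\<^bsub>W\<^esub> \<in> carrier W" using c[of "\<zero>\<^bsub>V\<^esub>"] assms(3) by simp
  have "\<exists>y\<in>carrier W. y \<oplus>\<^bsub>W\<^esub> x = \<zero>\<^bsub>W\<^esub>" if x: "x \<in> carrier W" for x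
  proof -
    obtain v where v: "v \<in> carrier V" "x = f v" using s[OF x] by blast
    then have "f (\<ominus>\<^bsub>V\<^esub> v) \<in> carrier W" "f (\<ominus>\<^bsub>V\<^esub> v) \<oplus>\<^bsub>W\<^esub> x = \<zero>\<^bsub>W\<^esub>"
      using c assms(3) by (auto simp: V.l_neg h)
    then show ?thesis by blast
  qed
  then have "abelian_group W"
    by (intro abelian_groupI z) (auto dest!: s intro!: c simp: h V.a_ac assms(3)[symmetric])
  then show ?thesis
    by (rule moduleI[OF is_cring])
       (auto dest!: s intro!: c simp: h V.smult_l_distr V.smult_r_distr V.smult_assoc1)
qed

section \<open>Complements and linear splittings\<close>

lemma exists_complement:
  assumes "module R V" "submodule N R V"
  shows "\<exists>C. submodule C R V \<and> C \<inter> N = {\<zero>\<^bsub>V\<^esub>} \<and> (\<forall>x\<in>carrier V. \<exists>c\<in>C. \<exists>n\<in>N. x = c \<oplus>\<^bsub>V\<^esub> n)"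
proof -
  interpret V: module R V by fact
  note N = submoduleD[OF assms]
  define S where "S = {C. submodule C R V \<and> C \<inter> N = {\<zero>\<^bsub>V\<^esub>}}"
  \<comment> \<open>Zorn's lemma for the subspaces meeting \<open>N\<close> trivially: such
    subspaces are closed under unions of nonempty chains, where nonemptiness puts zero into the
    union.\<close>
  have "\<exists>C\<in>S. \<forall>X\<in>S. C \<subseteq> X \<longrightarrow> X = C"
  proof (rule subset_Zorn_nonempty)
    show "S \<noteq> {}" using submodule_zero[OF assms(1)] N(2) unfolding S_def by blast
    fix \<C> assume c: "\<C> \<noteq> {}" "subset.chain S \<C>"
    then have S: "C \<in> S" if "C \<in> \<C>" for C using that by (auto simp: subset.chain_def)
    then have sub: "submodule C R V" if "C \<in> \<C>" for C using that by (auto simp: S_def)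
    have "submodule (\<Union>\<C>) R V"
    proof (rule submoduleI'[OF assms(1)])
      show "\<Union>\<C> \<subseteq> carrier V" using submoduleD(1)[OF assms(1) sub] by blast
      show "\<zero>\<^bsub>V\<^esub> \<in> \<Union>\<C>" using submoduleD(2)[OF assms(1) sub] c(1) by blast
      fix x y assume "x \<in> \<Union>\<C>" "y \<in> \<Union>\<C>"
      then obtain C D where CD: "C \<in> \<C>" "D \<in> \<C>" "x \<in> C" "y \<in> D" by blast
      then have "C \<subseteq> D \<or> D \<subseteq> C" using c(2) by (auto simp: subset.chain_def)
      then show "x \<oplus>\<^bsub>V\<^esub> y \<in> \<Union>\<C>"
        using CD submoduleD(3)[OF assms(1) sub] by blast
    next
      fix a x assume "a \<in> carrier R" "x \<in> \<Union>\<C>"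
      then show "a \<odot>\<^bsub>V\<^esub> x \<in> \<Union>\<C>" using submoduleD(4)[OF assms(1) sub] by blast
    qed
    moreover have "\<Union>\<C> \<inter> N = {\<zero>\<^bsub>V\<^esub>}" using S c(1) unfolding S_def by blast
    ultimately show "\<Union>\<C> \<in> S" by (simp add: S_def)
  qed
  then obtain C where CS: "C \<in> S" and CM: "\<forall>X\<in>S. C \<subseteq> X \<longrightarrow> X = C" by blast
  have C: "submodule C R V" "C \<inter> N = {\<zero>\<^bsub>V\<^esub>}" using CS by (simp_all add: S_def)
  have max: "X = C" if "submodule X R V" "X \<inter> N = {\<zero>\<^bsub>V\<^esub>}" "C \<subseteq> X" for X
    using CM that by (simp add: S_def)
  note C' = submoduleD[OF assms(1) C(1)]
  have "\<exists>c\<in>C. \<exists>n\<in>N. x = c \<oplus>\<^bsub>V\<^esub> n" if x: "x \<in> carrier V" for x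
  proof (rule ccontr)
    assume no: "\<not> ?thesis"
    \<comment> \<open>Adjoining \<open>x\<close> to the maximal \<open>C\<close> still meets
      \<open>N\<close> only in zero: a member \<open>c \<oplus> a x\<close> of \<open>N\<close> with
      nonzero \<open>a\<close> could be solved for \<open>x\<close>, contradicting
      \<open>no\<close>.\<close>
    define X where "X = {c \<oplus>\<^bsub>V\<^esub> a \<odot>\<^bsub>V\<^esub> x | c a. c \<in> C \<and> a \<in> carrier R}"
    have CX: "c \<in> X" if "c \<in> C" for c
    proof -
      have "c = c \<oplus>\<^bsub>V\<^esub> \<zero> \<odot>\<^bsub>V\<^esub> x" using that x C'(1) by simp
      then show ?thesis using that unfolding X_def by blast
    qed
    have sX: "submodule X R V"
    proof (rule submoduleI'[OF assms(1)])
      show "X \<subseteq> carrier V" using C'(1) x by (auto simp: X_def)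
      show "\<zero>\<^bsub>V\<^esub> \<in> X" using CX C'(2) by blast
      fix y z assume "y \<in> X" "z \<in> X"
      then obtain c d a b where h: "c \<in> C" "d \<in> C" "a \<in> carrier R" "b \<in> carrier R"
        "y = c \<oplus>\<^bsub>V\<^esub> a \<odot>\<^bsub>V\<^esub> x" "z = d \<oplus>\<^bsub>V\<^esub> b \<odot>\<^bsub>V\<^esub> x" unfolding X_def by blast
      then have "y \<oplus>\<^bsub>V\<^esub> z = (c \<oplus>\<^bsub>V\<^esub> d) \<oplus>\<^bsub>V\<^esub> (a \<oplus> b) \<odot>\<^bsub>V\<^esub> x"
        using C'(1) x by (simp add: V.smult_l_distr V.a_ac)
      then show "y \<oplus>\<^bsub>V\<^esub> z \<in> X" using h C'(3) a_closed unfolding X_def by blast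
    next
      fix b y assume b: "b \<in> carrier R" and "y \<in> X"
      then obtain c a where h: "c \<in> C" "a \<in> carrier R" "y = c \<oplus>\<^bsub>V\<^esub> a \<odot>\<^bsub>V\<^esub> x"
        unfolding X_def by blast
      then have "b \<odot>\<^bsub>V\<^esub> y = b \<odot>\<^bsub>V\<^esub> c \<oplus>\<^bsub>V\<^esub> (b \<otimes> a) \<odot>\<^bsub>V\<^esub> x"
        using C'(1) x b by (simp add: V.smult_r_distr V.smult_assoc1)
      then show "b \<odot>\<^bsub>V\<^esub> y \<in> X" using h b C'(4) m_closed unfolding X_def by blast
    qed
    have "X \<inter> N \<subseteq> {\<zero>\<^bsub>V\<^esub>}"
    proof
      fix y assume y: "y \<in> X \<inter> N"
      then obtain c a where h: "c \<in> C" "a \<in> carrier R" "y = c \<oplus>\<^bsub>V\<^esub> a \<odot>\<^bsub>V\<^esub> x"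
        unfolding X_def by blast
      have yc: "y \<in> carrier V" "c \<in> carrier V" using y N(1) h C'(1) by auto
      have ax: "a \<odot>\<^bsub>V\<^esub> x = \<ominus>\<^bsub>V\<^esub> c \<oplus>\<^bsub>V\<^esub> y" using h x yc by (simp add: V.r_neg1)
      have "a = \<zero>"
      proof (rule ccontr)
        assume "a \<noteq> \<zero>"
        then have a: "inv a \<in> carrier R" "inv a \<otimes> a = \<one>" using h(2) by (auto simp: field_Units)
        have "x = inv a \<odot>\<^bsub>V\<^esub> (a \<odot>\<^bsub>V\<^esub> x)" using a x h(2) by (simp add: V.smult_assoc1[symmetric])
        also have "\<dots> = inv a \<odot>\<^bsub>V\<^esub> (\<ominus>\<^bsub>V\<^esub> c) \<oplus>\<^bsub>V\<^esub> inv a \<odot>\<^bsub>V\<^esub> y"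
          unfolding ax using a yc by (simp add: V.smult_r_distr)
        finally show False using no a C'(4)[OF a(1) C'(5)[OF h(1)]] N(4)[OF a(1), of y] y by blast
      qed
      then have "y = c" using h x yc by simp
      then show "y \<in> {\<zero>\<^bsub>V\<^esub>}" using y h C(2) by blast
    qed
    then have "X \<inter> N = {\<zero>\<^bsub>V\<^esub>}" using submoduleD(2)[OF assms(1) sX] N(2) by blast
    then have "X = C" using max[OF sX] CX by blast
    moreover have "\<zero>\<^bsub>V\<^esub> \<oplus>\<^bsub>V\<^esub> \<one> \<odot>\<^bsub>V\<^esub> x \<in> X" unfolding X_def using C'(2) one_closed by blast
    ultimately have "x \<in> C" using x by simp
    moreover have "x = x \<oplus>\<^bsub>V\<^esub> \<zero>\<^bsub>V\<^esub>" using x by simp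
    ultimately show False using no N(2) by blast
  qed
  then show ?thesis using C by blast
qed

text \<open>With complements \<open>C\<close> of the kernel and \<open>D\<close> of the image, each
  vector of \<open>W\<close> is \<open>d \<oplus> f c\<close> for a unique \<open>c\<close>, which
  \<open>g\<close> returns. The projections, sections and lifts chosen later all come from this
  lemma.\<close>

lemma exists_pseudo_inverse:
  assumes "module R V" "module R W" "f \<in> lin V W"
  shows "\<exists>g\<in>lin W V. \<forall>x\<in>carrier V. f (g (f x)) = f x"
proof -
  interpret V: module R V by fact
  interpret W: module R W by fact
  note f = linearD[OF assms(3)]
  note sK = submodule_kernel[OF assms] and sF = submodule_image[OF assms submodule_carrier[OF assms(1)]]
  obtain C where C: "submodule C R V" "C \<inter> {x \<in> carrier V. f x = \<zero>\<^bsub>W\<^esub>} = {\<zero>\<^bsub>V\<^esub>}"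
    and sumC: "\<And>x. x \<in> carrier V \<Longrightarrow> \<exists>c\<in>C. \<exists>k\<in>{x \<in> carrier V. f x = \<zero>\<^bsub>W\<^esub>}. x = c \<oplus>\<^bsub>V\<^esub> k"
    using exists_complement[OF assms(1) sK] by blast
  obtain D where D: "submodule D R W" "D \<inter> f ` carrier V = {\<zero>\<^bsub>W\<^esub>}"
    and sumD: "\<And>y. y \<in> carrier W \<Longrightarrow> \<exists>d\<in>D. \<exists>w\<in>f ` carrier V. y = d \<oplus>\<^bsub>W\<^esub> w"
    using exists_complement[OF assms(2) sF] by blast
  note C' = submoduleD[OF assms(1) C(1)] and D' = submoduleD[OF assms(2) D(1)]
  have fC: "\<exists>c\<in>C. f x = f c" if x: "x \<in> carrier V" for x
  proof -
    obtain c k where "c \<in> C" "k \<in> carrier V" "f k = \<zero>\<^bsub>W\<^esub>" "x = c \<oplus>\<^bsub>V\<^esub> k" using sumC[OF x] by blast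
    then show ?thesis using f(1,2) C'(1) by (intro bexI[of _ c]) simp_all
  qed
  have ex: "\<exists>c\<in>C. \<exists>d\<in>D. y = d \<oplus>\<^bsub>W\<^esub> f c" if "y \<in> carrier W" for y
    using sumD[OF that] fC by (metis imageE)
  \<comment> \<open>After moving the \<open>D\<close> parts to one side, \<open>f (c' - c)\<close>
    lies in \<open>D\<close> and in the image, so it is zero; then \<open>c' - c\<close> lies in
    \<open>C\<close> and in the kernel.\<close>
  have uniq: "c = c'" if h: "c \<in> C" "c' \<in> C" "d \<in> D" "d' \<in> D" "d \<oplus>\<^bsub>W\<^esub> f c = d' \<oplus>\<^bsub>W\<^esub> f c'" for c c' d d'
  proof -
    note cc = C'(1)[OF h(1)] C'(1)[OF h(2)] and dc = D'(1)[OF h(3)] D'(1)[OF h(4)]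
    have "\<ominus>\<^bsub>W\<^esub> d' \<oplus>\<^bsub>W\<^esub> (d \<oplus>\<^bsub>W\<^esub> f c) \<ominus>\<^bsub>W\<^esub> f c = \<ominus>\<^bsub>W\<^esub> d' \<oplus>\<^bsub>W\<^esub> (d' \<oplus>\<^bsub>W\<^esub> f c') \<ominus>\<^bsub>W\<^esub> f c" unfolding h(5) ..
    then have e: "\<ominus>\<^bsub>W\<^esub> d' \<oplus>\<^bsub>W\<^esub> d = f (c' \<ominus>\<^bsub>V\<^esub> c)"
      unfolding linear_minus[OF assms cc(2,1)]
      using cc dc f(1) by (simp add: a_minus_def W.a_assoc W.r_neg W.r_neg1)
    have "f (c' \<ominus>\<^bsub>V\<^esub> c) \<in> D \<inter> f ` carrier V"
      using D'(3)[OF D'(5)[OF h(4)] h(3)] cc by (simp add: e[symmetric]) (simp add: e)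
    then have "c' \<ominus>\<^bsub>V\<^esub> c = \<zero>\<^bsub>V\<^esub>" using C(2) C'(6)[OF h(2,1)] C'(1) unfolding D(2) by blast
    then show ?thesis using V.minus_eq_zero_iff[OF cc(2,1)] by simp
  qed
  define g where "g y = (THE c. c \<in> C \<and> (\<exists>d\<in>D. y = d \<oplus>\<^bsub>W\<^esub> f c))" for y
  have g: "g (d \<oplus>\<^bsub>W\<^esub> f c) = c" if "c \<in> C" "d \<in> D" for c d
    unfolding g_def using that uniq by (intro the_equality) blast+
  have "g \<in> lin W V"
  proof (rule linearI)
    fix y assume "y \<in> carrier W" then show "g y \<in> carrier V" using ex g C'(1) by metis
  next
    fix y z assume "y \<in> carrier W" "z \<in> carrier W"
    then obtain c d c' d' where h: "c \<in> C" "d \<in> D" "c' \<in> C" "d' \<in> D" "y = d \<oplus>\<^bsub>W\<^esub> f c" "z = d' \<oplus>\<^bsub>W\<^esub> f c'"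
      using ex by meson
    then have "y \<oplus>\<^bsub>W\<^esub> z = (d \<oplus>\<^bsub>W\<^esub> d') \<oplus>\<^bsub>W\<^esub> f (c \<oplus>\<^bsub>V\<^esub> c')" using C'(1) D'(1) f by (simp add: W.a_ac)
    then show "g (y \<oplus>\<^bsub>W\<^esub> z) = g y \<oplus>\<^bsub>V\<^esub> g z" using h g C'(3) D'(3) by simp
  next
    fix a y assume a: "a \<in> carrier R" "y \<in> carrier W"
    then obtain c d where h: "c \<in> C" "d \<in> D" "y = d \<oplus>\<^bsub>W\<^esub> f c" using ex by meson
    then have "a \<odot>\<^bsub>W\<^esub> y = a \<odot>\<^bsub>W\<^esub> d \<oplus>\<^bsub>W\<^esub> f (a \<odot>\<^bsub>V\<^esub> c)" using C'(1) D'(1) a f by (simp add: W.smult_r_distr)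
    then show "g (a \<odot>\<^bsub>W\<^esub> y) = a \<odot>\<^bsub>V\<^esub> g y" using h g C'(4) D'(4) a by simp
  qed
  moreover have "f (g (f x)) = f x" if x: "x \<in> carrier V" for x
  proof -
    obtain c where c: "c \<in> C" "f x = f c" using fC[OF x] by blast
    show ?thesis using g[OF c(1) D'(2)] f(1)[OF C'(1)[OF c(1)]] unfolding c(2) by simp
  qed
  ultimately show ?thesis by blast
qed

text \<open>A pseudo-inverse of the inclusion of \<open>N\<close>: for an inclusion,
  \<open>f (g (f x)) = f x\<close> says that \<open>g\<close> fixes the members of
  \<open>N\<close>.\<close>

lemma exists_projection:
  assumes "module R V" "submodule N R V"
  shows "\<exists>p\<in>lin V V. (\<forall>x\<in>carrier V. p x \<in> N) \<and> (\<forall>x\<in>N. p x = x)"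
proof -
  note N = submoduleD[OF assms]
  have "(\<lambda>x. x) \<in> lin (V\<lparr>carrier := N\<rparr>) V"
    by (rule linear_restrict_dom[OF linear_id]) (use N(1) in blast)
  then obtain g where g: "g \<in> lin V (V\<lparr>carrier := N\<rparr>)" "\<forall>x\<in>N. g (g x) = g x \<and> g x = x"
    using exists_pseudo_inverse[OF module_submodule[OF assms] assms(1)] by force
  have "g \<in> lin V V" using linearD[OF g(1)] N(1) by (intro linearI) simp_all
  then show ?thesis using linearD(1)[OF g(1)] g(2) by auto
qed

section \<open>Cosets, quotients and isomorphisms between quotients\<close>

lemma a_r_coset_carrier_update [simp]: "N +>\<^bsub>V\<lparr>carrier := C\<rparr>\<^esub> x = N +>\<^bsub>V\<^esub> x"
  by (simp add: a_r_coset_def r_coset_def)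

lemma mem_coset_iff:
  assumes "module R V" "submodule N R V" "x \<in> carrier V"
  shows "y \<in> N +>\<^bsub>V\<^esub> x \<longleftrightarrow> y \<in> carrier V \<and> y \<ominus>\<^bsub>V\<^esub> x \<in> N"
proof -
  interpret V: module R V by fact
  note N = submoduleD[OF assms(1,2)]
  show ?thesis
  proof (intro iffI conjI)
    assume "y \<in> N +>\<^bsub>V\<^esub> x"
    then obtain n where n: "n \<in> N" "y = n \<oplus>\<^bsub>V\<^esub> x" by (auto simp: a_r_coset_def')
    then show "y \<in> carrier V" "y \<ominus>\<^bsub>V\<^esub> x \<in> N" using N(1) assms(3) by (auto simp: a_minus_def V.a_assoc V.r_neg)
  next
    assume y: "y \<in> carrier V \<and> y \<ominus>\<^bsub>V\<^esub> x \<in> N"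
    then have "y = (y \<ominus>\<^bsub>V\<^esub> x) \<oplus>\<^bsub>V\<^esub> x" using assms(3) by (simp add: a_minus_def V.a_assoc V.l_neg)
    then show "y \<in> N +>\<^bsub>V\<^esub> x" using y by (auto simp: a_r_coset_def')
  qed
qed

lemma coset_eq_iff:
  assumes "module R V" "submodule N R V" "x \<in> carrier V" "y \<in> carrier V"
  shows "N +>\<^bsub>V\<^esub> x = N +>\<^bsub>V\<^esub> y \<longleftrightarrow> x \<ominus>\<^bsub>V\<^esub> y \<in> N"
proof -
  interpret V: module R V by fact
  note N = submoduleD[OF assms(1,2)]
  have sub: "N +>\<^bsub>V\<^esub> u \<subseteq> N +>\<^bsub>V\<^esub> v" if h: "u \<ominus>\<^bsub>V\<^esub> v \<in> N" "u \<in> carrier V" "v \<in> carrier V" for u v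
  proof
    fix z assume "z \<in> N +>\<^bsub>V\<^esub> u"
    then have z: "z \<in> carrier V" "z \<ominus>\<^bsub>V\<^esub> u \<in> N" using mem_coset_iff[OF assms(1,2) h(2)] by auto
    then have "z \<ominus>\<^bsub>V\<^esub> v \<in> N" using N(3)[OF z(2) h(1)] h V.minus_add_minus by simp
    then show "z \<in> N +>\<^bsub>V\<^esub> v" using mem_coset_iff[OF assms(1,2) h(3)] z by simp
  qed
  show ?thesis
  proof
    assume "N +>\<^bsub>V\<^esub> x = N +>\<^bsub>V\<^esub> y"
    moreover have "x \<in> N +>\<^bsub>V\<^esub> x"
      using mem_coset_iff[OF assms(1-3)] assms(3) N(2) V.minus_eq_zero_iff by simp
    ultimately show "x \<ominus>\<^bsub>V\<^esub> y \<in> N" using mem_coset_iff[OF assms(1,2,4)] by simp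
  next
    assume h: "x \<ominus>\<^bsub>V\<^esub> y \<in> N"
    then have "y \<ominus>\<^bsub>V\<^esub> x \<in> N" using N(5)[OF h] assms by (simp add: a_minus_def V.minus_add V.a_comm)
    then show "N +>\<^bsub>V\<^esub> x = N +>\<^bsub>V\<^esub> y" using sub h assms by blast
  qed
qed

lemma coset_eq_self_iff:
  assumes "module R V" "submodule N R V" "x \<in> carrier V"
  shows "N +>\<^bsub>V\<^esub> x = N \<longleftrightarrow> x \<in> N"
proof -
  interpret V: module R V by fact
  note N = submoduleD[OF assms(1,2)]
  have "N +>\<^bsub>V\<^esub> \<zero>\<^bsub>V\<^esub> = N" using mem_coset_iff[OF assms(1,2), of "\<zero>\<^bsub>V\<^esub>"] N(1) by auto
  then show ?thesis using coset_eq_iff[OF assms, of "\<zero>\<^bsub>V\<^esub>"] assms(3) by simp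
qed

lemma mem_coset_self:
  assumes "module R V" "submodule N R V" "x \<in> carrier V"
  shows "x \<in> N +>\<^bsub>V\<^esub> x"
proof -
  interpret V: module R V by fact
  show ?thesis using mem_coset_iff[OF assms, of x] submoduleD(2)[OF assms(1,2)] assms(3) V.minus_eq_zero_iff
    by simp
qed

lemma quotient_module_simps [simp]:
  "zero (quotient_module V N) = N" "add (quotient_module V N) = (<+>\<^bsub>V\<^esub>)"
  "carrier (quotient_module V N) = a_rcosets\<^bsub>V\<^esub> N"
  by (simp_all add: quotient_module_def)

lemma quotient_carrier: "carrier (quotient_module V N) = (\<lambda>x. N +>\<^bsub>V\<^esub> x) ` carrier V"
  by (auto simp: A_RCOSETS_def')

lemma quotient_zero: "\<zero>\<^bsub>quotient_module V N\<^esub> = N"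
  by simp

lemma quotient_add:
  assumes "module R V" "submodule N R V" "x \<in> carrier V" "y \<in> carrier V"
  shows "(N +>\<^bsub>V\<^esub> x) \<oplus>\<^bsub>quotient_module V N\<^esub> (N +>\<^bsub>V\<^esub> y) = N +>\<^bsub>V\<^esub> (x \<oplus>\<^bsub>V\<^esub> y)"
proof -
  interpret V: module R V by fact
  interpret N: additive_subgroup N V
    using submodule.axioms(1)[OF assms(2)] by (rule additive_subgroup.intro)
  interpret N: abelian_subgroup N V
    by (rule abelian_subgroupI3) (rule N.is_additive_subgroup, rule V.abelian_group_axioms)
  show ?thesis using N.a_rcos_sum assms by simp
qed

text \<open>The union in \<open>quotient_module\<close> ranges over the members of one coset. All of
  them yield the same scaled coset, so the union has a single value.\<close>

lemma quotient_smult: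
  assumes "module R V" "submodule N R V" "x \<in> carrier V" "a \<in> carrier R"
  shows "a \<odot>\<^bsub>quotient_module V N\<^esub> (N +>\<^bsub>V\<^esub> x) = N +>\<^bsub>V\<^esub> (a \<odot>\<^bsub>V\<^esub> x)"
proof -
  interpret V: module R V by fact
  note N = submoduleD[OF assms(1,2)]
  have "N +>\<^bsub>V\<^esub> (a \<odot>\<^bsub>V\<^esub> y) = N +>\<^bsub>V\<^esub> (a \<odot>\<^bsub>V\<^esub> x)" if "y \<in> N +>\<^bsub>V\<^esub> x" for y
  proof -
    have y: "y \<in> carrier V" "y \<ominus>\<^bsub>V\<^esub> x \<in> N" using that mem_coset_iff[OF assms(1-3)] by auto
    then have "a \<odot>\<^bsub>V\<^esub> y \<ominus>\<^bsub>V\<^esub> a \<odot>\<^bsub>V\<^esub> x \<in> N" using N(4)[OF assms(4) y(2)] assms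
      by (simp add: a_minus_def V.smult_r_distr V.smult_r_minus)
    then show ?thesis using coset_eq_iff[OF assms(1,2)] y assms by simp
  qed
  moreover have "N +>\<^bsub>V\<^esub> x \<noteq> {}" using mem_coset_self[OF assms(1-3)] by blast
  ultimately show ?thesis by (simp add: quotient_module_def)
qed

lemma quotient_map_linear:
  assumes "module R V" "submodule N R V"
  shows "(\<lambda>x. N +>\<^bsub>V\<^esub> x) \<in> lin V (quotient_module V N)"
  using quotient_add[OF assms] quotient_smult[OF assms] by (intro linearI) (auto simp del: quotient_module_simps simp: quotient_carrier)

lemma module_quotient:
  assumes "module R V" "submodule N R V"
  shows "module R (quotient_module V N)"
proof (rule module_of_surjection[OF assms(1)])
  interpret V: module R V by fact
  show "(\<lambda>x. N +>\<^bsub>V\<^esub> x) ` carrier V = carrier (quotient_module V N)" by (simp add: quotient_carrier del: quotient_module_simps)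
  show "N +>\<^bsub>V\<^esub> \<zero>\<^bsub>V\<^esub> = \<zero>\<^bsub>quotient_module V N\<^esub>"
    using coset_eq_self_iff[OF assms, of "\<zero>\<^bsub>V\<^esub>"] submoduleD(2)[OF assms] by simp
qed (use quotient_add[OF assms] quotient_smult[OF assms] in auto)

lemma linearly_isomorphic_refl: "linearly_isomorphic R V V"
  unfolding linearly_isomorphic_def using linear_id[of V] by (auto simp: bij_betw_def intro!: bexI)

lemma linearly_isomorphicI:
  assumes "module R V" "module R W" "f \<in> lin V W"
    "\<And>x. x \<in> carrier V \<Longrightarrow> f x = \<zero>\<^bsub>W\<^esub> \<Longrightarrow> x = \<zero>\<^bsub>V\<^esub>" "\<And>y. y \<in> carrier W \<Longrightarrow> \<exists>x\<in>carrier V. y = f x"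
  shows "linearly_isomorphic R V W"
proof -
  interpret V: module R V by fact
  interpret W: module R W by fact
  note f = linearD[OF assms(3)]
  have "inj_on f (carrier V)"
  proof (rule inj_onI)
    fix x y assume h: "x \<in> carrier V" "y \<in> carrier V" "f x = f y"
    then have "f (x \<ominus>\<^bsub>V\<^esub> y) = \<zero>\<^bsub>W\<^esub>" using linear_minus[OF assms(1-3)] f W.minus_eq_zero_iff by simp
    then show "x = y" using assms(4)[of "x \<ominus>\<^bsub>V\<^esub> y"] h V.minus_eq_zero_iff by simp
  qed
  moreover have "f ` carrier V = carrier W" using f(1) assms(5) by blast
  ultimately show ?thesis using assms(3) unfolding linearly_isomorphic_def bij_betw_def by blast
qed

lemma linearly_isomorphic_trans:
  assumes "linearly_isomorphic R U V" "linearly_isomorphic R V W"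
  shows "linearly_isomorphic R U W"
proof -
  obtain f g where "f \<in> lin U V" "bij_betw f (carrier U) (carrier V)"
    "g \<in> lin V W" "bij_betw g (carrier V) (carrier W)"
    using assms unfolding linearly_isomorphic_def by blast
  then have "(\<lambda>x. g (f x)) \<in> lin U W" "bij_betw (\<lambda>x. g (f x)) (carrier U) (carrier W)"
    using linear_comp bij_betw_trans[of f _ _ g] by (auto simp: comp_def)
  then show ?thesis unfolding linearly_isomorphic_def by blast
qed

lemma linearly_isomorphic_sym:
  assumes "module R V" "linearly_isomorphic R V W"
  shows "linearly_isomorphic R W V"
proof -
  interpret V: module R V by fact
  obtain f where f: "f \<in> lin V W" "bij_betw f (carrier V) (carrier W)"
    using assms unfolding linearly_isomorphic_def by blast
  define g where "g = inv_into (carrier V) f"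
  have g: "bij_betw g (carrier W) (carrier V)" unfolding g_def by (rule bij_betw_inv_into[OF f(2)])
  have fg: "f (g y) = y" if "y \<in> carrier W" for y
    unfolding g_def using that f(2) by (intro f_inv_into_f) (auto simp: bij_betw_def)
  have gf: "g (f x) = x" if "x \<in> carrier V" for x
    unfolding g_def using that f(2) by (intro inv_into_f_f) (auto simp: bij_betw_def)
  have gc: "g y \<in> carrier V" if "y \<in> carrier W" for y using bij_betwE[OF g] that by blast
  have "g \<in> lin W V"
  proof (rule linearI)
    fix x y assume "x \<in> carrier W" "y \<in> carrier W"
    then show "g (x \<oplus>\<^bsub>W\<^esub> y) = g x \<oplus>\<^bsub>V\<^esub> g y"
      using gf[of "g x \<oplus>\<^bsub>V\<^esub> g y"] linearD(2)[OF f(1) gc gc] fg gc by simp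
  next
    fix a x assume "a \<in> carrier R" "x \<in> carrier W"
    then show "g (a \<odot>\<^bsub>W\<^esub> x) = a \<odot>\<^bsub>V\<^esub> g x"
      using gf[of "a \<odot>\<^bsub>V\<^esub> g x"] linearD(3)[OF f(1) _ gc] fg gc by simp
  qed (rule gc)
  then show ?thesis using g unfolding linearly_isomorphic_def by blast
qed

text \<open>That \<open>U\<close> is exactly the preimage of \<open>B\<close> makes the induced map
  well defined and injective at once, and \<open>f\<close> has to be surjective only modulo
  \<open>B\<close>. The comparisons of subquotients below are instances of this.\<close>

lemma linearly_isomorphic_quotients:
  assumes "module R V" "submodule U R V" "module R W" "submodule B R W"
    "f \<in> lin V W" "\<And>x. x \<in> carrier V \<Longrightarrow> f x \<in> B \<longleftrightarrow> x \<in> U"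
    "\<And>y. y \<in> carrier W \<Longrightarrow> \<exists>x\<in>carrier V. y \<ominus>\<^bsub>W\<^esub> f x \<in> B"
  shows "linearly_isomorphic R (quotient_module V U) (quotient_module W B)"
proof -
  interpret V: module R V by fact
  interpret W: module R W by fact
  let ?Q = "quotient_module V U" and ?S = "quotient_module W B"
  note f = linearD[OF assms(5)]
  define g where "g C = B +>\<^bsub>W\<^esub> f (SOME x. x \<in> carrier V \<and> C = U +>\<^bsub>V\<^esub> x)" for C
  have g: "g (U +>\<^bsub>V\<^esub> x) = B +>\<^bsub>W\<^esub> f x" if x: "x \<in> carrier V" for x
  proof -
    let ?z = "SOME z. z \<in> carrier V \<and> U +>\<^bsub>V\<^esub> x = U +>\<^bsub>V\<^esub> z"
    have z: "?z \<in> carrier V \<and> U +>\<^bsub>V\<^esub> x = U +>\<^bsub>V\<^esub> ?z" by (rule someI[of _ x]) (use x in auto)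
    then have "x \<ominus>\<^bsub>V\<^esub> ?z \<in> U" using coset_eq_iff[OF assms(1,2)] x by blast
    then have "f (x \<ominus>\<^bsub>V\<^esub> ?z) \<in> B" using assms(6) x z by simp
    then have "f x \<ominus>\<^bsub>W\<^esub> f ?z \<in> B" using linear_minus[OF assms(1,3,5)] x z by simp
    then have "B +>\<^bsub>W\<^esub> f x = B +>\<^bsub>W\<^esub> f ?z" using coset_eq_iff[OF assms(3,4) f(1)[OF x] f(1)] z by blast
    then show ?thesis unfolding g_def by (simp only:)
  qed
  note mQ = module_quotient[OF assms(1,2)] and mS = module_quotient[OF assms(3,4)]
  note [simp del] = quotient_module_simps
  show ?thesis
  proof (rule linearly_isomorphicI[OF mQ mS])
    show "g \<in> lin ?Q ?S"
      by (rule linearI)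
         (auto simp: quotient_carrier g quotient_add[OF assms(1,2)] quotient_add[OF assms(3,4)]
           quotient_smult[OF assms(1,2)] quotient_smult[OF assms(3,4)] f)
  next
    fix x assume x: "x \<in> carrier ?Q" "g x = \<zero>\<^bsub>?S\<^esub>"
    then obtain v where v: "v \<in> carrier V" "x = U +>\<^bsub>V\<^esub> v" unfolding quotient_carrier by blast
    then have "B +>\<^bsub>W\<^esub> f v = B" using x(2) g by (simp add: quotient_zero)
    then have "v \<in> U" using coset_eq_self_iff[OF assms(3,4) f(1)] assms(6) v(1) by blast
    then show "x = \<zero>\<^bsub>?Q\<^esub>" using coset_eq_self_iff[OF assms(1,2) v(1)] v(2) by (simp add: quotient_zero)
  next
    fix y assume "y \<in> carrier ?S"
    then obtain w where w: "w \<in> carrier W" "y = B +>\<^bsub>W\<^esub> w" by (auto simp: quotient_carrier)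
    then obtain x where x: "x \<in> carrier V" "w \<ominus>\<^bsub>W\<^esub> f x \<in> B" using assms(7) by blast
    then have "y = g (U +>\<^bsub>V\<^esub> x)"
      unfolding g[OF x(1)] w(2) using coset_eq_iff[OF assms(3,4) w(1) f(1)[OF x(1)]] x(2) by blast
    then show "\<exists>x\<in>carrier ?Q. y = g x" using x(1) unfolding quotient_carrier by blast
  qed
qed

lemma linearly_isomorphic_quotient_zero:
  assumes "module R V"
  shows "linearly_isomorphic R V (quotient_module V {\<zero>\<^bsub>V\<^esub>})"
proof (rule linearly_isomorphicI[OF assms module_quotient[OF assms submodule_zero[OF assms]]
      quotient_map_linear[OF assms submodule_zero[OF assms]]])
  show "\<And>x. x \<in> carrier V \<Longrightarrow> {\<zero>\<^bsub>V\<^esub>} +>\<^bsub>V\<^esub> x = \<zero>\<^bsub>quotient_module V {\<zero>\<^bsub>V\<^esub>}\<^esub> \<Longrightarrow> x = \<zero>\<^bsub>V\<^esub>"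
    using coset_eq_self_iff[OF assms submodule_zero[OF assms]] by simp
qed (auto simp: quotient_carrier simp del: quotient_module_simps)

lemma linearly_isomorphic_quotientI:
  assumes "module R V" "module R W" "submodule B R W" "f \<in> lin V W"
    "\<And>x. x \<in> carrier V \<Longrightarrow> f x \<in> B \<Longrightarrow> x = \<zero>\<^bsub>V\<^esub>"
    "\<And>y. y \<in> carrier W \<Longrightarrow> \<exists>x\<in>carrier V. y \<ominus>\<^bsub>W\<^esub> f x \<in> B"
  shows "linearly_isomorphic R V (quotient_module W B)"
proof (rule linearly_isomorphic_trans[OF linearly_isomorphic_quotient_zero[OF assms(1)]
      linearly_isomorphic_quotients[OF assms(1) submodule_zero[OF assms(1)] assms(2-4) _ assms(6)]])
  show "f x \<in> B \<longleftrightarrow> x \<in> {\<zero>\<^bsub>V\<^esub>}" if "x \<in> carrier V" for x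
    using that assms(5)[of x] linear_zero[OF assms(1,2,4)] submoduleD(2)[OF assms(2,3)]
    by (metis singleton_iff)
qed

text \<open>The isomorphism theorem for a surjection with kernel \<open>U\<close>, oriented as in
  \<open>spectral_sequence\<close>, where the new page stands on the left and the quotient on the
  right.\<close>

lemma linearly_isomorphic_quotientI':
  assumes "module R V" "submodule U R V" "module R W" "f \<in> lin V W"
    "\<And>x. x \<in> carrier V \<Longrightarrow> f x = \<zero>\<^bsub>W\<^esub> \<longleftrightarrow> x \<in> U"
    "\<And>y. y \<in> carrier W \<Longrightarrow> \<exists>x\<in>carrier V. y = f x"
  shows "linearly_isomorphic R W (quotient_module V U)"
proof -
  interpret W: module R W by fact
  have "\<exists>x\<in>carrier V. y \<ominus>\<^bsub>W\<^esub> f x \<in> {\<zero>\<^bsub>W\<^esub>}" if "y \<in> carrier W" for y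
  proof -
    obtain x where x: "x \<in> carrier V" "y = f x" using assms(6) \<open>y \<in> carrier W\<close> by blast
    then have "y \<ominus>\<^bsub>W\<^esub> f x = \<zero>\<^bsub>W\<^esub>" using that by simp
    then show ?thesis using x(1) by blast
  qed
  then have "linearly_isomorphic R (quotient_module V U) (quotient_module W {\<zero>\<^bsub>W\<^esub>})"
    using assms(5) by (intro linearly_isomorphic_quotients[OF assms(1-3) submodule_zero[OF assms(3)] assms(4)]) auto
  then show ?thesis
    using linearly_isomorphic_trans[OF linearly_isomorphic_quotient_zero[OF assms(3)]]
      linearly_isomorphic_sym[OF module_quotient[OF assms(1,2)]] by blast
qed

end

section \<open>Tensor products\<close>

context field
begin

lemma module_ground: "module R (ground_module R)"
  by (rule moduleI[OF is_cring])
     (auto intro!: abelian_groupI simp: ground_module_def l_distr r_distr m_assoc a_assoc l_neg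
       intro: a_comm bexI[of _ "\<ominus> x" for x])

lemma free_module_simps [simp]:
  "c \<in> carrier (free_module R X) \<longleftrightarrow>
    (\<forall>x. c x \<in> carrier R) \<and> {x. c x \<noteq> \<zero>} \<subseteq> X \<and> finite {x. c x \<noteq> \<zero>}"
  "zero (free_module R X) = (\<lambda>x. \<zero>)" "add (free_module R X) = (\<lambda>c d x. c x \<oplus> d x)"
  "smult (free_module R X) = (\<lambda>a c x. a \<otimes> c x)"
  by (auto simp: free_module_def)

lemma module_free: "module R (free_module R X)"
proof (rule moduleI[OF is_cring])
  show "abelian_group (free_module R X)"
  proof (rule abelian_groupI, goal_cases)
    case (1 c d)
    then have "{x. c x \<oplus> d x \<noteq> \<zero>} \<subseteq> {x. c x \<noteq> \<zero>} \<union> {x. d x \<noteq> \<zero>}" by auto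
    moreover from this have "finite {x. c x \<oplus> d x \<noteq> \<zero>}" by (rule finite_subset) (use 1 in simp)
    ultimately show ?case using 1 by auto
  next
    case (6 c)
    have "(\<lambda>x. \<ominus> c x) \<in> carrier (free_module R X)"
    proof -
      have "{x. \<ominus> c x \<noteq> \<zero>} = {x. c x \<noteq> \<zero>}" using 6 by auto
      then show ?thesis using 6 by simp
    qed
    moreover have "(\<lambda>x. \<ominus> c x) \<oplus>\<^bsub>free_module R X\<^esub> c = \<zero>\<^bsub>free_module R X\<^esub>"
      using 6 by (auto simp: l_neg)
    ultimately show ?case by blast
  qed (auto simp: a_ac)
next
  fix a c assume h: "a \<in> carrier R" "c \<in> carrier (free_module R X)"
  then have "{x. a \<otimes> c x \<noteq> \<zero>} \<subseteq> {x. c x \<noteq> \<zero>}" by auto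
  moreover from this have "finite {x. a \<otimes> c x \<noteq> \<zero>}" by (rule finite_subset) (use h in simp)
  ultimately show "a \<odot>\<^bsub>free_module R X\<^esub> c \<in> carrier (free_module R X)"
    using h by auto
qed (auto simp: l_distr r_distr m_assoc)

lemma basis_vector_closed:
  assumes "x \<in> X" shows "basis_vector R x \<in> carrier (free_module R X)"
proof -
  have "{y. basis_vector R x y \<noteq> \<zero>} \<subseteq> {x}" by (auto simp: basis_vector_def)
  moreover from this have "finite {y. basis_vector R x y \<noteq> \<zero>}" by (rule finite_subset) simp
  ultimately show ?thesis using assms by (auto simp: basis_vector_def)
qed

text \<open>Induction on a finite set containing the support of \<open>c\<close>: the coefficient at
  the new point is split off, leaving \<open>c(x := \<zero>)\<close>.\<close>

lemma free_module_ext: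
  assumes "module R W" "f \<in> lin (free_module R X) W" "g \<in> lin (free_module R X) W"
    and eq: "\<And>x. x \<in> X \<Longrightarrow> f (basis_vector R x) = g (basis_vector R x)"
    and c: "c \<in> carrier (free_module R X)"
  shows "f c = g c"
proof -
  let ?M = "free_module R X"
  have "f c = g c" if "finite S" "c \<in> carrier ?M" "{x. c x \<noteq> \<zero>} \<subseteq> S" for S c
    using that
  proof (induction S arbitrary: c)
    case empty
    then have "c = \<zero>\<^bsub>?M\<^esub>" by auto
    then show ?case using linear_zero[OF module_free assms(1)] assms(2,3) by metis
  next
    case (insert x S)
    define d where "d = c(x := \<zero>)"
    have d: "d \<in> carrier ?M" "{x. d x \<noteq> \<zero>} \<subseteq> S"
    proof -
      have "{x. d x \<noteq> \<zero>} \<subseteq> {x. c x \<noteq> \<zero>}" by (auto simp: d_def)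
      moreover from this have "finite {x. d x \<noteq> \<zero>}" by (rule finite_subset) (use insert(4) in simp)
      ultimately show "d \<in> carrier ?M" using insert(4) by (auto simp: d_def)
      show "{x. d x \<noteq> \<zero>} \<subseteq> S" using insert(5) by (auto simp: d_def)
    qed
    show ?case
    proof (cases "c x = \<zero>")
      case True
      then have "c = d" by (auto simp: d_def)
      then show ?thesis using insert.IH d by simp
    next
      case False
      then have x: "x \<in> X" using insert(4) by auto
      have cx: "c x \<in> carrier R" using insert(4) by simp
      have "c = d \<oplus>\<^bsub>?M\<^esub> (c x \<odot>\<^bsub>?M\<^esub> basis_vector R x)"
        using insert(4) by (auto simp: d_def basis_vector_def)
      moreover have "h (d \<oplus>\<^bsub>?M\<^esub> (c x \<odot>\<^bsub>?M\<^esub> basis_vector R x)) =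
          h d \<oplus>\<^bsub>W\<^esub> c x \<odot>\<^bsub>W\<^esub> h (basis_vector R x)" if h: "h \<in> lin ?M W" for h
        using linearD(2,3)[OF h] d(1) module.smult_closed[OF module_free cx basis_vector_closed[OF x]]
          basis_vector_closed[OF x] cx by metis
      ultimately show ?thesis using insert.IH d assms(2,3) eq[OF x] by metis
    qed
  qed
  then show ?thesis using c by auto
qed

text \<open>The linear extension of \<open>\<phi>\<close> from basis vectors; this is what
  \<open>tensor_lift\<close> evaluates on the representative it chooses.\<close>

definition lincomb :: "('a, 'w, 'd) module_scheme \<Rightarrow> ('x \<Rightarrow> 'w) \<Rightarrow> ('x \<Rightarrow> 'a) \<Rightarrow> 'w"
  where "lincomb W \<phi> c = (\<Oplus>\<^bsub>W\<^esub>x\<in>{x. c x \<noteq> \<zero>}. c x \<odot>\<^bsub>W\<^esub> \<phi> x)"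

lemma lincomb_superset:
  assumes "module R W" "c \<in> carrier (free_module R X)" "\<phi> \<in> X \<rightarrow> carrier W"
    "finite S" "{x. c x \<noteq> \<zero>} \<subseteq> S" "S \<subseteq> X"
  shows "lincomb W \<phi> c = (\<Oplus>\<^bsub>W\<^esub>x\<in>S. c x \<odot>\<^bsub>W\<^esub> \<phi> x)"
proof -
  interpret W: module R W by fact
  show ?thesis unfolding lincomb_def
    by (rule W.add.finprod_mono_neutral_cong_left) (use assms in \<open>auto simp: Pi_iff subset_iff\<close>)
qed

lemma lincomb_linear:
  assumes "module R W" "\<phi> \<in> X \<rightarrow> carrier W"
  shows "lincomb W \<phi> \<in> lin (free_module R X) W"
proof -
  interpret W: module R W by fact
  have cl: "(\<lambda>x. c x \<odot>\<^bsub>W\<^esub> \<phi> x) \<in> S \<rightarrow> carrier W" if "c \<in> carrier (free_module R X)" "S \<subseteq> X" for c S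
    using that assms(2) by (auto simp: Pi_iff subset_iff)
  show ?thesis
  proof (rule linearI)
    fix c assume c: "c \<in> carrier (free_module R X)"
    then have "{x. c x \<noteq> \<zero>} \<subseteq> X" by simp
    then show "lincomb W \<phi> c \<in> carrier W" unfolding lincomb_def
      by (intro W.finsum_closed cl[OF c])
  next
    fix c d assume h: "c \<in> carrier (free_module R X)" "d \<in> carrier (free_module R X)"
    \<comment> \<open>The three supports differ because coefficients can cancel, so all sums are
      first extended to one finite set containing them.\<close>
    let ?S = "{x. c x \<noteq> \<zero>} \<union> {x. d x \<noteq> \<zero>}"
    have s: "finite ?S" "?S \<subseteq> X" "{x. c x \<noteq> \<zero>} \<subseteq> ?S" "{x. d x \<noteq> \<zero>} \<subseteq> ?S"
      "{x. (c \<oplus>\<^bsub>free_module R X\<^esub> d) x \<noteq> \<zero>} \<subseteq> ?S" using h by auto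
    have cd: "c \<oplus>\<^bsub>free_module R X\<^esub> d \<in> carrier (free_module R X)"
      using abelian_monoid.a_closed[OF abelian_group.axioms(1)[OF module.axioms(2)[OF module_free]]] h by blast
    have "lincomb W \<phi> (c \<oplus>\<^bsub>free_module R X\<^esub> d) = (\<Oplus>\<^bsub>W\<^esub>x\<in>?S. (c x \<oplus> d x) \<odot>\<^bsub>W\<^esub> \<phi> x)"
      using lincomb_superset[OF assms(1) cd assms(2) s(1,5,2)] by simp
    also have "\<dots> = (\<Oplus>\<^bsub>W\<^esub>x\<in>?S. c x \<odot>\<^bsub>W\<^esub> \<phi> x \<oplus>\<^bsub>W\<^esub> d x \<odot>\<^bsub>W\<^esub> \<phi> x)"
      by (rule W.finsum_cong') (use h s assms(2) in \<open>auto simp: W.smult_l_distr Pi_iff subset_iff\<close>)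
    also have "\<dots> = lincomb W \<phi> c \<oplus>\<^bsub>W\<^esub> lincomb W \<phi> d"
      unfolding lincomb_superset[OF assms(1) h(1) assms(2) s(1,3,2)]
        lincomb_superset[OF assms(1) h(2) assms(2) s(1,4,2)]
      by (rule W.finsum_addf[OF cl[OF h(1) s(2)] cl[OF h(2) s(2)]])
    finally show "lincomb W \<phi> (c \<oplus>\<^bsub>free_module R X\<^esub> d) = lincomb W \<phi> c \<oplus>\<^bsub>W\<^esub> lincomb W \<phi> d" .
  next
    fix a c assume h: "a \<in> carrier R" "c \<in> carrier (free_module R X)"
    let ?S = "{x. c x \<noteq> \<zero>}"
    have s: "finite ?S" "?S \<subseteq> X" "{x. (a \<odot>\<^bsub>free_module R X\<^esub> c) x \<noteq> \<zero>} \<subseteq> ?S" using h by auto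
    have ac: "a \<odot>\<^bsub>free_module R X\<^esub> c \<in> carrier (free_module R X)"
      using module.smult_closed[OF module_free] h by blast
    have "lincomb W \<phi> (a \<odot>\<^bsub>free_module R X\<^esub> c) = (\<Oplus>\<^bsub>W\<^esub>x\<in>?S. (a \<otimes> c x) \<odot>\<^bsub>W\<^esub> \<phi> x)"
      using lincomb_superset[OF assms(1) ac assms(2) s(1,3,2)] by simp
    also have "\<dots> = (\<Oplus>\<^bsub>W\<^esub>x\<in>?S. a \<odot>\<^bsub>W\<^esub> (c x \<odot>\<^bsub>W\<^esub> \<phi> x))"
      by (rule W.finsum_cong') (use h s assms(2) in \<open>auto simp: W.smult_assoc1 Pi_iff subset_iff\<close>)
    also have "\<dots> = a \<odot>\<^bsub>W\<^esub> lincomb W \<phi> c"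
      unfolding lincomb_def by (rule W.finsum_smult_ldistr[symmetric, OF s(1) h(1) cl[OF h(2) s(2)]])
    finally show "lincomb W \<phi> (a \<odot>\<^bsub>free_module R X\<^esub> c) = a \<odot>\<^bsub>W\<^esub> lincomb W \<phi> c" .
  qed
qed

lemma lincomb_basis_vector:
  assumes "module R W" "\<phi> x \<in> carrier W"
  shows "lincomb W \<phi> (basis_vector R x) = \<phi> x"
proof -
  interpret W: module R W by fact
  have "{y. basis_vector R x y \<noteq> \<zero>} = {x}" using one_not_zero by (auto simp: basis_vector_def)
  then show ?thesis unfolding lincomb_def using assms(2) by (simp add: basis_vector_def)
qed

lemma submodule_linear_span:
  assumes "module R V" "S \<subseteq> carrier V"
  shows "submodule (linear_span R V S) R V"
proof (rule submoduleI'[OF assms(1)])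
  have 1: "submodule (carrier V) R V" by (rule submodule_carrier[OF assms(1)])
  show "linear_span R V S \<subseteq> carrier V" unfolding linear_span_def using 1 assms(2) by blast
  show "\<zero>\<^bsub>V\<^esub> \<in> linear_span R V S"
    unfolding linear_span_def using submoduleD(2)[OF assms(1)] by blast
  show "x \<oplus>\<^bsub>V\<^esub> y \<in> linear_span R V S" if "x \<in> linear_span R V S" "y \<in> linear_span R V S" for x y
    using that unfolding linear_span_def using submoduleD(3)[OF assms(1)] by blast
  show "a \<odot>\<^bsub>V\<^esub> x \<in> linear_span R V S" if "a \<in> carrier R" "x \<in> linear_span R V S" for a x
    using that unfolding linear_span_def using submoduleD(4)[OF assms(1)] by blast
qed

lemma linear_span_subset: "S \<subseteq> linear_span R V S"
  unfolding linear_span_def by blast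

lemma linear_span_least: "\<lbrakk>submodule N R V; S \<subseteq> N\<rbrakk> \<Longrightarrow> linear_span R V S \<subseteq> N"
  unfolding linear_span_def by blast

section \<open>Multilinear maps and the universal property of the tensor product\<close>

definition multilinear :: "('a, 'p, 'c) module_scheme \<Rightarrow> nat \<Rightarrow> ('a, 'v, 'd) module_scheme
    \<Rightarrow> ('a, 'w, 'e) module_scheme \<Rightarrow> ('p list \<Rightarrow> 'v \<Rightarrow> 'w) \<Rightarrow> bool"
  where "multilinear P n V W \<phi> \<longleftrightarrow> (\<forall>ps v. (ps, v) \<in> tuples P n V \<longrightarrow>
     (\<forall>i<n. (\<lambda>p. \<phi> (ps[i := p]) v) \<in> lin P W) \<and> (\<lambda>u. \<phi> ps u) \<in> lin V W)"

lemma multilinearI: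
  assumes "\<And>ps v i. \<lbrakk>(ps, v) \<in> tuples P n V; i < n\<rbrakk> \<Longrightarrow> (\<lambda>p. \<phi> (ps[i := p]) v) \<in> lin P W"
    "\<And>ps v. (ps, v) \<in> tuples P n V \<Longrightarrow> (\<lambda>u. \<phi> ps u) \<in> lin V W"
  shows "multilinear P n V W \<phi>"
  unfolding multilinear_def using assms by simp

lemma multilinearD:
  assumes "multilinear P n V W \<phi>" "(ps, v) \<in> tuples P n V"
  shows "i < n \<Longrightarrow> (\<lambda>p. \<phi> (ps[i := p]) v) \<in> lin P W"
    "(\<lambda>u. \<phi> ps u) \<in> lin V W" "\<phi> ps v \<in> carrier W"
proof -
  show 1: "(\<lambda>u. \<phi> ps u) \<in> lin V W" using assms unfolding multilinear_def by blast
  show "i < n \<Longrightarrow> (\<lambda>p. \<phi> (ps[i := p]) v) \<in> lin P W"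
    using assms unfolding multilinear_def by blast
  show "\<phi> ps v \<in> carrier W" using linearD(1)[OF 1] assms(2) by (auto simp: tuples_def)
qed

lemma tuples_update:
  assumes "(ps, v) \<in> tuples P n V" "p \<in> carrier P"
  shows "(ps[i := p], v) \<in> tuples P n V"
  using assms set_update_subset_insert[of ps i p] by (auto simp: tuples_def)

lemma multilinear_relations_subset:
  assumes "module R P" "module R V"
  shows "multilinear_relations R P n V \<subseteq> carrier (free_tuples R P n V)"
proof -
  interpret P: module R P by fact
  interpret V: module R V by fact
  let ?X = "tuples P n V"
  interpret M: module R "free_module R ?X" by (rule module_free)
  have t: "(ps, v \<oplus>\<^bsub>V\<^esub> w) \<in> ?X" "(ps, w) \<in> ?X" if "(ps, v) \<in> ?X" "w \<in> carrier V" for ps v w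
    using that by (auto simp: tuples_def)
  have s: "(ps, a \<odot>\<^bsub>V\<^esub> v) \<in> ?X" if "(ps, v) \<in> ?X" "a \<in> carrier R" for ps v a
    using that by (auto simp: tuples_def)
  show ?thesis
    unfolding multilinear_relations_def Let_def
    by (auto simp del: free_module_simps
        intro!: M.minus_closed M.a_closed M.smult_closed basis_vector_closed tuples_update intro: t s)
qed

lemma submodule_null_tensors:
  assumes "module R P" "module R V"
  shows "submodule (null_tensors R P n V) R (free_tuples R P n V)"
  unfolding null_tensors_def
  by (rule submodule_linear_span[OF module_free multilinear_relations_subset[OF assms]])

lemma module_tensor:
  assumes "module R P" "module R V"
  shows "module R (tensor R P n V)"
  unfolding tensor_def by (rule module_quotient[OF module_free submodule_null_tensors[OF assms]])

text \<open>The kernel of the linear extension is a subspace. Multilinearity of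
  \<open>\<phi>\<close> puts the four families of relations into it, hence also their span.\<close>

lemma lincomb_null_tensors:
  assumes "module R P" "module R V" "module R W" and \<phi>: "multilinear P n V W \<phi>"
    and c: "c \<in> null_tensors R P n V"
  shows "lincomb W (\<lambda>x. \<phi> (fst x) (snd x)) c = \<zero>\<^bsub>W\<^esub>"
proof -
  interpret P: module R P by fact
  interpret V: module R V by fact
  interpret W: module R W by fact
  let ?M = "free_tuples R P n V" and ?l = "lincomb W (\<lambda>x. \<phi> (fst x) (snd x))" and ?X = "tuples P n V"
  interpret M: module R ?M by (rule module_free)
  have cl: "(\<lambda>x. \<phi> (fst x) (snd x)) \<in> ?X \<rightarrow> carrier W" using multilinearD(3)[OF \<phi>] by auto
  note l = lincomb_linear[OF assms(3) cl]
  note ker = submodule_kernel[OF module_free assms(3) l]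
  have lb: "?l (basis_vector R (ps, v)) = \<phi> ps v" if "(ps, v) \<in> ?X" for ps v
    using lincomb_basis_vector[OF assms(3), of "\<lambda>x. \<phi> (fst x) (snd x)" "(ps, v)"] multilinearD(3)[OF \<phi> that]
    by simp
  note lD = linearD[OF l] linear_minus[OF module_free assms(3) l]
  have "multilinear_relations R P n V \<subseteq> {c \<in> carrier ?M. ?l c = \<zero>\<^bsub>W\<^esub>}"
  proof
    fix r assume r: "r \<in> multilinear_relations R P n V"
    then have rc: "r \<in> carrier ?M" using multilinear_relations_subset[OF assms(1,2)] by blast
    have "?l r = \<zero>\<^bsub>W\<^esub>"
      using r unfolding multilinear_relations_def Let_def Un_iff mem_Collect_eq
    proof (elim disjE exE conjE)
      fix ps v i p q assume h: "r = basis_vector R (ps[i := p \<oplus>\<^bsub>P\<^esub> q], v) \<ominus>\<^bsub>?M\<^esub>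
          (basis_vector R (ps[i := p], v) \<oplus>\<^bsub>?M\<^esub> basis_vector R (ps[i := q], v))"
        "(ps, v) \<in> ?X" "i < n" "p \<in> carrier P" "q \<in> carrier P"
      have t: "(ps[i := p \<oplus>\<^bsub>P\<^esub> q], v) \<in> ?X" "(ps[i := p], v) \<in> ?X" "(ps[i := q], v) \<in> ?X"
        using tuples_update[OF h(2)] h by auto
      note b = t[THEN basis_vector_closed]
      show ?thesis
        unfolding h(1) lD(4)[OF b(1) M.a_closed[OF b(2,3)]] lD(2)[OF b(2,3)] t[THEN lb]
          linearD(2)[OF multilinearD(1)[OF \<phi> h(2,3)] h(4,5)]
        using t[THEN multilinearD(3)[OF \<phi>]] by simp
    next
      fix ps v i a p assume h: "r = basis_vector R (ps[i := a \<odot>\<^bsub>P\<^esub> p], v) \<ominus>\<^bsub>?M\<^esub>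
          (a \<odot>\<^bsub>?M\<^esub> basis_vector R (ps[i := p], v))"
        "(ps, v) \<in> ?X" "i < n" "a \<in> carrier R" "p \<in> carrier P"
      have t: "(ps[i := a \<odot>\<^bsub>P\<^esub> p], v) \<in> ?X" "(ps[i := p], v) \<in> ?X"
        using tuples_update[OF h(2)] h by auto
      note b = t[THEN basis_vector_closed]
      show ?thesis
        unfolding h(1) lD(4)[OF b(1) M.smult_closed[OF h(4) b(2)]] lD(3)[OF h(4) b(2)] t[THEN lb]
          linearD(3)[OF multilinearD(1)[OF \<phi> h(2,3)] h(4,5)]
        using t[THEN multilinearD(3)[OF \<phi>]] h(4) by simp
    next
      fix ps v w assume h: "r = basis_vector R (ps, v \<oplus>\<^bsub>V\<^esub> w) \<ominus>\<^bsub>?M\<^esub>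
          (basis_vector R (ps, v) \<oplus>\<^bsub>?M\<^esub> basis_vector R (ps, w))"
        "(ps, v) \<in> ?X" "w \<in> carrier V"
      have v: "v \<in> carrier V" using h(2) by (simp add: tuples_def)
      have t: "(ps, v \<oplus>\<^bsub>V\<^esub> w) \<in> ?X" "(ps, v) \<in> ?X" "(ps, w) \<in> ?X"
        using h v by (auto simp: tuples_def)
      note b = t[THEN basis_vector_closed]
      show ?thesis
        unfolding h(1) lD(4)[OF b(1) M.a_closed[OF b(2,3)]] lD(2)[OF b(2,3)] t[THEN lb]
          linearD(2)[OF multilinearD(2)[OF \<phi> h(2)] v h(3)]
        using t[THEN multilinearD(3)[OF \<phi>]] by simp
    next
      fix ps v a assume h: "r = basis_vector R (ps, a \<odot>\<^bsub>V\<^esub> v) \<ominus>\<^bsub>?M\<^esub> (a \<odot>\<^bsub>?M\<^esub> basis_vector R (ps, v))"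
        "(ps, v) \<in> ?X" "a \<in> carrier R"
      have v: "v \<in> carrier V" using h(2) by (simp add: tuples_def)
      have t: "(ps, a \<odot>\<^bsub>V\<^esub> v) \<in> ?X" "(ps, v) \<in> ?X" using h v by (auto simp: tuples_def)
      note b = t[THEN basis_vector_closed]
      show ?thesis
        unfolding h(1) lD(4)[OF b(1) M.smult_closed[OF h(3) b(2)]] lD(3)[OF h(3) b(2)] t[THEN lb]
          linearD(3)[OF multilinearD(2)[OF \<phi> h(2)] h(3) v]
        using t[THEN multilinearD(3)[OF \<phi>]] h(3) by simp
    qed
    then show "r \<in> {c \<in> carrier ?M. ?l c = \<zero>\<^bsub>W\<^esub>}" using rc by blast
  qed
  then have "null_tensors R P n V \<subseteq> {c \<in> carrier ?M. ?l c = \<zero>\<^bsub>W\<^esub>}"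
    unfolding null_tensors_def by (rule linear_span_least[OF ker])
  then show ?thesis using c by blast
qed

text \<open>The representative picked by \<open>SOME\<close> differs from \<open>c\<close> by a null
  tensor, on which the linear extension vanishes.\<close>

lemma tensor_lift_coset:
  assumes "module R P" "module R V" "module R W" and \<phi>: "multilinear P n V W \<phi>"
    and c: "c \<in> carrier (free_tuples R P n V)"
  shows "tensor_lift R W \<phi> (null_tensors R P n V +>\<^bsub>free_tuples R P n V\<^esub> c) =
    lincomb W (\<lambda>x. \<phi> (fst x) (snd x)) c"
proof -
  let ?M = "free_tuples R P n V" and ?l = "lincomb W (\<lambda>x. \<phi> (fst x) (snd x))" and ?N = "null_tensors R P n V"
  interpret M: module R ?M by (rule module_free)
  interpret W: module R W by fact
  note N = submodule_null_tensors[OF assms(1,2), of n]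
  have cl: "(\<lambda>x. \<phi> (fst x) (snd x)) \<in> tuples P n V \<rightarrow> carrier W" using multilinearD(3)[OF \<phi>] by auto
  note l = lincomb_linear[OF assms(3) cl]
  define d where "d = (SOME d. d \<in> ?N +>\<^bsub>?M\<^esub> c)"
  have "d \<in> ?N +>\<^bsub>?M\<^esub> c" unfolding d_def by (rule someI[of "\<lambda>d. d \<in> ?N +>\<^bsub>?M\<^esub> c"]) (rule mem_coset_self[OF module_free N c])
  then have d: "d \<in> carrier ?M" "d \<ominus>\<^bsub>?M\<^esub> c \<in> ?N" using mem_coset_iff[OF module_free N c] by blast+
  have "?l d \<ominus>\<^bsub>W\<^esub> ?l c = \<zero>\<^bsub>W\<^esub>"
    using lincomb_null_tensors[OF assms(1-3) \<phi> d(2)] linear_minus[OF module_free assms(3) l d(1) c]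
    by simp
  then have "?l d = ?l c" using W.minus_eq_zero_iff linearD(1)[OF l] d(1) c by blast
  then show ?thesis unfolding tensor_lift_def Let_def d_def[symmetric] lincomb_def by simp
qed

lemma tensor_carrier:
  "carrier (tensor R P n V) =
    (\<lambda>c. null_tensors R P n V +>\<^bsub>free_tuples R P n V\<^esub> c) ` carrier (free_tuples R P n V)"
  unfolding tensor_def quotient_carrier ..

lemma tensor_coset_linear:
  assumes "module R P" "module R V"
  shows "(\<lambda>c. null_tensors R P n V +>\<^bsub>free_tuples R P n V\<^esub> c) \<in>
    lin (free_tuples R P n V) (tensor R P n V)"
  unfolding tensor_def by (rule quotient_map_linear[OF module_free submodule_null_tensors[OF assms]])

lemma tensor_lift_linear:
  assumes "module R P" "module R V" "module R W" and \<phi>: "multilinear P n V W \<phi>"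
  shows "tensor_lift R W \<phi> \<in> lin (tensor R P n V) W"
proof -
  let ?M = "free_tuples R P n V" and ?T = "tensor R P n V"
  interpret M: module R ?M by (rule module_free)
  have cl: "(\<lambda>x. \<phi> (fst x) (snd x)) \<in> tuples P n V \<rightarrow> carrier W" using multilinearD(3)[OF \<phi>] by auto
  note l = linearD[OF lincomb_linear[OF assms(3) cl]]
  note eq = tensor_lift_coset[OF assms]
  note t = linearD[OF tensor_coset_linear[OF assms(1,2), of n]]
  show ?thesis
  proof (rule linearI)
    fix x assume "x \<in> carrier ?T"
    then show "tensor_lift R W \<phi> x \<in> carrier W" unfolding tensor_carrier using eq l(1) by auto
  next
    fix x y assume "x \<in> carrier ?T" "y \<in> carrier ?T"
    then obtain c d where h: "c \<in> carrier ?M" "d \<in> carrier ?M"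
      "x = null_tensors R P n V +>\<^bsub>?M\<^esub> c" "y = null_tensors R P n V +>\<^bsub>?M\<^esub> d"
      unfolding tensor_carrier by blast
    show "tensor_lift R W \<phi> (x \<oplus>\<^bsub>?T\<^esub> y) = tensor_lift R W \<phi> x \<oplus>\<^bsub>W\<^esub> tensor_lift R W \<phi> y"
      unfolding h(3,4) t(2)[OF h(1,2), symmetric] eq[OF h(1)] eq[OF h(2)] eq[OF M.a_closed[OF h(1,2)]]
      by (rule l(2)[OF h(1,2)])
  next
    fix a x assume a: "a \<in> carrier R" and "x \<in> carrier ?T"
    then obtain c where h: "c \<in> carrier ?M" "x = null_tensors R P n V +>\<^bsub>?M\<^esub> c"
      unfolding tensor_carrier by blast
    show "tensor_lift R W \<phi> (a \<odot>\<^bsub>?T\<^esub> x) = a \<odot>\<^bsub>W\<^esub> tensor_lift R W \<phi> x"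
      unfolding h(2) t(3)[OF a h(1), symmetric] eq[OF h(1)] eq[OF M.smult_closed[OF a h(1)]]
      by (rule l(3)[OF a h(1)])
  qed
qed

lemma tensor_lift_pure:
  assumes "module R P" "module R V" "module R W" and \<phi>: "multilinear P n V W \<phi>"
    and t: "(ps, v) \<in> tuples P n V"
  shows "tensor_lift R W \<phi> (pure_tensor R P V ps v) = \<phi> ps v"
proof -
  have n: "length ps = n" using t by (simp add: tuples_def)
  show ?thesis
    using tensor_lift_coset[OF assms(1-4) basis_vector_closed[OF t]]
      lincomb_basis_vector[OF assms(3), of "\<lambda>x. \<phi> (fst x) (snd x)" "(ps, v)"] multilinearD(3)[OF \<phi> t]
    unfolding pure_tensor_def n by simp
qed

lemma pure_tensor_closed:
  assumes "module R P" "module R V" "(ps, v) \<in> tuples P n V"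
  shows "pure_tensor R P V ps v \<in> carrier (tensor R P n V)"
proof -
  have n: "length ps = n" using assms(3) by (simp add: tuples_def)
  show ?thesis unfolding pure_tensor_def n
    by (rule linearD(1)[OF tensor_coset_linear[OF assms(1,2)] basis_vector_closed[OF assms(3)]])
qed

lemma tensor_ext:
  assumes "module R P" "module R V" "module R W"
    "f \<in> lin (tensor R P n V) W" "g \<in> lin (tensor R P n V) W"
    and eq: "\<And>ps v. (ps, v) \<in> tuples P n V \<Longrightarrow> f (pure_tensor R P V ps v) = g (pure_tensor R P V ps v)"
    and t: "t \<in> carrier (tensor R P n V)"
  shows "f t = g t"
proof -
  let ?c = "\<lambda>c. null_tensors R P n V +>\<^bsub>free_tuples R P n V\<^esub> c"
  note c = tensor_coset_linear[OF assms(1,2), of n]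
  obtain d where d: "d \<in> carrier (free_tuples R P n V)" "t = ?c d" using t unfolding tensor_carrier by blast
  have "f (?c d) = g (?c d)"
  proof (rule free_module_ext[OF assms(3) linear_comp[OF assms(4) c] linear_comp[OF assms(5) c] _ d(1)])
    fix x assume x: "x \<in> tuples P n V"
    obtain ps v where pv: "x = (ps, v)" by force
    then have "length ps = n" using x by (simp add: tuples_def)
    then show "f (?c (basis_vector R x)) = g (?c (basis_vector R x))"
      using eq[of ps v] x unfolding pure_tensor_def pv by simp
  qed
  then show ?thesis using d(2) by simp
qed

text \<open>Each linearity law is one of the imposed relations, read as an equality of
  cosets.\<close>

lemma pure_tensor_multilinear:
  assumes "module R P" "module R V"
  shows "multilinear P n V (tensor R P n V) (pure_tensor R P V)"
proof -
  interpret P: module R P by fact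
  interpret V: module R V by fact
  let ?M = "free_tuples R P n V" and ?T = "tensor R P n V" and ?N = "null_tensors R P n V"
  let ?X = "tuples P n V"
  interpret M: module R ?M by (rule module_free)
  note c = tensor_coset_linear[OF assms, of n]
  note sN = submodule_null_tensors[OF assms, of n]
  have pure: "pure_tensor R P V ps v = ?N +>\<^bsub>?M\<^esub> basis_vector R (ps, v)" if "(ps, v) \<in> ?X" for ps v
    using that by (simp add: pure_tensor_def tuples_def)
  have rel: "?N +>\<^bsub>?M\<^esub> b = ?N +>\<^bsub>?M\<^esub> d" if "b \<ominus>\<^bsub>?M\<^esub> d \<in> multilinear_relations R P n V"
    "b \<in> carrier ?M" "d \<in> carrier ?M" for b d
    by (rule coset_eq_iff[OF module_free sN that(2,3), THEN iffD2])
       (unfold null_tensors_def, rule subsetD[OF linear_span_subset that(1)])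
  show ?thesis
  proof (rule multilinearI; rule linearI)
    fix ps v i p assume h: "(ps, v) \<in> ?X" "i < n" "p \<in> carrier P"
    show "pure_tensor R P V (ps[i := p]) v \<in> carrier ?T"
      by (rule pure_tensor_closed[OF assms tuples_update[OF h(1,3)]])
  next
    fix ps v i p q assume h: "(ps, v) \<in> ?X" "i < n" "p \<in> carrier P" "q \<in> carrier P"
    have t: "(ps[i := p \<oplus>\<^bsub>P\<^esub> q], v) \<in> ?X" "(ps[i := p], v) \<in> ?X" "(ps[i := q], v) \<in> ?X"
      using tuples_update[OF h(1)] h by auto
    note b = t[THEN basis_vector_closed]
    show "pure_tensor R P V (ps[i := p \<oplus>\<^bsub>P\<^esub> q]) v =
        pure_tensor R P V (ps[i := p]) v \<oplus>\<^bsub>?T\<^esub> pure_tensor R P V (ps[i := q]) v"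
      unfolding t[THEN pure] linearD(2)[OF c b(2,3), symmetric]
    proof (rule rel[OF _ b(1) M.a_closed[OF b(2,3)]])
      show "basis_vector R (ps[i := p \<oplus>\<^bsub>P\<^esub> q], v) \<ominus>\<^bsub>?M\<^esub>
          (basis_vector R (ps[i := p], v) \<oplus>\<^bsub>?M\<^esub> basis_vector R (ps[i := q], v)) \<in> multilinear_relations R P n V"
        unfolding multilinear_relations_def Let_def using h by blast
    qed
  next
    fix ps v i a p assume h: "(ps, v) \<in> ?X" "i < n" "a \<in> carrier R" "p \<in> carrier P"
    have t: "(ps[i := a \<odot>\<^bsub>P\<^esub> p], v) \<in> ?X" "(ps[i := p], v) \<in> ?X"
      using tuples_update[OF h(1)] h by auto
    note b = t[THEN basis_vector_closed]
    show "pure_tensor R P V (ps[i := a \<odot>\<^bsub>P\<^esub> p]) v = a \<odot>\<^bsub>?T\<^esub> pure_tensor R P V (ps[i := p]) v"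
      unfolding t[THEN pure] linearD(3)[OF c h(3) b(2), symmetric]
    proof (rule rel[OF _ b(1) M.smult_closed[OF h(3) b(2)]])
      show "basis_vector R (ps[i := a \<odot>\<^bsub>P\<^esub> p], v) \<ominus>\<^bsub>?M\<^esub> a \<odot>\<^bsub>?M\<^esub> basis_vector R (ps[i := p], v)
          \<in> multilinear_relations R P n V"
        unfolding multilinear_relations_def Let_def using h by blast
    qed
  next
    fix ps v u assume h: "(ps, v) \<in> ?X" "u \<in> carrier V"
    show "pure_tensor R P V ps u \<in> carrier ?T"
      by (rule pure_tensor_closed[OF assms]) (use h in \<open>simp add: tuples_def\<close>)
  next
    fix ps v u w assume h: "(ps, v) \<in> ?X" "u \<in> carrier V" "w \<in> carrier V"
    have t: "(ps, u \<oplus>\<^bsub>V\<^esub> w) \<in> ?X" "(ps, u) \<in> ?X" "(ps, w) \<in> ?X"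
      using h by (auto simp: tuples_def)
    note b = t[THEN basis_vector_closed]
    show "pure_tensor R P V ps (u \<oplus>\<^bsub>V\<^esub> w) = pure_tensor R P V ps u \<oplus>\<^bsub>?T\<^esub> pure_tensor R P V ps w"
      unfolding t[THEN pure] linearD(2)[OF c b(2,3), symmetric]
    proof (rule rel[OF _ b(1) M.a_closed[OF b(2,3)]])
      show "basis_vector R (ps, u \<oplus>\<^bsub>V\<^esub> w) \<ominus>\<^bsub>?M\<^esub> (basis_vector R (ps, u) \<oplus>\<^bsub>?M\<^esub> basis_vector R (ps, w))
          \<in> multilinear_relations R P n V"
        unfolding multilinear_relations_def Let_def using h t by blast
    qed
  next
    fix ps v a u assume h: "(ps, v) \<in> ?X" "a \<in> carrier R" "u \<in> carrier V"
    have t: "(ps, a \<odot>\<^bsub>V\<^esub> u) \<in> ?X" "(ps, u) \<in> ?X" using h by (auto simp: tuples_def)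
    note b = t[THEN basis_vector_closed]
    show "pure_tensor R P V ps (a \<odot>\<^bsub>V\<^esub> u) = a \<odot>\<^bsub>?T\<^esub> pure_tensor R P V ps u"
      unfolding t[THEN pure] linearD(3)[OF c h(2) b(2), symmetric]
    proof (rule rel[OF _ b(1) M.smult_closed[OF h(2) b(2)]])
      show "basis_vector R (ps, a \<odot>\<^bsub>V\<^esub> u) \<ominus>\<^bsub>?M\<^esub> a \<odot>\<^bsub>?M\<^esub> basis_vector R (ps, u)
          \<in> multilinear_relations R P n V"
        unfolding multilinear_relations_def Let_def using h t by blast
    qed
  qed
qed

text \<open>Both lifts read the same chosen representative, and its support lies in
  \<open>tuples P n V\<close>, so agreement there is enough. The values have to lie in the carrier
  because finite sums are compared in \<open>W\<close>.\<close>

lemma tensor_lift_cong: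
  assumes "module R P" "module R V" "module R W"
    and cl: "\<And>ps v. (ps, v) \<in> tuples P n V \<Longrightarrow> \<phi> ps v \<in> carrier W"
    and eq: "\<And>ps v. (ps, v) \<in> tuples P n V \<Longrightarrow> \<phi> ps v = \<psi> ps v"
    and t: "t \<in> carrier (tensor R P n V)"
  shows "tensor_lift R W \<phi> t = tensor_lift R W \<psi> t"
proof -
  let ?M = "free_tuples R P n V" and ?N = "null_tensors R P n V"
  interpret W: module R W by fact
  note sN = submodule_null_tensors[OF assms(1,2), of n]
  obtain c where c: "c \<in> carrier ?M" "t = ?N +>\<^bsub>?M\<^esub> c" using t unfolding tensor_carrier by blast
  define d where "d = (SOME d. d \<in> t)"
  have "d \<in> t" unfolding d_def
    by (rule someI[of "\<lambda>d. d \<in> t"]) (unfold c(2), rule mem_coset_self[OF module_free sN c(1)])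
  then have d: "d \<in> carrier ?M" using mem_coset_iff[OF module_free sN c(1)] c(2) by blast
  show ?thesis unfolding tensor_lift_def Let_def d_def[symmetric]
  proof (rule W.finsum_cong')
    show "(\<lambda>x. d x \<odot>\<^bsub>W\<^esub> \<psi> (fst x) (snd x)) \<in> {x. d x \<noteq> \<zero>} \<rightarrow> carrier W"
    proof
      fix x assume "x \<in> {x. d x \<noteq> \<zero>}"
      then have "x \<in> tuples P n V" using d by auto
      then have "\<psi> (fst x) (snd x) \<in> carrier W" using cl eq by (metis prod.collapse)
      moreover have "d x \<in> carrier R" using d unfolding free_module_simps by blast
      ultimately show "d x \<odot>\<^bsub>W\<^esub> \<psi> (fst x) (snd x) \<in> carrier W" by (rule W.smult_closed[rotated])
    qed
    fix x assume "x \<in> {x. d x \<noteq> \<zero>}"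
    then have "x \<in> tuples P n V" using d by auto
    then show "d x \<odot>\<^bsub>W\<^esub> \<phi> (fst x) (snd x) = d x \<odot>\<^bsub>W\<^esub> \<psi> (fst x) (snd x)"
      using eq by (metis prod.collapse)
  qed simp
qed

end

section \<open>Multilinear calculus\<close>

text \<open>\<open>P \<otimes> V\<close> is written \<open>tensor K P 1 V\<close>; rewriting
  \<open>1\<close> to \<open>Suc 0\<close> would take terms out of reach of the rules stated for
  \<open>T 1 V\<close>.\<close>

declare One_nat_def [simp del]

type_synonym ('k, 'p, 'v) tensors = "('p list \<times> 'v \<Rightarrow> 'k) set"

locale tensor_power = K: field K + module K P
  for K :: "('k, 'a) ring_scheme" (structure) and P :: "('k, 'p, 'b) module_scheme" (structure)
begin

abbreviation "lin \<equiv> linear_maps K"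
abbreviation "T n V \<equiv> tensor K P n V"
abbreviation "pt V ps v \<equiv> pure_tensor K P V ps v"
abbreviation "sw W t \<beta> \<equiv> sweedler K W t \<beta>"

lemma module_P [simp, intro]: "module K P"
  by (rule module_axioms)

lemma module_T [simp, intro]: "module K V \<Longrightarrow> module K (T n V)"
  by (rule K.module_tensor[OF module_P])

definition bilinear :: "('k, 'v, 'c) module_scheme \<Rightarrow> ('k, 'w, 'd) module_scheme \<Rightarrow> ('p \<Rightarrow> 'v \<Rightarrow> 'w) \<Rightarrow> bool"
  where "bilinear X W \<beta> \<longleftrightarrow> (\<forall>p\<in>carrier P. \<beta> p \<in> lin X W) \<and> (\<forall>x\<in>carrier X. (\<lambda>p. \<beta> p x) \<in> lin P W)"

lemma bilinearI:
  assumes "\<And>p. p \<in> carrier P \<Longrightarrow> (\<lambda>x. \<beta> p x) \<in> lin X W" "\<And>x. x \<in> carrier X \<Longrightarrow> (\<lambda>p. \<beta> p x) \<in> lin P W"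
  shows "bilinear X W \<beta>"
  using assms by (simp add: bilinear_def)

lemma bilinearD:
  assumes "bilinear X W \<beta>"
  shows "p \<in> carrier P \<Longrightarrow> \<beta> p \<in> lin X W" "x \<in> carrier X \<Longrightarrow> (\<lambda>p. \<beta> p x) \<in> lin P W"
    "p \<in> carrier P \<Longrightarrow> x \<in> carrier X \<Longrightarrow> \<beta> p x \<in> carrier W"
  using assms K.linearD(1)[of "\<beta> p" X W x] by (simp_all add: bilinear_def)

lemma tuples_0: "(ps, v) \<in> tuples P 0 V \<longleftrightarrow> ps = [] \<and> v \<in> carrier V"
  by (auto simp: tuples_def)

lemma tuples_1: "(ps, v) \<in> tuples P 1 V \<longleftrightarrow> (\<exists>p. ps = [p] \<and> p \<in> carrier P \<and> v \<in> carrier V)"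
  by (auto simp: tuples_def length_Suc_conv One_nat_def)

lemma tuples_Suc: "(ps, v) \<in> tuples P (Suc n) V \<longleftrightarrow> (\<exists>p qs. ps = p # qs \<and> p \<in> carrier P \<and> (qs, v) \<in> tuples P n V)"
  by (auto simp: tuples_def length_Suc_conv)

lemma pure_closed: "\<lbrakk>module K V; (ps, v) \<in> tuples P n V\<rbrakk> \<Longrightarrow> pt V ps v \<in> carrier (T n V)"
  by (rule K.pure_tensor_closed[OF module_P])

lemma pure1_closed: "\<lbrakk>module K V; p \<in> carrier P; v \<in> carrier V\<rbrakk> \<Longrightarrow> pt V [p] v \<in> carrier (T 1 V)"
  by (rule pure_closed) (auto simp: tuples_1)

lemma pure0_closed: "\<lbrakk>module K V; v \<in> carrier V\<rbrakk> \<Longrightarrow> pt V [] v \<in> carrier (T 0 V)"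
  by (rule pure_closed) (auto simp: tuples_0)

lemma multilinear_bilinear:
  assumes "bilinear X W \<beta>"
  shows "K.multilinear P 1 X W (\<lambda>ps v. \<beta> (hd ps) v)"
  using bilinearD[OF assms] by (intro K.multilinearI) (auto simp: tuples_1)

lemma lin_sw_t0:
  assumes "module K X" "module K W" "bilinear X W \<beta>"
  shows "(\<lambda>t. sw W t \<beta>) \<in> lin (T 1 X) W"
  unfolding sweedler_def by (rule K.tensor_lift_linear[OF module_P assms(1,2) multilinear_bilinear[OF assms(3)]])

lemma sw_pure:
  assumes "module K X" "module K W" "bilinear X W \<beta>" "p \<in> carrier P" "x \<in> carrier X"
  shows "sw W (pt X [p] x) \<beta> = \<beta> p x"
  unfolding sweedler_def
  using K.tensor_lift_pure[OF module_P assms(1,2) multilinear_bilinear[OF assms(3)]] assms(4,5)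
  by (simp add: tuples_1)

lemma sw_closed:
  assumes "module K X" "module K W" "bilinear X W \<beta>" "t \<in> carrier (T 1 X)"
  shows "sw W t \<beta> \<in> carrier W"
  using K.linearD(1)[OF lin_sw_t0[OF assms(1-3)] assms(4)] .

lemma T1_ext:
  assumes "module K X" "module K W" "f \<in> lin (T 1 X) W" "g \<in> lin (T 1 X) W" "t \<in> carrier (T 1 X)"
    "\<And>p x. \<lbrakk>p \<in> carrier P; x \<in> carrier X\<rbrakk> \<Longrightarrow> f (pt X [p] x) = g (pt X [p] x)"
  shows "f t = g t"
  using K.tensor_ext[OF module_P assms(1-4) _ assms(5)] assms(6) by (auto simp: tuples_1)

lemma sw_cong:
  assumes "module K X" "module K W" "bilinear X W \<beta>" "t \<in> carrier (T 1 X)"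
    "\<And>p x. \<lbrakk>p \<in> carrier P; x \<in> carrier X\<rbrakk> \<Longrightarrow> \<beta> p x = \<gamma> p x"
  shows "sw W t \<beta> = sw W t \<gamma>"
  unfolding sweedler_def
  by (rule K.tensor_lift_cong[OF module_P assms(1,2) _ _ assms(4)])
     (use bilinearD(3)[OF assms(3)] assms(5) in \<open>auto simp: tuples_1\<close>)

lemma lin_sw_t:
  assumes "module K X" "module K W" "g \<in> lin U (T 1 X)" "bilinear X W \<beta>"
  shows "(\<lambda>u. sw W (g u) \<beta>) \<in> lin U W"
  by (rule K.linear_comp[OF lin_sw_t0[OF assms(1,2,4)] assms(3)])

text \<open>This is linearity in a parameter of the summand, as opposed to the tensor that is summed
  over. By \<open>T1_ext\<close> it may be checked on a pure tensor, where the Sweedler sum is a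
  single value.\<close>

lemma lin_sw_param:
  assumes "module K X" "module K W" "module K U" "t \<in> carrier (T 1 X)"
    "\<And>u. u \<in> carrier U \<Longrightarrow> bilinear X W (\<lambda>p x. \<beta> u p x)"
    "\<And>p x. \<lbrakk>p \<in> carrier P; x \<in> carrier X\<rbrakk> \<Longrightarrow> (\<lambda>u. \<beta> u p x) \<in> lin U W"
  shows "(\<lambda>u. sw W t (\<lambda>p x. \<beta> u p x)) \<in> lin U W"
proof (rule K.linearI)
  interpret U: module K U by fact
  interpret W: module K W by fact
  note sl = lin_sw_t0[OF assms(1,2,5)] and sp = sw_pure[OF assms(1,2,5)]
  show "sw W t (\<lambda>p x. \<beta> u p x) \<in> carrier W" if "u \<in> carrier U" for u
    by (rule sw_closed[OF assms(1,2) assms(5)[OF that] assms(4)])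
  show "sw W t (\<lambda>p x. \<beta> (u \<oplus>\<^bsub>U\<^esub> v) p x) = sw W t (\<lambda>p x. \<beta> u p x) \<oplus>\<^bsub>W\<^esub> sw W t (\<lambda>p x. \<beta> v p x)"
    if uv: "u \<in> carrier U" "v \<in> carrier U" for u v
    using T1_ext[OF assms(1,2) sl[OF U.a_closed[OF uv]] K.linear_add[OF assms(2) sl[OF uv(1)] sl[OF uv(2)]] assms(4)]
      sp uv K.linearD(2)[OF assms(6)] by simp
  show "sw W t (\<lambda>p x. \<beta> (a \<odot>\<^bsub>U\<^esub> u) p x) = a \<odot>\<^bsub>W\<^esub> sw W t (\<lambda>p x. \<beta> u p x)"
    if uv: "a \<in> carrier K" "u \<in> carrier U" for a u
    using T1_ext[OF assms(1,2) sl[OF U.smult_closed[OF uv]] K.linear_smult[OF assms(2) sl[OF uv(2)] uv(1)] assms(4)]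
      sp uv K.linearD(3)[OF assms(6)] by simp
qed

lemma lin_pure_r:
  assumes "module K V" "p \<in> carrier P" "g \<in> lin U V"
  shows "(\<lambda>u. pt V [p] (g u)) \<in> lin U (T 1 V)"
proof -
  interpret V: module K V by fact
  have "([p], \<zero>\<^bsub>V\<^esub>) \<in> tuples P 1 V" using assms(2) by (simp add: tuples_1)
  then show ?thesis
    using K.linear_comp[OF K.multilinearD(2)[OF K.pure_tensor_multilinear[OF module_P assms(1)]] assms(3)]
    by blast
qed

lemma lin_pure_l:
  assumes "module K V" "v \<in> carrier V" "g \<in> lin U P"
  shows "(\<lambda>u. pt V [g u] v) \<in> lin U (T 1 V)"
proof -
  have t: "([\<zero>\<^bsub>P\<^esub>], v) \<in> tuples P 1 V" using assms(2) by (simp add: tuples_1)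
  have "(\<lambda>p. pt V ([\<zero>\<^bsub>P\<^esub>][0 := p]) v) \<in> lin P (T 1 V)"
    by (rule K.multilinearD(1)[OF K.pure_tensor_multilinear[OF module_P assms(1)] t]) simp
  then have "(\<lambda>p. pt V [p] v) \<in> lin P (T 1 V)" by simp
  from K.linear_comp[OF this assms(3)] show ?thesis .
qed

lemma lin_pure0:
  assumes "module K V" "g \<in> lin U V"
  shows "(\<lambda>u. pt V [] (g u)) \<in> lin U (T 0 V)"
proof -
  interpret V: module K V by fact
  have "([], \<zero>\<^bsub>V\<^esub>) \<in> tuples P 0 V" by (simp add: tuples_0)
  then show ?thesis
    using K.linear_comp[OF K.multilinearD(2)[OF K.pure_tensor_multilinear[OF module_P assms(1)]] assms(2)]
    by blast
qed

lemma bilinear_pure: "module K X \<Longrightarrow> bilinear X (T 1 X) (\<lambda>p x. pt X [p] x)"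
  by (intro bilinearI lin_pure_r lin_pure_l K.linear_id)

lemma sw_eta:
  assumes "module K X" "t \<in> carrier (T 1 X)"
  shows "sw (T 1 X) t (\<lambda>p x. pt X [p] x) = t"
  using T1_ext[OF assms(1) module_T[OF assms(1)] lin_sw_t0[OF assms(1) module_T[OF assms(1)] bilinear_pure[OF assms(1)]]
    K.linear_id assms(2)] sw_pure[OF assms(1) module_T[OF assms(1)] bilinear_pure[OF assms(1)]]
  by simp

lemma bilinear_comp:
  assumes "f \<in> lin W W'" "bilinear X W \<beta>"
  shows "bilinear X W' (\<lambda>p x. f (\<beta> p x))"
  by (intro bilinearI K.linear_comp[OF assms(1)] bilinearD[OF assms(2)])

lemma lin_sw:
  assumes "module K X" "module K W" "module K W'" "f \<in> lin W W'" "bilinear X W \<beta>" "t \<in> carrier (T 1 X)"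
  shows "f (sw W t \<beta>) = sw W' t (\<lambda>p x. f (\<beta> p x))"
proof (rule T1_ext[OF assms(1,3) K.linear_comp[OF assms(4) lin_sw_t0[OF assms(1,2,5)]]
      lin_sw_t0[OF assms(1,3) bilinear_comp[OF assms(4,5)]] assms(6)])
  fix p x assume "p \<in> carrier P" "x \<in> carrier X"
  then show "f (sw W (pt X [p] x) \<beta>) = sw W' (pt X [p] x) (\<lambda>p x. f (\<beta> p x))"
    using sw_pure[OF assms(1,2,5)] sw_pure[OF assms(1,3) bilinear_comp[OF assms(4,5)]] by simp
qed

text \<open>Fubini for two independent Sweedler sums: when \<open>t\<close> is a pure tensor, both
  sides reduce to the sum over \<open>u\<close>.\<close>

lemma sw_swap:
  assumes "module K X" "module K Y" "module K W" "t \<in> carrier (T 1 X)" "u \<in> carrier (T 1 Y)"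
    "\<And>p x. \<lbrakk>p \<in> carrier P; x \<in> carrier X\<rbrakk> \<Longrightarrow> bilinear Y W (\<lambda>q y. \<phi> p x q y)"
    "\<And>q y. \<lbrakk>q \<in> carrier P; y \<in> carrier Y\<rbrakk> \<Longrightarrow> bilinear X W (\<lambda>p x. \<phi> p x q y)"
  shows "sw W t (\<lambda>p x. sw W u (\<lambda>q y. \<phi> p x q y)) = sw W u (\<lambda>q y. sw W t (\<lambda>p x. \<phi> p x q y))"
proof -
  have b: "bilinear X W (\<lambda>p x. sw W u (\<lambda>q y. \<phi> p x q y))"
    by (rule bilinearI; rule lin_sw_param[OF assms(2,3) _ assms(5)])
       (auto intro: assms(1,3,6) bilinearD(1,2)[OF assms(7)])
  have c: "bilinear Y W (\<lambda>q y. sw W s (\<lambda>p x. \<phi> p x q y))" if "s \<in> carrier (T 1 X)" for s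
    by (rule bilinearI; rule lin_sw_param[OF assms(1,3) _ that])
       (auto intro: assms(2,3,7) bilinearD(1,2)[OF assms(6)])
  show ?thesis
  proof (rule T1_ext[OF assms(1,3) lin_sw_t0[OF assms(1,3) b] _ assms(4)])
    show "(\<lambda>t. sw W u (\<lambda>q y. sw W t (\<lambda>p x. \<phi> p x q y))) \<in> lin (T 1 X) W"
      by (rule lin_sw_param[OF assms(2,3) module_T[OF assms(1)] assms(5) c])
         (auto intro!: lin_sw_t0[OF assms(1,3)] assms(7))
    fix p x assume px: "p \<in> carrier P" "x \<in> carrier X"
    have "sw W u (\<lambda>q y. sw W (pt X [p] x) (\<lambda>p x. \<phi> p x q y)) = sw W u (\<lambda>q y. \<phi> p x q y)"
      by (rule sw_cong[OF assms(2,3) c[OF pure1_closed[OF assms(1) px]] assms(5)])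
         (rule sw_pure[OF assms(1,3) assms(7) px])
    then show "sw W (pt X [p] x) (\<lambda>p x. sw W u (\<lambda>q y. \<phi> p x q y)) =
        sw W u (\<lambda>q y. sw W (pt X [p] x) (\<lambda>p x. \<phi> p x q y))"
      using sw_pure[OF assms(1,3) b px] by simp
  qed
qed

section \<open>Splitting off the first tensor factor\<close>

definition tcons :: "('k, 'v, 'c) module_scheme \<Rightarrow> nat \<Rightarrow> 'p \<Rightarrow> ('k, 'p, 'v) tensors \<Rightarrow> ('k, 'p, 'v) tensors"
  where "tcons V n p x = tensor_lift K (T (Suc n) V) (\<lambda>ps v. pt V (p # ps) v) x"

lemma multilinear_pure_Cons:
  assumes "module K V" "p \<in> carrier P"
  shows "K.multilinear P n V (T (Suc n) V) (\<lambda>ps v. pt V (p # ps) v)"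
proof (rule K.multilinearI)
  note m = K.pure_tensor_multilinear[OF module_P assms(1), of "Suc n"]
  fix ps v assume "(ps, v) \<in> tuples P n V"
  then have t: "(p # ps, v) \<in> tuples P (Suc n) V" using assms(2) by (simp add: tuples_Suc)
  show "(\<lambda>u. pt V (p # ps) u) \<in> lin V (T (Suc n) V)" by (rule K.multilinearD(2)[OF m t])
  fix i assume "i < n"
  then show "(\<lambda>q. pt V (p # ps[i := q]) v) \<in> lin P (T (Suc n) V)"
    using K.multilinearD(1)[OF m t, of "Suc i"] by simp
qed

lemma tcons_lin_r0:
  assumes "module K V" "p \<in> carrier P"
  shows "(\<lambda>x. tcons V n p x) \<in> lin (T n V) (T (Suc n) V)"
  unfolding tcons_def
  by (rule K.tensor_lift_linear[OF module_P assms(1) module_T[OF assms(1)] multilinear_pure_Cons[OF assms]])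

lemma tcons_pure:
  assumes "module K V" "p \<in> carrier P" "(ps, v) \<in> tuples P n V"
  shows "tcons V n p (pt V ps v) = pt V (p # ps) v"
  unfolding tcons_def
  by (rule K.tensor_lift_pure[OF module_P assms(1) module_T[OF assms(1)] multilinear_pure_Cons[OF assms(1,2)] assms(3)])

lemma T_ext:
  assumes "module K V" "module K W" "f \<in> lin (T n V) W" "g \<in> lin (T n V) W" "t \<in> carrier (T n V)"
    "\<And>ps v. (ps, v) \<in> tuples P n V \<Longrightarrow> f (pt V ps v) = g (pt V ps v)"
  shows "f t = g t"
  using K.tensor_ext[OF module_P assms(1-4) _ assms(5)] assms(6) by auto

text \<open>\<open>tcons\<close> is a lift in \<open>x\<close> for each fixed \<open>p\<close>,
  which does not show linearity in \<open>p\<close>; this is verified on pure tensors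
  \<open>x\<close>, where it is multilinearity of \<open>pure_tensor\<close>.\<close>

lemma tcons_lin_l0:
  assumes "module K V" "x \<in> carrier (T n V)"
  shows "(\<lambda>p. tcons V n p x) \<in> lin P (T (Suc n) V)"
proof (rule K.linearI)
  note mT = module_T[OF assms(1)]
  have pl: "(\<lambda>p. pt V (p # ps) v) \<in> lin P (T (Suc n) V)" if "(ps, v) \<in> tuples P n V" for ps v
  proof -
    have "(\<zero>\<^bsub>P\<^esub> # ps, v) \<in> tuples P (Suc n) V" using that by (simp add: tuples_Suc)
    from K.multilinearD(1)[OF K.pure_tensor_multilinear[OF module_P assms(1)] this, of 0]
    show ?thesis by simp
  qed
  note l = tcons_lin_r0[OF assms(1), of _ n]
  show "tcons V n p x \<in> carrier (T (Suc n) V)" if "p \<in> carrier P" for p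
    using K.linearD(1)[OF l[OF that] assms(2)] .
  show "tcons V n (p \<oplus>\<^bsub>P\<^esub> q) x = tcons V n p x \<oplus>\<^bsub>T (Suc n) V\<^esub> tcons V n q x"
    if "p \<in> carrier P" "q \<in> carrier P" for p q
    by (rule T_ext[OF assms(1) mT l[OF M.a_closed[OF that]] K.linear_add[OF mT l[OF that(1)] l[OF that(2)]] assms(2)])
       (use that tcons_pure[OF assms(1)] K.linearD(2)[OF pl] in simp)
  show "tcons V n (a \<odot>\<^bsub>P\<^esub> p) x = a \<odot>\<^bsub>T (Suc n) V\<^esub> tcons V n p x"
    if "a \<in> carrier K" "p \<in> carrier P" for a p
    by (rule T_ext[OF assms(1) mT l[OF smult_closed[OF that]] K.linear_smult[OF mT l[OF that(2)] that(1)] assms(2)])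
       (use that tcons_pure[OF assms(1)] K.linearD(3)[OF pl] in simp)
qed

lemma tcons_closed: "\<lbrakk>module K V; p \<in> carrier P; x \<in> carrier (T n V)\<rbrakk> \<Longrightarrow> tcons V n p x \<in> carrier (T (Suc n) V)"
  using K.linearD(1)[OF tcons_lin_r0] .

lemma lin_tcons_r: "\<lbrakk>module K V; p \<in> carrier P; g \<in> lin U (T n V)\<rbrakk> \<Longrightarrow> (\<lambda>u. tcons V n p (g u)) \<in> lin U (T (Suc n) V)"
  using K.linear_comp[OF tcons_lin_r0] .

lemma lin_tcons_l: "\<lbrakk>module K V; x \<in> carrier (T n V); g \<in> lin U P\<rbrakk> \<Longrightarrow> (\<lambda>u. tcons V n (g u) x) \<in> lin U (T (Suc n) V)"
  using K.linear_comp[OF tcons_lin_l0] .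

text \<open>A pure tensor with at least one factor \<open>P\<close> is a \<open>tcons\<close> of a
  shorter one. This reduces an identity on \<open>T (Suc n) V\<close> to elements on which the
  recursive constructions can be evaluated.\<close>

lemma T_Suc_ext:
  assumes "module K V" "module K W" "f \<in> lin (T (Suc n) V) W" "g \<in> lin (T (Suc n) V) W" "t \<in> carrier (T (Suc n) V)"
    "\<And>p x. \<lbrakk>p \<in> carrier P; x \<in> carrier (T n V)\<rbrakk> \<Longrightarrow> f (tcons V n p x) = g (tcons V n p x)"
  shows "f t = g t"
proof (rule T_ext[OF assms(1-5)])
  fix ps v assume "(ps, v) \<in> tuples P (Suc n) V"
  then obtain p qs where h: "ps = p # qs" "p \<in> carrier P" "(qs, v) \<in> tuples P n V" by (auto simp: tuples_Suc)
  show "f (pt V ps v) = g (pt V ps v)"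
    using assms(6)[OF h(2) pure_closed[OF assms(1) h(3)]] tcons_pure[OF assms(1) h(2,3)] h(1) by simp
qed

lemma T_0_ext:
  assumes "module K V" "module K W" "f \<in> lin (T 0 V) W" "g \<in> lin (T 0 V) W" "t \<in> carrier (T 0 V)"
    "\<And>v. v \<in> carrier V \<Longrightarrow> f (pt V [] v) = g (pt V [] v)"
  shows "f t = g t"
  by (rule T_ext[OF assms(1-5)]) (use assms(6) in \<open>auto simp: tuples_0\<close>)

text \<open>The universal property of \<open>T (Suc n) V\<close> as
  \<open>P \<otimes> T n V\<close>. With it, maps out of tensor powers are defined by recursion on
  the number of factors, without manipulating lists of factors.\<close>

definition tuncons :: "('k, 'v, 'c) module_scheme \<Rightarrow> ('k, 'w, 'd) module_scheme \<Rightarrow> ('p \<Rightarrow> ('k, 'p, 'v) tensors \<Rightarrow> 'w)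
    \<Rightarrow> ('k, 'p, 'v) tensors \<Rightarrow> 'w"
  where "tuncons V W \<beta> = tensor_lift K W (\<lambda>ps v. \<beta> (hd ps) (pt V (tl ps) v))"

lemma multilinear_tuncons:
  assumes "module K V" "bilinear (T n V) W \<beta>"
  shows "K.multilinear P (Suc n) V W (\<lambda>ps v. \<beta> (hd ps) (pt V (tl ps) v))"
proof (rule K.multilinearI)
  note m = K.pure_tensor_multilinear[OF module_P assms(1), of n]
  fix ps v assume "(ps, v) \<in> tuples P (Suc n) V"
  then obtain p qs where h: "ps = p # qs" "p \<in> carrier P" "(qs, v) \<in> tuples P n V" by (auto simp: tuples_Suc)
  show "(\<lambda>u. \<beta> (hd ps) (pt V (tl ps) u)) \<in> lin V W"
    using K.linear_comp[OF bilinearD(1)[OF assms(2) h(2)] K.multilinearD(2)[OF m h(3)]] h(1) by simp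
  fix i assume i: "i < Suc n"
  show "(\<lambda>q. \<beta> (hd (ps[i := q])) (pt V (tl (ps[i := q])) v)) \<in> lin P W"
  proof (cases i)
    case 0
    then show ?thesis using bilinearD(2)[OF assms(2) pure_closed[OF assms(1) h(3)]] h(1) by simp
  next
    case (Suc j)
    then show ?thesis
      using K.linear_comp[OF bilinearD(1)[OF assms(2) h(2)] K.multilinearD(1)[OF m h(3), of j]] h(1) i by simp
  qed
qed

lemma tuncons_lin:
  assumes "module K V" "module K W" "bilinear (T n V) W \<beta>"
  shows "tuncons V W \<beta> \<in> lin (T (Suc n) V) W"
  unfolding tuncons_def by (rule K.tensor_lift_linear[OF module_P assms(1,2) multilinear_tuncons[OF assms(1,3)]])

lemma tuncons_tcons:
  assumes "module K V" "module K W" "bilinear (T n V) W \<beta>" "p \<in> carrier P" "x \<in> carrier (T n V)"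
  shows "tuncons V W \<beta> (tcons V n p x) = \<beta> p x"
proof (rule T_ext[OF assms(1,2) K.linear_comp[OF tuncons_lin[OF assms(1-3)] tcons_lin_r0[OF assms(1,4)]]
      bilinearD(1)[OF assms(3,4)] assms(5)])
  fix ps v assume h: "(ps, v) \<in> tuples P n V"
  then have "(p # ps, v) \<in> tuples P (Suc n) V" using assms(4) by (simp add: tuples_Suc)
  then show "tuncons V W \<beta> (tcons V n p (pt V ps v)) = \<beta> p (pt V ps v)"
    unfolding tcons_pure[OF assms(1,4) h] tuncons_def
    using K.tensor_lift_pure[OF module_P assms(1,2) multilinear_tuncons[OF assms(1,3)]] by simp
qed

section \<open>Functoriality in the last factor\<close>

definition tmap :: "('k, 'w, 'd) module_scheme \<Rightarrow> nat \<Rightarrow> ('v \<Rightarrow> 'w) \<Rightarrow> ('k, 'p, 'v) tensors \<Rightarrow> ('k, 'p, 'w) tensors"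
  where "tmap W n g = tensor_lift K (T n W) (\<lambda>ps v. pt W ps (g v))"

lemma multilinear_tmap:
  assumes "module K V" "module K W" "g \<in> lin V W"
  shows "K.multilinear P n V (T n W) (\<lambda>ps v. pt W ps (g v))"
proof (rule K.multilinearI)
  note m = K.pure_tensor_multilinear[OF module_P assms(2), of n]
  fix ps v assume "(ps, v) \<in> tuples P n V"
  then have h: "(ps, g v) \<in> tuples P n W" using K.linearD(1)[OF assms(3)] by (simp add: tuples_def)
  show "(\<lambda>u. pt W ps (g u)) \<in> lin V (T n W)" by (rule K.linear_comp[OF K.multilinearD(2)[OF m h] assms(3)])
  show "(\<lambda>q. pt W (ps[i := q]) (g v)) \<in> lin P (T n W)" if "i < n" for i by (rule K.multilinearD(1)[OF m h that])
qed

lemma tmap_lin: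
  assumes "module K V" "module K W" "g \<in> lin V W"
  shows "tmap W n g \<in> lin (T n V) (T n W)"
  unfolding tmap_def by (rule K.tensor_lift_linear[OF module_P assms(1) module_T[OF assms(2)] multilinear_tmap[OF assms]])

lemma tmap_closed:
  assumes "module K V" "module K W" "g \<in> lin V W" "t \<in> carrier (T n V)"
  shows "tmap W n g t \<in> carrier (T n W)"
  using K.linearD(1)[OF tmap_lin[OF assms(1-3)] assms(4)] .

lemma lin_tmap:
  assumes "module K V" "module K W" "g \<in> lin V W" "h \<in> lin U (T n V)"
  shows "(\<lambda>u. tmap W n g (h u)) \<in> lin U (T n W)"
  using K.linear_comp[OF tmap_lin[OF assms(1-3)] assms(4)] .

lemma tmap_pure:
  assumes "module K V" "module K W" "g \<in> lin V W" "(ps, v) \<in> tuples P n V"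
  shows "tmap W n g (pt V ps v) = pt W ps (g v)"
  unfolding tmap_def
  by (rule K.tensor_lift_pure[OF module_P assms(1) module_T[OF assms(2)] multilinear_tmap[OF assms(1-3)] assms(4)])

lemma tmap_cong:
  assumes "module K V" "module K W" "g \<in> lin V W" "t \<in> carrier (T n V)" "\<And>v. v \<in> carrier V \<Longrightarrow> g v = h v"
  shows "tmap W n g t = tmap W n h t"
proof -
  have h: "h \<in> lin V W" using K.linear_cong[OF assms(1), of g h W] assms(3,5) by blast
  show ?thesis
    by (rule T_ext[OF assms(1) module_T[OF assms(2)] tmap_lin[OF assms(1-3)] tmap_lin[OF assms(1,2) h] assms(4)])
       (use tmap_pure[OF assms(1-3)] tmap_pure[OF assms(1,2) h] assms(5) in \<open>auto simp: tuples_def\<close>)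
qed

lemma tmap_id:
  assumes "module K V" "t \<in> carrier (T n V)"
  shows "tmap V n (\<lambda>v. v) t = t"
  by (rule T_ext[OF assms(1) module_T[OF assms(1)] tmap_lin[OF assms(1,1) K.linear_id] K.linear_id assms(2)])
     (rule tmap_pure[OF assms(1,1) K.linear_id])

lemma tmap_comp:
  assumes "module K U" "module K V" "module K W" "f \<in> lin U V" "g \<in> lin V W" "t \<in> carrier (T n U)"
  shows "tmap W n g (tmap V n f t) = tmap W n (\<lambda>x. g (f x)) t"
proof (rule T_ext[OF assms(1) module_T[OF assms(3)] lin_tmap[OF assms(2,3,5) tmap_lin[OF assms(1,2,4)]]
      tmap_lin[OF assms(1,3) K.linear_comp[OF assms(5,4)]] assms(6)])
  fix ps v assume h: "(ps, v) \<in> tuples P n U"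
  then have "(ps, f v) \<in> tuples P n V" using K.linearD(1)[OF assms(4)] by (simp add: tuples_def)
  then show "tmap W n g (tmap V n f (pt U ps v)) = tmap W n (\<lambda>x. g (f x)) (pt U ps v)"
    using tmap_pure[OF assms(1,2,4) h] tmap_pure[OF assms(2,3,5)]
      tmap_pure[OF assms(1,3) K.linear_comp[OF assms(5,4)] h] by simp
qed

lemma tmap_zero:
  assumes "module K V" "module K W" "t \<in> carrier (T n V)"
  shows "tmap W n (\<lambda>x. \<zero>\<^bsub>W\<^esub>) t = \<zero>\<^bsub>T n W\<^esub>"
proof (rule T_ext[OF assms(1) module_T[OF assms(2)] tmap_lin[OF assms(1,2) K.linear_const_zero[OF assms(2)]]
      K.linear_const_zero[OF module_T[OF assms(2)]] assms(3)])
  fix ps v assume h: "(ps, v) \<in> tuples P n V"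
  interpret W: module K W by fact
  have "(ps, \<zero>\<^bsub>W\<^esub>) \<in> tuples P n W" using h by (simp add: tuples_def)
  from K.linear_zero[OF assms(2) module_T[OF assms(2)] K.multilinearD(2)[OF K.pure_tensor_multilinear[OF module_P assms(2)] this]]
  show "tmap W n (\<lambda>x. \<zero>\<^bsub>W\<^esub>) (pt V ps v) = \<zero>\<^bsub>T n W\<^esub>"
    using tmap_pure[OF assms(1,2) K.linear_const_zero[OF assms(2)] h] by simp
qed

lemma tmap_minus:
  assumes "module K V" "module K W" "f \<in> lin V W" "g \<in> lin V W" "t \<in> carrier (T n V)"
  shows "tmap W n (\<lambda>x. f x \<ominus>\<^bsub>W\<^esub> g x) t = tmap W n f t \<ominus>\<^bsub>T n W\<^esub> tmap W n g t"
proof -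
  note d = K.linear_minus_fun[OF assms(2-4)]
  show ?thesis
  proof (rule T_ext[OF assms(1) module_T[OF assms(2)] tmap_lin[OF assms(1,2) d]
        K.linear_minus_fun[OF module_T[OF assms(2)] tmap_lin[OF assms(1,2,3)] tmap_lin[OF assms(1,2,4)]] assms(5)])
    fix ps v assume h: "(ps, v) \<in> tuples P n V"
    then have v: "f v \<in> carrier W" "g v \<in> carrier W" using K.linearD(1) assms(3,4) by (auto simp: tuples_def)
    then have "(ps, f v) \<in> tuples P n W" using h by (simp add: tuples_def)
    note m = K.multilinearD(2)[OF K.pure_tensor_multilinear[OF module_P assms(2)] this]
    show "tmap W n (\<lambda>x. f x \<ominus>\<^bsub>W\<^esub> g x) (pt V ps v) = tmap W n f (pt V ps v) \<ominus>\<^bsub>T n W\<^esub> tmap W n g (pt V ps v)"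
      unfolding tmap_pure[OF assms(1,2) d h] tmap_pure[OF assms(1-3) h] tmap_pure[OF assms(1,2,4) h]
      by (rule K.linear_minus[OF assms(2) module_T[OF assms(2)] m v])
  qed
qed

lemma tmap_tcons:
  assumes "module K V" "module K W" "g \<in> lin V W" "p \<in> carrier P" "x \<in> carrier (T n V)"
  shows "tmap W (Suc n) g (tcons V n p x) = tcons W n p (tmap W n g x)"
proof (rule T_ext[OF assms(1) module_T[OF assms(2)] lin_tmap[OF assms(1-3) tcons_lin_r0[OF assms(1,4)]]
      lin_tcons_r[OF assms(2,4) tmap_lin[OF assms(1-3)]] assms(5)])
  fix ps v assume h: "(ps, v) \<in> tuples P n V"
  then have "(p # ps, v) \<in> tuples P (Suc n) V" using assms(4) by (simp add: tuples_Suc)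
  moreover have "(ps, g v) \<in> tuples P n W" using h K.linearD(1)[OF assms(3)] by (simp add: tuples_def)
  ultimately show "tmap W (Suc n) g (tcons V n p (pt V ps v)) = tcons W n p (tmap W n g (pt V ps v))"
    using tmap_pure[OF assms(1-3)] tcons_pure[OF assms(1,4) h] tcons_pure[OF assms(2,4)] h by simp
qed

text \<open>The two lifts differ only in writing the single factor as \<open>[hd ps]\<close> or as
  \<open>ps\<close>. Calculations are carried out with \<open>tmap\<close>.\<close>

lemma id_tensor_eq_tmap:
  assumes "module K V" "module K W" "g \<in> lin V W" "t \<in> carrier (T 1 V)"
  shows "id_tensor K P W g t = tmap W 1 g t"
  unfolding id_tensor_def sweedler_def tmap_def
  by (rule K.tensor_lift_cong[OF module_P assms(1) module_T[OF assms(2)] _ _ assms(4)])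
     (use K.linearD(1)[OF assms(3)] pure1_closed[OF assms(2)] in \<open>auto simp: tuples_1\<close>)

lemma tmap_pure1:
  assumes "module K V" "module K W" "g \<in> lin V W" "p \<in> carrier P" "v \<in> carrier V"
  shows "tmap W 1 g (pt V [p] v) = pt W [p] (g v)"
  by (rule tmap_pure[OF assms(1-3)]) (simp add: tuples_1 assms)

lemma bilinear_precomp:
  assumes "g \<in> lin V X" "bilinear X W \<beta>"
  shows "bilinear V W (\<lambda>p v. \<beta> p (g v))"
  by (rule bilinearI)
    (auto intro: K.linear_comp[OF bilinearD(1)[OF assms(2)] assms(1)] bilinearD(2)[OF assms(2)] K.linearD(1)[OF assms(1)])

lemma sw_tmap:
  assumes "module K V" "module K X" "module K W" "g \<in> lin V X" "bilinear X W \<beta>" "t \<in> carrier (T 1 V)"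
  shows "sw W (tmap X 1 g t) \<beta> = sw W t (\<lambda>p v. \<beta> p (g v))"
proof (rule T1_ext[OF assms(1,3) lin_sw_t[OF assms(2,3) tmap_lin[OF assms(1,2,4)] assms(5)]
      lin_sw_t0[OF assms(1,3) bilinear_precomp[OF assms(4,5)]] assms(6)])
  fix p v assume h: "p \<in> carrier P" "v \<in> carrier V"
  show "sw W (tmap X 1 g (pt V [p] v)) \<beta> = sw W (pt V [p] v) (\<lambda>p v. \<beta> p (g v))"
    unfolding tmap_pure1[OF assms(1,2,4) h] sw_pure[OF assms(1,3) bilinear_precomp[OF assms(4,5)] h]
    using sw_pure[OF assms(2,3,5) h(1)] K.linearD(1)[OF assms(4) h(2)] by simp
qed

text \<open>These rules prove linearity and closedness of nested Sweedler expressions by structural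
  descent. The rotations bring forward the premises that determine the schematic space, ahead of
  those stating that it is a module.\<close>

lemmas lin_intros = bilinearI lin_sw_t[rotated 2] lin_sw_param[rotated 3] lin_pure_r lin_pure_l lin_pure0
  lin_tcons_r lin_tcons_l lin_tmap[rotated 3] K.linear_id K.module_ground module_P module_T
  sw_closed[rotated 3] pure1_closed pure0_closed tcons_closed tmap_closed[rotated 3]

end

section \<open>Hopf algebras and tensor powers of comodules\<close>

context tensor_power
begin

definition trilinear :: "('k, 'v, 'c) module_scheme \<Rightarrow> ('k, 'w, 'd) module_scheme \<Rightarrow> ('p \<Rightarrow> 'p \<Rightarrow> 'v \<Rightarrow> 'w) \<Rightarrow> bool"
  where "trilinear X W \<phi> \<longleftrightarrow> (\<forall>a\<in>carrier P. bilinear X W (\<phi> a)) \<and>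
    (\<forall>b\<in>carrier P. \<forall>x\<in>carrier X. (\<lambda>a. \<phi> a b x) \<in> lin P W)"

lemma trilinearI:
  assumes "\<And>a b. \<lbrakk>a \<in> carrier P; b \<in> carrier P\<rbrakk> \<Longrightarrow> (\<lambda>x. \<phi> a b x) \<in> lin X W"
    "\<And>a x. \<lbrakk>a \<in> carrier P; x \<in> carrier X\<rbrakk> \<Longrightarrow> (\<lambda>b. \<phi> a b x) \<in> lin P W"
    "\<And>b x. \<lbrakk>b \<in> carrier P; x \<in> carrier X\<rbrakk> \<Longrightarrow> (\<lambda>a. \<phi> a b x) \<in> lin P W"
  shows "trilinear X W \<phi>"
  using assms by (simp add: trilinear_def bilinear_def)

lemma lin_bil:
  assumes "bilinear X W \<beta>"
  shows "\<lbrakk>p \<in> carrier P; g \<in> lin U X\<rbrakk> \<Longrightarrow> (\<lambda>u. \<beta> p (g u)) \<in> lin U W"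
    "\<lbrakk>x \<in> carrier X; h \<in> lin U' P\<rbrakk> \<Longrightarrow> (\<lambda>u. \<beta> (h u) x) \<in> lin U' W"
    "\<lbrakk>p \<in> carrier P; x \<in> carrier X\<rbrakk> \<Longrightarrow> \<beta> p x \<in> carrier W"
  using K.linear_comp[OF bilinearD(1)[OF assms]] K.linear_comp[OF bilinearD(2)[OF assms]]
    bilinearD(3)[OF assms] by blast+

lemma lin_tri:
  assumes "trilinear X W \<phi>"
  shows "\<lbrakk>a \<in> carrier P; b \<in> carrier P; g \<in> lin U X\<rbrakk> \<Longrightarrow> (\<lambda>u. \<phi> a b (g u)) \<in> lin U W"
    "\<lbrakk>a \<in> carrier P; x \<in> carrier X; h \<in> lin U' P\<rbrakk> \<Longrightarrow> (\<lambda>u. \<phi> a (h u) x) \<in> lin U' W"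
    "\<lbrakk>b \<in> carrier P; x \<in> carrier X; h \<in> lin U' P\<rbrakk> \<Longrightarrow> (\<lambda>u. \<phi> (h u) b x) \<in> lin U' W"
    "\<lbrakk>a \<in> carrier P; b \<in> carrier P; x \<in> carrier X\<rbrakk> \<Longrightarrow> \<phi> a b x \<in> carrier W"
proof -
  have b: "bilinear X W (\<phi> a)" if "a \<in> carrier P" for a using assms that by (simp add: trilinear_def)
  have l: "(\<lambda>a. \<phi> a b x) \<in> lin P W" if "b \<in> carrier P" "x \<in> carrier X" for b x
    using assms that by (simp add: trilinear_def)
  show "\<lbrakk>a \<in> carrier P; b \<in> carrier P; g \<in> lin U X\<rbrakk> \<Longrightarrow> (\<lambda>u. \<phi> a b (g u)) \<in> lin U W"
    by (rule lin_bil(1)[OF b])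
  show "\<lbrakk>a \<in> carrier P; x \<in> carrier X; h \<in> lin U' P\<rbrakk> \<Longrightarrow> (\<lambda>u. \<phi> a (h u) x) \<in> lin U' W"
    by (rule lin_bil(2)[OF b])
  show "\<lbrakk>a \<in> carrier P; b \<in> carrier P; x \<in> carrier X\<rbrakk> \<Longrightarrow> \<phi> a b x \<in> carrier W"
    by (rule lin_bil(3)[OF b])
  show "\<lbrakk>b \<in> carrier P; x \<in> carrier X; h \<in> lin U' P\<rbrakk> \<Longrightarrow> (\<lambda>u. \<phi> (h u) b x) \<in> lin U' W"
    by (rule K.linear_comp[OF l])
qed

lemma tuples_2: "(ps, v) \<in> tuples P 2 V \<longleftrightarrow> (\<exists>p q. ps = [p, q] \<and> p \<in> carrier P \<and> q \<in> carrier P \<and> v \<in> carrier V)"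
  by (auto simp: tuples_def length_Suc_conv numeral_2_eq_2)

lemma trilinear_pure2:
  assumes "module K X"
  shows "trilinear X (T 2 X) (\<lambda>a b x. pt X [a, b] x)"
proof (rule trilinearI)
  interpret X: module K X by fact
  note m = K.pure_tensor_multilinear[OF module_P assms, of 2]
  fix a b x assume h: "a \<in> carrier P"
  show "(\<lambda>x. pt X [a, b] x) \<in> lin X (T 2 X)" if "b \<in> carrier P"
    by (rule K.multilinearD(2)[OF m, of _ "\<zero>\<^bsub>X\<^esub>"]) (use h that in \<open>simp add: tuples_2\<close>)
  show "(\<lambda>b. pt X [a, b] x) \<in> lin P (T 2 X)" if x: "x \<in> carrier X"
  proof -
    have "([a, a], x) \<in> tuples P 2 X" using h x by (simp add: tuples_2)
    from K.multilinearD(1)[OF m this, of 1] show ?thesis by (simp add: One_nat_def)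
  qed
  show "(\<lambda>b. pt X [b, a] x) \<in> lin P (T 2 X)" if x: "x \<in> carrier X"
  proof -
    have "([a, a], x) \<in> tuples P 2 X" using h x by (simp add: tuples_2)
    from K.multilinearD(1)[OF m this, of 0] show ?thesis by simp
  qed
qed

lemma trilinear_lift:
  assumes "module K X" "module K W" "trilinear X W \<phi>"
  obtains f where "f \<in> lin (T 2 X) W"
    "\<And>a b x. \<lbrakk>a \<in> carrier P; b \<in> carrier P; x \<in> carrier X\<rbrakk> \<Longrightarrow> f (pt X [a, b] x) = \<phi> a b x"
proof
  have m: "K.multilinear P 2 X W (\<lambda>ps x. \<phi> (ps ! 0) (ps ! 1) x)"
  proof (rule K.multilinearI)
    fix ps x assume "(ps, x) \<in> tuples P 2 X"
    then obtain p q where h: "ps = [p, q]" "p \<in> carrier P" "q \<in> carrier P" "x \<in> carrier X" by (auto simp: tuples_2)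
    show "(\<lambda>x. \<phi> (ps ! 0) (ps ! 1) x) \<in> lin X W"
      using lin_tri(1)[OF assms(3) h(2,3) K.linear_id] h(1) by (simp add: One_nat_def)
    fix i :: nat assume "i < 2"
    then consider "i = 0" | "i = 1" by linarith
    then show "(\<lambda>r. \<phi> (ps[i := r] ! 0) (ps[i := r] ! 1) x) \<in> lin P W"
      by cases (use lin_tri(2)[OF assms(3) h(2,4) K.linear_id] lin_tri(3)[OF assms(3) h(3,4) K.linear_id] h(1)
        in \<open>simp_all add: One_nat_def\<close>)
  qed
  show "tensor_lift K W (\<lambda>ps x. \<phi> (ps ! 0) (ps ! 1) x) \<in> lin (T 2 X) W"
    by (rule K.tensor_lift_linear[OF module_P assms(1,2) m])
  show "tensor_lift K W (\<lambda>ps x. \<phi> (ps ! 0) (ps ! 1) x) (pt X [a, b] x) = \<phi> a b x"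
    if "a \<in> carrier P" "b \<in> carrier P" "x \<in> carrier X" for a b x
    using K.tensor_lift_pure[OF module_P assms(1,2) m, of "[a, b]" x] that by (simp add: tuples_2 One_nat_def)
qed

text \<open>\<open>T 0 V\<close> consists of cosets of formal combinations and is only isomorphic to
  \<open>V\<close>; this is the inverse of \<open>pt V []\<close>.\<close>

definition unpure :: "('k, 'v, 'c) module_scheme \<Rightarrow> ('k, 'p, 'v) tensors \<Rightarrow> 'v"
  where "unpure V = tensor_lift K V (\<lambda>ps v. v)"

lemma multilinear_unpure: "K.multilinear P 0 V V (\<lambda>ps v. v)"
  by (rule K.multilinearI) (simp_all add: K.linear_id)

lemma unpure_lin: "module K V \<Longrightarrow> unpure V \<in> lin (T 0 V) V"
  unfolding unpure_def by (rule K.tensor_lift_linear[OF module_P _ _ multilinear_unpure])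

lemma unpure_pure: "\<lbrakk>module K V; v \<in> carrier V\<rbrakk> \<Longrightarrow> unpure V (pt V [] v) = v"
  unfolding unpure_def by (rule K.tensor_lift_pure[OF module_P _ _ multilinear_unpure]) (simp_all add: tuples_0)

lemma pure_lin: "module K V \<Longrightarrow> pt V [] \<in> lin V (T 0 V)"
  using lin_pure0[OF _ K.linear_id] .

end

sublocale hopf_algebra \<subseteq> tensor_power K P
  by unfold_locales

context hopf_algebra
begin

abbreviation "\<Delta> \<equiv> comult P"
abbreviation "\<epsilon> \<equiv> counit P"
abbreviation "S \<equiv> antipode P"

lemma comult_closed [simp]: "p \<in> carrier P \<Longrightarrow> \<Delta> p \<in> carrier (T 1 P)"
  using K.linearD(1)[OF comult_linear] .

lemma antipode_closed [simp]: "p \<in> carrier P \<Longrightarrow> S p \<in> carrier P"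
  using K.linearD(1)[OF antipode_linear] .

lemma counit_closed [simp]: "p \<in> carrier P \<Longrightarrow> \<epsilon> p \<in> carrier K"
  using K.linearD(1)[OF counit_linear] by (simp add: ground_module_def)

lemma lin_comult: "g \<in> lin U P \<Longrightarrow> (\<lambda>u. \<Delta> (g u)) \<in> lin U (T 1 P)"
  using K.linear_comp[OF comult_linear] .

lemma lin_antipode: "g \<in> lin U P \<Longrightarrow> (\<lambda>u. S (g u)) \<in> lin U P"
  using K.linear_comp[OF antipode_linear] .

lemma lin_counit_smult:
  assumes "module K W" "x \<in> carrier W" "g \<in> lin U P"
  shows "(\<lambda>u. \<epsilon> (g u) \<odot>\<^bsub>W\<^esub> x) \<in> lin U W"
proof -
  interpret W: module K W by fact
  note g = K.linearD[OF K.linear_comp[OF counit_linear assms(3)]]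
  show ?thesis using g assms(2)
    by (intro K.linearI) (auto simp: ground_module_def W.smult_l_distr W.smult_assoc1)
qed

lemma lin_mult_r: "\<lbrakk>p \<in> carrier P; g \<in> lin U P\<rbrakk> \<Longrightarrow> (\<lambda>u. p \<otimes>\<^bsub>P\<^esub> g u) \<in> lin U P"
  by (rule K.linear_comp[of "\<lambda>q. p \<otimes>\<^bsub>P\<^esub> q", rotated], assumption, rule K.linearI)
     (simp_all add: P.r_distr smult_mult_right)

lemma lin_mult_l: "\<lbrakk>p \<in> carrier P; g \<in> lin U P\<rbrakk> \<Longrightarrow> (\<lambda>u. g u \<otimes>\<^bsub>P\<^esub> p) \<in> lin U P"
  by (rule K.linear_comp[of "\<lambda>q. q \<otimes>\<^bsub>P\<^esub> p", rotated], assumption, rule K.linearI)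
     (simp_all add: P.l_distr smult_mult_left)

lemma lin_smult: "\<lbrakk>module K W; a \<in> carrier K; g \<in> lin U W\<rbrakk> \<Longrightarrow> (\<lambda>u. a \<odot>\<^bsub>W\<^esub> g u) \<in> lin U W"
  using K.linear_smult by blast

lemmas lins = lin_intros lin_comult lin_antipode lin_counit_smult lin_mult_r lin_mult_l lin_smult
  comult_closed antipode_closed P.m_closed P.one_closed

lemma left_comoduleD:
  assumes "left_comodule K P V \<rho>"
  shows "module K V" "\<rho> \<in> lin V (T 1 V)" "v \<in> carrier V \<Longrightarrow> \<rho> v \<in> carrier (T 1 V)"
    "g \<in> lin U V \<Longrightarrow> (\<lambda>u. \<rho> (g u)) \<in> lin U (T 1 V)"
proof -
  show "module K V" and l: "\<rho> \<in> lin V (T 1 V)" using assms by (auto simp: left_comodule_def)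
  show "v \<in> carrier V \<Longrightarrow> \<rho> v \<in> carrier (T 1 V)" using K.linearD(1)[OF l] .
  show "g \<in> lin U V \<Longrightarrow> (\<lambda>u. \<rho> (g u)) \<in> lin U (T 1 V)" using K.linear_comp[OF l] .
qed

text \<open>Viewing \<open>P\<close> as a comodule over itself turns the coassociativity and counit
  laws of \<open>\<Delta>\<close> into instances of the comodule rules that follow.\<close>

lemma comult_comodule: "left_comodule K P P \<Delta>"
  unfolding left_comodule_def using comult_linear comult_coassoc counit_left by simp

text \<open>The axiom is one equation in \<open>T 2 V\<close>. Applying the linear map induced by
  \<open>\<phi>\<close> makes it available under an arbitrary trilinear expression.\<close>

lemma comodule_coassoc:
  assumes "left_comodule K P V \<rho>" "module K W" "trilinear V W \<phi>" "v \<in> carrier V"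
  shows "sw W (\<rho> v) (\<lambda>p w. sw W (\<Delta> p) (\<lambda>p1 p2. \<phi> p1 p2 w)) = sw W (\<rho> v) (\<lambda>p w. sw W (\<rho> w) (\<lambda>q u. \<phi> p q u))"
proof -
  note V = left_comoduleD[OF assms(1)]
  obtain f where f: "f \<in> lin (T 2 V) W"
    "\<And>a b x. \<lbrakk>a \<in> carrier P; b \<in> carrier P; x \<in> carrier V\<rbrakk> \<Longrightarrow> f (pt V [a, b] x) = \<phi> a b x"
    using trilinear_lift[OF V(1) assms(2,3)] by blast
  note t2 = lin_tri[OF trilinear_pure2[OF V(1)]] and tp = lin_tri[OF assms(3)]
  have "f (sw (T 2 V) (\<rho> v) (\<lambda>p w. sw (T 2 V) (\<Delta> p) (\<lambda>p1 p2. pt V [p1, p2] w))) =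
      sw W (\<rho> v) (\<lambda>p w. f (sw (T 2 V) (\<Delta> p) (\<lambda>p1 p2. pt V [p1, p2] w)))"
    by (rule lin_sw[OF V(1) module_T[OF V(1)] assms(2) f(1) _ V(3)[OF assms(4)]])
       (assumption | rule V(1) lins t2)+
  also have "\<dots> = sw W (\<rho> v) (\<lambda>p w. sw W (\<Delta> p) (\<lambda>p1 p2. \<phi> p1 p2 w))"
  proof (rule sw_cong[OF V(1) assms(2) _ V(3)[OF assms(4)]])
    show "bilinear V W (\<lambda>p w. f (sw (T 2 V) (\<Delta> p) (\<lambda>p1 p2. pt V [p1, p2] w)))"
      by (rule bilinear_comp[OF f(1)]) (assumption | rule V(1) lins t2)+
    fix p x assume h: "p \<in> carrier P" "x \<in> carrier V"
    show "f (sw (T 2 V) (\<Delta> p) (\<lambda>p1 p2. pt V [p1, p2] x)) = sw W (\<Delta> p) (\<lambda>p1 p2. \<phi> p1 p2 x)"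
    proof (subst lin_sw[OF module_P module_T[OF V(1)] assms(2) f(1)])
      show "bilinear P (T 2 V) (\<lambda>p1 p2. pt V [p1, p2] x)" by (assumption | rule V(1) lins t2 h)+
      show "sw W (\<Delta> p) (\<lambda>a b. f (pt V [a, b] x)) = sw W (\<Delta> p) (\<lambda>p1 p2. \<phi> p1 p2 x)"
      proof (rule sw_cong[OF module_P assms(2)])
        show "bilinear P W (\<lambda>a b. f (pt V [a, b] x))" by (rule bilinear_comp[OF f(1)]) (assumption | rule V(1) lins t2 h)+
      qed (use f h in simp_all)
    qed (use h in simp)
  qed
  finally have 1: "f (sw (T 2 V) (\<rho> v) (\<lambda>p w. sw (T 2 V) (\<Delta> p) (\<lambda>p1 p2. pt V [p1, p2] w))) =
    sw W (\<rho> v) (\<lambda>p w. sw W (\<Delta> p) (\<lambda>p1 p2. \<phi> p1 p2 w))" .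
  have "f (sw (T 2 V) (\<rho> v) (\<lambda>p w. sw (T 2 V) (\<rho> w) (\<lambda>q u. pt V [p, q] u))) =
      sw W (\<rho> v) (\<lambda>p w. f (sw (T 2 V) (\<rho> w) (\<lambda>q u. pt V [p, q] u)))"
    by (rule lin_sw[OF V(1) module_T[OF V(1)] assms(2) f(1) _ V(3)[OF assms(4)]])
       (assumption | rule V lins t2)+
  also have "\<dots> = sw W (\<rho> v) (\<lambda>p w. sw W (\<rho> w) (\<lambda>q u. \<phi> p q u))"
  proof (rule sw_cong[OF V(1) assms(2) _ V(3)[OF assms(4)]])
    show "bilinear V W (\<lambda>p w. f (sw (T 2 V) (\<rho> w) (\<lambda>q u. pt V [p, q] u)))"
      by (rule bilinear_comp[OF f(1)]) (assumption | rule V lins t2)+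
    fix p x assume h: "p \<in> carrier P" "x \<in> carrier V"
    show "f (sw (T 2 V) (\<rho> x) (\<lambda>q u. pt V [p, q] u)) = sw W (\<rho> x) (\<lambda>q u. \<phi> p q u)"
    proof (subst lin_sw[OF V(1) module_T[OF V(1)] assms(2) f(1)])
      show "bilinear V (T 2 V) (\<lambda>q u. pt V [p, q] u)" by (assumption | rule V(1) lins t2 h)+
      show "sw W (\<rho> x) (\<lambda>q u. f (pt V [p, q] u)) = sw W (\<rho> x) (\<lambda>q u. \<phi> p q u)"
      proof (rule sw_cong[OF V(1) assms(2)])
        show "bilinear V W (\<lambda>a b. f (pt V [p, a] b))" by (rule bilinear_comp[OF f(1)]) (assumption | rule V(1) lins t2 h)+
      qed (use f h V in simp_all)
    qed (use h V in simp)
  qed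
  finally have 2: "f (sw (T 2 V) (\<rho> v) (\<lambda>p w. sw (T 2 V) (\<rho> w) (\<lambda>q u. pt V [p, q] u))) =
    sw W (\<rho> v) (\<lambda>p w. sw W (\<rho> w) (\<lambda>q u. \<phi> p q u))" .
  have "sw (T 2 V) (\<rho> v) (\<lambda>p w. sw (T 2 V) (\<Delta> p) (\<lambda>p1 p2. pt V [p1, p2] w)) =
      sw (T 2 V) (\<rho> v) (\<lambda>p w. sw (T 2 V) (\<rho> w) (\<lambda>q u. pt V [p, q] u))"
    using assms(1,4) by (simp add: left_comodule_def)
  then show ?thesis using 1 2 by simp
qed

text \<open>Pulling \<open>f\<close> through the Sweedler sum lets the counit be cancelled
  underneath any linear map.\<close>

lemma comodule_counit:
  assumes "left_comodule K P V \<rho>" "module K W" "f \<in> lin V W" "v \<in> carrier V"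
  shows "sw W (\<rho> v) (\<lambda>p w. \<epsilon> p \<odot>\<^bsub>W\<^esub> f w) = f v"
proof -
  note V = left_comoduleD[OF assms(1)]
  have e: "sw V (\<rho> v) (\<lambda>p w. \<epsilon> p \<odot>\<^bsub>V\<^esub> w) = v" using assms(1,4) by (simp add: left_comodule_def)
  have b: "bilinear V V (\<lambda>p w. \<epsilon> p \<odot>\<^bsub>V\<^esub> w)" by (assumption | rule V(1) lins counit_closed)+
  have "f v = sw W (\<rho> v) (\<lambda>p w. f (\<epsilon> p \<odot>\<^bsub>V\<^esub> w))"
    using lin_sw[OF V(1,1) assms(2,3) b V(3)[OF assms(4)]] e by simp
  also have "\<dots> = sw W (\<rho> v) (\<lambda>p w. \<epsilon> p \<odot>\<^bsub>W\<^esub> f w)"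
    by (rule sw_cong[OF V(1) assms(2) bilinear_comp[OF assms(3) b] V(3)[OF assms(4)]])
       (simp add: K.linearD(3)[OF assms(3)])
  finally show ?thesis by simp
qed

lemma sw_comult_one:
  assumes "module K W" "bilinear P W \<beta>"
  shows "sw W (\<Delta> \<one>\<^bsub>P\<^esub>) \<beta> = \<beta> \<one>\<^bsub>P\<^esub> \<one>\<^bsub>P\<^esub>"
  unfolding comult_one by (rule sw_pure[OF module_P assms]) simp_all

lemma sw_comult_mult:
  assumes "module K W" "bilinear P W \<beta>" "p \<in> carrier P" "q \<in> carrier P"
  shows "sw W (\<Delta> (p \<otimes>\<^bsub>P\<^esub> q)) \<beta> =
    sw W (\<Delta> p) (\<lambda>p1 p2. sw W (\<Delta> q) (\<lambda>q1 q2. \<beta> (p1 \<otimes>\<^bsub>P\<^esub> q1) (p2 \<otimes>\<^bsub>P\<^esub> q2)))"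
proof -
  let ?f = "\<lambda>t. sw W t \<beta>"
  note f = lin_sw_t0[OF module_P assms(1,2)] and mT = module_T[OF module_P]
  have "?f (\<Delta> (p \<otimes>\<^bsub>P\<^esub> q)) = sw W (\<Delta> p) (\<lambda>p1 p2. ?f (sw (T 1 P) (\<Delta> q) (\<lambda>q1 q2. pt P [p1 \<otimes>\<^bsub>P\<^esub> q1] (p2 \<otimes>\<^bsub>P\<^esub> q2))))"
    unfolding comult_mult[OF assms(3,4)]
    by (rule lin_sw[OF module_P mT assms(1) f]) (assumption | rule lins assms)+
  also have "\<dots> = sw W (\<Delta> p) (\<lambda>p1 p2. sw W (\<Delta> q) (\<lambda>q1 q2. \<beta> (p1 \<otimes>\<^bsub>P\<^esub> q1) (p2 \<otimes>\<^bsub>P\<^esub> q2)))"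
  proof (rule sw_cong[OF module_P assms(1) bilinear_comp[OF f]])
    fix p1 p2 assume h: "p1 \<in> carrier P" "p2 \<in> carrier P"
    have b: "bilinear P (T 1 P) (\<lambda>q1 q2. pt P [p1 \<otimes>\<^bsub>P\<^esub> q1] (p2 \<otimes>\<^bsub>P\<^esub> q2))"
      by (assumption | rule lins h)+
    have "?f (sw (T 1 P) (\<Delta> q) (\<lambda>q1 q2. pt P [p1 \<otimes>\<^bsub>P\<^esub> q1] (p2 \<otimes>\<^bsub>P\<^esub> q2))) =
        sw W (\<Delta> q) (\<lambda>q1 q2. ?f (pt P [p1 \<otimes>\<^bsub>P\<^esub> q1] (p2 \<otimes>\<^bsub>P\<^esub> q2)))"
      by (rule lin_sw[OF module_P mT assms(1) f b]) (rule lins assms)+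
    also have "\<dots> = sw W (\<Delta> q) (\<lambda>q1 q2. \<beta> (p1 \<otimes>\<^bsub>P\<^esub> q1) (p2 \<otimes>\<^bsub>P\<^esub> q2))"
      by (rule sw_cong[OF module_P assms(1) bilinear_comp[OF f b]])
         (use assms h in \<open>simp_all add: sw_pure[OF module_P assms(1,2)]\<close>)
    finally show "?f (sw (T 1 P) (\<Delta> q) (\<lambda>q1 q2. pt P [p1 \<otimes>\<^bsub>P\<^esub> q1] (p2 \<otimes>\<^bsub>P\<^esub> q2))) =
        sw W (\<Delta> q) (\<lambda>q1 q2. \<beta> (p1 \<otimes>\<^bsub>P\<^esub> q1) (p2 \<otimes>\<^bsub>P\<^esub> q2))" .
  qed (assumption | rule lins assms)+
  finally show ?thesis .
qed

end

context tensor_power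
begin

lemma sw_sw:
  assumes "module K Y" "module K X" "module K W" "bilinear Y (T 1 X) \<beta>" "bilinear X W \<gamma>" "t \<in> carrier (T 1 Y)"
  shows "sw W (sw (T 1 X) t \<beta>) \<gamma> = sw W t (\<lambda>p y. sw W (\<beta> p y) \<gamma>)"
  by (rule lin_sw[OF assms(1) module_T[OF assms(2)] assms(3) lin_sw_t0[OF assms(2,3,5)] assms(4,6)])

end

section \<open>The tensor product coaction by recursion\<close>

context hopf_algebra
begin

text \<open>The first factor is split into \<open>p1\<close> and \<open>p2\<close>, and
  \<open>p1\<close> multiplies the coefficient \<open>q\<close> of the remaining tensor from the
  left. This is the recursion of \<open>sweedler_tuple\<close>, performed on tensors instead of
  lists.\<close>

primrec cact :: "('k, 'v, 'c) module_scheme \<Rightarrow> ('v \<Rightarrow> ('k, 'p, 'v) tensors) \<Rightarrow> nat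
    \<Rightarrow> ('k, 'p, 'v) tensors \<Rightarrow> ('k, 'p, ('k, 'p, 'v) tensors) tensors"
  where "cact V \<rho> 0 = (\<lambda>t. tmap (T 0 V) 1 (pt V []) (\<rho> (unpure V t)))"
  | "cact V \<rho> (Suc n) = tuncons V (T 1 (T (Suc n) V)) (\<lambda>p x.
      sw (T 1 (T (Suc n) V)) (\<Delta> p) (\<lambda>p1 p2. sw (T 1 (T (Suc n) V)) (cact V \<rho> n x) (\<lambda>q y.
        pt (T (Suc n) V) [p1 \<otimes>\<^bsub>P\<^esub> q] (tcons V n p2 y))))"

context
  fixes V :: "('k, 'v, 'c) module_scheme" and \<rho> :: "'v \<Rightarrow> ('k, 'p, 'v) tensors"
  assumes mV: "module K V" and \<rho>_lin: "\<rho> \<in> lin V (T 1 V)"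
begin

lemma mTV: "module K (T n V)"
  by (rule module_T[OF mV])

lemma \<rho>_closed: "v \<in> carrier V \<Longrightarrow> \<rho> v \<in> carrier (T 1 V)"
  by (rule K.linearD(1)[OF \<rho>_lin])

lemma \<rho>_lin': "g \<in> lin U V \<Longrightarrow> (\<lambda>u. \<rho> (g u)) \<in> lin U (T 1 V)"
  by (rule K.linear_comp[OF \<rho>_lin])

text \<open>Linearity of the preceding stage appears as a hypothesis: the next stage is a
  \<open>tuncons\<close> of this expression, so bilinearity has to be available during the induction
  for \<open>cact_lin\<close>.\<close>

lemma cact_bilinear:
  assumes "cact V \<rho> n \<in> lin (T n V) (T 1 (T n V))"
  shows "bilinear (T n V) (T 1 (T (Suc n) V)) (\<lambda>p x.
      sw (T 1 (T (Suc n) V)) (\<Delta> p) (\<lambda>p1 p2. sw (T 1 (T (Suc n) V)) (cact V \<rho> n x) (\<lambda>q y.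
        pt (T (Suc n) V) [p1 \<otimes>\<^bsub>P\<^esub> q] (tcons V n p2 y))))"
  by (assumption | rule lins mV K.linear_comp[OF assms] K.linearD(1)[OF assms])+

lemma cact_lin: "cact V \<rho> n \<in> lin (T n V) (T 1 (T n V))"
proof (induction n)
  case 0
  show ?case unfolding cact.simps
    by (rule lin_tmap[OF mV mTV pure_lin[OF mV]]) (rule \<rho>_lin' unpure_lin mV)+
next
  case (Suc n)
  show ?case unfolding cact.simps by (rule tuncons_lin[OF mV module_T[OF mTV] cact_bilinear[OF Suc]])
qed

lemma cact_closed: "x \<in> carrier (T n V) \<Longrightarrow> cact V \<rho> n x \<in> carrier (T 1 (T n V))"
  by (rule K.linearD(1)[OF cact_lin])

lemma lin_cact: "g \<in> lin U (T n V) \<Longrightarrow> (\<lambda>u. cact V \<rho> n (g u)) \<in> lin U (T 1 (T n V))"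
  by (rule K.linear_comp[OF cact_lin])

lemmas clins = lins mV \<rho>_closed \<rho>_lin' cact_closed lin_cact

lemma cact_0: "v \<in> carrier V \<Longrightarrow> cact V \<rho> 0 (pt V [] v) = tmap (T 0 V) 1 (pt V []) (\<rho> v)"
  by (simp add: unpure_pure[OF mV])

lemma cact_Suc:
  assumes "p \<in> carrier P" "x \<in> carrier (T n V)"
  shows "cact V \<rho> (Suc n) (tcons V n p x) =
      sw (T 1 (T (Suc n) V)) (\<Delta> p) (\<lambda>p1 p2. sw (T 1 (T (Suc n) V)) (cact V \<rho> n x) (\<lambda>q y.
        pt (T (Suc n) V) [p1 \<otimes>\<^bsub>P\<^esub> q] (tcons V n p2 y)))"
  unfolding cact.simps by (rule tuncons_tcons[OF mV module_T[OF mTV] cact_bilinear[OF cact_lin] assms])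

lemma sw_cact_0:
  assumes "module K W" "bilinear (T 0 V) W \<beta>" "v \<in> carrier V"
  shows "sw W (cact V \<rho> 0 (pt V [] v)) \<beta> = sw W (\<rho> v) (\<lambda>q u. \<beta> q (pt V [] u))"
  unfolding cact_0[OF assms(3)] by (rule sw_tmap[OF mV mTV assms(1) pure_lin[OF mV] assms(2) \<rho>_closed[OF assms(3)]])

lemma sw_cact_Suc:
  assumes "module K W" "bilinear (T (Suc n) V) W \<beta>" "p \<in> carrier P" "x \<in> carrier (T n V)"
  shows "sw W (cact V \<rho> (Suc n) (tcons V n p x)) \<beta> =
    sw W (\<Delta> p) (\<lambda>p1 p2. sw W (cact V \<rho> n x) (\<lambda>q y. \<beta> (p1 \<otimes>\<^bsub>P\<^esub> q) (tcons V n p2 y)))"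
proof -
  let ?M = "T (Suc n) V"
  note b = lin_bil[OF assms(2)]
  have "sw W (cact V \<rho> (Suc n) (tcons V n p x)) \<beta> = sw W (\<Delta> p) (\<lambda>p1 p2. sw W (sw (T 1 ?M) (cact V \<rho> n x)
      (\<lambda>q y. pt ?M [p1 \<otimes>\<^bsub>P\<^esub> q] (tcons V n p2 y))) \<beta>)"
    unfolding cact_Suc[OF assms(3,4)]
    by (rule sw_sw[OF module_P mTV assms(1) _ assms(2)]) (assumption | rule clins assms)+
  also have "\<dots> = sw W (\<Delta> p) (\<lambda>p1 p2. sw W (cact V \<rho> n x) (\<lambda>q y. \<beta> (p1 \<otimes>\<^bsub>P\<^esub> q) (tcons V n p2 y)))"
  proof (rule sw_cong[OF module_P assms(1)], (assumption | rule assms clins)+)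
    fix p1 p2 assume h: "p1 \<in> carrier P" "p2 \<in> carrier P"
    have "sw W (sw (T 1 ?M) (cact V \<rho> n x) (\<lambda>q y. pt ?M [p1 \<otimes>\<^bsub>P\<^esub> q] (tcons V n p2 y))) \<beta> =
        sw W (cact V \<rho> n x) (\<lambda>q y. sw W (pt ?M [p1 \<otimes>\<^bsub>P\<^esub> q] (tcons V n p2 y)) \<beta>)"
      by (rule sw_sw[OF mTV mTV assms(1) _ assms(2)]) (assumption | rule clins assms h)+
    also have "\<dots> = sw W (cact V \<rho> n x) (\<lambda>q y. \<beta> (p1 \<otimes>\<^bsub>P\<^esub> q) (tcons V n p2 y))"
    proof (rule sw_cong[OF mTV assms(1)])
      show "bilinear (T n V) W (\<lambda>q y. sw W (pt ?M [p1 \<otimes>\<^bsub>P\<^esub> q] (tcons V n p2 y)) \<beta>)"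
        by (assumption | rule clins assms h)+
    qed (use assms h sw_pure[OF mTV assms(1,2)] tcons_closed[OF mV] cact_closed in simp_all)
    finally show "sw W (sw (T 1 ?M) (cact V \<rho> n x) (\<lambda>q y. pt ?M [p1 \<otimes>\<^bsub>P\<^esub> q] (tcons V n p2 y))) \<beta> =
        sw W (cact V \<rho> n x) (\<lambda>q y. \<beta> (p1 \<otimes>\<^bsub>P\<^esub> q) (tcons V n p2 y))" .
  qed
  finally show ?thesis .
qed

text \<open>Passing to the tail of the list replaces \<open>\<Phi>\<close> and
  \<open>\<beta>\<close> by variants that multiply by \<open>p1\<close> and prepend
  \<open>p2\<close>, so both must vary in the induction. They need to agree only on tuples.\<close>

lemma sweedler_tuple_eq:
  assumes "module K W" "bilinear (T n V) W \<beta>" "(ps, v) \<in> tuples P n V"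
    "\<And>q qs u. \<lbrakk>q \<in> carrier P; (qs, u) \<in> tuples P n V\<rbrakk> \<Longrightarrow> \<Phi> q qs u = \<beta> q (pt V qs u)"
  shows "sweedler_tuple K P W \<rho> ps v \<Phi> = sw W (cact V \<rho> n (pt V ps v)) \<beta>"
  using assms(2-4)
proof (induction n arbitrary: ps \<beta> \<Phi>)
  case 0
  then have h: "ps = []" "v \<in> carrier V" by (auto simp: tuples_0)
  note b = lin_bil[OF 0(1)]
  have "sw W (\<rho> v) (\<lambda>q u. \<beta> q (pt V [] u)) = sw W (\<rho> v) (\<lambda>q u. \<Phi> q [] u)"
  proof (rule sw_cong[OF mV assms(1)], (assumption | rule clins b)+)
  qed (use h 0(3) \<rho>_closed in \<open>simp_all add: tuples_0\<close>)
  then show ?case using sw_cact_0[OF assms(1) 0(1) h(2)] h(1) by simp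
next
  case (Suc n)
  then obtain p qs where h: "ps = p # qs" "p \<in> carrier P" "(qs, v) \<in> tuples P n V" by (auto simp: tuples_Suc)
  note b = lin_bil[OF Suc.prems(1)]
  note x = pure_closed[OF mV h(3)]
  have "sw W (\<Delta> p) (\<lambda>p1 p2. sw W (cact V \<rho> n (pt V qs v)) (\<lambda>q y. \<beta> (p1 \<otimes>\<^bsub>P\<^esub> q) (tcons V n p2 y))) =
    sw W (\<Delta> p) (\<lambda>p1 p2. sweedler_tuple K P W \<rho> qs v (\<lambda>q qs u. \<Phi> (p1 \<otimes>\<^bsub>P\<^esub> q) (p2 # qs) u))"
  proof (rule sw_cong[OF module_P assms(1)], (assumption | rule clins b assms(1) x)+)
    fix p1 p2 assume p: "p1 \<in> carrier P" "p2 \<in> carrier P"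
    show "sw W (cact V \<rho> n (pt V qs v)) (\<lambda>q y. \<beta> (p1 \<otimes>\<^bsub>P\<^esub> q) (tcons V n p2 y)) =
        sweedler_tuple K P W \<rho> qs v (\<lambda>q qs u. \<Phi> (p1 \<otimes>\<^bsub>P\<^esub> q) (p2 # qs) u)"
    proof (rule Suc.IH[symmetric, OF _ h(3)], (assumption | rule clins b p)+)
      fix q rs u assume q: "q \<in> carrier P" "(rs, u) \<in> tuples P n V"
      then show "\<Phi> (p1 \<otimes>\<^bsub>P\<^esub> q) (p2 # rs) u = \<beta> (p1 \<otimes>\<^bsub>P\<^esub> q) (tcons V n p2 (pt V rs u))"
        using Suc.prems(3)[of "p1 \<otimes>\<^bsub>P\<^esub> q" "p2 # rs" u] p tcons_pure[OF mV p(2) q(2)] by (simp add: tuples_Suc)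
    qed
  qed (use h in simp)
  then show ?case
    using sw_cact_Suc[OF assms(1) Suc.prems(1) h(2) x] tcons_pure[OF mV h(2,3)] h(1) by simp
qed

text \<open>\<open>tensor_lift_cong\<close> exchanges the values on tuples for those of the linear
  map \<open>cact\<close>, whose multilinearity is immediate; the nested Sweedler expression itself
  is never tested for it.\<close>

lemma tensor_coaction_eq:
  assumes "t \<in> carrier (T n V)"
  shows "tensor_coaction K P n V \<rho> t = cact V \<rho> n t"
proof -
  let ?D = "T n V" and ?W = "T 1 (T n V)"
  note mW = module_T[OF mTV]
  have eq: "sweedler_tuple K P ?W \<rho> ps v (\<lambda>q qs u. pt ?D [q] (pt V qs u)) = cact V \<rho> n (pt V ps v)"
    if "(ps, v) \<in> tuples P n V" for ps v
    using sweedler_tuple_eq[OF mW bilinear_pure[OF mTV] that] sw_eta[OF mTV cact_closed[OF pure_closed[OF mV that]]]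
    by simp
  have m: "K.multilinear P n V ?W (\<lambda>ps v. cact V \<rho> n (pt V ps v))"
  proof (rule K.multilinearI)
    note m = K.pure_tensor_multilinear[OF module_P mV, of n]
    fix ps v assume h: "(ps, v) \<in> tuples P n V"
    show "(\<lambda>u. cact V \<rho> n (pt V ps u)) \<in> lin V ?W" by (rule lin_cact[OF K.multilinearD(2)[OF m h]])
    show "(\<lambda>p. cact V \<rho> n (pt V (ps[i := p]) v)) \<in> lin P ?W" if "i < n" for i
      by (rule lin_cact[OF K.multilinearD(1)[OF m h that]])
  qed
  have "tensor_coaction K P n V \<rho> t = tensor_lift K ?W (\<lambda>ps v. cact V \<rho> n (pt V ps v)) t"
    unfolding tensor_coaction_def Let_def
    by (rule K.tensor_lift_cong[OF module_P mV mW _ eq assms]) (use eq cact_closed[OF pure_closed[OF mV]] in simp)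
  also have "\<dots> = cact V \<rho> n t"
    by (rule T_ext[OF mV mW K.tensor_lift_linear[OF module_P mV mW m] cact_lin assms])
       (rule K.tensor_lift_pure[OF module_P mV mW m])
  finally show ?thesis .
qed

end

text \<open>In the step, multiplicativity of \<open>\<Delta>\<close> separates \<open>p\<close> from
  \<open>x\<close>. After exchanging the sums, the induction hypothesis handles \<open>x\<close> and
  coassociativity of \<open>P\<close> handles \<open>p\<close>, and the sums are exchanged back. The
  counit law uses multiplicativity of \<open>\<epsilon>\<close>.\<close>

lemma cact_comodule:
  assumes com: "left_comodule K P V \<rho>"
  shows "left_comodule K P (T n V) (cact V \<rho> n)"
proof (induction n)
  case 0
  note V = left_comoduleD[OF com]
  note cl = clins[OF V(1,2)] and mTV = module_T[OF V(1)]
  let ?c = "cact V \<rho> 0" and ?X = "T 0 V" and ?W = "T 2 (T 0 V)"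
  note mW = module_T[OF mTV] and tp = lin_tri[OF trilinear_pure2[OF mTV]]
  have coassoc: "sw ?W (?c t) (\<lambda>p w. sw ?W (\<Delta> p) (\<lambda>p1 p2. pt ?X [p1, p2] w)) =
      sw ?W (?c t) (\<lambda>p w. sw ?W (?c w) (\<lambda>q u. pt ?X [p, q] u))" if "t \<in> carrier ?X" for t
  proof (rule T_0_ext[OF V(1) mW _ _ that], (assumption | rule cl tp)+)
    fix v assume v: "v \<in> carrier V"
    have "sw ?W (?c (pt V [] v)) (\<lambda>p w. sw ?W (\<Delta> p) (\<lambda>p1 p2. pt ?X [p1, p2] w)) =
        sw ?W (\<rho> v) (\<lambda>p u. sw ?W (\<Delta> p) (\<lambda>p1 p2. pt ?X [p1, p2] (pt V [] u)))"
      by (rule sw_cact_0[OF V(1,2) mW _ v]) (assumption | rule cl tp)+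
    also have "\<dots> = sw ?W (\<rho> v) (\<lambda>p u. sw ?W (\<rho> u) (\<lambda>q z. pt ?X [p, q] (pt V [] z)))"
      by (rule comodule_coassoc[OF com mW _ v], rule trilinearI) (assumption | rule cl tp)+
    also have "\<dots> = sw ?W (\<rho> v) (\<lambda>p u. sw ?W (?c (pt V [] u)) (\<lambda>q z. pt ?X [p, q] z))"
    proof (rule sw_cong[OF V(1) mW _ V(3)[OF v]], (assumption | rule cl tp)+)
      fix p u assume h: "p \<in> carrier P" "u \<in> carrier V"
      show "sw ?W (\<rho> u) (\<lambda>q z. pt ?X [p, q] (pt V [] z)) = sw ?W (?c (pt V [] u)) (\<lambda>q z. pt ?X [p, q] z)"
        by (rule sw_cact_0[symmetric, OF V(1,2) mW _ h(2)]) (assumption | rule cl tp h)+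
    qed
    also have "\<dots> = sw ?W (?c (pt V [] v)) (\<lambda>p w. sw ?W (?c w) (\<lambda>q u. pt ?X [p, q] u))"
      by (rule sw_cact_0[symmetric, OF V(1,2) mW _ v]) (assumption | rule cl tp)+
    finally show "sw ?W (?c (pt V [] v)) (\<lambda>p w. sw ?W (\<Delta> p) (\<lambda>p1 p2. pt ?X [p1, p2] w)) =
        sw ?W (?c (pt V [] v)) (\<lambda>p w. sw ?W (?c w) (\<lambda>q u. pt ?X [p, q] u))" .
  qed
  have counit: "sw ?X (?c t) (\<lambda>p w. \<epsilon> p \<odot>\<^bsub>?X\<^esub> w) = t" if "t \<in> carrier ?X" for t
  proof (rule T_0_ext[OF V(1) mTV _ K.linear_id that], (assumption | rule cl counit_closed)+)
    fix v assume v: "v \<in> carrier V"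
    have "sw ?X (?c (pt V [] v)) (\<lambda>p w. \<epsilon> p \<odot>\<^bsub>?X\<^esub> w) = sw ?X (\<rho> v) (\<lambda>p u. \<epsilon> p \<odot>\<^bsub>?X\<^esub> pt V [] u)"
      by (rule sw_cact_0[OF V(1,2) mTV _ v]) (assumption | rule cl counit_closed)+
    also have "\<dots> = pt V [] v" by (rule comodule_counit[OF com mTV pure_lin[OF V(1)] v])
    finally show "sw ?X (?c (pt V [] v)) (\<lambda>p w. \<epsilon> p \<odot>\<^bsub>?X\<^esub> w) = pt V [] v" .
  qed
  show ?case unfolding left_comodule_def using mTV cact_lin[OF V(1,2), of 0] coassoc counit by blast
next
  case (Suc n)
  note V = left_comoduleD[OF com]
  note cl = clins[OF V(1,2)] and mTV = module_T[OF V(1)]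
  let ?c = "cact V \<rho> (Suc n)" and ?d = "cact V \<rho> n" and ?Y = "T n V" and ?X = "T (Suc n) V" and ?W = "T 2 (T (Suc n) V)"
  let ?t = "tcons V n"
  note mW = module_T[OF mTV] and tp = lin_tri[OF trilinear_pure2[OF mTV]]
  note dcl = cact_closed[OF V(1,2)]
  have coassoc: "sw ?W (?c t) (\<lambda>p w. sw ?W (\<Delta> p) (\<lambda>p1 p2. pt ?X [p1, p2] w)) =
      sw ?W (?c t) (\<lambda>p w. sw ?W (?c w) (\<lambda>q u. pt ?X [p, q] u))" if "t \<in> carrier ?X" for t
  proof (rule T_Suc_ext[OF V(1) mW _ _ that], (assumption | rule cl tp)+)
    fix p x assume h: "p \<in> carrier P" "x \<in> carrier ?Y"
    have "sw ?W (?c (?t p x)) (\<lambda>p w. sw ?W (\<Delta> p) (\<lambda>p1 p2. pt ?X [p1, p2] w)) =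
        sw ?W (\<Delta> p) (\<lambda>p1 p2. sw ?W (?d x) (\<lambda>q y. sw ?W (\<Delta> (p1 \<otimes>\<^bsub>P\<^esub> q)) (\<lambda>a b. pt ?X [a, b] (?t p2 y))))"
      by (rule sw_cact_Suc[OF V(1,2) mW _ h]) (assumption | rule cl tp)+
    also have "\<dots> = sw ?W (\<Delta> p) (\<lambda>p1 p2. sw ?W (\<Delta> p1) (\<lambda>r1 r2. sw ?W (?d x) (\<lambda>q y. sw ?W (?d y) (\<lambda>b z.
        pt ?X [r1 \<otimes>\<^bsub>P\<^esub> q, r2 \<otimes>\<^bsub>P\<^esub> b] (?t p2 z)))))"
    proof (rule sw_cong[OF module_P mW], (assumption | rule cl tp h)+)
      fix p1 p2 assume p: "p1 \<in> carrier P" "p2 \<in> carrier P"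
      have "sw ?W (?d x) (\<lambda>q y. sw ?W (\<Delta> (p1 \<otimes>\<^bsub>P\<^esub> q)) (\<lambda>a b. pt ?X [a, b] (?t p2 y))) =
          sw ?W (?d x) (\<lambda>q y. sw ?W (\<Delta> p1) (\<lambda>r1 r2. sw ?W (\<Delta> q) (\<lambda>q1 q2.
            pt ?X [r1 \<otimes>\<^bsub>P\<^esub> q1, r2 \<otimes>\<^bsub>P\<^esub> q2] (?t p2 y))))"
      proof (rule sw_cong[OF mTV mW _ dcl[OF h(2)]], (assumption | rule cl tp h p)+)
        fix q y assume q: "q \<in> carrier P" "y \<in> carrier ?Y"
        show "sw ?W (\<Delta> (p1 \<otimes>\<^bsub>P\<^esub> q)) (\<lambda>a b. pt ?X [a, b] (?t p2 y)) = sw ?W (\<Delta> p1) (\<lambda>r1 r2. sw ?W (\<Delta> q) (\<lambda>q1 q2.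
            pt ?X [r1 \<otimes>\<^bsub>P\<^esub> q1, r2 \<otimes>\<^bsub>P\<^esub> q2] (?t p2 y)))"
          by (rule sw_comult_mult[OF mW _ p(1) q(1)]) (assumption | rule cl tp p q)+
      qed
      also have "\<dots> = sw ?W (\<Delta> p1) (\<lambda>r1 r2. sw ?W (?d x) (\<lambda>q y. sw ?W (\<Delta> q) (\<lambda>q1 q2.
            pt ?X [r1 \<otimes>\<^bsub>P\<^esub> q1, r2 \<otimes>\<^bsub>P\<^esub> q2] (?t p2 y))))"
        by (rule sw_swap[OF mTV module_P mW dcl[OF h(2)] comult_closed[OF p(1)]]) (assumption | rule cl tp p)+
      also have "\<dots> = sw ?W (\<Delta> p1) (\<lambda>r1 r2. sw ?W (?d x) (\<lambda>q y. sw ?W (?d y) (\<lambda>b z.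
        pt ?X [r1 \<otimes>\<^bsub>P\<^esub> q, r2 \<otimes>\<^bsub>P\<^esub> b] (?t p2 z))))"
      proof (rule sw_cong[OF module_P mW _ comult_closed[OF p(1)]], (assumption | rule cl tp h p)+)
        fix r1 r2 assume r: "r1 \<in> carrier P" "r2 \<in> carrier P"
        show "sw ?W (?d x) (\<lambda>q y. sw ?W (\<Delta> q) (\<lambda>q1 q2. pt ?X [r1 \<otimes>\<^bsub>P\<^esub> q1, r2 \<otimes>\<^bsub>P\<^esub> q2] (?t p2 y))) =
            sw ?W (?d x) (\<lambda>q y. sw ?W (?d y) (\<lambda>b z. pt ?X [r1 \<otimes>\<^bsub>P\<^esub> q, r2 \<otimes>\<^bsub>P\<^esub> b] (?t p2 z)))"
          by (rule comodule_coassoc[OF Suc mW _ h(2)], rule trilinearI) (assumption | rule cl tp p r)+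
      qed
      finally show "sw ?W (?d x) (\<lambda>q y. sw ?W (\<Delta> (p1 \<otimes>\<^bsub>P\<^esub> q)) (\<lambda>a b. pt ?X [a, b] (?t p2 y))) =
          sw ?W (\<Delta> p1) (\<lambda>r1 r2. sw ?W (?d x) (\<lambda>q y. sw ?W (?d y) (\<lambda>b z.
            pt ?X [r1 \<otimes>\<^bsub>P\<^esub> q, r2 \<otimes>\<^bsub>P\<^esub> b] (?t p2 z))))" .
    qed
    also have "\<dots> = sw ?W (\<Delta> p) (\<lambda>p1 p2. sw ?W (\<Delta> p2) (\<lambda>s1 s2. sw ?W (?d x) (\<lambda>q y. sw ?W (?d y) (\<lambda>b z.
        pt ?X [p1 \<otimes>\<^bsub>P\<^esub> q, s1 \<otimes>\<^bsub>P\<^esub> b] (?t s2 z)))))"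
      by (rule comodule_coassoc[OF comult_comodule mW _ h(1)], rule trilinearI) (assumption | rule cl tp h)+
    also have "\<dots> = sw ?W (\<Delta> p) (\<lambda>p1 p2. sw ?W (?d x) (\<lambda>q y. sw ?W (?c (?t p2 y)) (\<lambda>a u. pt ?X [p1 \<otimes>\<^bsub>P\<^esub> q, a] u)))"
    proof (rule sw_cong[OF module_P mW _ comult_closed[OF h(1)]], (assumption | rule cl tp h)+)
      fix p1 p2 assume p: "p1 \<in> carrier P" "p2 \<in> carrier P"
      have "sw ?W (\<Delta> p2) (\<lambda>s1 s2. sw ?W (?d x) (\<lambda>q y. sw ?W (?d y) (\<lambda>b z.
          pt ?X [p1 \<otimes>\<^bsub>P\<^esub> q, s1 \<otimes>\<^bsub>P\<^esub> b] (?t s2 z)))) =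
          sw ?W (?d x) (\<lambda>q y. sw ?W (\<Delta> p2) (\<lambda>s1 s2. sw ?W (?d y) (\<lambda>b z.
          pt ?X [p1 \<otimes>\<^bsub>P\<^esub> q, s1 \<otimes>\<^bsub>P\<^esub> b] (?t s2 z))))"
        by (rule sw_swap[OF module_P mTV mW comult_closed[OF p(2)] dcl[OF h(2)]]) (assumption | rule cl tp p)+
      also have "\<dots> = sw ?W (?d x) (\<lambda>q y. sw ?W (?c (?t p2 y)) (\<lambda>a u. pt ?X [p1 \<otimes>\<^bsub>P\<^esub> q, a] u))"
      proof (rule sw_cong[OF mTV mW _ dcl[OF h(2)]], (assumption | rule cl tp h p)+)
        fix q y assume q: "q \<in> carrier P" "y \<in> carrier ?Y"
        show "sw ?W (\<Delta> p2) (\<lambda>s1 s2. sw ?W (?d y) (\<lambda>b z. pt ?X [p1 \<otimes>\<^bsub>P\<^esub> q, s1 \<otimes>\<^bsub>P\<^esub> b] (?t s2 z))) =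
            sw ?W (?c (?t p2 y)) (\<lambda>a u. pt ?X [p1 \<otimes>\<^bsub>P\<^esub> q, a] u)"
          by (rule sw_cact_Suc[symmetric, OF V(1,2) mW _ p(2) q(2)]) (assumption | rule cl tp p q)+
      qed
      finally show "sw ?W (\<Delta> p2) (\<lambda>s1 s2. sw ?W (?d x) (\<lambda>q y. sw ?W (?d y) (\<lambda>b z.
          pt ?X [p1 \<otimes>\<^bsub>P\<^esub> q, s1 \<otimes>\<^bsub>P\<^esub> b] (?t s2 z)))) =
          sw ?W (?d x) (\<lambda>q y. sw ?W (?c (?t p2 y)) (\<lambda>a u. pt ?X [p1 \<otimes>\<^bsub>P\<^esub> q, a] u))" .
    qed
    also have "\<dots> = sw ?W (?c (?t p x)) (\<lambda>p w. sw ?W (?c w) (\<lambda>q u. pt ?X [p, q] u))"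
      by (rule sw_cact_Suc[symmetric, OF V(1,2) mW _ h]) (assumption | rule cl tp)+
    finally show "sw ?W (?c (?t p x)) (\<lambda>p w. sw ?W (\<Delta> p) (\<lambda>p1 p2. pt ?X [p1, p2] w)) =
        sw ?W (?c (?t p x)) (\<lambda>p w. sw ?W (?c w) (\<lambda>q u. pt ?X [p, q] u))" .
  qed
  have counit: "sw ?X (?c t) (\<lambda>p w. \<epsilon> p \<odot>\<^bsub>?X\<^esub> w) = t" if "t \<in> carrier ?X" for t
  proof (rule T_Suc_ext[OF V(1) mTV _ K.linear_id that], (assumption | rule cl counit_closed)+)
    fix p x assume h: "p \<in> carrier P" "x \<in> carrier ?Y"
    interpret X: module K ?X by (rule mTV)
    have "sw ?X (?c (?t p x)) (\<lambda>p w. \<epsilon> p \<odot>\<^bsub>?X\<^esub> w) =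
        sw ?X (\<Delta> p) (\<lambda>p1 p2. sw ?X (?d x) (\<lambda>q y. \<epsilon> (p1 \<otimes>\<^bsub>P\<^esub> q) \<odot>\<^bsub>?X\<^esub> ?t p2 y))"
      by (rule sw_cact_Suc[OF V(1,2) mTV _ h]) (assumption | rule cl counit_closed)+
    also have "\<dots> = sw ?X (\<Delta> p) (\<lambda>p1 p2. \<epsilon> p1 \<odot>\<^bsub>?X\<^esub> ?t p2 x)"
    proof (rule sw_cong[OF module_P mTV _ comult_closed[OF h(1)]], (assumption | rule cl h counit_closed)+)
      fix p1 p2 assume p: "p1 \<in> carrier P" "p2 \<in> carrier P"
      have "sw ?X (?d x) (\<lambda>q y. \<epsilon> (p1 \<otimes>\<^bsub>P\<^esub> q) \<odot>\<^bsub>?X\<^esub> ?t p2 y) =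
          sw ?X (?d x) (\<lambda>q y. \<epsilon> q \<odot>\<^bsub>?X\<^esub> (\<epsilon> p1 \<odot>\<^bsub>?X\<^esub> ?t p2 y))"
      proof (rule sw_cong[OF mTV mTV _ dcl[OF h(2)]], (assumption | rule cl p counit_closed)+)
        fix q y assume q: "q \<in> carrier P" "y \<in> carrier ?Y"
        show "\<epsilon> (p1 \<otimes>\<^bsub>P\<^esub> q) \<odot>\<^bsub>?X\<^esub> ?t p2 y = \<epsilon> q \<odot>\<^bsub>?X\<^esub> (\<epsilon> p1 \<odot>\<^bsub>?X\<^esub> ?t p2 y)"
          using p q tcons_closed[OF V(1) p(2) q(2)] by (simp add: counit_mult X.smult_assoc1[symmetric] K.m_comm)
      qed
      also have "\<dots> = \<epsilon> p1 \<odot>\<^bsub>?X\<^esub> ?t p2 x"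
        by (rule comodule_counit[OF Suc mTV _ h(2)]) (assumption | rule cl p counit_closed)+
      finally show "sw ?X (?d x) (\<lambda>q y. \<epsilon> (p1 \<otimes>\<^bsub>P\<^esub> q) \<odot>\<^bsub>?X\<^esub> ?t p2 y) = \<epsilon> p1 \<odot>\<^bsub>?X\<^esub> ?t p2 x" .
    qed
    also have "\<dots> = ?t p x"
      by (rule comodule_counit[OF comult_comodule mTV _ h(1)]) (assumption | rule cl h)+
    finally show "sw ?X (?c (?t p x)) (\<lambda>p w. \<epsilon> p \<odot>\<^bsub>?X\<^esub> w) = ?t p x" .
  qed
  show ?case unfolding left_comodule_def using mTV cact_lin[OF V(1,2), of "Suc n"] coassoc counit by blast
qed

end

section \<open>Naturality of the coaction and equivariant maps\<close>

context tensor_power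
begin

lemma tmap1_sw:
  assumes "module K V" "module K W" "g \<in> lin V W" "t \<in> carrier (T 1 V)"
  shows "tmap W 1 g t = sw (T 1 W) t (\<lambda>p v. pt W [p] (g v))"
proof (rule T1_ext[OF assms(1) module_T[OF assms(2)] tmap_lin[OF assms(1-3)] _ assms(4)])
  have b: "bilinear V (T 1 W) (\<lambda>p v. pt W [p] (g v))"
    by (rule bilinear_precomp[OF assms(3) bilinear_pure[OF assms(2)]])
  show "(\<lambda>t. sw (T 1 W) t (\<lambda>p v. pt W [p] (g v))) \<in> lin (T 1 V) (T 1 W)"
    by (rule lin_sw_t0[OF assms(1) module_T[OF assms(2)] b])
  show "tmap W 1 g (pt V [p] x) = sw (T 1 W) (pt V [p] x) (\<lambda>p v. pt W [p] (g v))"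
    if "p \<in> carrier P" "x \<in> carrier V" for p x
    using tmap_pure1[OF assms(1-3) that] sw_pure[OF assms(1) module_T[OF assms(2)] b that] by simp
qed

text \<open>The map \<open>id \<otimes> f\<close> with one further factor \<open>P\<close>. In
  contrast to \<open>tmap\<close>, \<open>f\<close> may change the number of factors, as the
  differentials and homotopies do.\<close>

definition pmap :: "('k, 'v, 'c) module_scheme \<Rightarrow> ('k, 'w, 'd) module_scheme \<Rightarrow> nat
    \<Rightarrow> (('k, 'p, 'v) tensors \<Rightarrow> ('k, 'p, 'w) tensors) \<Rightarrow> ('k, 'p, 'v) tensors \<Rightarrow> ('k, 'p, 'w) tensors"
  where "pmap V W m f = tuncons V (T (Suc m) W) (\<lambda>p x. tcons W m p (f x))"

lemma bilinear_pmap: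
  assumes "module K V" "module K W" "f \<in> lin (T n V) (T m W)"
  shows "bilinear (T n V) (T (Suc m) W) (\<lambda>p x. tcons W m p (f x))"
  by (rule bilinearI lin_tcons_r lin_tcons_l assms K.linear_id K.linearD(1)[OF assms(3)] | assumption)+

lemma pmap_lin:
  assumes "module K V" "module K W" "f \<in> lin (T n V) (T m W)"
  shows "pmap V W m f \<in> lin (T (Suc n) V) (T (Suc m) W)"
  unfolding pmap_def by (rule tuncons_lin[OF assms(1) module_T[OF assms(2)] bilinear_pmap[OF assms]])

lemma pmap_tcons:
  assumes "module K V" "module K W" "f \<in> lin (T n V) (T m W)" "p \<in> carrier P" "x \<in> carrier (T n V)"
  shows "pmap V W m f (tcons V n p x) = tcons W m p (f x)"
  unfolding pmap_def by (rule tuncons_tcons[OF assms(1) module_T[OF assms(2)] bilinear_pmap[OF assms(1-3)] assms(4,5)])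

lemma pmap_id:
  assumes "module K V" "t \<in> carrier (T (Suc n) V)"
  shows "pmap V V n (\<lambda>x. x) t = t"
  by (rule T_Suc_ext[OF assms(1) module_T[OF assms(1)] pmap_lin[OF assms(1,1) K.linear_id] K.linear_id assms(2)])
     (rule pmap_tcons[OF assms(1,1) K.linear_id])

lemma pmap_tmap:
  assumes "module K V" "module K W" "g \<in> lin V W" "t \<in> carrier (T (Suc n) V)"
  shows "tmap W (Suc n) g t = pmap V W n (tmap W n g) t"
  by (rule T_Suc_ext[OF assms(1) module_T[OF assms(2)] tmap_lin[OF assms(1-3)]
      pmap_lin[OF assms(1,2) tmap_lin[OF assms(1-3)]] assms(4)])
     (simp add: tmap_tcons[OF assms(1-3)] pmap_tcons[OF assms(1,2) tmap_lin[OF assms(1-3)]])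

end

context hopf_algebra
begin

text \<open>Adding a factor \<open>P\<close> only multiplies the coefficient by \<open>p1\<close>,
  which commutes with applying \<open>g\<close> to the other leg. Allowing different tensor powers
  makes this serve \<open>cact_tmap\<close> and, through \<open>equivariant_pmap\<close>, the
  differential and the homotopy.\<close>

lemma cact_pmap:
  assumes "left_comodule K P V \<rho>V" "left_comodule K P W \<rho>W" "module K U"
    "h \<in> lin (T k U) (T m W)" "f \<in> lin (T k U) (T n V)" "g \<in> lin (T n V) (T m W)"
    and eq: "\<And>x. x \<in> carrier (T k U) \<Longrightarrow> cact W \<rho>W m (h x) = tmap (T m W) 1 g (cact V \<rho>V n (f x))"
    and t: "t \<in> carrier (T (Suc k) U)"
  shows "cact W \<rho>W (Suc m) (pmap U W m h t) =
    tmap (T (Suc m) W) 1 (pmap V W m g) (cact V \<rho>V (Suc n) (pmap U V n f t))"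
proof -
  note V = left_comoduleD[OF assms(1)] and W = left_comoduleD[OF assms(2)]
  note cV = clins[OF V(1,2)] and cW = clins[OF W(1,2)]
  note hl = K.linearD(1)[OF assms(4)] and fl = K.linearD(1)[OF assms(5)] and gl = K.linearD(1)[OF assms(6)]
  note mW = module_T[OF W(1)] and mV = module_T[OF V(1)]
  note pg = pmap_lin[OF V(1) W(1) assms(6)] and ph = pmap_lin[OF assms(3) W(1) assms(4)] and pf = pmap_lin[OF assms(3) V(1) assms(5)]
  let ?Q = "T 1 (T (Suc m) W)"
  note mQ = module_T[OF mW]
  show ?thesis
  proof (rule T_Suc_ext[OF assms(3) mQ _ _ t])
    show "(\<lambda>t. cact W \<rho>W (Suc m) (pmap U W m h t)) \<in> lin (T (Suc k) U) ?Q"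
      by (rule lin_cact[OF W(1,2) ph])
    show "(\<lambda>t. tmap (T (Suc m) W) 1 (pmap V W m g) (cact V \<rho>V (Suc n) (pmap U V n f t))) \<in> lin (T (Suc k) U) ?Q"
      by (rule lin_tmap[OF mV mW pg lin_cact[OF V(1,2) pf]])
    fix p x assume p: "p \<in> carrier P" "x \<in> carrier (T k U)"
    have "cact W \<rho>W (Suc m) (pmap U W m h (tcons U k p x)) = cact W \<rho>W (Suc m) (tcons W m p (h x))"
      by (simp add: pmap_tcons[OF assms(3) W(1) assms(4) p])
    also have "\<dots> = sw ?Q (\<Delta> p) (\<lambda>p1 p2. sw ?Q (tmap (T m W) 1 g (cact V \<rho>V n (f x)))
        (\<lambda>q y. pt (T (Suc m) W) [p1 \<otimes>\<^bsub>P\<^esub> q] (tcons W m p2 y)))"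
      unfolding eq[OF p(2), symmetric] by (rule cact_Suc[OF W(1,2) p(1) hl[OF p(2)]])
    also have "\<dots> = sw ?Q (\<Delta> p) (\<lambda>p1 p2. sw ?Q (cact V \<rho>V n (f x))
        (\<lambda>q y. pt (T (Suc m) W) [p1 \<otimes>\<^bsub>P\<^esub> q] (tcons W m p2 (g y))))"
    proof (rule sw_cong[OF module_P mQ], (assumption | rule cW V(1) p hl fl gl cact_closed[OF V(1,2)] assms)+)
      fix p1 p2 assume q: "p1 \<in> carrier P" "p2 \<in> carrier P"
      show "sw ?Q (tmap (T m W) 1 g (cact V \<rho>V n (f x))) (\<lambda>q y. pt (T (Suc m) W) [p1 \<otimes>\<^bsub>P\<^esub> q] (tcons W m p2 y)) =
        sw ?Q (cact V \<rho>V n (f x)) (\<lambda>q y. pt (T (Suc m) W) [p1 \<otimes>\<^bsub>P\<^esub> q] (tcons W m p2 (g y)))"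
        by (rule sw_tmap[OF mV mW mQ assms(6)]) (assumption | rule cW V(1) p q hl fl gl cact_closed[OF V(1,2)] assms)+
    qed
    also have "\<dots> = sw ?Q (\<Delta> p) (\<lambda>p1 p2. sw ?Q (cact V \<rho>V n (f x))
        (\<lambda>q y. pt (T (Suc m) W) [p1 \<otimes>\<^bsub>P\<^esub> q] (pmap V W m g (tcons V n p2 y))))"
    proof (rule sw_cong[OF module_P mQ], (assumption | rule cW V(1) p hl fl gl cact_closed[OF V(1,2)] assms)+)
      fix p1 p2 assume q: "p1 \<in> carrier P" "p2 \<in> carrier P"
      show "sw ?Q (cact V \<rho>V n (f x)) (\<lambda>q y. pt (T (Suc m) W) [p1 \<otimes>\<^bsub>P\<^esub> q] (tcons W m p2 (g y))) =
        sw ?Q (cact V \<rho>V n (f x)) (\<lambda>q y. pt (T (Suc m) W) [p1 \<otimes>\<^bsub>P\<^esub> q] (pmap V W m g (tcons V n p2 y)))"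
      proof (rule sw_cong[OF mV mQ], (assumption | rule cW V(1) p q hl fl gl cact_closed[OF V(1,2)] assms)+)
      qed (use p q fl cact_closed[OF V(1,2)] pmap_tcons[OF V(1) W(1) assms(6)] in simp_all)
    qed
    also have "\<dots> = sw ?Q (cact V \<rho>V (Suc n) (tcons V n p (f x))) (\<lambda>q y. pt (T (Suc m) W) [q] (pmap V W m g y))"
      by (rule sw_cact_Suc[symmetric, OF V(1,2) mQ bilinear_precomp[OF pg bilinear_pure[OF mW]] p(1) fl[OF p(2)]])
    also have "\<dots> = tmap (T (Suc m) W) 1 (pmap V W m g) (cact V \<rho>V (Suc n) (tcons V n p (f x)))"
      by (rule tmap1_sw[symmetric, OF mV mW pg cact_closed[OF V(1,2) tcons_closed[OF V(1) p(1) fl[OF p(2)]]]])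
    finally show "cact W \<rho>W (Suc m) (pmap U W m h (tcons U k p x)) =
      tmap (T (Suc m) W) 1 (pmap V W m g) (cact V \<rho>V (Suc n) (pmap U V n f (tcons U k p x)))"
      by (simp add: pmap_tcons[OF assms(3) V(1) assms(5) p])
  qed
qed

text \<open>For \<open>f\<close> the identity and \<open>h = g\<close> this is ordinary naturality.
  The general triple covers the class map \<open>\<kappa>\<close>, which intertwines the coactions
  only after the linear projection \<open>e\<close> onto cocycles has been applied.\<close>

lemma cact_tmap:
  assumes "left_comodule K P V \<rho>V" "left_comodule K P W \<rho>W" "module K U"
    "h \<in> lin U W" "f \<in> lin U V" "g \<in> lin V W"
    and eq: "\<And>u. u \<in> carrier U \<Longrightarrow> \<rho>W (h u) = tmap W 1 g (\<rho>V (f u))"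
    and t: "t \<in> carrier (T n U)"
  shows "cact W \<rho>W n (tmap W n h t) = tmap (T n W) 1 (tmap W n g) (cact V \<rho>V n (tmap V n f t))"
  using t
proof (induction n arbitrary: t)
  case 0
  note V = left_comoduleD[OF assms(1)] and W = left_comoduleD[OF assms(2)]
  note mW = module_T[OF W(1)] and mV = module_T[OF V(1)]
  note hl = K.linearD(1)[OF assms(4)] and fl = K.linearD(1)[OF assms(5)] and gl = K.linearD(1)[OF assms(6)]
  note th = tmap_lin[OF assms(3) W(1) assms(4)] and tf = tmap_lin[OF assms(3) V(1) assms(5)] and tg = tmap_lin[OF V(1) W(1) assms(6)]
  show ?case
  proof (rule T_0_ext[OF assms(3) module_T[OF mW] _ _ 0])
    show "(\<lambda>t. cact W \<rho>W 0 (tmap W 0 h t)) \<in> lin (T 0 U) (T 1 (T 0 W))" by (rule lin_cact[OF W(1,2) th])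
    show "(\<lambda>t. tmap (T 0 W) 1 (tmap W 0 g) (cact V \<rho>V 0 (tmap V 0 f t))) \<in> lin (T 0 U) (T 1 (T 0 W))"
      by (rule lin_tmap[OF mV mW tg lin_cact[OF V(1,2) tf]])
    fix u assume u: "u \<in> carrier U"
    have p0: "tmap B 0 j (pt A [] a) = pt B [] (j a)" if "module K A" "module K B" "j \<in> lin A B" "a \<in> carrier A"
      for A :: "('k, 'x, 'y) module_scheme" and B :: "('k, 'z, 'w) module_scheme" and j a
      by (rule tmap_pure[OF that(1-3)]) (simp add: tuples_0 that)
    have "cact W \<rho>W 0 (tmap W 0 h (pt U [] u)) = tmap (T 0 W) 1 (pt W []) (tmap W 1 g (\<rho>V (f u)))"
      unfolding p0[OF assms(3) W(1) assms(4) u] cact_0[OF W(1,2) hl[OF u]] eq[OF u] ..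
    also have "\<dots> = tmap (T 0 W) 1 (\<lambda>v. pt W [] (g v)) (\<rho>V (f u))"
      by (rule tmap_comp[OF V(1) W(1) mW assms(6) pure_lin[OF W(1)] V(3)[OF fl[OF u]]])
    also have "\<dots> = tmap (T 0 W) 1 (\<lambda>v. tmap W 0 g (pt V [] v)) (\<rho>V (f u))"
      by (rule tmap_cong[OF V(1) mW lin_pure0[OF W(1) assms(6)] V(3)[OF fl[OF u]]])
         (rule p0[symmetric, OF V(1) W(1) assms(6)])
    also have "\<dots> = tmap (T 0 W) 1 (tmap W 0 g) (tmap (T 0 V) 1 (pt V []) (\<rho>V (f u)))"
      by (rule tmap_comp[symmetric, OF V(1) mV mW pure_lin[OF V(1)] tg V(3)[OF fl[OF u]]])
    finally show "cact W \<rho>W 0 (tmap W 0 h (pt U [] u)) =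
        tmap (T 0 W) 1 (tmap W 0 g) (cact V \<rho>V 0 (tmap V 0 f (pt U [] u)))"
      unfolding p0[OF assms(3) V(1) assms(5) u] cact_0[OF V(1,2) fl[OF u]] .
  qed
next
  case (Suc n)
  note V = left_comoduleD[OF assms(1)] and W = left_comoduleD[OF assms(2)]
  note mW = module_T[OF W(1)] and mV = module_T[OF V(1)]
  note th = tmap_lin[OF assms(3) W(1) assms(4)] and tf = tmap_lin[OF assms(3) V(1) assms(5)] and tg = tmap_lin[OF V(1) W(1) assms(6)]
  have c: "cact V \<rho>V (Suc n) (tmap V (Suc n) f t) \<in> carrier (T 1 (T (Suc n) V))"
    by (rule cact_closed[OF V(1,2) tmap_closed[OF assms(3) V(1) assms(5) Suc.prems]])
  have "cact W \<rho>W (Suc n) (tmap W (Suc n) h t) =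
      tmap (T (Suc n) W) 1 (pmap V W n (tmap W n g)) (cact V \<rho>V (Suc n) (tmap V (Suc n) f t))"
    unfolding pmap_tmap[OF assms(3) W(1) assms(4) Suc.prems] pmap_tmap[OF assms(3) V(1) assms(5) Suc.prems]
    by (rule cact_pmap[OF assms(1-3) th tf tg Suc.IH Suc.prems])
  also have "\<dots> = tmap (T (Suc n) W) 1 (tmap W (Suc n) g) (cact V \<rho>V (Suc n) (tmap V (Suc n) f t))"
    by (rule tmap_cong[symmetric, OF mV mW tg c pmap_tmap[OF V(1) W(1) assms(6)]])
  finally show ?case .
qed

definition equivariant :: "('k, 'v, 'c) module_scheme \<Rightarrow> ('v \<Rightarrow> ('k, 'p, 'v) tensors)
    \<Rightarrow> ('k, 'w, 'd) module_scheme \<Rightarrow> ('w \<Rightarrow> ('k, 'p, 'w) tensors) \<Rightarrow> ('v \<Rightarrow> 'w) \<Rightarrow> bool"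
  where "equivariant V \<rho>V W \<rho>W f \<longleftrightarrow> f \<in> lin V W \<and> (\<forall>v\<in>carrier V. \<rho>W (f v) = tmap W 1 f (\<rho>V v))"

lemma equivariantI:
  "\<lbrakk>f \<in> lin V W; \<And>v. v \<in> carrier V \<Longrightarrow> \<rho>W (f v) = tmap W 1 f (\<rho>V v)\<rbrakk> \<Longrightarrow> equivariant V \<rho>V W \<rho>W f"
  by (simp add: equivariant_def)

lemma equivariantD:
  assumes "equivariant V \<rho>V W \<rho>W f"
  shows "f \<in> lin V W" "v \<in> carrier V \<Longrightarrow> \<rho>W (f v) = tmap W 1 f (\<rho>V v)"
  using assms by (simp_all add: equivariant_def)

lemma comodule_map_equivariant:
  assumes "left_comodule K P V \<rho>V" "left_comodule K P W \<rho>W"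
  shows "comodule_map K P V \<rho>V W \<rho>W f \<longleftrightarrow> equivariant V \<rho>V W \<rho>W f"
  using id_tensor_eq_tmap[OF left_comoduleD(1)[OF assms(1)] left_comoduleD(1)[OF assms(2)] _ left_comoduleD(3)[OF assms(1)]]
  unfolding comodule_map_def equivariant_def by auto

lemma equivariant_minus:
  assumes "left_comodule K P V \<rho>V" "left_comodule K P W \<rho>W" "equivariant V \<rho>V W \<rho>W f" "equivariant V \<rho>V W \<rho>W g"
  shows "equivariant V \<rho>V W \<rho>W (\<lambda>x. f x \<ominus>\<^bsub>W\<^esub> g x)"
proof (rule equivariantI)
  note V = left_comoduleD[OF assms(1)] and W = left_comoduleD[OF assms(2)]
  note f = equivariantD[OF assms(3)] and g = equivariantD[OF assms(4)]
  show "(\<lambda>x. f x \<ominus>\<^bsub>W\<^esub> g x) \<in> lin V W" by (rule K.linear_minus_fun[OF W(1) f(1) g(1)])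
  fix v assume v: "v \<in> carrier V"
  show "\<rho>W (f v \<ominus>\<^bsub>W\<^esub> g v) = tmap W 1 (\<lambda>x. f x \<ominus>\<^bsub>W\<^esub> g x) (\<rho>V v)"
    unfolding tmap_minus[OF V(1) W(1) f(1) g(1) V(3)[OF v]]
      K.linear_minus[OF W(1) module_T[OF W(1)] W(2) K.linearD(1)[OF f(1) v] K.linearD(1)[OF g(1) v]]
      f(2)[OF v] g(2)[OF v] ..
qed

lemma equivariant_pmap:
  assumes "left_comodule K P V \<rho>V" "left_comodule K P W \<rho>W"
    "equivariant (T n V) (cact V \<rho>V n) (T m W) (cact W \<rho>W m) f"
  shows "equivariant (T (Suc n) V) (cact V \<rho>V (Suc n)) (T (Suc m) W) (cact W \<rho>W (Suc m)) (pmap V W m f)"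
proof (rule equivariantI)
  note V = left_comoduleD[OF assms(1)] and W = left_comoduleD[OF assms(2)]
  note f = equivariantD[OF assms(3)]
  show "pmap V W m f \<in> lin (T (Suc n) V) (T (Suc m) W)" by (rule pmap_lin[OF V(1) W(1) f(1)])
  fix v assume v: "v \<in> carrier (T (Suc n) V)"
  show "cact W \<rho>W (Suc m) (pmap V W m f v) = tmap (T (Suc m) W) 1 (pmap V W m f) (cact V \<rho>V (Suc n) v)"
    using cact_pmap[OF assms(1,2) V(1) f(1) K.linear_id f(1,2) v] pmap_id[OF V(1) v] by simp
qed

lemma equivariant_tmap:
  assumes "left_comodule K P V \<rho>V" "left_comodule K P W \<rho>W" "equivariant V \<rho>V W \<rho>W f"
  shows "equivariant (T n V) (cact V \<rho>V n) (T n W) (cact W \<rho>W n) (tmap W n f)"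
proof (rule equivariantI)
  note V = left_comoduleD[OF assms(1)] and W = left_comoduleD[OF assms(2)]
  note f = equivariantD[OF assms(3)]
  show "tmap W n f \<in> lin (T n V) (T n W)" by (rule tmap_lin[OF V(1) W(1) f(1)])
  fix v assume v: "v \<in> carrier (T n V)"
  show "cact W \<rho>W n (tmap W n f v) = tmap (T n W) 1 (tmap W n f) (cact V \<rho>V n v)"
    using cact_tmap[OF assms(1,2) V(1) f(1) K.linear_id f(1,2) v] tmap_id[OF V(1) v] by simp
qed

text \<open>Because \<open>\<Delta> \<one> = \<one> \<otimes> \<one>\<close>, an inserted unit
  multiplies the coefficient by one and remains a unit.\<close>

lemma equivariant_tcons_one:
  assumes "left_comodule K P V \<rho>"
  shows "equivariant (T n V) (cact V \<rho> n) (T (Suc n) V) (cact V \<rho> (Suc n)) (tcons V n \<one>\<^bsub>P\<^esub>)"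
proof (rule equivariantI)
  note V = left_comoduleD[OF assms(1)]
  note c = clins[OF V(1,2)] and mT = module_T[OF V(1)]
  show l: "tcons V n \<one>\<^bsub>P\<^esub> \<in> lin (T n V) (T (Suc n) V)" by (rule tcons_lin_r0[OF V(1)]) simp
  fix x assume x: "x \<in> carrier (T n V)"
  let ?X = "T (Suc n) V"
  have "cact V \<rho> (Suc n) (tcons V n \<one>\<^bsub>P\<^esub> x) =
      sw (T 1 ?X) (cact V \<rho> n x) (\<lambda>q y. pt ?X [\<one>\<^bsub>P\<^esub> \<otimes>\<^bsub>P\<^esub> q] (tcons V n \<one>\<^bsub>P\<^esub> y))"
    unfolding cact_Suc[OF V(1,2) P.one_closed x]
    by (rule sw_comult_one[OF module_T[OF mT]]) (assumption | rule c x)+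
  also have "\<dots> = sw (T 1 ?X) (cact V \<rho> n x) (\<lambda>q y. pt ?X [q] (tcons V n \<one>\<^bsub>P\<^esub> y))"
  proof (rule sw_cong[OF mT module_T[OF mT]], (assumption | rule c)+)
  qed (use x cact_closed[OF V(1,2)] in simp_all)
  also have "\<dots> = tmap ?X 1 (tcons V n \<one>\<^bsub>P\<^esub>) (cact V \<rho> n x)"
    by (rule tmap1_sw[symmetric, OF mT mT l cact_closed[OF V(1,2) x]])
  finally show "cact V \<rho> (Suc n) (tcons V n \<one>\<^bsub>P\<^esub> x) = tmap ?X 1 (tcons V n \<one>\<^bsub>P\<^esub>) (cact V \<rho> n x)" .
qed

section \<open>Coinvariants and the differential by recursion\<close>

definition coinv :: "('k, 'v, 'c) module_scheme \<Rightarrow> ('v \<Rightarrow> ('k, 'p, 'v) tensors) \<Rightarrow> 'v set"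
  where "coinv V \<rho> = {v \<in> carrier V. \<rho> v = pt V [\<one>\<^bsub>P\<^esub>] v}"

lemma coinvariants_eq: "coinvariants K P V \<rho> = V\<lparr>carrier := coinv V \<rho>\<rparr>"
  by (simp add: coinvariants_def coinv_def)

lemma equivariant_coinv:
  assumes "module K V" "module K W" "equivariant V \<rho>V W \<rho>W f" "v \<in> coinv V \<rho>V"
  shows "f v \<in> coinv W \<rho>W"
proof -
  note f = equivariantD[OF assms(3)]
  have v: "v \<in> carrier V" "\<rho>V v = pt V [\<one>\<^bsub>P\<^esub>] v" using assms(4) by (simp_all add: coinv_def)
  show ?thesis unfolding coinv_def
    using f(2)[OF v(1)] v(2) tmap_pure1[OF assms(1,2) f(1) P.one_closed v(1)] K.linearD(1)[OF f(1) v(1)] by simp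
qed

text \<open>The coinvariants are the kernel of the difference of two linear maps, the coaction and
  \<open>v \<mapsto> \<one> \<otimes> v\<close>.\<close>

lemma submodule_coinv:
  assumes "module K V" "\<rho> \<in> lin V (T 1 V)"
  shows "submodule (coinv V \<rho>) K V"
proof -
  interpret V: module K V by fact
  interpret TV: module K "T 1 V" by (rule module_T[OF assms(1)])
  note l = K.linear_minus_fun[OF module_T[OF assms(1)] assms(2) lin_pure_r[OF assms(1) P.one_closed K.linear_id]]
  have "coinv V \<rho> = {v \<in> carrier V. \<rho> v \<ominus>\<^bsub>T 1 V\<^esub> pt V [\<one>\<^bsub>P\<^esub>] v = \<zero>\<^bsub>T 1 V\<^esub>}"
    unfolding coinv_def
    using TV.minus_eq_zero_iff[OF K.linearD(1)[OF assms(2)] pure1_closed[OF assms(1) P.one_closed]] by auto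
  then show ?thesis using K.submodule_kernel[OF assms(1) module_T[OF assms(1)] l] by simp
qed

text \<open>The alternating sum of unit insertions obeys \<open>d (p \<otimes> x) = 1 \<otimes> p
  \<otimes> x - p \<otimes> d x\<close>. The index counts the factors \<open>P\<close>, so degree
  \<open>n\<close> of the Hopf complex has the differential \<open>tdiff V (Suc n)\<close>, and
  \<open>tdiff V 0\<close> is the augmentation \<open>1 \<otimes> _\<close>.\<close>

primrec tdiff :: "('k, 'v, 'c) module_scheme \<Rightarrow> nat \<Rightarrow> ('k, 'p, 'v) tensors \<Rightarrow> ('k, 'p, 'v) tensors"
  where "tdiff V 0 = tcons V 0 \<one>\<^bsub>P\<^esub>"
  | "tdiff V (Suc n) = (\<lambda>x. tcons V (Suc n) \<one>\<^bsub>P\<^esub> x \<ominus>\<^bsub>T (Suc (Suc n)) V\<^esub> pmap V V (Suc n) (tdiff V n) x)"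

lemma tdiff_lin: "module K V \<Longrightarrow> tdiff V n \<in> lin (T n V) (T (Suc n) V)"
proof (induction n)
  case 0 then show ?case using tcons_lin_r0[OF 0 P.one_closed] by simp
next
  case (Suc n) then show ?case unfolding tdiff.simps
    by (intro K.linear_minus_fun[OF module_T] tcons_lin_r0 pmap_lin P.one_closed)
qed

lemma tdiff_closed: "\<lbrakk>module K V; x \<in> carrier (T n V)\<rbrakk> \<Longrightarrow> tdiff V n x \<in> carrier (T (Suc n) V)"
  using K.linearD(1)[OF tdiff_lin] .

lemma tdiff_tcons:
  assumes "module K V" "p \<in> carrier P" "x \<in> carrier (T n V)"
  shows "tdiff V (Suc n) (tcons V n p x) =
    tcons V (Suc n) \<one>\<^bsub>P\<^esub> (tcons V n p x) \<ominus>\<^bsub>T (Suc (Suc n)) V\<^esub> tcons V (Suc n) p (tdiff V n x)"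
  using pmap_tcons[OF assms(1,1) tdiff_lin[OF assms(1)] assms(2,3)] by simp

lemma tdiff_equivariant:
  assumes "left_comodule K P V \<rho>"
  shows "equivariant (T n V) (cact V \<rho> n) (T (Suc n) V) (cact V \<rho> (Suc n)) (tdiff V n)"
proof (induction n)
  case 0
  show ?case using equivariant_tcons_one[OF assms, of 0] by simp
next
  case (Suc n)
  show ?case unfolding tdiff.simps
    by (rule equivariant_minus[OF cact_comodule[OF assms] cact_comodule[OF assms]
        equivariant_tcons_one[OF assms] equivariant_pmap[OF assms assms Suc]])
qed

lemma tcons_minus:
  assumes "module K V" "p \<in> carrier P" "x \<in> carrier (T n V)" "y \<in> carrier (T n V)"
  shows "tcons V n p (x \<ominus>\<^bsub>T n V\<^esub> y) = tcons V n p x \<ominus>\<^bsub>T (Suc n) V\<^esub> tcons V n p y"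
  by (rule K.linear_minus[OF module_T[OF assms(1)] module_T[OF assms(1)] tcons_lin_r0[OF assms(1,2)] assms(3,4)])

lemma tdiff_minus:
  assumes "module K V" "x \<in> carrier (T n V)" "y \<in> carrier (T n V)"
  shows "tdiff V n (x \<ominus>\<^bsub>T n V\<^esub> y) = tdiff V n x \<ominus>\<^bsub>T (Suc n) V\<^esub> tdiff V n y"
  by (rule K.linear_minus[OF module_T[OF assms(1)] module_T[OF assms(1)] tdiff_lin[OF assms(1)] assms(2,3)])

text \<open>Applied to \<open>p x\<close>, with \<open>e\<close> the unit, the composite is
  \<open>e e p x - (e e p x - e p (d x)) - (e p (d x) - p (d (d x)))\<close>; the last term vanishes
  by induction and the others cancel.\<close>

lemma tdiff_tdiff:
  assumes "module K V" "x \<in> carrier (T n V)"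
  shows "tdiff V (Suc n) (tdiff V n x) = \<zero>\<^bsub>T (Suc (Suc n)) V\<^esub>"
  using assms(2)
proof (induction n arbitrary: x)
  case 0
  interpret T2: module K "T (Suc (Suc 0)) V" by (rule module_T[OF assms(1)])
  have c: "tcons V (Suc 0) \<one>\<^bsub>P\<^esub> (tcons V 0 \<one>\<^bsub>P\<^esub> x) \<in> carrier (T (Suc (Suc 0)) V)"
    by (rule tcons_closed[OF assms(1) P.one_closed tcons_closed[OF assms(1) P.one_closed 0]])
  show ?case unfolding tdiff.simps(1) tdiff_tcons[OF assms(1) P.one_closed 0] using T2.minus_self[OF c] .
next
  case (Suc n)
  note tc = tcons_closed[OF assms(1)] and td = tdiff_closed[OF assms(1)] and mT = module_T[OF assms(1)]
  interpret A: module K "T (Suc (Suc (Suc n))) V" by (rule mT)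
  show ?case
  proof (rule T_Suc_ext[OF assms(1) mT K.linear_comp[OF tdiff_lin[OF assms(1)] tdiff_lin[OF assms(1)]]
        K.linear_const_zero[OF mT] Suc.prems])
    fix p x assume h: "p \<in> carrier P" "x \<in> carrier (T n V)"
    let ?px = "tcons V n p x" and ?e = "\<one>\<^bsub>P\<^esub>"
    note px = tc[OF h] and dx = td[OF h(2)]
    have z: "tcons V (Suc (Suc n)) p (tdiff V (Suc n) (tdiff V n x)) = \<zero>\<^bsub>T (Suc (Suc (Suc n))) V\<^esub>"
      unfolding Suc.IH[OF h(2)] by (rule K.linear_zero[OF mT mT tcons_lin_r0[OF assms(1) h(1)]])
    have "tdiff V (Suc (Suc n)) (tdiff V (Suc n) ?px) =
      tdiff V (Suc (Suc n)) (tcons V (Suc n) ?e ?px) \<ominus>\<^bsub>T (Suc (Suc (Suc n))) V\<^esub>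
      tdiff V (Suc (Suc n)) (tcons V (Suc n) p (tdiff V n x))"
      unfolding tdiff_tcons[OF assms(1) h] by (rule tdiff_minus[OF assms(1) tc[OF P.one_closed px] tc[OF h(1) dx]])
    also have "\<dots> = tcons V (Suc (Suc n)) ?e (tcons V (Suc n) ?e ?px) \<ominus>\<^bsub>T (Suc (Suc (Suc n))) V\<^esub>
       (tcons V (Suc (Suc n)) ?e (tcons V (Suc n) ?e ?px) \<ominus>\<^bsub>T (Suc (Suc (Suc n))) V\<^esub>
         tcons V (Suc (Suc n)) ?e (tcons V (Suc n) p (tdiff V n x))) \<ominus>\<^bsub>T (Suc (Suc (Suc n))) V\<^esub>
       (tcons V (Suc (Suc n)) ?e (tcons V (Suc n) p (tdiff V n x)) \<ominus>\<^bsub>T (Suc (Suc (Suc n))) V\<^esub>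
        \<zero>\<^bsub>T (Suc (Suc (Suc n))) V\<^esub>)"
      unfolding tdiff_tcons[OF assms(1) P.one_closed px] tdiff_tcons[OF assms(1) h(1) dx]
        tdiff_tcons[OF assms(1) h] z
        tcons_minus[OF assms(1) P.one_closed tc[OF P.one_closed px] tc[OF h(1) dx]] ..
    also have "\<dots> = \<zero>\<^bsub>T (Suc (Suc (Suc n))) V\<^esub>"
      using tc[OF P.one_closed tc[OF P.one_closed px]] tc[OF P.one_closed tc[OF h(1) dx]]
      by (simp add: a_minus_def A.minus_add A.a_ac A.r_neg1 A.r_neg2 A.r_neg A.l_neg)
    finally show "tdiff V (Suc (Suc n)) (tdiff V (Suc n) ?px) = \<zero>\<^bsub>T (Suc (Suc (Suc n))) V\<^esub>" .
  qed
qed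

lemma tdiff_tmap:
  assumes "module K V" "module K W" "g \<in> lin V W" "x \<in> carrier (T n V)"
  shows "tdiff W n (tmap W n g x) = tmap W (Suc n) g (tdiff V n x)"
  using assms(4)
proof (induction n arbitrary: x)
  case 0
  then show ?case using tmap_tcons[OF assms(1-3) P.one_closed 0] by simp
next
  case (Suc n)
  note mV = module_T[OF assms(1)] and mW = module_T[OF assms(2)] and tg = tmap_lin[OF assms(1-3)]
  show ?case
  proof (rule T_Suc_ext[OF assms(1) mW K.linear_comp[OF tdiff_lin[OF assms(2)] tg]
        lin_tmap[OF assms(1-3) tdiff_lin[OF assms(1)]] Suc.prems])
    fix p x assume h: "p \<in> carrier P" "x \<in> carrier (T n V)"
    note tc = tcons_closed[OF assms(1)]
    show "tdiff W (Suc n) (tmap W (Suc n) g (tcons V n p x)) = tmap W (Suc (Suc n)) g (tdiff V (Suc n) (tcons V n p x))"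
      unfolding tmap_tcons[OF assms(1-3) h] tdiff_tcons[OF assms(2) h(1) tmap_closed[OF assms(1-3) h(2)]]
        tdiff_tcons[OF assms(1) h] Suc.IH[OF h(2)]
        K.linear_minus[OF mV mW tg tc[OF P.one_closed tc[OF h]] tc[OF h(1) tdiff_closed[OF assms(1) h(2)]]]
        tmap_tcons[OF assms(1-3) P.one_closed tc[OF h]] tmap_tcons[OF assms(1-3) h(1) tdiff_closed[OF assms(1) h(2)]] ..
  qed
qed

text \<open>The summand for index zero is the unit in front. The remaining ones keep the first
  factor and carry one additional sign, which is absorbed by replacing \<open>p\<close> with its
  negative, so that the induction hypothesis sums them.\<close>

lemma tdiff_pure:
  assumes "module K V" "(ps, v) \<in> tuples P n V"
  shows "(\<Oplus>\<^bsub>T (Suc n) V\<^esub>i\<in>{..n}. ((\<ominus>\<^bsub>K\<^esub> \<one>\<^bsub>K\<^esub>) [^]\<^bsub>K\<^esub> i) \<odot>\<^bsub>T (Suc n) V\<^esub>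
      pt V (take i ps @ \<one>\<^bsub>P\<^esub> # drop i ps) v) = tdiff V n (pt V ps v)"
  using assms(2)
proof (induction n arbitrary: ps)
  case 0
  then have h: "ps = []" "v \<in> carrier V" by (auto simp: tuples_0)
  interpret T: module K "T (Suc 0) V" by (rule module_T[OF assms(1)])
  have "pt V [\<one>\<^bsub>P\<^esub>] v \<in> carrier (T (Suc 0) V)" by (rule pure_closed[OF assms(1)]) (use h in \<open>simp add: tuples_def\<close>)
  then show ?case using h tcons_pure[OF assms(1) P.one_closed, of "[]" v 0] by (simp add: tuples_0)
next
  case (Suc n)
  let ?T = "T (Suc n) V" and ?S = "T (Suc (Suc n)) V" and ?m = "\<ominus>\<^bsub>K\<^esub> \<one>\<^bsub>K\<^esub>"
  interpret T: module K ?T by (rule module_T[OF assms(1)])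
  interpret S: module K ?S by (rule module_T[OF assms(1)])
  obtain p qs where h: "ps = p # qs" "p \<in> carrier P" "(qs, v) \<in> tuples P n V" using Suc.prems by (auto simp: tuples_Suc)
  have tc: "pt V (take i ps @ \<one>\<^bsub>P\<^esub> # drop i ps) v \<in> carrier (T (Suc m) V)" if "(ps, v) \<in> tuples P m V" for i m ps
  proof (rule pure_closed[OF assms(1)])
    have "set (take i ps @ \<one>\<^bsub>P\<^esub> # drop i ps) \<subseteq> carrier P"
      using that set_take_subset[of i ps] set_drop_subset[of i ps] by (auto simp: tuples_def)
    then show "(take i ps @ \<one>\<^bsub>P\<^esub> # drop i ps, v) \<in> tuples P (Suc m) V" using that by (auto simp: tuples_def)
  qed
  have ins: "(take i ps @ \<one>\<^bsub>P\<^esub> # drop i ps, v) \<in> tuples P (Suc m) V" if "(ps, v) \<in> tuples P m V" for i m ps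
    using that set_take_subset[of i ps] set_drop_subset[of i ps] by (auto simp: tuples_def)
  define f where "f i = (?m [^]\<^bsub>K\<^esub> i) \<odot>\<^bsub>?S\<^esub> pt V (take i ps @ \<one>\<^bsub>P\<^esub> # drop i ps) v" for i :: nat
  define g where "g i = (?m [^]\<^bsub>K\<^esub> i) \<odot>\<^bsub>?T\<^esub> pt V (take i qs @ \<one>\<^bsub>P\<^esub> # drop i qs) v" for i :: nat
  have fc: "f i \<in> carrier ?S" for i unfolding f_def by (intro S.smult_closed tc[OF Suc.prems]) simp
  have gc: "g i \<in> carrier ?T" for i unfolding g_def by (intro T.smult_closed tc[OF h(3)]) simp
  note tl = tcons_lin_r0[OF assms(1) h(2)]
  have fg: "f (Suc i) = tcons V (Suc n) (\<ominus>\<^bsub>P\<^esub> p) (g i)" for i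
  proof -
    have "f (Suc i) = (?m [^]\<^bsub>K\<^esub> i \<otimes>\<^bsub>K\<^esub> ?m) \<odot>\<^bsub>?S\<^esub> tcons V (Suc n) p (pt V (take i qs @ \<one>\<^bsub>P\<^esub> # drop i qs) v)"
      unfolding f_def tcons_pure[OF assms(1) h(2) ins[OF h(3)]] by (simp add: h(1))
    also have "\<dots> = ?m [^]\<^bsub>K\<^esub> i \<odot>\<^bsub>?S\<^esub> (?m \<odot>\<^bsub>?S\<^esub> tcons V (Suc n) p (pt V (take i qs @ \<one>\<^bsub>P\<^esub> # drop i qs) v))"
      by (rule S.smult_assoc1) (simp_all add: tcons_closed[OF assms(1) h(2) tc[OF h(3)]])
    also have "?m \<odot>\<^bsub>?S\<^esub> tcons V (Suc n) p (pt V (take i qs @ \<one>\<^bsub>P\<^esub> # drop i qs) v) =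
        tcons V (Suc n) (\<ominus>\<^bsub>P\<^esub> p) (pt V (take i qs @ \<one>\<^bsub>P\<^esub> # drop i qs) v)"
      using K.linear_uminus[OF module_P module_T[OF assms(1)] tcons_lin_l0[OF assms(1) tc[OF h(3)]] h(2)]
      by (simp add: S.smult_l_minus tcons_closed[OF assms(1) h(2) tc[OF h(3)]])
    also have "?m [^]\<^bsub>K\<^esub> i \<odot>\<^bsub>?S\<^esub> \<dots> = tcons V (Suc n) (\<ominus>\<^bsub>P\<^esub> p) (g i)"
      unfolding g_def by (rule K.linearD(3)[symmetric, OF tcons_lin_r0[OF assms(1)] _ tc[OF h(3)]]) (use h(2) in simp_all)
    finally show ?thesis .
  qed
  have IH: "(\<Oplus>\<^bsub>?T\<^esub>i\<in>{..n}. g i) = tdiff V n (pt V qs v)" unfolding g_def by (rule Suc.IH[OF h(3)])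
  have mp: "\<ominus>\<^bsub>P\<^esub> p \<in> carrier P" using h(2) by simp
  have "(\<Oplus>\<^bsub>?S\<^esub>i\<in>{..Suc n}. f i) = (\<Oplus>\<^bsub>?S\<^esub>i\<in>{..n}. f (Suc i)) \<oplus>\<^bsub>?S\<^esub> f 0"
    by (rule S.finsum_Suc2) (use fc in simp)
  also have "(\<Oplus>\<^bsub>?S\<^esub>i\<in>{..n}. f (Suc i)) = tcons V (Suc n) (\<ominus>\<^bsub>P\<^esub> p) (\<Oplus>\<^bsub>?T\<^esub>i\<in>{..n}. g i)"
    unfolding fg
    by (rule K.linear_finsum[symmetric, OF module_T[OF assms(1)] module_T[OF assms(1)] tcons_lin_r0[OF assms(1) mp]])
       (use gc in auto)
  also have "\<dots> = \<ominus>\<^bsub>?S\<^esub> tcons V (Suc n) p (tdiff V n (pt V qs v))"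
    unfolding IH by (rule K.linear_uminus[OF module_P module_T[OF assms(1)] tcons_lin_l0[OF assms(1)
          tdiff_closed[OF assms(1) pure_closed[OF assms(1) h(3)]]] h(2)])
  also have "\<dots> \<oplus>\<^bsub>?S\<^esub> f 0 = f 0 \<ominus>\<^bsub>?S\<^esub> tcons V (Suc n) p (tdiff V n (pt V qs v))"
    unfolding a_minus_def
    by (rule S.a_comm) (use fc tcons_closed[OF assms(1) h(2) tdiff_closed[OF assms(1) pure_closed[OF assms(1) h(3)]]] in simp_all)
  also have "f 0 = tcons V (Suc n) \<one>\<^bsub>P\<^esub> (tcons V n p (pt V qs v))"
    unfolding f_def tcons_pure[OF assms(1) h(2,3)] using tc[OF Suc.prems, of 0]
      tcons_pure[OF assms(1) P.one_closed Suc.prems] h(1) by simp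
  finally show ?case unfolding f_def[symmetric] h(1)[symmetric]
    using tdiff_tcons[OF assms(1) h(2) pure_closed[OF assms(1) h(3)]] tcons_pure[OF assms(1) h(2,3)] h(1) by simp
qed

lemma hopf_differential_eq:
  assumes "module K V" "t \<in> carrier (T (Suc n) V)"
  shows "hopf_differential K P V n t = tdiff V (Suc n) t"
proof -
  have n: "{0..n + 1} = {..Suc n}" "n + 2 = Suc (Suc n)" by auto
  note mT = module_T[OF assms(1)]
  have m: "K.multilinear P (Suc n) V (T (Suc (Suc n)) V) (\<lambda>ps v. tdiff V (Suc n) (pt V ps v))"
  proof (rule K.multilinearI)
    note m = K.pure_tensor_multilinear[OF module_P assms(1), of "Suc n"] and d = tdiff_lin[OF assms(1)]
    fix ps v assume h: "(ps, v) \<in> tuples P (Suc n) V"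
    show "(\<lambda>u. tdiff V (Suc n) (pt V ps u)) \<in> lin V (T (Suc (Suc n)) V)"
      by (rule K.linear_comp[OF d K.multilinearD(2)[OF m h]])
    show "(\<lambda>p. tdiff V (Suc n) (pt V (ps[i := p]) v)) \<in> lin P (T (Suc (Suc n)) V)" if "i < Suc n" for i
      by (rule K.linear_comp[OF d K.multilinearD(1)[OF m h that]])
  qed
  have "hopf_differential K P V n t = tensor_lift K (T (Suc (Suc n)) V) (\<lambda>ps v. tdiff V (Suc n) (pt V ps v)) t"
    unfolding hopf_differential_def Let_def n
    by (rule K.tensor_lift_cong[OF module_P assms(1) mT _ tdiff_pure[OF assms(1)] assms(2)])
       (simp_all add: tdiff_pure[OF assms(1)] tdiff_closed[OF assms(1) pure_closed[OF assms(1)]] del: tdiff.simps)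
  also have "\<dots> = tdiff V (Suc n) t"
    by (rule T_ext[OF assms(1) mT K.tensor_lift_linear[OF module_P assms(1) mT m] tdiff_lin[OF assms(1)] assms(2)])
       (rule K.tensor_lift_pure[OF module_P assms(1) mT m])
  finally show ?thesis .
qed

end

section \<open>Contracting homotopy and coinvariants\<close>

context tensor_power
begin

lemma one_T: "T (Suc 0) V = T 1 V"
  by (simp only: One_nat_def)

lemma tcons_pure0: "\<lbrakk>module K V; p \<in> carrier P; v \<in> carrier V\<rbrakk> \<Longrightarrow> tcons V 0 p (pt V [] v) = pt V [p] v"
  by (rule tcons_pure) (simp_all add: tuples_0)

end

context hopf_algebra
begin

text \<open>The innermost factor \<open>P\<close> acts on \<open>V\<close> and the outer factors
  stay. Dropping the first factor by the counit would also contract the complex, but that map does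
  not respect the coactions in general.\<close>

primrec hcontr :: "('k, 'v, 'c) module_scheme \<Rightarrow> (('k, 'p, 'v) tensors \<Rightarrow> 'v) \<Rightarrow> nat
    \<Rightarrow> ('k, 'p, 'v) tensors \<Rightarrow> ('k, 'p, 'v) tensors"
  where "hcontr V act 0 = (\<lambda>t. pt V [] (act t))"
  | "hcontr V act (Suc n) = pmap V V n (hcontr V act n)"

lemma hcontr_lin:
  assumes "module K V" "act \<in> lin (T 1 V) V"
  shows "hcontr V act n \<in> lin (T (Suc n) V) (T n V)"
proof (induction n)
  case 0 then show ?case using lin_pure0[OF assms] by (simp add: one_T)
next
  case (Suc n) then show ?case unfolding hcontr.simps by (rule pmap_lin[OF assms(1,1)])
qed

lemma hcontr_closed:
  assumes "module K V" "act \<in> lin (T 1 V) V" "t \<in> carrier (T (Suc n) V)"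
  shows "hcontr V act n t \<in> carrier (T n V)"
  using K.linearD(1)[OF hcontr_lin[OF assms(1,2)] assms(3)] .

lemma hcontr_tcons:
  assumes "module K V" "act \<in> lin (T 1 V) V" "p \<in> carrier P" "x \<in> carrier (T (Suc n) V)"
  shows "hcontr V act (Suc n) (tcons V (Suc n) p x) = tcons V n p (hcontr V act n x)"
  unfolding hcontr.simps by (rule pmap_tcons[OF assms(1,1) hcontr_lin[OF assms(1,2)] assms(3,4)])

text \<open>The base case is the computation \<open>1 \<otimes> p v - p \<otimes> 1 v\<close>. Every
  further factor reverses the sign of the identity term, through the minus in the recursion of
  \<open>tdiff\<close>; the sign stays existential, as later only its square is evaluated.\<close>

lemma hcontr_homotopy:
  assumes "module K V" "act \<in> lin (T 1 V) V" and one: "\<And>v. v \<in> carrier V \<Longrightarrow> act (pt V [\<one>\<^bsub>P\<^esub>] v) = v"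
  shows "\<exists>c\<in>{\<one>\<^bsub>K\<^esub>, \<ominus>\<^bsub>K\<^esub> \<one>\<^bsub>K\<^esub>}. \<forall>t\<in>carrier (T (Suc n) V). hcontr V act (Suc n) (tdiff V (Suc n) t) =
    tdiff V n (hcontr V act n t) \<ominus>\<^bsub>T (Suc n) V\<^esub> c \<odot>\<^bsub>T (Suc n) V\<^esub> t"
proof (induction n)
  case 0
  note mT = module_T[OF assms(1)] and tc = tcons_closed[OF assms(1)] and td = tdiff_closed[OF assms(1)]
    and hl = hcontr_lin[OF assms(1,2)] and hc = hcontr_closed[OF assms(1,2)]
  interpret T1: module K "T (Suc 0) V" by (rule mT)
  have "hcontr V act (Suc 0) (tdiff V (Suc 0) t) =
    tdiff V 0 (hcontr V act 0 t) \<ominus>\<^bsub>T (Suc 0) V\<^esub> t" if t: "t \<in> carrier (T (Suc 0) V)" for t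
  proof (rule T_Suc_ext[OF assms(1) mT K.linear_comp[OF hl tdiff_lin[OF assms(1)]]
      K.linear_minus_fun[OF mT K.linear_comp[OF tdiff_lin[OF assms(1)] hl] K.linear_id] t])
    fix p x assume h: "p \<in> carrier P" "x \<in> carrier (T 0 V)"
    have x1: "hcontr V act 0 (tcons V 0 \<one>\<^bsub>P\<^esub> x) = x"
    proof (rule T_0_ext[OF assms(1) mT K.linear_comp[OF hl tcons_lin_r0[OF assms(1) P.one_closed]]
          K.linear_id h(2)])
      fix v assume v: "v \<in> carrier V"
      show "hcontr V act 0 (tcons V 0 \<one>\<^bsub>P\<^esub> (pt V [] v)) = pt V [] v"
        unfolding tcons_pure0[OF assms(1) P.one_closed v] using one[OF v] by simp
    qed
    note px = tc[OF h]
    have d0: "tdiff V 0 y = tcons V 0 \<one>\<^bsub>P\<^esub> y" for y by simp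
    have "hcontr V act (Suc 0) (tdiff V (Suc 0) (tcons V 0 p x)) =
      hcontr V act (Suc 0) (tcons V (Suc 0) \<one>\<^bsub>P\<^esub> (tcons V 0 p x)) \<ominus>\<^bsub>T (Suc 0) V\<^esub>
      hcontr V act (Suc 0) (tcons V (Suc 0) p (tdiff V 0 x))"
      unfolding tdiff_tcons[OF assms(1) h]
      by (rule K.linear_minus[OF mT mT hl tc[OF P.one_closed px] tc[OF h(1) td[OF h(2)]]])
    also have "\<dots> = tcons V 0 \<one>\<^bsub>P\<^esub> (hcontr V act 0 (tcons V 0 p x)) \<ominus>\<^bsub>T (Suc 0) V\<^esub> tcons V 0 p x"
      unfolding hcontr_tcons[OF assms(1,2) P.one_closed px] hcontr_tcons[OF assms(1,2) h(1) td[OF h(2)]]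
      unfolding d0 x1 ..
    finally show "hcontr V act (Suc 0) (tdiff V (Suc 0) (tcons V 0 p x)) =
      tdiff V 0 (hcontr V act 0 (tcons V 0 p x)) \<ominus>\<^bsub>T (Suc 0) V\<^esub> tcons V 0 p x" unfolding d0 .
  qed
  then show ?case by (intro bexI[of _ "\<one>\<^bsub>K\<^esub>"]) simp_all
next
  case (Suc n)
  note mT = module_T[OF assms(1)] and tc = tcons_closed[OF assms(1)] and td = tdiff_closed[OF assms(1)]
    and hl = hcontr_lin[OF assms(1,2)] and hc = hcontr_closed[OF assms(1,2)]
  let ?A = "T (Suc (Suc n)) V"
  interpret A: module K ?A by (rule mT)
  obtain c where c: "c \<in> {\<one>\<^bsub>K\<^esub>, \<ominus>\<^bsub>K\<^esub> \<one>\<^bsub>K\<^esub>}" and IH: "\<And>t. t \<in> carrier (T (Suc n) V) \<Longrightarrow>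
    hcontr V act (Suc n) (tdiff V (Suc n) t) = tdiff V n (hcontr V act n t) \<ominus>\<^bsub>T (Suc n) V\<^esub> c \<odot>\<^bsub>T (Suc n) V\<^esub> t"
    using Suc by blast
  have cK: "c \<in> carrier K" using c by auto
  define d where "d = \<ominus>\<^bsub>K\<^esub> c"
  have d: "d \<in> {\<one>\<^bsub>K\<^esub>, \<ominus>\<^bsub>K\<^esub> \<one>\<^bsub>K\<^esub>}" "d \<in> carrier K" using c unfolding d_def by auto
  have "hcontr V act (Suc (Suc n)) (tdiff V (Suc (Suc n)) t) =
    tdiff V (Suc n) (hcontr V act (Suc n) t) \<ominus>\<^bsub>?A\<^esub> d \<odot>\<^bsub>?A\<^esub> t" if t: "t \<in> carrier ?A" for t
  proof (rule T_Suc_ext[OF assms(1) mT K.linear_comp[OF hl tdiff_lin[OF assms(1)]]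
      K.linear_minus_fun[OF mT K.linear_comp[OF tdiff_lin[OF assms(1)] hl] lin_smult[OF mT d(2) K.linear_id]] t])
    fix p x assume h: "p \<in> carrier P" "x \<in> carrier (T (Suc n) V)"
    note px = tc[OF h] and hx = hc[OF h(2)]
    note dhx = td[OF hx]
    interpret B: module K "T (Suc n) V" by (rule mT)
    have cx: "c \<odot>\<^bsub>T (Suc n) V\<^esub> x \<in> carrier (T (Suc n) V)" using cK h(2) by simp
    have "hcontr V act (Suc (Suc n)) (tdiff V (Suc (Suc n)) (tcons V (Suc n) p x)) =
      hcontr V act (Suc (Suc n)) (tcons V (Suc (Suc n)) \<one>\<^bsub>P\<^esub> (tcons V (Suc n) p x)) \<ominus>\<^bsub>?A\<^esub>
      hcontr V act (Suc (Suc n)) (tcons V (Suc (Suc n)) p (tdiff V (Suc n) x))"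
      unfolding tdiff_tcons[OF assms(1) h]
      by (rule K.linear_minus[OF mT mT hl tc[OF P.one_closed px] tc[OF h(1) td[OF h(2)]]])
    also have "\<dots> = tcons V (Suc n) \<one>\<^bsub>P\<^esub> (tcons V n p (hcontr V act n x)) \<ominus>\<^bsub>?A\<^esub>
      (tcons V (Suc n) p (tdiff V n (hcontr V act n x)) \<ominus>\<^bsub>?A\<^esub> c \<odot>\<^bsub>?A\<^esub> tcons V (Suc n) p x)"
      unfolding hcontr_tcons[OF assms(1,2) P.one_closed px] hcontr_tcons[OF assms(1,2) h(1) td[OF h(2)]]
        hcontr_tcons[OF assms(1,2) h] IH[OF h(2)] tcons_minus[OF assms(1) h(1) dhx cx]
        K.linearD(3)[OF tcons_lin_r0[OF assms(1) h(1)] cK h(2)] ..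
    also have "\<dots> = (tcons V (Suc n) \<one>\<^bsub>P\<^esub> (tcons V n p (hcontr V act n x)) \<ominus>\<^bsub>?A\<^esub>
      tcons V (Suc n) p (tdiff V n (hcontr V act n x))) \<ominus>\<^bsub>?A\<^esub> d \<odot>\<^bsub>?A\<^esub> tcons V (Suc n) p x"
      using tc[OF P.one_closed tc[OF h(1) hx]] tc[OF h(1) dhx] px cK
      by (simp add: d_def a_minus_def A.minus_add A.smult_l_minus A.a_assoc)
    also have "\<dots> = tdiff V (Suc n) (hcontr V act (Suc n) (tcons V (Suc n) p x)) \<ominus>\<^bsub>?A\<^esub> d \<odot>\<^bsub>?A\<^esub> tcons V (Suc n) p x"
      unfolding hcontr_tcons[OF assms(1,2) h] tdiff_tcons[OF assms(1) h(1) hx] ..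
    finally show "hcontr V act (Suc (Suc n)) (tdiff V (Suc (Suc n)) (tcons V (Suc n) p x)) =
      tdiff V (Suc n) (hcontr V act (Suc n) (tcons V (Suc n) p x)) \<ominus>\<^bsub>?A\<^esub> d \<odot>\<^bsub>?A\<^esub> tcons V (Suc n) p x" .
  qed
  then show ?case using d(1) by blast
qed

text \<open>On a cocycle the homotopy relation reads \<open>d (h t) = c t\<close>, and
  \<open>c\<close> is its own inverse. The preimage is kept explicit because it must later be
  recognised as coinvariant.\<close>

lemma tdiff_exact:
  assumes "module K V" "act \<in> lin (T 1 V) V" "\<And>v. v \<in> carrier V \<Longrightarrow> act (pt V [\<one>\<^bsub>P\<^esub>] v) = v"
    and t: "t \<in> carrier (T (Suc n) V)" "tdiff V (Suc n) t = \<zero>\<^bsub>T (Suc (Suc n)) V\<^esub>"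
  shows "\<exists>c\<in>carrier K. t = tdiff V n (c \<odot>\<^bsub>T n V\<^esub> hcontr V act n t)"
proof -
  note mT = module_T[OF assms(1)] and hl = hcontr_lin[OF assms(1,2)] and hc = hcontr_closed[OF assms(1,2)]
  interpret A: module K "T (Suc n) V" by (rule mT)
  from hcontr_homotopy[OF assms(1-3)] obtain c where c: "c \<in> {\<one>\<^bsub>K\<^esub>, \<ominus>\<^bsub>K\<^esub> \<one>\<^bsub>K\<^esub>}" and
    eqs: "\<forall>t\<in>carrier (T (Suc n) V). hcontr V act (Suc n) (tdiff V (Suc n) t) =
      tdiff V n (hcontr V act n t) \<ominus>\<^bsub>T (Suc n) V\<^esub> c \<odot>\<^bsub>T (Suc n) V\<^esub> t" ..
  note eq = bspec[OF eqs t(1)]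
  have cK: "c \<in> carrier K" and cc: "c \<otimes>\<^bsub>K\<^esub> c = \<one>\<^bsub>K\<^esub>" using c by (auto simp: K.l_minus K.r_minus)
  have "tdiff V n (hcontr V act n t) \<ominus>\<^bsub>T (Suc n) V\<^esub> c \<odot>\<^bsub>T (Suc n) V\<^esub> t = \<zero>\<^bsub>T (Suc n) V\<^esub>"
    unfolding eq[symmetric] t(2) by (rule K.linear_zero[OF mT mT hl])
  then have e: "tdiff V n (hcontr V act n t) = c \<odot>\<^bsub>T (Suc n) V\<^esub> t"
    by (rule iffD1[OF A.minus_eq_zero_iff[OF tdiff_closed[OF assms(1) hc[OF t(1)]] A.smult_closed[OF cK t(1)]]])
  have "tdiff V n (c \<odot>\<^bsub>T n V\<^esub> hcontr V act n t) = c \<odot>\<^bsub>T (Suc n) V\<^esub> (c \<odot>\<^bsub>T (Suc n) V\<^esub> t)"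
    unfolding K.linearD(3)[OF tdiff_lin[OF assms(1)] cK hc[OF t(1)]] e ..
  also have "\<dots> = t" using cK cc t(1) by (simp add: A.smult_assoc1[symmetric])
  finally show ?thesis by (intro bexI[OF _ cK]) (rule sym)
qed

lemma equivariant_comp:
  assumes "module K U" "module K V" "module K W" "\<And>u. u \<in> carrier U \<Longrightarrow> \<rho>U u \<in> carrier (T 1 U)"
    "equivariant U \<rho>U V \<rho>V f" "equivariant V \<rho>V W \<rho>W g"
  shows "equivariant U \<rho>U W \<rho>W (\<lambda>x. g (f x))"
proof (rule equivariantI)
  note f = equivariantD[OF assms(5)] and g = equivariantD[OF assms(6)]
  show "(\<lambda>x. g (f x)) \<in> lin U W" by (rule K.linear_comp[OF g(1) f(1)])
  fix u assume u: "u \<in> carrier U"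
  show "\<rho>W (g (f u)) = tmap W 1 (\<lambda>x. g (f x)) (\<rho>U u)"
    unfolding g(2)[OF K.linearD(1)[OF f(1) u]] f(2)[OF u] by (rule tmap_comp[OF assms(1-3) f(1) g(1) assms(4)[OF u]])
qed

lemma equivariant_pure0:
  assumes "left_comodule K P V \<rho>"
  shows "equivariant V \<rho> (T 0 V) (cact V \<rho> 0) (pt V [])"
  using pure_lin[OF left_comoduleD(1)[OF assms]] cact_0[OF left_comoduleD(1,2)[OF assms]]
  unfolding equivariant_def by blast

text \<open>Covariance of the action is the base case, and the outer factors are carried along by
  \<open>equivariant_pmap\<close>.\<close>

lemma hcontr_equivariant:
  assumes "left_comodule K P V \<rho>" "equivariant (T 1 V) (cact V \<rho> 1) V \<rho> act"
  shows "equivariant (T (Suc n) V) (cact V \<rho> (Suc n)) (T n V) (cact V \<rho> n) (hcontr V act n)"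
proof (induction n)
  case 0
  note V = left_comoduleD[OF assms(1)]
  have "equivariant (T 1 V) (cact V \<rho> 1) (T 0 V) (cact V \<rho> 0) (\<lambda>t. pt V [] (act t))"
    by (rule equivariant_comp[OF module_T[OF V(1)] V(1) module_T[OF V(1)] cact_closed[OF V(1,2)] assms(2) equivariant_pure0[OF assms(1)]])
  then show ?case by (simp only: hcontr.simps One_nat_def)
next
  case (Suc n)
  show ?case unfolding hcontr.simps by (rule equivariant_pmap[OF assms(1,1) Suc])
qed

text \<open>\<open>p \<otimes> x \<mapsto> \<epsilon>(p) x\<close> and \<open>x \<mapsto> S(x\<^sub>[\<^sub>-\<^sub>1\<^sub>]) \<otimes> x\<^sub>[\<^sub>0\<^sub>]\<close> are mutually inverse between the coinvariants of \<open>P \<otimes> X\<close> and \<open>X\<close>.\<close>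

definition tev :: "('k, 'v, 'c) module_scheme \<Rightarrow> nat \<Rightarrow> ('k, 'p, 'v) tensors \<Rightarrow> ('k, 'p, 'v) tensors"
  where "tev V n = tuncons V (T n V) (\<lambda>p x. \<epsilon> p \<odot>\<^bsub>T n V\<^esub> x)"

definition tiota :: "('k, 'v, 'c) module_scheme \<Rightarrow> ('v \<Rightarrow> ('k, 'p, 'v) tensors) \<Rightarrow> nat
    \<Rightarrow> ('k, 'p, 'v) tensors \<Rightarrow> ('k, 'p, 'v) tensors"
  where "tiota V \<rho> n x = sw (T (Suc n) V) (cact V \<rho> n x) (\<lambda>q y. tcons V n (S q) y)"

text \<open>With this action \<open>P \<otimes> X\<close> is a left Hopf module. The correspondence
  between its coinvariants and \<open>X\<close> is the structure theorem of Hopf modules in this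
  case.\<close>

definition lmul :: "('k, 'v, 'c) module_scheme \<Rightarrow> nat \<Rightarrow> 'p \<Rightarrow> ('k, 'p, 'v) tensors \<Rightarrow> ('k, 'p, 'v) tensors"
  where "lmul V n a = tuncons V (T (Suc n) V) (\<lambda>p x. tcons V n (a \<otimes>\<^bsub>P\<^esub> p) x)"

context
  fixes V :: "('k, 'v, 'c) module_scheme" and \<rho> :: "'v \<Rightarrow> ('k, 'p, 'v) tensors" and n :: nat
  assumes com: "left_comodule K P V \<rho>"
begin

private lemmas V = left_comoduleD[OF com]
private lemmas cl = clins[OF V(1,2)] counit_closed
private lemmas mT = module_T[OF V(1)]

lemma tev_bil: "bilinear (T n V) (T n V) (\<lambda>p x. \<epsilon> p \<odot>\<^bsub>T n V\<^esub> x)"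
  by (assumption | rule cl)+

lemma tev_lin: "tev V n \<in> lin (T (Suc n) V) (T n V)"
  unfolding tev_def by (rule tuncons_lin[OF V(1) mT tev_bil])

lemma tev_tcons: "\<lbrakk>p \<in> carrier P; x \<in> carrier (T n V)\<rbrakk> \<Longrightarrow> tev V n (tcons V n p x) = \<epsilon> p \<odot>\<^bsub>T n V\<^esub> x"
  unfolding tev_def by (rule tuncons_tcons[OF V(1) mT tev_bil])

lemma tiota_lin: "tiota V \<rho> n \<in> lin (T n V) (T (Suc n) V)"
  unfolding tiota_def by (assumption | rule cl)+

lemma lmul_bil: "a \<in> carrier P \<Longrightarrow> bilinear (T n V) (T (Suc n) V) (\<lambda>p x. tcons V n (a \<otimes>\<^bsub>P\<^esub> p) x)"
  by (assumption | rule cl)+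

lemma lmul_lin: "a \<in> carrier P \<Longrightarrow> lmul V n a \<in> lin (T (Suc n) V) (T (Suc n) V)"
  unfolding lmul_def by (rule tuncons_lin[OF V(1) mT lmul_bil])

lemma lmul_tcons: "\<lbrakk>a \<in> carrier P; p \<in> carrier P; x \<in> carrier (T n V)\<rbrakk> \<Longrightarrow> lmul V n a (tcons V n p x) = tcons V n (a \<otimes>\<^bsub>P\<^esub> p) x"
  unfolding lmul_def by (rule tuncons_tcons[OF V(1) mT lmul_bil])

lemma lmul_lin_l0:
  assumes "m \<in> carrier (T (Suc n) V)" shows "(\<lambda>a. lmul V n a m) \<in> lin P (T (Suc n) V)"
proof (rule K.linearI)
  note l = K.linearD[OF tcons_lin_l0[OF V(1), of _ n]]
  show "lmul V n a m \<in> carrier (T (Suc n) V)" if "a \<in> carrier P" for a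
    by (rule K.linearD(1)[OF lmul_lin[OF that] assms])
  show "lmul V n (a \<oplus>\<^bsub>P\<^esub> b) m = lmul V n a m \<oplus>\<^bsub>T (Suc n) V\<^esub> lmul V n b m"
    if ab: "a \<in> carrier P" "b \<in> carrier P" for a b
    by (rule T_Suc_ext[OF V(1) mT lmul_lin[OF P.a_closed[OF ab]] K.linear_add[OF mT lmul_lin[OF ab(1)] lmul_lin[OF ab(2)]] assms])
       (use ab in \<open>simp add: lmul_tcons P.l_distr l(2)\<close>)
  show "lmul V n (c \<odot>\<^bsub>P\<^esub> a) m = c \<odot>\<^bsub>T (Suc n) V\<^esub> lmul V n a m"
    if ca: "c \<in> carrier K" "a \<in> carrier P" for a c
    by (rule T_Suc_ext[OF V(1) mT lmul_lin[OF smult_closed[OF ca]] lin_smult[OF mT ca(1) lmul_lin[OF ca(2)]] assms])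
       (use ca in \<open>simp add: lmul_tcons smult_mult_left l(3)\<close>)
qed

lemma lin_lmul_r: "\<lbrakk>a \<in> carrier P; g \<in> lin U (T (Suc n) V)\<rbrakk> \<Longrightarrow> (\<lambda>u. lmul V n a (g u)) \<in> lin U (T (Suc n) V)"
  by (rule K.linear_comp[OF lmul_lin])

lemma lin_lmul_l: "\<lbrakk>m \<in> carrier (T (Suc n) V); g \<in> lin U P\<rbrakk> \<Longrightarrow> (\<lambda>u. lmul V n (g u) m) \<in> lin U (T (Suc n) V)"
  by (rule K.linear_comp[OF lmul_lin_l0])

lemma lmul_closed: "\<lbrakk>a \<in> carrier P; m \<in> carrier (T (Suc n) V)\<rbrakk> \<Longrightarrow> lmul V n a m \<in> carrier (T (Suc n) V)"
  by (rule K.linearD(1)[OF lmul_lin])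

lemma lin_tiota: "g \<in> lin U (T n V) \<Longrightarrow> (\<lambda>u. tiota V \<rho> n (g u)) \<in> lin U (T (Suc n) V)"
  by (rule K.linear_comp[OF tiota_lin])

lemma tiota_closed: "x \<in> carrier (T n V) \<Longrightarrow> tiota V \<rho> n x \<in> carrier (T (Suc n) V)"
  by (rule K.linearD(1)[OF tiota_lin])

lemma lin_tev: "g \<in> lin U (T (Suc n) V) \<Longrightarrow> (\<lambda>u. tev V n (g u)) \<in> lin U (T n V)"
  by (rule K.linear_comp[OF tev_lin])

lemma tev_closed: "x \<in> carrier (T (Suc n) V) \<Longrightarrow> tev V n x \<in> carrier (T n V)"
  by (rule K.linearD(1)[OF tev_lin])

private lemmas dl = cl lin_lmul_r lin_lmul_l lmul_closed lin_tiota tiota_closed lin_tev tev_closed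

lemma lmul_one: "m \<in> carrier (T (Suc n) V) \<Longrightarrow> lmul V n \<one>\<^bsub>P\<^esub> m = m"
  by (rule T_Suc_ext[OF V(1) mT lmul_lin[OF P.one_closed] K.linear_id]) (simp_all add: lmul_tcons)

lemma lmul_mult:
  assumes "a \<in> carrier P" "b \<in> carrier P" "m \<in> carrier (T (Suc n) V)"
  shows "lmul V n (a \<otimes>\<^bsub>P\<^esub> b) m = lmul V n a (lmul V n b m)"
  by (rule T_Suc_ext[OF V(1) mT lmul_lin[OF P.m_closed[OF assms(1,2)]] lin_lmul_r[OF assms(1) lmul_lin[OF assms(2)]] assms(3)])
     (use assms in \<open>simp add: lmul_tcons P.m_assoc\<close>)

text \<open>By coassociativity the left side becomes the sum of \<open>q1 S(q2) \<otimes> y\<close>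
  over the coaction \<open>q \<otimes> y\<close> of \<open>x\<close>; the antipode law turns this
  into \<open>\<epsilon>(q) \<otimes> y\<close>, and the counit law removes
  \<open>q\<close>.\<close>

lemma lmul_tiota:
  assumes "x \<in> carrier (T n V)"
  shows "sw (T (Suc n) V) (cact V \<rho> n x) (\<lambda>q y. lmul V n q (tiota V \<rho> n y)) = tcons V n \<one>\<^bsub>P\<^esub> x"
proof -
  let ?X = "T n V" and ?M = "T (Suc n) V" and ?c = "cact V \<rho> n"
  note c = cact_closed[OF V(1,2)]
  have "sw ?M (?c x) (\<lambda>q y. lmul V n q (tiota V \<rho> n y)) =
      sw ?M (?c x) (\<lambda>q y. sw ?M (?c y) (\<lambda>r z. tcons V n (q \<otimes>\<^bsub>P\<^esub> S r) z))"
  proof (rule sw_cong[OF mT mT _ c[OF assms]], (assumption | rule dl)+)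
    fix q y assume h: "q \<in> carrier P" "y \<in> carrier ?X"
    have b: "bilinear ?X ?M (\<lambda>r z. tcons V n (S r) z)" by (assumption | rule dl)+
    have "lmul V n q (tiota V \<rho> n y) = sw ?M (?c y) (\<lambda>r z. lmul V n q (tcons V n (S r) z))"
      unfolding tiota_def by (rule lin_sw[OF mT mT mT lmul_lin[OF h(1)] b c[OF h(2)]])
    also have "\<dots> = sw ?M (?c y) (\<lambda>r z. tcons V n (q \<otimes>\<^bsub>P\<^esub> S r) z)"
      by (rule sw_cong[OF mT mT bilinear_comp[OF lmul_lin[OF h(1)] b] c[OF h(2)]]) (use h in \<open>simp add: lmul_tcons\<close>)
    finally show "lmul V n q (tiota V \<rho> n y) = sw ?M (?c y) (\<lambda>r z. tcons V n (q \<otimes>\<^bsub>P\<^esub> S r) z)" .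
  qed
  also have "\<dots> = sw ?M (?c x) (\<lambda>q y. sw ?M (\<Delta> q) (\<lambda>q1 q2. tcons V n (q1 \<otimes>\<^bsub>P\<^esub> S q2) y))"
    by (rule comodule_coassoc[symmetric, OF cact_comodule[OF com] mT _ assms], rule trilinearI) (assumption | rule dl)+
  also have "\<dots> = sw ?M (?c x) (\<lambda>q y. \<epsilon> q \<odot>\<^bsub>?M\<^esub> tcons V n \<one>\<^bsub>P\<^esub> y)"
  proof (rule sw_cong[OF mT mT _ c[OF assms]], (assumption | rule dl)+)
    fix q y assume h: "q \<in> carrier P" "y \<in> carrier ?X"
    have b: "bilinear P P (\<lambda>a b. a \<otimes>\<^bsub>P\<^esub> S b)" by (assumption | rule dl)+
    have "sw ?M (\<Delta> q) (\<lambda>q1 q2. tcons V n (q1 \<otimes>\<^bsub>P\<^esub> S q2) y) = tcons V n (sw P (\<Delta> q) (\<lambda>a b. a \<otimes>\<^bsub>P\<^esub> S b)) y"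
      by (rule lin_sw[symmetric, OF module_P module_P mT tcons_lin_l0[OF V(1) h(2)] b comult_closed[OF h(1)]])
    also have "\<dots> = \<epsilon> q \<odot>\<^bsub>?M\<^esub> tcons V n \<one>\<^bsub>P\<^esub> y"
      unfolding antipode_right[OF h(1)]
      by (rule K.linearD(3)[OF tcons_lin_l0[OF V(1) h(2)] counit_closed[OF h(1)] P.one_closed])
    finally show "sw ?M (\<Delta> q) (\<lambda>q1 q2. tcons V n (q1 \<otimes>\<^bsub>P\<^esub> S q2) y) = \<epsilon> q \<odot>\<^bsub>?M\<^esub> tcons V n \<one>\<^bsub>P\<^esub> y" .
  qed
  also have "\<dots> = tcons V n \<one>\<^bsub>P\<^esub> x"
    by (rule comodule_counit[OF cact_comodule[OF com] mT tcons_lin_r0[OF V(1) P.one_closed] assms])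
  finally show ?thesis .
qed

text \<open>For \<open>t = p \<otimes> x\<close>, \<open>tev\<close> replaces \<open>p2\<close> by
  its counit and \<open>lmul_tiota\<close> evaluates the sum over the coaction of \<open>x\<close>.
  What remains is \<open>\<epsilon>(p2) p1 \<otimes> x\<close>, that is \<open>t\<close>.\<close>

lemma sw_lmul_tiota_tev:
  assumes "t \<in> carrier (T (Suc n) V)"
  shows "sw (T (Suc n) V) (cact V \<rho> (Suc n) t) (\<lambda>q m. lmul V n q (tiota V \<rho> n (tev V n m))) = t"
proof (rule T_Suc_ext[OF V(1) mT _ K.linear_id assms])
  let ?X = "T n V" and ?M = "T (Suc n) V" and ?c = "cact V \<rho> n"
  note c = cact_closed[OF V(1,2)]
  interpret M: module K ?M by (rule mT)
  have b: "bilinear ?M ?M (\<lambda>q m. lmul V n q (tiota V \<rho> n (tev V n m)))" by (assumption | rule dl)+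
  show "(\<lambda>t. sw ?M (cact V \<rho> (Suc n) t) (\<lambda>q m. lmul V n q (tiota V \<rho> n (tev V n m)))) \<in> lin ?M ?M"
    by (rule lin_sw_t[OF mT mT cact_lin[OF V(1,2)] b])
  fix p x assume h: "p \<in> carrier P" "x \<in> carrier ?X"
  have "sw ?M (cact V \<rho> (Suc n) (tcons V n p x)) (\<lambda>q m. lmul V n q (tiota V \<rho> n (tev V n m))) =
      sw ?M (\<Delta> p) (\<lambda>p1 p2. sw ?M (?c x) (\<lambda>q y. lmul V n (p1 \<otimes>\<^bsub>P\<^esub> q) (tiota V \<rho> n (tev V n (tcons V n p2 y)))))"
    by (rule sw_cact_Suc[OF V(1,2) mT b h])
  also have "\<dots> = sw ?M (\<Delta> p) (\<lambda>p1 p2. tcons V n (\<epsilon> p2 \<odot>\<^bsub>P\<^esub> p1) x)"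
  proof (rule sw_cong[OF module_P mT _ comult_closed[OF h(1)]], (assumption | rule dl h)+)
    fix p1 p2 assume p: "p1 \<in> carrier P" "p2 \<in> carrier P"
    have e: "\<epsilon> p2 \<in> carrier K" using p by simp
    have l: "(\<lambda>m. \<epsilon> p2 \<odot>\<^bsub>?M\<^esub> lmul V n p1 m) \<in> lin ?M ?M" by (rule lin_smult[OF mT e lmul_lin[OF p(1)]])
    have b2: "bilinear ?X ?M (\<lambda>q y. lmul V n q (tiota V \<rho> n y))" by (assumption | rule dl)+
    have "sw ?M (?c x) (\<lambda>q y. lmul V n (p1 \<otimes>\<^bsub>P\<^esub> q) (tiota V \<rho> n (tev V n (tcons V n p2 y)))) =
      sw ?M (?c x) (\<lambda>q y. \<epsilon> p2 \<odot>\<^bsub>?M\<^esub> lmul V n p1 (lmul V n q (tiota V \<rho> n y)))"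
    proof (rule sw_cong[OF mT mT _ c[OF h(2)]], (assumption | rule dl p)+)
      fix q y assume q: "q \<in> carrier P" "y \<in> carrier ?X"
      show "lmul V n (p1 \<otimes>\<^bsub>P\<^esub> q) (tiota V \<rho> n (tev V n (tcons V n p2 y))) =
          \<epsilon> p2 \<odot>\<^bsub>?M\<^esub> lmul V n p1 (lmul V n q (tiota V \<rho> n y))"
        using p q e K.linearD(3)[OF tiota_lin] K.linearD(3)[OF lmul_lin] tiota_closed
        by (simp add: tev_tcons lmul_mult[symmetric])
    qed
    also have "\<dots> = \<epsilon> p2 \<odot>\<^bsub>?M\<^esub> lmul V n p1 (sw ?M (?c x) (\<lambda>q y. lmul V n q (tiota V \<rho> n y)))"
      by (rule lin_sw[symmetric, OF mT mT mT l b2 c[OF h(2)]])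
    also have "\<dots> = tcons V n (\<epsilon> p2 \<odot>\<^bsub>P\<^esub> p1) x"
      unfolding lmul_tiota[OF h(2)]
      using p h e K.linearD(3)[OF tcons_lin_l0[OF V(1) h(2)]] by (simp add: lmul_tcons)
    finally show "sw ?M (?c x) (\<lambda>q y. lmul V n (p1 \<otimes>\<^bsub>P\<^esub> q) (tiota V \<rho> n (tev V n (tcons V n p2 y)))) =
      tcons V n (\<epsilon> p2 \<odot>\<^bsub>P\<^esub> p1) x" .
  qed
  also have "\<dots> = tcons V n (sw P (\<Delta> p) (\<lambda>p1 p2. \<epsilon> p2 \<odot>\<^bsub>P\<^esub> p1)) x"
    by (rule lin_sw[symmetric, OF module_P module_P mT tcons_lin_l0[OF V(1) h(2)] _ comult_closed[OF h(1)]])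
       (assumption | rule dl)+
  also have "\<dots> = tcons V n p x" unfolding counit_right[OF h(1)] ..
  finally show "sw ?M (cact V \<rho> (Suc n) (tcons V n p x)) (\<lambda>q m. lmul V n q (tiota V \<rho> n (tev V n m))) = tcons V n p x" .
qed

text \<open>For coinvariant \<open>t\<close> the Hopf module decomposition runs over the single
  summand \<open>1 \<otimes> t\<close>.\<close>

lemma coinv_eq_tiota:
  assumes "t \<in> coinv (T (Suc n) V) (cact V \<rho> (Suc n))"
  shows "t = tiota V \<rho> n (tev V n t)"
proof -
  have t: "t \<in> carrier (T (Suc n) V)" "cact V \<rho> (Suc n) t = pt (T (Suc n) V) [\<one>\<^bsub>P\<^esub>] t"
    using assms by (simp_all add: coinv_def)
  have b: "bilinear (T (Suc n) V) (T (Suc n) V) (\<lambda>q m. lmul V n q (tiota V \<rho> n (tev V n m)))" by (assumption | rule dl)+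
  have "t = lmul V n \<one>\<^bsub>P\<^esub> (tiota V \<rho> n (tev V n t))"
    using sw_lmul_tiota_tev[OF t(1)] sw_pure[OF mT mT b P.one_closed t(1)] unfolding t(2) by simp
  then show ?thesis using lmul_one[OF tiota_closed[OF tev_closed[OF t(1)]]] by simp
qed

section \<open>The diagonal action and the coinvariance of \<open>tiota\<close>\<close>

private abbreviation "X \<equiv> T n V"
private abbreviation "M \<equiv> T (Suc n) V"
private abbreviation "Q \<equiv> T 1 (T (Suc n) V)"
private abbreviation "c \<equiv> cact V \<rho> n"

text \<open>\<open>P\<close> acts through \<open>\<Delta>\<close> by left multiplication in both
  legs of \<open>P \<otimes> M\<close>. For this action the coaction of \<open>M\<close> is
  \<open>P\<close>-linear.\<close>

definition dmul :: "'p \<Rightarrow> ('k, 'p, ('k, 'p, 'v) tensors) tensors \<Rightarrow> ('k, 'p, ('k, 'p, 'v) tensors) tensors"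
  where "dmul a u = sw Q (\<Delta> a) (\<lambda>a1 a2. sw Q u (\<lambda>q m. pt M [a1 \<otimes>\<^bsub>P\<^esub> q] (lmul V n a2 m)))"

lemma lin_dmul_r: "\<lbrakk>a \<in> carrier P; g \<in> lin U Q\<rbrakk> \<Longrightarrow> (\<lambda>u. dmul a (g u)) \<in> lin U Q"
  unfolding dmul_def by (rule K.linear_comp[of "\<lambda>u. sw Q (\<Delta> a) (\<lambda>a1 a2. sw Q u (\<lambda>q m. pt M [a1 \<otimes>\<^bsub>P\<^esub> q] (lmul V n a2 m)))" Q Q g])
    (assumption | rule dl)+

lemma lin_dmul_l: "\<lbrakk>u \<in> carrier Q; g \<in> lin U P\<rbrakk> \<Longrightarrow> (\<lambda>a. dmul (g a) u) \<in> lin U Q"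
  unfolding dmul_def by (assumption | rule dl)+

lemma dmul_closed: "\<lbrakk>a \<in> carrier P; u \<in> carrier Q\<rbrakk> \<Longrightarrow> dmul a u \<in> carrier Q"
  using K.linearD(1)[OF lin_dmul_r[OF _ K.linear_id]] .

private lemmas el = dl lin_dmul_r lin_dmul_l dmul_closed
private lemmas cc = cact_closed[OF V(1,2)]
private lemmas mQ = module_T[OF mT]

lemma dmul_pure:
  assumes "a \<in> carrier P" "q \<in> carrier P" "m \<in> carrier M"
  shows "dmul a (pt M [q] m) = sw Q (\<Delta> a) (\<lambda>a1 a2. pt M [a1 \<otimes>\<^bsub>P\<^esub> q] (lmul V n a2 m))"
  unfolding dmul_def
proof (rule sw_cong[OF module_P mQ _ comult_closed[OF assms(1)]], (assumption | rule el assms)+)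
  fix a1 a2 assume h: "a1 \<in> carrier P" "a2 \<in> carrier P"
  show "sw Q (pt M [q] m) (\<lambda>q m. pt M [a1 \<otimes>\<^bsub>P\<^esub> q] (lmul V n a2 m)) = pt M [a1 \<otimes>\<^bsub>P\<^esub> q] (lmul V n a2 m)"
    by (rule sw_pure[OF mT mQ _ assms(2,3)]) (assumption | rule el assms h)+
qed

lemma dmul_one:
  assumes "u \<in> carrier Q" shows "dmul \<one>\<^bsub>P\<^esub> u = u"
proof (rule T1_ext[OF mT mQ lin_dmul_r[OF P.one_closed K.linear_id] K.linear_id assms])
  fix q m assume h: "q \<in> carrier P" "m \<in> carrier M"
  have b: "bilinear P Q (\<lambda>a1 a2. pt M [a1 \<otimes>\<^bsub>P\<^esub> q] (lmul V n a2 m))" by (assumption | rule el h)+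
  show "dmul \<one>\<^bsub>P\<^esub> (pt M [q] m) = pt M [q] m"
    unfolding dmul_pure[OF P.one_closed h] sw_comult_one[OF mQ b] using h by (simp add: lmul_one)
qed

text \<open>Multiplicativity of \<open>\<Delta>\<close> splits \<open>\<Delta> (a b)\<close>, and
  exchanging the sums over \<open>a\<close> and \<open>b\<close> lets the action of \<open>b\<close>
  be carried out before that of \<open>a\<close>.\<close>

lemma dmul_mult:
  assumes "a \<in> carrier P" "b \<in> carrier P" "u \<in> carrier Q"
  shows "dmul (a \<otimes>\<^bsub>P\<^esub> b) u = dmul a (dmul b u)"
proof (rule T1_ext[OF mT mQ lin_dmul_r[OF P.m_closed[OF assms(1,2)] K.linear_id]
      lin_dmul_r[OF assms(1) lin_dmul_r[OF assms(2) K.linear_id]] assms(3)])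
  fix q m assume h: "q \<in> carrier P" "m \<in> carrier M"
  have "dmul (a \<otimes>\<^bsub>P\<^esub> b) (pt M [q] m) = sw Q (\<Delta> a) (\<lambda>a1 a2. sw Q (\<Delta> b) (\<lambda>b1 b2.
      pt M [(a1 \<otimes>\<^bsub>P\<^esub> b1) \<otimes>\<^bsub>P\<^esub> q] (lmul V n (a2 \<otimes>\<^bsub>P\<^esub> b2) m)))"
    unfolding dmul_pure[OF P.m_closed[OF assms(1,2)] h]
    by (rule sw_comult_mult[OF mQ _ assms(1,2)]) (assumption | rule el h)+
  also have "\<dots> = sw Q (\<Delta> b) (\<lambda>b1 b2. sw Q (\<Delta> a) (\<lambda>a1 a2.
      pt M [(a1 \<otimes>\<^bsub>P\<^esub> b1) \<otimes>\<^bsub>P\<^esub> q] (lmul V n (a2 \<otimes>\<^bsub>P\<^esub> b2) m)))"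
    by (rule sw_swap[OF module_P module_P mQ comult_closed[OF assms(1)] comult_closed[OF assms(2)]])
       (assumption | rule el h)+
  also have "\<dots> = sw Q (\<Delta> b) (\<lambda>b1 b2. dmul a (pt M [b1 \<otimes>\<^bsub>P\<^esub> q] (lmul V n b2 m)))"
  proof (rule sw_cong[OF module_P mQ _ comult_closed[OF assms(2)]], (assumption | rule el h assms)+)
    fix b1 b2 assume g: "b1 \<in> carrier P" "b2 \<in> carrier P"
    show "sw Q (\<Delta> a) (\<lambda>a1 a2. pt M [(a1 \<otimes>\<^bsub>P\<^esub> b1) \<otimes>\<^bsub>P\<^esub> q] (lmul V n (a2 \<otimes>\<^bsub>P\<^esub> b2) m)) =
        dmul a (pt M [b1 \<otimes>\<^bsub>P\<^esub> q] (lmul V n b2 m))"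
      unfolding dmul_pure[OF assms(1) P.m_closed[OF g(1) h(1)] lmul_closed[OF g(2) h(2)]]
    proof (rule sw_cong[OF module_P mQ _ comult_closed[OF assms(1)]], (assumption | rule el h g)+)
    qed (use h g in \<open>simp add: lmul_mult P.m_assoc\<close>)
  qed
  also have "\<dots> = dmul a (sw Q (\<Delta> b) (\<lambda>b1 b2. pt M [b1 \<otimes>\<^bsub>P\<^esub> q] (lmul V n b2 m)))"
    by (rule lin_sw[symmetric, OF module_P mQ mQ lin_dmul_r[OF assms(1) K.linear_id] _ comult_closed[OF assms(2)]])
       (assumption | rule el h)+
  finally show "dmul (a \<otimes>\<^bsub>P\<^esub> b) (pt M [q] m) = dmul a (dmul b (pt M [q] m))"
    unfolding dmul_pure[OF assms(2) h] .
qed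

text \<open>The Hopf module condition for \<open>M = P \<otimes> X\<close>; on
  \<open>p \<otimes> x\<close> it is multiplicativity of \<open>\<Delta>\<close> on
  \<open>a p\<close> together with associativity of the product.\<close>

lemma cact_lmul:
  assumes "a \<in> carrier P" "m \<in> carrier M"
  shows "cact V \<rho> (Suc n) (lmul V n a m) = dmul a (cact V \<rho> (Suc n) m)"
proof (rule T_Suc_ext[OF V(1) mQ lin_cact[OF V(1,2) lmul_lin[OF assms(1)]] lin_dmul_r[OF assms(1) cact_lin[OF V(1,2)]] assms(2)])
  fix p x assume h: "p \<in> carrier P" "x \<in> carrier X"
  have "cact V \<rho> (Suc n) (lmul V n a (tcons V n p x)) =
      sw Q (\<Delta> (a \<otimes>\<^bsub>P\<^esub> p)) (\<lambda>p1 p2. sw Q (c x) (\<lambda>q y. pt M [p1 \<otimes>\<^bsub>P\<^esub> q] (tcons V n p2 y)))"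
    unfolding lmul_tcons[OF assms(1) h] by (rule cact_Suc[OF V(1,2) P.m_closed[OF assms(1) h(1)] h(2)])
  also have "\<dots> = sw Q (\<Delta> a) (\<lambda>a1 a2. sw Q (\<Delta> p) (\<lambda>p1 p2. sw Q (c x) (\<lambda>q y.
      pt M [(a1 \<otimes>\<^bsub>P\<^esub> p1) \<otimes>\<^bsub>P\<^esub> q] (tcons V n (a2 \<otimes>\<^bsub>P\<^esub> p2) y))))"
    by (rule sw_comult_mult[OF mQ _ assms(1) h(1)]) (assumption | rule el h)+
  also have "\<dots> = dmul a (cact V \<rho> (Suc n) (tcons V n p x))"
    unfolding dmul_def
  proof (rule sw_cong[OF module_P mQ _ comult_closed[OF assms(1)]], (assumption | rule el h)+)
    fix a1 a2 assume g: "a1 \<in> carrier P" "a2 \<in> carrier P"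
    have "sw Q (cact V \<rho> (Suc n) (tcons V n p x)) (\<lambda>q m. pt M [a1 \<otimes>\<^bsub>P\<^esub> q] (lmul V n a2 m)) =
        sw Q (\<Delta> p) (\<lambda>p1 p2. sw Q (c x) (\<lambda>q y. pt M [a1 \<otimes>\<^bsub>P\<^esub> (p1 \<otimes>\<^bsub>P\<^esub> q)] (lmul V n a2 (tcons V n p2 y))))"
      by (rule sw_cact_Suc[OF V(1,2) mQ _ h]) (assumption | rule el g)+
    also have "\<dots> = sw Q (\<Delta> p) (\<lambda>p1 p2. sw Q (c x) (\<lambda>q y.
        pt M [(a1 \<otimes>\<^bsub>P\<^esub> p1) \<otimes>\<^bsub>P\<^esub> q] (tcons V n (a2 \<otimes>\<^bsub>P\<^esub> p2) y)))"
    proof (rule sw_cong[OF module_P mQ _ comult_closed[OF h(1)]], (assumption | rule el g h)+)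
      fix p1 p2 assume f: "p1 \<in> carrier P" "p2 \<in> carrier P"
      show "sw Q (c x) (\<lambda>q y. pt M [a1 \<otimes>\<^bsub>P\<^esub> (p1 \<otimes>\<^bsub>P\<^esub> q)] (lmul V n a2 (tcons V n p2 y))) =
          sw Q (c x) (\<lambda>q y. pt M [(a1 \<otimes>\<^bsub>P\<^esub> p1) \<otimes>\<^bsub>P\<^esub> q] (tcons V n (a2 \<otimes>\<^bsub>P\<^esub> p2) y))"
      proof (rule sw_cong[OF mT mQ _ cc[OF h(2)]], (assumption | rule el g f)+)
      qed (use g f in \<open>simp add: lmul_tcons P.m_assoc\<close>)
    qed
    finally show "sw Q (\<Delta> p) (\<lambda>p1 p2. sw Q (c x) (\<lambda>q y. pt M [(a1 \<otimes>\<^bsub>P\<^esub> p1) \<otimes>\<^bsub>P\<^esub> q] (tcons V n (a2 \<otimes>\<^bsub>P\<^esub> p2) y))) =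
      sw Q (cact V \<rho> (Suc n) (tcons V n p x)) (\<lambda>q m. pt M [a1 \<otimes>\<^bsub>P\<^esub> q] (lmul V n a2 m))" by (rule sym)
  qed
  finally show "cact V \<rho> (Suc n) (lmul V n a (tcons V n p x)) = dmul a (cact V \<rho> (Suc n) (tcons V n p x))" .
qed

text \<open>The map \<open>G \<mapsto> (x \<mapsto> x\<^sub>[\<^sub>-\<^sub>1\<^sub>] \<cdot> G x\<^sub>[\<^sub>0\<^sub>])\<close> is injective: multiplying by the antipode inverts it.\<close>

lemma dmul_recover:
  assumes G: "G \<in> lin X Q" and x: "x \<in> carrier X"
  shows "sw Q (c x) (\<lambda>q y. dmul (S q) (sw Q (c y) (\<lambda>r z. dmul r (G z)))) = G x"
proof -
  have Gl: "(\<lambda>u. G (g u)) \<in> lin U Q" if "g \<in> lin U X" for g and U :: "('k, 'u, 'z) module_scheme"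
    by (rule K.linear_comp[OF G that])
  have Gl': "(\<lambda>u. G (g u)) \<in> lin P Q" if "g \<in> lin P X" for g by (rule K.linear_comp[OF G that])
  have GlX: "(\<lambda>u. G (g u)) \<in> lin X Q" if "g \<in> lin X X" for g by (rule K.linear_comp[OF G that])
  note Gc = K.linearD(1)[OF G]
  have bG: "bilinear X Q (\<lambda>r z. dmul r (G z))" by (assumption | rule GlX Gc el)+
  have "sw Q (c x) (\<lambda>q y. dmul (S q) (sw Q (c y) (\<lambda>r z. dmul r (G z)))) =
      sw Q (c x) (\<lambda>q y. sw Q (c y) (\<lambda>r z. dmul (S q \<otimes>\<^bsub>P\<^esub> r) (G z)))"
  proof (rule sw_cong[OF mT mQ _ cc[OF x]], (assumption | rule GlX Gc el)+)
    fix q y assume h: "q \<in> carrier P" "y \<in> carrier X"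
    have Sq: "S q \<in> carrier P" using h by simp
    have "dmul (S q) (sw Q (c y) (\<lambda>r z. dmul r (G z))) = sw Q (c y) (\<lambda>r z. dmul (S q) (dmul r (G z)))"
      by (rule lin_sw[OF mT mQ mQ lin_dmul_r[OF Sq K.linear_id] bG cc[OF h(2)]])
    also have "\<dots> = sw Q (c y) (\<lambda>r z. dmul (S q \<otimes>\<^bsub>P\<^esub> r) (G z))"
      by (rule sw_cong[OF mT mQ bilinear_comp[OF lin_dmul_r[OF Sq K.linear_id] bG] cc[OF h(2)]])
         (simp add: dmul_mult[OF Sq] Gc)
    finally show "dmul (S q) (sw Q (c y) (\<lambda>r z. dmul r (G z))) = sw Q (c y) (\<lambda>r z. dmul (S q \<otimes>\<^bsub>P\<^esub> r) (G z))" .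
  qed
  also have "\<dots> = sw Q (c x) (\<lambda>q y. sw Q (\<Delta> q) (\<lambda>q1 q2. dmul (S q1 \<otimes>\<^bsub>P\<^esub> q2) (G y)))"
    by (rule comodule_coassoc[symmetric, OF cact_comodule[OF com] mQ _ x], rule trilinearI)
       (assumption | rule GlX Gc el)+
  also have "\<dots> = sw Q (c x) (\<lambda>q y. \<epsilon> q \<odot>\<^bsub>Q\<^esub> G y)"
  proof (rule sw_cong[OF mT mQ _ cc[OF x]], (assumption | rule GlX Gc el)+)
    fix q y assume h: "q \<in> carrier P" "y \<in> carrier X"
    note l = lin_dmul_l[OF Gc[OF h(2)] K.linear_id]
    have b: "bilinear P P (\<lambda>a b. S a \<otimes>\<^bsub>P\<^esub> b)" by (assumption | rule el)+
    have "sw Q (\<Delta> q) (\<lambda>q1 q2. dmul (S q1 \<otimes>\<^bsub>P\<^esub> q2) (G y)) = dmul (sw P (\<Delta> q) (\<lambda>a b. S a \<otimes>\<^bsub>P\<^esub> b)) (G y)"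
      by (rule lin_sw[symmetric, OF module_P module_P mQ l b comult_closed[OF h(1)]])
    also have "\<dots> = \<epsilon> q \<odot>\<^bsub>Q\<^esub> G y"
      unfolding antipode_left[OF h(1)] K.linearD(3)[OF l counit_closed[OF h(1)] P.one_closed] dmul_one[OF Gc[OF h(2)]] ..
    finally show "sw Q (\<Delta> q) (\<lambda>q1 q2. dmul (S q1 \<otimes>\<^bsub>P\<^esub> q2) (G y)) = \<epsilon> q \<odot>\<^bsub>Q\<^esub> G y" .
  qed
  also have "\<dots> = G x" by (rule comodule_counit[OF cact_comodule[OF com] mQ G x])
  finally show ?thesis .
qed

text \<open>A direct computation would have to expand \<open>\<Delta> (S q)\<close>. Instead,
  \<open>?G\<close> and \<open>?G'\<close> are shown to have equal twisted sums, and
  \<open>dmul_recover\<close> reconstructs both maps from these sums.\<close>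

lemma tiota_coinv:
  assumes "x \<in> carrier X"
  shows "tiota V \<rho> n x \<in> coinv M (cact V \<rho> (Suc n))"
proof -
  let ?G = "\<lambda>y. cact V \<rho> (Suc n) (tiota V \<rho> n y)" and ?G' = "\<lambda>y. pt M [\<one>\<^bsub>P\<^esub>] (tiota V \<rho> n y)"
  have G: "?G \<in> lin X Q" "?G' \<in> lin X Q" by (assumption | rule el)+
  have t1: "tcons V n \<one>\<^bsub>P\<^esub> \<in> lin X M" by (rule tcons_lin_r0[OF V(1) P.one_closed])
  have bi: "bilinear X M (\<lambda>q y. lmul V n q (tiota V \<rho> n y))" by (assumption | rule el)+
  \<comment> \<open>Both sums are the coaction of \<open>1 \<otimes> y\<close>: for
    \<open>?G\<close> by linearity of the coaction and \<open>lmul_tiota\<close>, for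
    \<open>?G'\<close> by expanding \<open>1 \<otimes> z\<close> with \<open>lmul_tiota\<close> and
    regrouping by coassociativity.\<close>
  have A: "sw Q (c y) (\<lambda>r z. dmul r (?G z)) = sw Q (c y) (\<lambda>r z. dmul r (?G' z))" if y: "y \<in> carrier X" for y
  proof -
    have "sw Q (c y) (\<lambda>r z. dmul r (?G z)) = sw Q (c y) (\<lambda>r z. cact V \<rho> (Suc n) (lmul V n r (tiota V \<rho> n z)))"
    proof (rule sw_cong[OF mT mQ _ cc[OF y]], (assumption | rule el)+)
    qed (simp add: cact_lmul tiota_closed del: cact.simps)
    also have "\<dots> = cact V \<rho> (Suc n) (tcons V n \<one>\<^bsub>P\<^esub> y)"
      unfolding lmul_tiota[OF y, symmetric]
      by (rule lin_sw[symmetric, OF mT mT mQ cact_lin[OF V(1,2)] bi cc[OF y]])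
    also have "\<dots> = sw Q (c y) (\<lambda>q z. pt M [q] (tcons V n \<one>\<^bsub>P\<^esub> z))"
      unfolding equivariantD(2)[OF equivariant_tcons_one[OF com] y] by (rule tmap1_sw[OF mT mT t1 cc[OF y]])
    also have "\<dots> = sw Q (c y) (\<lambda>q z. sw Q (c z) (\<lambda>r w. pt M [q] (lmul V n r (tiota V \<rho> n w))))"
    proof (rule sw_cong[OF mT mQ _ cc[OF y]], (assumption | rule el)+)
      fix q z assume h: "q \<in> carrier P" "z \<in> carrier X"
      show "pt M [q] (tcons V n \<one>\<^bsub>P\<^esub> z) = sw Q (c z) (\<lambda>r w. pt M [q] (lmul V n r (tiota V \<rho> n w)))"
        unfolding lmul_tiota[OF h(2), symmetric]
        by (rule lin_sw[OF mT mT mQ lin_pure_r[OF mT h(1) K.linear_id] bi cc[OF h(2)]])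
    qed
    also have "\<dots> = sw Q (c y) (\<lambda>q z. sw Q (\<Delta> q) (\<lambda>q1 q2. pt M [q1] (lmul V n q2 (tiota V \<rho> n z))))"
      by (rule comodule_coassoc[symmetric, OF cact_comodule[OF com] mQ _ y], rule trilinearI) (assumption | rule el)+
    also have "\<dots> = sw Q (c y) (\<lambda>r z. dmul r (?G' z))"
    proof (rule sw_cong[OF mT mQ _ cc[OF y]], (assumption | rule el)+)
      fix q z assume h: "q \<in> carrier P" "z \<in> carrier X"
      show "sw Q (\<Delta> q) (\<lambda>q1 q2. pt M [q1] (lmul V n q2 (tiota V \<rho> n z))) = dmul q (?G' z)"
        unfolding dmul_pure[OF h(1) P.one_closed tiota_closed[OF h(2)]]
      proof (rule sw_cong[OF module_P mQ _ comult_closed[OF h(1)]], (assumption | rule el h)+)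
      qed simp
    qed
    finally show ?thesis .
  qed
  have "?G x = sw Q (c x) (\<lambda>q y. dmul (S q) (sw Q (c y) (\<lambda>r z. dmul r (?G z))))"
    by (rule dmul_recover[symmetric, OF G(1) assms])
  also have "\<dots> = sw Q (c x) (\<lambda>q y. dmul (S q) (sw Q (c y) (\<lambda>r z. dmul r (?G' z))))"
  proof (rule sw_cong[OF mT mQ _ cc[OF assms]], (assumption | rule el)+)
  qed (simp add: A del: cact.simps)
  also have "\<dots> = ?G' x" by (rule dmul_recover[OF G(2) assms])
  finally show ?thesis using tiota_closed[OF assms] by (simp add: coinv_def)
qed

end

lemma tev_tmap:
  assumes "left_comodule K P V \<rho>V" "left_comodule K P W \<rho>W" "g \<in> lin V W" "t \<in> carrier (T (Suc n) V)"
  shows "tev W n (tmap W (Suc n) g t) = tmap W n g (tev V n t)"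
proof -
  note V = left_comoduleD(1)[OF assms(1)] and W = left_comoduleD(1)[OF assms(2)]
  note tg = tmap_lin[OF V W assms(3)] and mW = module_T[OF W]
  show ?thesis
    by (rule T_Suc_ext[OF V mW K.linear_comp[OF tev_lin[OF assms(2)] tg] K.linear_comp[OF tg tev_lin[OF assms(1)]] assms(4)])
       (simp add: tmap_tcons[OF V W assms(3)] tev_tcons[OF assms(1)] tev_tcons[OF assms(2)]
          tmap_closed[OF V W assms(3)] K.linearD(3)[OF tg])
qed

text \<open>Naturality for the triples of \<open>cact_tmap\<close>. It allows a merely linear
  section \<open>f\<close> to be used for lifting coinvariants, provided that the coaction
  downstairs is computed from \<open>\<rho>V (f u)\<close>.\<close>

lemma tiota_tmap:
  assumes "left_comodule K P V \<rho>V" "left_comodule K P W \<rho>W" "module K U"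
    "h \<in> lin U W" "f \<in> lin U V" "g \<in> lin V W"
    and eq: "\<And>u. u \<in> carrier U \<Longrightarrow> \<rho>W (h u) = tmap W 1 g (\<rho>V (f u))"
    and t: "t \<in> carrier (T n U)"
  shows "tiota W \<rho>W n (tmap W n h t) = tmap W (Suc n) g (tiota V \<rho>V n (tmap V n f t))"
proof -
  note V = left_comoduleD[OF assms(1)] and W = left_comoduleD[OF assms(2)]
  note mV = module_T[OF V(1)] and mW = module_T[OF W(1)] and tg = tmap_lin[OF V(1) W(1) assms(6)]
  note clV = clins[OF V(1,2)] and clW = clins[OF W(1,2)]
  let ?C = "cact V \<rho>V n (tmap V n f t)"
  have C: "?C \<in> carrier (T 1 (T n V))" by (rule cact_closed[OF V(1,2) tmap_closed[OF assms(3) V(1) assms(5) t]])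
  have bV: "bilinear (T n V) (T (Suc n) V) (\<lambda>q y. tcons V n (S q) y)" by (assumption | rule clV)+
  have bW: "bilinear (T n W) (T (Suc n) W) (\<lambda>q y. tcons W n (S q) y)" by (assumption | rule clW)+
  have e: "cact W \<rho>W n (tmap W n h t) = tmap (T n W) 1 (tmap W n g) ?C"
    by (rule cact_tmap[OF assms(1-6) _ t]) (rule eq)
  have "tiota W \<rho>W n (tmap W n h t) = sw (T (Suc n) W) (tmap (T n W) 1 (tmap W n g) ?C) (\<lambda>q y. tcons W n (S q) y)"
    unfolding tiota_def e ..
  also have "\<dots> = sw (T (Suc n) W) ?C (\<lambda>q y. tcons W n (S q) (tmap W n g y))"
    by (rule sw_tmap[OF mV mW mW tg bW C])
  also have "\<dots> = sw (T (Suc n) W) ?C (\<lambda>q y. tmap W (Suc n) g (tcons V n (S q) y))"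
    by (rule sw_cong[OF mV mW bilinear_precomp[OF tg bW] C]) (simp add: tmap_tcons[OF V(1) W(1) assms(6)])
  also have "\<dots> = tmap W (Suc n) g (tiota V \<rho>V n (tmap V n f t))"
    unfolding tiota_def by (rule lin_sw[symmetric, OF mV mV mW tg bV C])
  finally show ?thesis .
qed

end

section \<open>Spectral sequences from chains of cycles and boundaries\<close>

text \<open>\<open>E\<^sub>r\<^sup>n\<^sup>,\<^sup>m\<close> is \<open>Zs r n m / Bs r n m\<close>; for \<open>r = 2\<close> the map \<open>\<psi>\<close> realises this quotient as the given \<open>E n m\<close>.\<close>

locale cycle_chains = field R for R (structure) +
  fixes A :: "int \<Rightarrow> int \<Rightarrow> ('a, 'x, 'c) module_scheme" and E :: "int \<Rightarrow> int \<Rightarrow> ('a, 'e, 'd) module_scheme"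
    and Zs Bs :: "nat \<Rightarrow> int \<Rightarrow> int \<Rightarrow> 'x set" and \<psi> :: "int \<Rightarrow> int \<Rightarrow> 'x \<Rightarrow> 'e" and d :: "nat \<Rightarrow> int \<Rightarrow> int \<Rightarrow> 'x \<Rightarrow> 'x"
  assumes mA: "module R (A n m)" and mE: "module R (E n m)"
    and E_zero: "n < 0 \<or> m < 0 \<Longrightarrow> carrier (E n m) = {\<zero>\<^bsub>E n m\<^esub>}"
    and sZ: "submodule (Zs r n m) R (A n m)" and sB: "submodule (Bs r n m) R (A n m)"
    and Z_mono: "2 \<le> r \<Longrightarrow> Zs (Suc r) n m \<subseteq> Zs r n m" and B_mono: "2 \<le> r \<Longrightarrow> Bs r n m \<subseteq> Bs (Suc r) n m"
    and B_sub_Z: "2 \<le> r \<Longrightarrow> 2 \<le> q \<Longrightarrow> Bs r n m \<subseteq> Zs q n m"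
    and \<psi>_lin: "\<psi> n m \<in> lin ((A n m)\<lparr>carrier := Zs 2 n m\<rparr>) (E n m)"
    and \<psi>_surj: "e \<in> carrier (E n m) \<Longrightarrow> \<exists>z\<in>Zs 2 n m. e = \<psi> n m z"
    and \<psi>_ker: "z \<in> Zs 2 n m \<Longrightarrow> \<psi> n m z = \<zero>\<^bsub>E n m\<^esub> \<longleftrightarrow> z \<in> Bs 2 n m"
    and d_lin: "2 \<le> r \<Longrightarrow> d r n m \<in> lin (A n m) (A (n + int r) (m + 1 - int r))"
    and d_B: "2 \<le> r \<Longrightarrow> a \<in> Zs r n m \<Longrightarrow> d r n m a \<in> Bs (Suc r) (n + int r) (m + 1 - int r)"
    and d_ker: "2 \<le> r \<Longrightarrow> a \<in> Zs r n m \<Longrightarrow>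
      d r n m a \<in> Bs r (n + int r) (m + 1 - int r) \<longleftrightarrow> a \<in> Zs (Suc r) n m"
    and d_surj: "2 \<le> r \<Longrightarrow> b \<in> Bs (Suc r) (n + int r) (m + 1 - int r) \<Longrightarrow>
      \<exists>a\<in>Zs r n m. b \<ominus>\<^bsub>A (n + int r) (m + 1 - int r)\<^esub> d r n m a \<in> Bs r (n + int r) (m + 1 - int r)"
begin

lemma Z_sub_Z2: "2 \<le> r \<Longrightarrow> Zs r n m \<subseteq> Zs 2 n m"
proof (induction r rule: dec_induct)
  case (step r) then show ?case using Z_mono[of r n m] by auto
qed simp

lemma B2_sub_B: "2 \<le> r \<Longrightarrow> Bs 2 n m \<subseteq> Bs r n m"
proof (induction r rule: dec_induct)
  case (step r) then show ?case using B_mono[of r n m] by auto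
qed simp

lemmas ZD = submoduleD[OF mA sZ]
lemmas BD = submoduleD[OF mA sB]

definition proj :: "int \<Rightarrow> int \<Rightarrow> 'x set \<Rightarrow> 'x \<Rightarrow> 'x"
  where "proj n m N = (SOME p. p \<in> lin (A n m) (A n m) \<and> (\<forall>x\<in>carrier (A n m). p x \<in> N) \<and> (\<forall>x\<in>N. p x = x))"

lemma proj:
  assumes "submodule N R (A n m)"
  shows "proj n m N \<in> lin (A n m) (A n m)" "x \<in> carrier (A n m) \<Longrightarrow> proj n m N x \<in> N"
    "x \<in> N \<Longrightarrow> proj n m N x = x"
proof -
  have "\<exists>p. p \<in> lin (A n m) (A n m) \<and> (\<forall>x\<in>carrier (A n m). p x \<in> N) \<and> (\<forall>x\<in>N. p x = x)"
    using exists_projection[OF mA assms] by blast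
  from someI_ex[OF this] show "proj n m N \<in> lin (A n m) (A n m)"
    "x \<in> carrier (A n m) \<Longrightarrow> proj n m N x \<in> N" "x \<in> N \<Longrightarrow> proj n m N x = x"
    unfolding proj_def by blast+
qed

text \<open>A linear idempotent with kernel \<open>Bs r n m\<close>. It selects a representative
  modulo \<open>Bs r n m\<close>, so that \<open>C r n m\<close> below is a complement of
  \<open>Bs r n m\<close> in \<open>Zs r n m\<close>.\<close>

definition \<pi> :: "nat \<Rightarrow> int \<Rightarrow> int \<Rightarrow> 'x \<Rightarrow> 'x"
  where "\<pi> r n m x = x \<ominus>\<^bsub>A n m\<^esub> proj n m (Bs r n m) x"

lemma \<pi>_lin: "\<pi> r n m \<in> lin (A n m) (A n m)"
  unfolding \<pi>_def by (rule linear_minus_fun[OF mA linear_id proj(1)[OF sB]])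

lemma \<pi>_closed: "x \<in> carrier (A n m) \<Longrightarrow> \<pi> r n m x \<in> carrier (A n m)"
  using linearD(1)[OF \<pi>_lin] .

lemma \<pi>_B:
  assumes "x \<in> Bs r n m" shows "\<pi> r n m x = \<zero>\<^bsub>A n m\<^esub>"
proof -
  interpret A: module R "A n m" by (rule mA)
  show ?thesis unfolding \<pi>_def proj(3)[OF sB assms] by (rule A.minus_self[OF BD(1)[OF assms]])
qed

lemma \<pi>_eq_zero_iff:
  assumes "x \<in> carrier (A n m)" shows "\<pi> r n m x = \<zero>\<^bsub>A n m\<^esub> \<longleftrightarrow> x \<in> Bs r n m"
proof
  interpret A: module R "A n m" by (rule mA)
  assume h: "\<pi> r n m x = \<zero>\<^bsub>A n m\<^esub>"
  have p: "proj n m (Bs r n m) x \<in> Bs r n m" by (rule proj(2)[OF sB assms])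
  have "x = proj n m (Bs r n m) x"
    using A.minus_eq_zero_iff[OF assms BD(1)[OF p]] h unfolding \<pi>_def by (rule iffD1)
  then show "x \<in> Bs r n m" using p by simp
qed (rule \<pi>_B)

lemma diff_\<pi>:
  assumes "x \<in> carrier (A n m)" shows "x \<ominus>\<^bsub>A n m\<^esub> \<pi> r n m x \<in> Bs r n m"
proof -
  interpret A: module R "A n m" by (rule mA)
  have p: "proj n m (Bs r n m) x \<in> Bs r n m" by (rule proj(2)[OF sB assms])
  note pc = BD(1)[OF p]
  have "x \<ominus>\<^bsub>A n m\<^esub> \<pi> r n m x = proj n m (Bs r n m) x"
    unfolding \<pi>_def using assms pc by (simp add: a_minus_def A.minus_add A.r_neg1 A.r_neg2)
  then show ?thesis using p by simp
qed

lemma \<pi>_eqI: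
  assumes "x \<in> carrier (A n m)" "y \<in> carrier (A n m)" "x \<ominus>\<^bsub>A n m\<^esub> y \<in> Bs r n m"
  shows "\<pi> r n m x = \<pi> r n m y"
proof -
  interpret A: module R "A n m" by (rule mA)
  have "\<pi> r n m x \<ominus>\<^bsub>A n m\<^esub> \<pi> r n m y = \<zero>\<^bsub>A n m\<^esub>"
    using \<pi>_B[OF assms(3)] linear_minus[OF mA mA \<pi>_lin assms(1,2)] by simp
  then show ?thesis using A.minus_eq_zero_iff[OF \<pi>_closed[OF assms(1)] \<pi>_closed[OF assms(2)]] by blast
qed

text \<open>The correction made by the earlier projection lies in \<open>Bs r\<close>, hence in
  \<open>Bs q\<close>, where the later projection does not see it.\<close>

lemma \<pi>_\<pi>:
  assumes "x \<in> carrier (A n m)" "2 \<le> r" "r \<le> q"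
  shows "\<pi> q n m (\<pi> r n m x) = \<pi> q n m x"
proof -
  have "Bs r n m \<subseteq> Bs q n m" using assms(3,2)
  proof (induction q rule: dec_induct)
    case (step k) then show ?case using B_mono[of k n m] by auto
  qed simp
  then show ?thesis using \<pi>_eqI[OF assms(1) \<pi>_closed[OF assms(1)], of r q] diff_\<pi>[OF assms(1), of r] by auto
qed

lemma \<pi>_Z:
  assumes "2 \<le> r" "2 \<le> q" "x \<in> Zs q n m" shows "\<pi> r n m x \<in> Zs q n m"
proof -
  have "proj n m (Bs r n m) x \<in> Zs q n m" using proj(2)[OF sB ZD(1)[OF assms(3)]] B_sub_Z[OF assms(1,2)] by blast
  then show ?thesis unfolding \<pi>_def by (rule ZD(6)[OF assms(3)])
qed

definition C :: "nat \<Rightarrow> int \<Rightarrow> int \<Rightarrow> 'x set"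
  where "C r n m = \<pi> r n m ` Zs r n m"

lemma C_iff: "2 \<le> r \<Longrightarrow> c \<in> C r n m \<longleftrightarrow> c \<in> Zs r n m \<and> \<pi> r n m c = c"
proof
  assume r: "2 \<le> r" and "c \<in> C r n m"
  then obtain z where z: "z \<in> Zs r n m" "c = \<pi> r n m z" unfolding C_def by blast
  then show "c \<in> Zs r n m \<and> \<pi> r n m c = c" using \<pi>_Z[OF r r z(1)] \<pi>_\<pi>[OF ZD(1)[OF z(1)] r order_refl] by simp
next
  assume "c \<in> Zs r n m \<and> \<pi> r n m c = c"
  then show "c \<in> C r n m" unfolding C_def by (metis imageI)
qed

lemma sC: "submodule (C r n m) R (A n m)"
  unfolding C_def by (rule submodule_image[OF mA mA \<pi>_lin sZ])

lemmas CD = submoduleD[OF mA sC]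

lemma C_Z2: "2 \<le> r \<Longrightarrow> c \<in> C r n m \<Longrightarrow> c \<in> Zs 2 n m"
  using C_iff Z_sub_Z2 by blast

lemma mZ2: "module R ((A n m)\<lparr>carrier := Zs 2 n m\<rparr>)"
  by (rule module_submodule[OF mA sZ])

lemma \<psi>_add: "\<lbrakk>x \<in> Zs 2 n m; y \<in> Zs 2 n m\<rbrakk> \<Longrightarrow> \<psi> n m (x \<oplus>\<^bsub>A n m\<^esub> y) = \<psi> n m x \<oplus>\<^bsub>E n m\<^esub> \<psi> n m y"
  using linearD(2)[OF \<psi>_lin, of x n m y] by simp

lemma \<psi>_smult: "\<lbrakk>a \<in> carrier R; x \<in> Zs 2 n m\<rbrakk> \<Longrightarrow> \<psi> n m (a \<odot>\<^bsub>A n m\<^esub> x) = a \<odot>\<^bsub>E n m\<^esub> \<psi> n m x"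
  using linearD(3)[OF \<psi>_lin, of a x n m] by simp

lemma \<psi>_closed: "x \<in> Zs 2 n m \<Longrightarrow> \<psi> n m x \<in> carrier (E n m)"
  using linearD(1)[OF \<psi>_lin, of x n m] by simp

lemma \<psi>_zero: "\<psi> n m \<zero>\<^bsub>A n m\<^esub> = \<zero>\<^bsub>E n m\<^esub>"
  using linear_zero[OF mZ2 mE \<psi>_lin] by simp

text \<open>The kernel of \<open>\<psi>\<close> is \<open>Bs 2\<close>, which lies in
  \<open>Bs r\<close>; and \<open>\<pi> r\<close> kills \<open>Bs r\<close> while fixing
  \<open>C r\<close>.\<close>

lemma \<psi>_C_zero:
  assumes "2 \<le> r" "c \<in> C r n m" shows "\<psi> n m c = \<zero>\<^bsub>E n m\<^esub> \<longleftrightarrow> c = \<zero>\<^bsub>A n m\<^esub>"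
proof
  assume "\<psi> n m c = \<zero>\<^bsub>E n m\<^esub>"
  then have "c \<in> Bs r n m" using \<psi>_ker[OF C_Z2[OF assms]] B2_sub_B[OF assms(1)] by blast
  then show "c = \<zero>\<^bsub>A n m\<^esub>" using \<pi>_B C_iff[OF assms(1)] assms(2) by metis
qed (simp add: \<psi>_zero)

text \<open>\<open>\<psi>\<close> is injective on the complement \<open>C r n m\<close>, so this is
  a copy of \<open>Zs r / Bs r\<close> inside \<open>E n m\<close>. All pages share one type, and
  for \<open>r = 2\<close> the whole of \<open>E n m\<close> results.\<close>

definition page :: "nat \<Rightarrow> int \<Rightarrow> int \<Rightarrow> ('a, 'e, 'd) module_scheme"
  where "page r n m = (E n m)\<lparr>carrier := \<psi> n m ` C r n m\<rparr>"

definition \<chi>0 :: "int \<Rightarrow> int \<Rightarrow> 'e \<Rightarrow> 'x"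
  where "\<chi>0 n m = (SOME g. g \<in> lin (E n m) ((A n m)\<lparr>carrier := Zs 2 n m\<rparr>) \<and>
    (\<forall>z\<in>Zs 2 n m. \<psi> n m (g (\<psi> n m z)) = \<psi> n m z))"

lemma \<chi>0: "\<chi>0 n m \<in> lin (E n m) ((A n m)\<lparr>carrier := Zs 2 n m\<rparr>)"
  "z \<in> Zs 2 n m \<Longrightarrow> \<psi> n m (\<chi>0 n m (\<psi> n m z)) = \<psi> n m z"
proof -
  have "\<exists>g. g \<in> lin (E n m) ((A n m)\<lparr>carrier := Zs 2 n m\<rparr>) \<and> (\<forall>z\<in>Zs 2 n m. \<psi> n m (g (\<psi> n m z)) = \<psi> n m z)"
    using exists_pseudo_inverse[OF mZ2 mE \<psi>_lin, of n m] unfolding Bex_def by simp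
  from someI_ex[OF this] show "\<chi>0 n m \<in> lin (E n m) ((A n m)\<lparr>carrier := Zs 2 n m\<rparr>)"
    "z \<in> Zs 2 n m \<Longrightarrow> \<psi> n m (\<chi>0 n m (\<psi> n m z)) = \<psi> n m z"
    unfolding \<chi>0_def by blast+
qed

text \<open>A preimage under \<open>\<psi>\<close> is determined up to \<open>Bs 2\<close>. The
  projection \<open>\<pi> r\<close> removes this ambiguity, so \<open>\<chi>\<close> inverts
  \<open>\<psi>\<close> on page \<open>r\<close>.\<close>

definition \<chi> :: "nat \<Rightarrow> int \<Rightarrow> int \<Rightarrow> 'e \<Rightarrow> 'x"
  where "\<chi> r n m e = \<pi> r n m (\<chi>0 n m e)"

lemma \<chi>_lin: "\<chi> r n m \<in> lin (E n m) (A n m)"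
proof -
  note l = linearD[OF \<chi>0(1)[of n m], simplified]
  have "\<chi>0 n m \<in> lin (E n m) (A n m)" by (rule linearI) (simp_all add: l ZD(1)[OF l(1)])
  then show ?thesis unfolding \<chi>_def by (rule linear_comp[OF \<pi>_lin])
qed

lemma \<chi>_\<psi>:
  assumes "2 \<le> r" "c \<in> C r n m" shows "\<chi> r n m (\<psi> n m c) = c"
proof -
  interpret A: module R "A n m" by (rule mA)
  interpret E: module R "E n m" by (rule mE)
  note c = C_Z2[OF assms]
  have g: "\<chi>0 n m (\<psi> n m c) \<in> Zs 2 n m" using linearD(1)[OF \<chi>0(1) \<psi>_closed[OF c]] by simp
  have s: "submodule (Zs 2 n m) R (A n m)" by (rule sZ)
  have "\<psi> n m (\<chi>0 n m (\<psi> n m c) \<ominus>\<^bsub>A n m\<^esub> c) = \<zero>\<^bsub>E n m\<^esub>"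
  proof -
    have m1: "\<ominus>\<^bsub>A n m\<^esub> c = (\<ominus> \<one>) \<odot>\<^bsub>A n m\<^esub> c" using ZD(1)[OF c] by (simp add: A.smult_l_minus)
    have "\<psi> n m (\<chi>0 n m (\<psi> n m c) \<ominus>\<^bsub>A n m\<^esub> c) = \<psi> n m (\<chi>0 n m (\<psi> n m c)) \<oplus>\<^bsub>E n m\<^esub> (\<ominus> \<one>) \<odot>\<^bsub>E n m\<^esub> \<psi> n m c"
      unfolding a_minus_def m1 using g c ZD(4) by (simp add: \<psi>_add \<psi>_smult)
    also have "\<dots> = \<zero>\<^bsub>E n m\<^esub>" using \<chi>0(2)[OF c] \<psi>_closed[OF c] by (simp add: E.smult_l_minus E.r_neg)
    finally show ?thesis .
  qed
  then have "\<chi>0 n m (\<psi> n m c) \<ominus>\<^bsub>A n m\<^esub> c \<in> Bs r n m"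
    using \<psi>_ker[OF ZD(6)[OF g c]] B2_sub_B[OF assms(1)] by blast
  then have "\<chi> r n m (\<psi> n m c) = \<pi> r n m c" unfolding \<chi>_def by (rule \<pi>_eqI[OF ZD(1)[OF g] ZD(1)[OF c]])
  then show ?thesis using C_iff[OF assms(1)] assms(2) by simp
qed

text \<open>\<open>d r\<close> is defined on all of \<open>A n m\<close> but carries meaning only on
  \<open>Zs r\<close> and modulo \<open>Bs r\<close>. Hence \<open>\<chi>\<close> supplies a cycle
  before it and \<open>\<pi>\<close> normalises the result.\<close>

definition D :: "nat \<Rightarrow> int \<Rightarrow> int \<Rightarrow> 'e \<Rightarrow> 'e"
  where "D r n m e = \<psi> (n + int r) (m + 1 - int r) (\<pi> r (n + int r) (m + 1 - int r) (d r n m (\<chi> r n m e)))"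

lemma D_\<psi>:
  assumes "2 \<le> r" "c \<in> C r n m"
  shows "D r n m (\<psi> n m c) = \<psi> (n + int r) (m + 1 - int r) (\<pi> r (n + int r) (m + 1 - int r) (d r n m c))"
  unfolding D_def \<chi>_\<psi>[OF assms] ..

lemma \<pi>d_C:
  assumes "2 \<le> r" "c \<in> C r n m"
  shows "\<pi> r (n + int r) (m + 1 - int r) (d r n m c) \<in> C r (n + int r) (m + 1 - int r)"
proof -
  have "d r n m c \<in> Bs (Suc r) (n + int r) (m + 1 - int r)" using d_B[OF assms(1)] C_iff[OF assms(1)] assms(2) by blast
  then have "d r n m c \<in> Zs r (n + int r) (m + 1 - int r)" using B_sub_Z[of "Suc r" r] assms(1) by auto
  then show ?thesis unfolding C_def by (rule imageI)
qed

lemma submodule_page: "2 \<le> r \<Longrightarrow> submodule (\<psi> n m ` C r n m) R (E n m)"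
  by (rule submodule_image[OF mZ2 mE \<psi>_lin submodule_restrict[OF mA sZ sC]]) (use C_Z2 in blast)

lemma module_page: "2 \<le> r \<Longrightarrow> module R (page r n m)"
  unfolding page_def by (rule module_submodule[OF mE submodule_page])

lemma page_2: "page 2 n m = E n m"
proof -
  have "\<psi> n m ` C 2 n m = carrier (E n m)"
  proof (intro equalityI subsetI)
    show "e \<in> carrier (E n m)" if "e \<in> \<psi> n m ` C 2 n m" for e using that C_Z2[of 2] \<psi>_closed by auto
    fix e assume "e \<in> carrier (E n m)"
    then obtain z where z: "z \<in> Zs 2 n m" "e = \<psi> n m z" using \<psi>_surj by blast
    interpret A: module R "A n m" by (rule mA)
    have p: "\<pi> 2 n m z \<in> Zs 2 n m" "z \<ominus>\<^bsub>A n m\<^esub> \<pi> 2 n m z \<in> Bs 2 n m"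
      using \<pi>_Z[of 2 2 z n m] z diff_\<pi>[OF ZD(1)[OF z(1)]] by simp_all
    have q: "z \<ominus>\<^bsub>A n m\<^esub> \<pi> 2 n m z \<in> Zs 2 n m" by (rule ZD(6)[OF z(1) p(1)])
    interpret E: module R "E n m" by (rule mE)
    have "z = (z \<ominus>\<^bsub>A n m\<^esub> \<pi> 2 n m z) \<oplus>\<^bsub>A n m\<^esub> \<pi> 2 n m z"
      using A.minus_add_cancel ZD(1)[OF z(1)] ZD(1)[OF p(1)] by simp
    then have "e = \<psi> n m (z \<ominus>\<^bsub>A n m\<^esub> \<pi> 2 n m z) \<oplus>\<^bsub>E n m\<^esub> \<psi> n m (\<pi> 2 n m z)"
      using z(2) \<psi>_add[OF q p(1)] by simp
    then have "e = \<psi> n m (\<pi> 2 n m z)" using \<psi>_ker[OF q] p(2) \<psi>_closed[OF p(1)] by simp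
    then show "e \<in> \<psi> n m ` C 2 n m" using z(1) unfolding C_def by blast
  qed
  then show ?thesis by (simp add: page_def)
qed

lemma page_cong: "\<lbrakk>Zs r n m = Zs q n m; Bs r n m = Bs q n m\<rbrakk> \<Longrightarrow> page r n m = page q n m"
  by (simp add: page_def C_def \<pi>_def)

lemma D_lin:
  assumes "2 \<le> r"
  shows "D r n m \<in> lin (page r n m) (page r (n + int r) (m + 1 - int r))"
proof -
  let ?n = "n + int r" and ?m = "m + 1 - int r"
  note l = linearD[OF linear_comp[OF \<pi>_lin[of r ?n ?m] d_lin[OF assms, of n m]]]
  note z = C_Z2[OF assms]
  show ?thesis
  proof (rule linearI)
    fix e assume "e \<in> carrier (page r n m)"
    then obtain c where c: "c \<in> C r n m" "e = \<psi> n m c" by (auto simp: page_def)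
    show "D r n m e \<in> carrier (page r ?n ?m)"
      unfolding c(2) D_\<psi>[OF assms c(1)] page_def using \<pi>d_C[OF assms c(1)] by simp
  next
    fix e f assume "e \<in> carrier (page r n m)" "f \<in> carrier (page r n m)"
    then obtain b c where h: "b \<in> C r n m" "e = \<psi> n m b" "c \<in> C r n m" "f = \<psi> n m c" by (auto simp: page_def)
    have "e \<oplus>\<^bsub>page r n m\<^esub> f = \<psi> n m (b \<oplus>\<^bsub>A n m\<^esub> c)" using h z \<psi>_add by (simp add: page_def)
    then show "D r n m (e \<oplus>\<^bsub>page r n m\<^esub> f) = D r n m e \<oplus>\<^bsub>page r ?n ?m\<^esub> D r n m f"
      unfolding h(2,4) using D_\<psi>[OF assms] h(1,3) CD(1,3) l(2) \<psi>_add[OF z[OF \<pi>d_C[OF assms h(1)]] z[OF \<pi>d_C[OF assms h(3)]]]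
      by (simp add: page_def)
  next
    fix a e assume "a \<in> carrier R" "e \<in> carrier (page r n m)"
    then obtain b where h: "a \<in> carrier R" "b \<in> C r n m" "e = \<psi> n m b" by (auto simp: page_def)
    have "a \<odot>\<^bsub>page r n m\<^esub> e = \<psi> n m (a \<odot>\<^bsub>A n m\<^esub> b)" using h z \<psi>_smult by (simp add: page_def)
    then show "D r n m (a \<odot>\<^bsub>page r n m\<^esub> e) = a \<odot>\<^bsub>page r ?n ?m\<^esub> D r n m e"
      unfolding h(3) using D_\<psi>[OF assms] h(1,2) CD(1,4) l(3) \<psi>_smult[OF h(1) z[OF \<pi>d_C[OF assms h(2)]]]
      by (simp add: page_def)
  qed
qed

lemma D_zero_iff:
  assumes "2 \<le> r" "c \<in> C r n m"
  shows "D r n m (\<psi> n m c) = \<zero>\<^bsub>E (n + int r) (m + 1 - int r)\<^esub> \<longleftrightarrow> c \<in> Zs (Suc r) n m"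
proof -
  have c: "c \<in> Zs r n m" using C_iff[OF assms(1)] assms(2) by blast
  show ?thesis
    unfolding D_\<psi>[OF assms] \<psi>_C_zero[OF assms(1) \<pi>d_C[OF assms]]
      \<pi>_eq_zero_iff[OF linearD(1)[OF d_lin[OF assms(1)] CD(1)[OF assms(2)]]] d_ker[OF assms(1) c] ..
qed

text \<open>\<open>d r\<close> takes values in \<open>Bs (Suc r)\<close>, which is contained in
  \<open>Zs (Suc r)\<close>, and on classes from there \<open>D\<close> vanishes by
  \<open>D_zero_iff\<close>.\<close>

lemma D_D:
  assumes "2 \<le> r" "e \<in> carrier (page r n m)"
  shows "D r (n + int r) (m + 1 - int r) (D r n m e) =
    \<zero>\<^bsub>E (n + int r + int r) (m + 1 - int r + 1 - int r)\<^esub>"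
proof -
  let ?n = "n + int r" and ?m = "m + 1 - int r"
  obtain c where c: "c \<in> C r n m" "e = \<psi> n m c" using assms(2) by (auto simp: page_def)
  have "d r n m c \<in> Bs (Suc r) ?n ?m" using d_B[OF assms(1)] C_iff[OF assms(1)] c(1) by blast
  then have "d r n m c \<in> Zs (Suc r) ?n ?m" using B_sub_Z[of "Suc r" "Suc r"] assms(1) by auto
  then have "\<pi> r ?n ?m (d r n m c) \<in> Zs (Suc r) ?n ?m" using \<pi>_Z[of r "Suc r"] assms(1) by simp
  then show ?thesis unfolding c(2) D_\<psi>[OF assms(1) c(1)] using D_zero_iff[OF assms(1) \<pi>d_C[OF assms(1) c(1)]] by blast
qed

lemma D_image:
  assumes "2 \<le> r"
  shows "D r n m ` carrier (page r n m) =
    (\<lambda>b. \<psi> (n + int r) (m + 1 - int r) (\<pi> r (n + int r) (m + 1 - int r) b)) ` Bs (Suc r) (n + int r) (m + 1 - int r)"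
proof (intro equalityI subsetI)
  let ?n = "n + int r" and ?m = "m + 1 - int r"
  fix f assume "f \<in> D r n m ` carrier (page r n m)"
  then obtain c where c: "c \<in> C r n m" "f = D r n m (\<psi> n m c)" by (auto simp: page_def)
  have "d r n m c \<in> Bs (Suc r) ?n ?m" using d_B[OF assms] C_iff[OF assms] c(1) by blast
  then show "f \<in> (\<lambda>b. \<psi> ?n ?m (\<pi> r ?n ?m b)) ` Bs (Suc r) ?n ?m" unfolding c(2) D_\<psi>[OF assms c(1)] by blast
next
  let ?n = "n + int r" and ?m = "m + 1 - int r"
  interpret A': module R "A ?n ?m" by (rule mA)
  fix f assume "f \<in> (\<lambda>b. \<psi> ?n ?m (\<pi> r ?n ?m b)) ` Bs (Suc r) ?n ?m"
  then obtain b where b: "b \<in> Bs (Suc r) ?n ?m" "f = \<psi> ?n ?m (\<pi> r ?n ?m b)" by blast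
  then obtain a where a: "a \<in> Zs r n m" "b \<ominus>\<^bsub>A ?n ?m\<^esub> d r n m a \<in> Bs r ?n ?m" using d_surj[OF assms] by blast
  \<comment> \<open>The source must come from \<open>C r\<close>. Replacing \<open>a\<close> by
    \<open>?c\<close> alters it by an element of \<open>Bs r n m\<close>, hence of
    \<open>Zs (Suc r) n m\<close>, so \<open>d r\<close> changes only within
    \<open>Bs r\<close>.\<close>
  let ?c = "\<pi> r n m a"
  note ac = ZD(1)[OF a(1)]
  have c: "?c \<in> C r n m" using a(1) unfolding C_def by blast
  have bc: "?c \<in> carrier (A n m)" by (rule \<pi>_closed[OF ac])
  have "a \<ominus>\<^bsub>A n m\<^esub> ?c \<in> Bs r n m" by (rule diff_\<pi>[OF ac])
  then have a': "a \<ominus>\<^bsub>A n m\<^esub> ?c \<in> Zs r n m" "a \<ominus>\<^bsub>A n m\<^esub> ?c \<in> Zs (Suc r) n m"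
    using B_sub_Z[OF assms] assms by (meson le_SucI subsetD)+
  have "d r n m (a \<ominus>\<^bsub>A n m\<^esub> ?c) \<in> Bs r ?n ?m" using d_ker[OF assms a'(1)] a'(2) by blast
  then have e: "d r n m a \<ominus>\<^bsub>A ?n ?m\<^esub> d r n m ?c \<in> Bs r ?n ?m"
    using linear_minus[OF mA mA d_lin[OF assms] ac bc] by simp
  note da = linearD(1)[OF d_lin[OF assms] ac] and dc = linearD(1)[OF d_lin[OF assms] bc]
  have "b \<ominus>\<^bsub>A ?n ?m\<^esub> d r n m ?c \<in> Bs r ?n ?m"
    using BD(3)[OF a(2) e] A'.minus_add_minus[OF BD(1)[OF b(1)] da dc] by simp
  then have "f = D r n m (\<psi> n m ?c)"
    unfolding D_\<psi>[OF assms c] b(2) using \<pi>_eqI[OF BD(1)[OF b(1)] dc] by simp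
  then show "f \<in> D r n m ` carrier (page r n m)" using c by (auto simp: page_def)
qed

text \<open>Cycles of \<open>D\<close> are the classes of \<open>C r \<inter> Zs (Suc r)\<close>,
  and boundaries are the classes coming from \<open>Bs (Suc r)\<close>. Projecting again with
  \<open>\<pi> (Suc r)\<close> maps the cycles onto the next page, and its kernel is exactly the
  boundaries.\<close>

lemma page_Suc_iso:
  assumes "2 \<le> r"
  shows "linearly_isomorphic R (page (Suc r) n m) (quotient_module
    ((page r n m)\<lparr>carrier := a_kernel (page r n m) (page r (n + int r) (m + 1 - int r)) (D r n m)\<rparr>)
    (D r (n - int r) (m - 1 + int r) ` carrier (page r (n - int r) (m - 1 + int r))))"
proof -
  let ?n = "n + int r" and ?m = "m + 1 - int r"
  let ?I = "(\<lambda>b. \<psi> n m (\<pi> r n m b)) ` Bs (Suc r) n m"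
  let ?k = "\<psi> n m ` (C r n m \<inter> Zs (Suc r) n m)"
  have S: "2 \<le> Suc r" using assms by simp
  interpret A: module R "A n m" by (rule mA)
  have I: "D r (n - int r) (m - 1 + int r) ` carrier (page r (n - int r) (m - 1 + int r)) = ?I"
    using D_image[OF assms, of "n - int r" "m - 1 + int r"] by simp
  have k: "a_kernel (page r n m) (page r ?n ?m) (D r n m) = ?k"
    using D_zero_iff[OF assms] unfolding a_kernel_def' page_def by auto
  have sk: "submodule ?k R (E n m)"
  proof (rule submodule_image[OF mZ2 mE \<psi>_lin submodule_restrict[OF mA sZ submodule_Int[OF mA sC sZ]]])
    show "C r n m \<inter> Zs (Suc r) n m \<subseteq> Zs 2 n m" using C_Z2[OF assms] by blast
  qed
  let ?V = "(E n m)\<lparr>carrier := ?k\<rparr>"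
  have mV: "module R ?V" by (rule module_submodule[OF mE sk])
  have bC: "\<pi> r n m b \<in> C r n m \<inter> Zs (Suc r) n m" if "b \<in> Bs (Suc r) n m" for b
    using that B_sub_Z[OF S assms, of n m] B_sub_Z[OF S S, of n m] \<pi>_Z[OF assms S] unfolding C_def by auto
  have lc: "(\<lambda>b. \<psi> n m (\<pi> r n m b)) \<in> lin ((A n m)\<lparr>carrier := Bs (Suc r) n m\<rparr>) (E n m)"
  proof (rule linearI)
    note l = linearD[OF \<pi>_lin[of r n m]] and z = C_Z2[OF assms, THEN \<psi>_closed]
    have b2: "\<pi> r n m b \<in> Zs 2 n m" if "b \<in> Bs (Suc r) n m" for b using bC[OF that] C_Z2[OF assms] by blast
    show "\<psi> n m (\<pi> r n m x) \<in> carrier (E n m)" if "x \<in> carrier ((A n m)\<lparr>carrier := Bs (Suc r) n m\<rparr>)" for x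
      using that b2 \<psi>_closed by simp
    show "\<psi> n m (\<pi> r n m (x \<oplus>\<^bsub>(A n m)\<lparr>carrier := Bs (Suc r) n m\<rparr>\<^esub> y)) = \<psi> n m (\<pi> r n m x) \<oplus>\<^bsub>E n m\<^esub> \<psi> n m (\<pi> r n m y)"
      if "x \<in> carrier ((A n m)\<lparr>carrier := Bs (Suc r) n m\<rparr>)" "y \<in> carrier ((A n m)\<lparr>carrier := Bs (Suc r) n m\<rparr>)" for x y
      using that b2 \<psi>_add l(2) BD(1) by simp
    show "\<psi> n m (\<pi> r n m (a \<odot>\<^bsub>(A n m)\<lparr>carrier := Bs (Suc r) n m\<rparr>\<^esub> x)) = a \<odot>\<^bsub>E n m\<^esub> \<psi> n m (\<pi> r n m x)"
      if "a \<in> carrier R" "x \<in> carrier ((A n m)\<lparr>carrier := Bs (Suc r) n m\<rparr>)" for a x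
      using that b2 \<psi>_smult l(3) BD(1) by simp
  qed
  have mB: "module R ((A n m)\<lparr>carrier := Bs (Suc r) n m\<rparr>)" by (rule module_submodule[OF mA sB])
  have sI0: "submodule ?I R (E n m)"
    using submodule_image[OF mB mE lc submodule_carrier[OF mB]] by simp
  have sI: "submodule ?I R ?V"
    by (rule submodule_restrict[OF mE sk sI0]) (use bC in blast)
  define f where "f e = \<psi> n m (\<pi> (Suc r) n m (\<chi> r n m e))" for e
  have f: "f (\<psi> n m c) = \<psi> n m (\<pi> (Suc r) n m c)" if "c \<in> C r n m" for c unfolding f_def \<chi>_\<psi>[OF assms that] ..
  have pc: "\<pi> (Suc r) n m c \<in> C (Suc r) n m" if "c \<in> Zs (Suc r) n m" for c using that unfolding C_def by blast
  have "linearly_isomorphic R (page (Suc r) n m) (quotient_module ?V ?I)"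
  proof (rule linearly_isomorphic_quotientI'[OF mV sI module_page[OF S]])
    show "f \<in> lin ?V (page (Suc r) n m)"
    proof (rule linearI)
      note l = linearD[OF \<pi>_lin[of "Suc r" n m]] and z = C_Z2[OF S]
      fix e assume "e \<in> carrier ?V"
      then obtain c where c: "c \<in> C r n m" "c \<in> Zs (Suc r) n m" "e = \<psi> n m c" by auto
      show "f e \<in> carrier (page (Suc r) n m)" unfolding c(3) f[OF c(1)] using pc[OF c(2)] by (simp add: page_def)
      fix a assume a: "a \<in> carrier R"
      have "a \<odot>\<^bsub>?V\<^esub> e = \<psi> n m (a \<odot>\<^bsub>A n m\<^esub> c)" using c C_Z2[OF assms] \<psi>_smult a by simp
      then show "f (a \<odot>\<^bsub>?V\<^esub> e) = a \<odot>\<^bsub>page (Suc r) n m\<^esub> f e"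
        unfolding c(3) f[OF c(1)] using f[OF CD(4)[OF a c(1)]] l(3)[OF a CD(1)[OF c(1)]] \<psi>_smult[OF a z[OF pc[OF c(2)]]]
        by (simp add: page_def)
    next
      note l = linearD[OF \<pi>_lin[of "Suc r" n m]] and z = C_Z2[OF S]
      fix e g assume "e \<in> carrier ?V" "g \<in> carrier ?V"
      then obtain b c where h: "b \<in> C r n m" "b \<in> Zs (Suc r) n m" "e = \<psi> n m b"
        "c \<in> C r n m" "c \<in> Zs (Suc r) n m" "g = \<psi> n m c" by auto
      have "e \<oplus>\<^bsub>?V\<^esub> g = \<psi> n m (b \<oplus>\<^bsub>A n m\<^esub> c)" using h C_Z2[OF assms] \<psi>_add by simp
      then show "f (e \<oplus>\<^bsub>?V\<^esub> g) = f e \<oplus>\<^bsub>page (Suc r) n m\<^esub> f g"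
        unfolding h(3,6) f[OF h(1)] f[OF h(4)] using f[OF CD(3)[OF h(1,4)]] l(2)[OF CD(1)[OF h(1)] CD(1)[OF h(4)]]
          \<psi>_add[OF z[OF pc[OF h(2)]] z[OF pc[OF h(5)]]]
        by (simp add: page_def)
    qed
  next
    fix e assume "e \<in> carrier ?V"
    then obtain c where c: "c \<in> C r n m" "c \<in> Zs (Suc r) n m" "e = \<psi> n m c" by auto
    have "f e = \<zero>\<^bsub>page (Suc r) n m\<^esub> \<longleftrightarrow> c \<in> Bs (Suc r) n m"
      unfolding c(3) f[OF c(1)] page_def using \<psi>_C_zero[OF S pc[OF c(2)]] \<pi>_eq_zero_iff[OF CD(1)[OF c(1)], of "Suc r"] by simp
    also have "\<dots> \<longleftrightarrow> e \<in> ?I"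
    proof
      assume "c \<in> Bs (Suc r) n m"
      then show "e \<in> ?I" using C_iff[OF assms] c(1,3) by (metis (no_types, lifting) imageI)
    next
      assume "e \<in> ?I"
      then obtain b where b: "b \<in> Bs (Suc r) n m" "e = \<psi> n m (\<pi> r n m b)" by blast
      have "c = \<pi> r n m b" using \<chi>_\<psi>[OF assms] c(1,3) b(2) bC[OF b(1)] by (metis IntD1)
      moreover have "b \<ominus>\<^bsub>A n m\<^esub> \<pi> r n m b \<in> Bs (Suc r) n m"
        using diff_\<pi>[OF BD(1)[OF b(1)], of r] B_mono[OF assms] by blast
      ultimately have "b \<ominus>\<^bsub>A n m\<^esub> (b \<ominus>\<^bsub>A n m\<^esub> c) \<in> Bs (Suc r) n m" using BD(6)[OF b(1)] by simp
      moreover have "b \<ominus>\<^bsub>A n m\<^esub> (b \<ominus>\<^bsub>A n m\<^esub> c) = c"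
        using BD(1)[OF b(1)] CD(1)[OF c(1)] by (simp add: a_minus_def A.minus_add A.r_neg1 A.r_neg2)
      ultimately show "c \<in> Bs (Suc r) n m" by simp
    qed
    finally show "f e = \<zero>\<^bsub>page (Suc r) n m\<^esub> \<longleftrightarrow> e \<in> ?I" .
  next
    fix g assume "g \<in> carrier (page (Suc r) n m)"
    then obtain z where z: "z \<in> Zs (Suc r) n m" "g = \<psi> n m (\<pi> (Suc r) n m z)" by (auto simp: page_def C_def)
    have zr: "z \<in> Zs r n m" using Z_mono[OF assms] z(1) by blast
    have c: "\<pi> r n m z \<in> C r n m" using zr unfolding C_def by blast
    have "f (\<psi> n m (\<pi> r n m z)) = g" unfolding f[OF c] z(2) using \<pi>_\<pi>[OF ZD(1)[OF zr] assms, of "Suc r"] by simp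
    moreover have "\<psi> n m (\<pi> r n m z) \<in> ?k" using c \<pi>_Z[OF assms S z(1)] by blast
    ultimately show "\<exists>x\<in>carrier ?V. g = f x" by (intro bexI[of _ "\<psi> n m (\<pi> r n m z)"]) simp_all
  qed
  then show ?thesis unfolding I k by (simp add: page_def)
qed

lemma spectral_sequence_page: "spectral_sequence R page D"
  unfolding spectral_sequence_def
proof (intro allI impI conjI)
  fix r :: nat and n m :: int assume r: "2 \<le> r"
  show "module R (page r n m)" by (rule module_page[OF r])
  show "D r n m \<in> lin (page r n m) (page r (n + int r) (m + 1 - int r))" by (rule D_lin[OF r])
  show "linearly_isomorphic R (page (Suc r) n m) (quotient_module
    ((page r n m)\<lparr>carrier := a_kernel (page r n m) (page r (n + int r) (m + 1 - int r)) (D r n m)\<rparr>)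
    (D r (n - int r) (m - 1 + int r) ` carrier (page r (n - int r) (m - 1 + int r))))" by (rule page_Suc_iso[OF r])
  assume "n < 0 \<or> m < 0"
  then have "\<psi> n m ` C r n m \<subseteq> {\<zero>\<^bsub>E n m\<^esub>}" using E_zero C_Z2[OF r] \<psi>_closed by blast
  then show "carrier (page r n m) = {\<zero>\<^bsub>page r n m\<^esub>}"
    using submoduleD(2)[OF mE submodule_page[OF r, of n m]] by (auto simp: page_def)
next
  fix r :: nat and n m :: int assume r: "2 \<le> r"
  show "\<forall>x\<in>carrier (page r n m). D r (n + int r) (m + 1 - int r) (D r n m x) =
      \<zero>\<^bsub>page r (n + int r + int r) (m + 1 - int r + 1 - int r)\<^esub>"
    using D_D[OF r] by (simp add: page_def)
qed

end

section \<open>The spectral sequence of a double complex\<close>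

locale double_complex = field R for R (structure) +
  fixes A :: "int \<Rightarrow> int \<Rightarrow> ('a, 'x, 'c) module_scheme" and dh dv :: "int \<Rightarrow> int \<Rightarrow> 'x \<Rightarrow> 'x"
  assumes mA: "module R (A n m)"
    and A_zero: "n < 0 \<or> m < 0 \<Longrightarrow> carrier (A n m) = {\<zero>\<^bsub>A n m\<^esub>}"
    and dh_lin: "dh n m \<in> lin (A n m) (A (n + 1) m)"
    and dv_lin: "dv n m \<in> lin (A n m) (A n (m + 1))"
    and dh_dh: "x \<in> carrier (A n m) \<Longrightarrow> dh (n + 1) m (dh n m x) = \<zero>\<^bsub>A (n + 1 + 1) m\<^esub>"
    and dv_dv: "x \<in> carrier (A n m) \<Longrightarrow> dv n (m + 1) (dv n m x) = \<zero>\<^bsub>A n (m + 1 + 1)\<^esub>"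
    and anticommute: "x \<in> carrier (A n m) \<Longrightarrow>
      dh n (m + 1) (dv n m x) \<oplus>\<^bsub>A (n + 1) (m + 1)\<^esub> dv (n + 1) m (dh n m x) = \<zero>\<^bsub>A (n + 1) (m + 1)\<^esub>"
begin

text \<open>As \<open>A_zero\<close> kills the components outside \<open>0..s\<close>, this product
  over all integers is at the same time the direct sum.\<close>

definition tot :: "int \<Rightarrow> ('a, int \<Rightarrow> 'x) module"
  where "tot s = \<lparr>carrier = {x. \<forall>i. x i \<in> carrier (A i (s - i))}, mult = undefined, one = undefined,
    zero = (\<lambda>i. \<zero>\<^bsub>A i (s - i)\<^esub>), add = (\<lambda>x y i. x i \<oplus>\<^bsub>A i (s - i)\<^esub> y i), smult = (\<lambda>a x i. a \<odot>\<^bsub>A i (s - i)\<^esub> x i)\<rparr>"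

lemma tot_simps [simp]:
  "x \<in> carrier (tot s) \<longleftrightarrow> (\<forall>i. x i \<in> carrier (A i (s - i)))" "\<zero>\<^bsub>tot s\<^esub> = (\<lambda>i. \<zero>\<^bsub>A i (s - i)\<^esub>)"
  "x \<oplus>\<^bsub>tot s\<^esub> y = (\<lambda>i. x i \<oplus>\<^bsub>A i (s - i)\<^esub> y i)" "a \<odot>\<^bsub>tot s\<^esub> x = (\<lambda>i. a \<odot>\<^bsub>A i (s - i)\<^esub> x i)"
  by (simp_all add: tot_def)

lemma aA: "abelian_group (A n m)"
  by (rule module.axioms(2)[OF mA])

lemmas A_simps = abelian_monoid.a_closed[OF abelian_group.axioms(1)[OF aA]]
  abelian_monoid.zero_closed[OF abelian_group.axioms(1)[OF aA]] abelian_group.a_inv_closed[OF aA]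
  module.smult_closed[OF mA]

lemma m_tot: "module R (tot s)"
proof (rule moduleI[OF is_cring])
  show "abelian_group (tot s)"
  proof (rule abelian_groupI, goal_cases)
    case (3 x y z)
    then show ?case using abelian_monoid.a_assoc[OF abelian_group.axioms(1)[OF aA]] by simp
  next
    case (4 x y)
    then show ?case using abelian_monoid.a_comm[OF abelian_group.axioms(1)[OF aA]] by simp
  next
    case (5 x)
    then show ?case using abelian_monoid.l_zero[OF abelian_group.axioms(1)[OF aA]] by simp
  next
    case (6 x)
    then show ?case using abelian_group.l_neg[OF aA] A_simps(3)
      by (intro bexI[of _ "\<lambda>i. \<ominus>\<^bsub>A i (s - i)\<^esub> x i"]) simp_all
  qed (simp_all add: A_simps)
qed (simp_all add: A_simps module.smult_l_distr[OF mA] module.smult_r_distr[OF mA] module.smult_assoc1[OF mA] module.smult_one[OF mA])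

lemma ev_lin: "(\<lambda>x. x i) \<in> lin (tot s) (A i (s - i))"
  by (rule linearI) simp_all

lemma tot_minus: "\<lbrakk>x \<in> carrier (tot s); y \<in> carrier (tot s)\<rbrakk> \<Longrightarrow> (x \<ominus>\<^bsub>tot s\<^esub> y) i = x i \<ominus>\<^bsub>A i (s - i)\<^esub> y i"
  using linear_minus[OF m_tot mA ev_lin] .

text \<open>No sign is inserted, because the squares of the double complex already
  anticommute.\<close>

definition td :: "int \<Rightarrow> (int \<Rightarrow> 'x) \<Rightarrow> int \<Rightarrow> 'x"
  where "td s x i = dh (i - 1) (s + 1 - i) (x (i - 1)) \<oplus>\<^bsub>A i (s + 1 - i)\<^esub> dv i (s - i) (x i)"

lemma dh_lin': "dh (i - 1) m \<in> lin (A (i - 1) m) (A i m)"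
  using dh_lin[of "i - 1" m] by simp

lemma dv_lin': "dv i (s - i) \<in> lin (A i (s - i)) (A i (s + 1 - i))"
proof -
  have e: "s - i + 1 = s + 1 - i" by simp
  show ?thesis using dv_lin[of i "s - i"] unfolding e .
qed

lemma ev_lin': "(\<lambda>x. x (i - 1)) \<in> lin (tot s) (A (i - 1) (s + 1 - i))"
proof -
  have e: "s - (i - 1) = s + 1 - i" by simp
  show ?thesis using ev_lin[of "i - 1" s] unfolding e .
qed

lemma td_lin: "td s \<in> lin (tot s) (tot (s + 1))"
proof -
  have l: "(\<lambda>x. td s x i) \<in> lin (tot s) (A i (s + 1 - i))" for i
    unfolding td_def by (rule linear_add[OF mA linear_comp[OF dh_lin' ev_lin'] linear_comp[OF dv_lin' ev_lin]])
  note lD = linearD[OF l]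
  show ?thesis
  proof (rule linearI)
    show "td s x \<in> carrier (tot (s + 1))" if "x \<in> carrier (tot s)" for x using lD(1)[OF that] unfolding tot_simps by blast
    show "td s (x \<oplus>\<^bsub>tot s\<^esub> y) = td s x \<oplus>\<^bsub>tot (s + 1)\<^esub> td s y" if "x \<in> carrier (tot s)" "y \<in> carrier (tot s)" for x y
      by (rule ext) (use lD(2)[OF that] in \<open>simp only: tot_simps\<close>)
    show "td s (a \<odot>\<^bsub>tot s\<^esub> x) = a \<odot>\<^bsub>tot (s + 1)\<^esub> td s x" if "a \<in> carrier R" "x \<in> carrier (tot s)" for a x
      by (rule ext) (use lD(3)[OF that] in \<open>simp only: tot_simps\<close>)
  qed
qed

lemmas td_closed = linearD(1)[OF td_lin]

lemma td_minus: "\<lbrakk>x \<in> carrier (tot s); y \<in> carrier (tot s)\<rbrakk> \<Longrightarrow> td s (x \<ominus>\<^bsub>tot s\<^esub> y) = td s x \<ominus>\<^bsub>tot (s + 1)\<^esub> td s y"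
  using linear_minus[OF m_tot m_tot td_lin] .

lemma td_td:
  assumes x: "x \<in> carrier (tot s)" shows "td (s + 1) (td s x) = \<zero>\<^bsub>tot (s + 1 + 1)\<^esub>"
proof
  fix i
  let ?B = "A i (s + 1 + 1 - i)"
  interpret B: module R ?B by (rule mA)
  \<comment> \<open>The row indices occur as several syntactically different integers; expressing
    them through \<open>j\<close> makes the spaces involved match literally.\<close>
  define j where "j = s + 1 - i"
  have ji: "s - i + 1 = j" "s + 1 - i = j" "s + 1 + 1 - i = j + 1" "s - i = j - 1" "s + 1 - (i - 1) = j + 1"
    "s - (i - 1) = j" "s - (i - 1 - 1) = j + 1" by (simp_all add: j_def)
  have x0: "x i \<in> carrier (A i (j - 1))" and x1: "x (i - 1) \<in> carrier (A (i - 1) j)"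
    and x2: "x (i - 1 - 1) \<in> carrier (A (i - 1 - 1) (j + 1))"
    using x ji by (metis tot_simps(1))+
  let ?a = "dh (i - 1 - 1) (j + 1) (x (i - 1 - 1))" and ?b = "dv (i - 1) j (x (i - 1))"
  let ?c = "dh (i - 1) j (x (i - 1))" and ?e = "dv i (j - 1) (x i)"
  have a: "?a \<in> carrier (A (i - 1) (j + 1))" and b: "?b \<in> carrier (A (i - 1) (j + 1))"
    and c: "?c \<in> carrier (A i j)" and e: "?e \<in> carrier (A i j)"
    using linearD(1)[OF dh_lin' x2] linearD(1)[OF dv_lin x1] linearD(1)[OF dh_lin' x1]
      linearD(1)[OF dv_lin x0] by simp_all
  have "td (s + 1) (td s x) i = dh (i - 1) (j + 1) (?a \<oplus>\<^bsub>A (i - 1) (j + 1)\<^esub> ?b) \<oplus>\<^bsub>A i (j + 1)\<^esub>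
      dv i j (?c \<oplus>\<^bsub>A i j\<^esub> ?e)"
    unfolding td_def ji ..
  also have "\<dots> = (dh (i - 1) (j + 1) ?a \<oplus>\<^bsub>A i (j + 1)\<^esub> dh (i - 1) (j + 1) ?b) \<oplus>\<^bsub>A i (j + 1)\<^esub>
      (dv i j ?c \<oplus>\<^bsub>A i (j + 1)\<^esub> dv i j ?e)"
    using linearD(2)[OF dh_lin' a b] linearD(2)[OF dv_lin c e] by simp
  also have "dh (i - 1) (j + 1) ?a = \<zero>\<^bsub>A i (j + 1)\<^esub>" using dh_dh[OF x2] by simp
  also have "dv i j ?e = \<zero>\<^bsub>A i (j + 1)\<^esub>" using dv_dv[OF x0] by simp
  also have "(\<zero>\<^bsub>A i (j + 1)\<^esub> \<oplus>\<^bsub>A i (j + 1)\<^esub> dh (i - 1) (j + 1) ?b) \<oplus>\<^bsub>A i (j + 1)\<^esub> (dv i j ?c \<oplus>\<^bsub>A i (j + 1)\<^esub> \<zero>\<^bsub>A i (j + 1)\<^esub>) =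
      dh (i - 1) (j + 1) ?b \<oplus>\<^bsub>A i (j + 1)\<^esub> dv i j ?c"
    using linearD(1)[OF dh_lin' b] linearD(1)[OF dv_lin c] B.l_zero B.r_zero unfolding ji by simp
  also have "\<dots> = \<zero>\<^bsub>A i (j + 1)\<^esub>" using anticommute[OF x1] by simp
  finally show "td (s + 1) (td s x) i = \<zero>\<^bsub>tot (s + 1 + 1)\<^esub> i" unfolding tot_simps(2) ji .
qed

section \<open>The column filtration with its cycles and boundaries\<close>

definition Fil :: "int \<Rightarrow> int \<Rightarrow> (int \<Rightarrow> 'x) set"
  where "Fil p s = {x \<in> carrier (tot s). \<forall>i<p. x i = \<zero>\<^bsub>A i (s - i)\<^esub>}"

lemma FilI: "\<lbrakk>x \<in> carrier (tot s); \<And>i. i < p \<Longrightarrow> x i = \<zero>\<^bsub>A i (s - i)\<^esub>\<rbrakk> \<Longrightarrow> x \<in> Fil p s"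
  unfolding Fil_def by blast

lemma FilD: assumes "x \<in> Fil p s" shows "x \<in> carrier (tot s)" "i < p \<Longrightarrow> x i = \<zero>\<^bsub>A i (s - i)\<^esub>"
  using assms unfolding Fil_def by blast+

lemma sFil: "submodule (Fil p s) R (tot s)"
proof (rule submoduleI'[OF m_tot])
  show "Fil p s \<subseteq> carrier (tot s)" unfolding Fil_def by blast
  show "\<zero>\<^bsub>tot s\<^esub> \<in> Fil p s" unfolding Fil_def by (simp add: A_simps)
  fix x y assume "x \<in> Fil p s" "y \<in> Fil p s"
  note h = FilD[OF this(1)] FilD[OF this(2)]
  show "x \<oplus>\<^bsub>tot s\<^esub> y \<in> Fil p s"
  proof (rule FilI)
    show "x \<oplus>\<^bsub>tot s\<^esub> y \<in> carrier (tot s)" using h by (simp add: A_simps)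
    show "(x \<oplus>\<^bsub>tot s\<^esub> y) i = \<zero>\<^bsub>A i (s - i)\<^esub>" if "i < p" for i
      using h(2,4)[OF that] abelian_monoid.l_zero[OF abelian_group.axioms(1)[OF aA]] A_simps(2) by simp
  qed
next
  fix a x assume a: "a \<in> carrier R" and "x \<in> Fil p s"
  note h = FilD[OF this(2)]
  show "a \<odot>\<^bsub>tot s\<^esub> x \<in> Fil p s"
  proof (rule FilI)
    show "a \<odot>\<^bsub>tot s\<^esub> x \<in> carrier (tot s)" using h a by (simp add: A_simps)
    show "(a \<odot>\<^bsub>tot s\<^esub> x) i = \<zero>\<^bsub>A i (s - i)\<^esub>" if "i < p" for i
      using h(2)[OF that] module.smult_r_null[OF mA a] by simp
  qed
qed

lemmas FilS = submoduleD[OF m_tot sFil]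

lemma Fil_mono: "p \<le> q \<Longrightarrow> Fil q s \<subseteq> Fil p s"
  unfolding Fil_def by auto

lemma Fil_nonpos: "p \<le> 0 \<Longrightarrow> Fil p s = carrier (tot s)"
proof (intro equalityI subsetI)
  fix x assume p: "p \<le> 0" and x: "x \<in> carrier (tot s)"
  show "x \<in> Fil p s"
  proof (rule FilI[OF x])
    fix i assume "i < p"
    then show "x i = \<zero>\<^bsub>A i (s - i)\<^esub>" using x A_zero[of i "s - i"] p by auto
  qed
qed (simp add: Fil_def)

text \<open>Components in columns beyond \<open>s\<close> lie in negative rows. Together with
  \<open>Fil_nonpos\<close> this makes the filtration finite in each total degree, which is the
  source of convergence.\<close>

lemma Fil_above:
  assumes "s < p" "x \<in> Fil p s" shows "x = \<zero>\<^bsub>tot s\<^esub>"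
proof
  fix i
  show "x i = \<zero>\<^bsub>tot s\<^esub> i"
  proof (cases "i < p")
    case True then show ?thesis using FilD(2)[OF assms(2)] by simp
  next
    case False
    then show ?thesis using FilD(1)[OF assms(2)] A_zero[of i "s - i"] assms(1) by auto
  qed
qed

lemma Fil_Suc: "\<lbrakk>x \<in> Fil p s; x p = \<zero>\<^bsub>A p (s - p)\<^esub>\<rbrakk> \<Longrightarrow> x \<in> Fil (p + 1) s"
  unfolding Fil_def by (auto simp: order_le_less)

definition W :: "int \<Rightarrow> int \<Rightarrow> int \<Rightarrow> (int \<Rightarrow> 'x) set"
  where "W p q s = {x \<in> Fil p s. td s x \<in> Fil q (s + 1)}"

lemma sW: "submodule (W p q s) R (tot s)"
proof -
  have "W p q s = Fil p s \<inter> {x \<in> carrier (tot s). td s x \<in> Fil q (s + 1)}"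
    unfolding W_def using FilD(1) by blast
  then show ?thesis using submodule_Int[OF m_tot sFil submodule_vimage[OF m_tot m_tot td_lin sFil]] by simp
qed

lemmas WS = submoduleD[OF m_tot sW]

lemma W_iff: "x \<in> W p q s \<longleftrightarrow> x \<in> Fil p s \<and> td s x \<in> Fil q (s + 1)"
  by (simp add: W_def)

text \<open>The classical approximate cycles of order \<open>r\<close>, taken modulo the next
  filtration step, i.e. recorded by their leading component, so that they form a subspace of
  \<open>A n m\<close>.\<close>

definition Zs :: "nat \<Rightarrow> int \<Rightarrow> int \<Rightarrow> 'x set"
  where "Zs r n m = (\<lambda>x. x n) ` W n (n + int r) (n + m)"

text \<open>Leading components of boundaries of elements at most \<open>r - 1\<close> filtration
  steps lower, whence the index \<open>n - r + 1\<close>.\<close>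

definition Bs :: "nat \<Rightarrow> int \<Rightarrow> int \<Rightarrow> 'x set"
  where "Bs r n m = (\<lambda>x. td (n + m - 1) x n) ` W (n - int r + 1) n (n + m - 1)"

lemma ev_lin'': "(\<lambda>x. x n) \<in> lin (tot (n + m)) (A n m)"
  using ev_lin[of n "n + m"] by simp

lemma td_lin': "td (s - 1) \<in> lin (tot (s - 1)) (tot s)"
  using td_lin[of "s - 1"] by simp

lemma sZs: "submodule (Zs r n m) R (A n m)"
  unfolding Zs_def by (rule submodule_image[OF m_tot mA ev_lin'' sW])

lemma sBs: "submodule (Bs r n m) R (A n m)"
  unfolding Bs_def by (rule submodule_image[OF m_tot mA linear_comp[OF ev_lin'' td_lin'] sW])

text \<open>A pseudo-inverse of the leading component on \<open>W p q s\<close>, that is, a linear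
  choice of an approximate cycle above each leading component.\<close>

definition lift :: "int \<Rightarrow> int \<Rightarrow> int \<Rightarrow> 'x \<Rightarrow> int \<Rightarrow> 'x"
  where "lift p q s = (SOME g. g \<in> lin (A p (s - p)) ((tot s)\<lparr>carrier := W p q s\<rparr>) \<and>
    (\<forall>x\<in>W p q s. g (x p) p = x p))"

lemma lift:
  shows "lift p q s \<in> lin (A p (s - p)) ((tot s)\<lparr>carrier := W p q s\<rparr>)"
    "x \<in> W p q s \<Longrightarrow> lift p q s (x p) p = x p"
proof -
  have l: "(\<lambda>x. x p) \<in> lin ((tot s)\<lparr>carrier := W p q s\<rparr>) (A p (s - p))"
    by (rule linear_restrict_dom[OF ev_lin]) (use WS(1) in blast)
  have "\<exists>g. g \<in> lin (A p (s - p)) ((tot s)\<lparr>carrier := W p q s\<rparr>) \<and> (\<forall>x\<in>W p q s. g (x p) p = x p)"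
    using exists_pseudo_inverse[OF module_submodule[OF m_tot sW] mA l] unfolding Bex_def by simp
  from someI_ex[OF this] show "lift p q s \<in> lin (A p (s - p)) ((tot s)\<lparr>carrier := W p q s\<rparr>)"
    "x \<in> W p q s \<Longrightarrow> lift p q s (x p) p = x p" unfolding lift_def by blast+
qed

lemma lift_lin: "lift p q s \<in> lin (A p (s - p)) (tot s)"
proof -
  note l = linearD[OF lift(1)[of p q s], simplified]
  show ?thesis by (rule linearI) (use l WS(1)[of _ p q s] in simp_all)
qed

lemma lift_W: "a \<in> carrier (A p (s - p)) \<Longrightarrow> lift p q s a \<in> W p q s"
  using linearD(1)[OF lift(1)] by simp

definition zd :: "nat \<Rightarrow> int \<Rightarrow> int \<Rightarrow> 'x \<Rightarrow> 'x"
  where "zd r n m a = td (n + m) (lift n (n + int r) (n + m) a) (n + int r)"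

lemma Zs_lift:
  assumes "a \<in> Zs r n m"
  shows "lift n (n + int r) (n + m) a \<in> W n (n + int r) (n + m)" "lift n (n + int r) (n + m) a n = a"
proof -
  obtain x where x: "x \<in> W n (n + int r) (n + m)" "a = x n" using assms unfolding Zs_def by blast
  have "a \<in> carrier (A n m)" using submoduleD(1)[OF mA sZs assms] .
  then show "lift n (n + int r) (n + m) a \<in> W n (n + int r) (n + m)" using lift_W[of a n "n + m"] by simp
  show "lift n (n + int r) (n + m) a n = a" unfolding x(2) by (rule lift(2)[OF x(1)])
qed

lemma zd_lin: "zd r n m \<in> lin (A n m) (A (n + int r) (m + 1 - int r))"
proof -
  have e: "n + m + 1 - (n + int r) = m + 1 - int r" by simp
  have "lift n (n + int r) (n + m) \<in> lin (A n m) (tot (n + m))" using lift_lin[of n "n + int r" "n + m"] by simp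
  then show ?thesis unfolding zd_def
    using linear_comp[OF ev_lin[of "n + int r" "n + m + 1"] linear_comp[OF td_lin]] e by simp
qed

text \<open>The first two inclusions reflect that the filtration decreases. In the third,
  \<open>r\<close> and \<open>q\<close> are independent, because a total boundary has zero
  differential, which lies in every filtration step.\<close>

lemma Z_B_mono:
  "Zs (Suc r) n m \<subseteq> Zs r n m" "Bs r n m \<subseteq> Bs (Suc r) n m" "Bs r n m \<subseteq> Zs q n m"
proof -
  have "W n (n + int (Suc r)) (n + m) \<subseteq> W n (n + int r) (n + m)"
    unfolding W_def using Fil_mono[of "n + int r" "n + int (Suc r)"] by auto
  then show "Zs (Suc r) n m \<subseteq> Zs r n m" unfolding Zs_def by blast
  have "W (n - int r + 1) n (n + m - 1) \<subseteq> W (n - int (Suc r) + 1) n (n + m - 1)"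
    unfolding W_def using Fil_mono[of "n - int (Suc r) + 1" "n - int r + 1"] by auto
  then show "Bs r n m \<subseteq> Bs (Suc r) n m" unfolding Bs_def by blast
  show "Bs r n m \<subseteq> Zs q n m"
  proof
    fix b assume "b \<in> Bs r n m"
    then obtain x where x: "x \<in> W (n - int r + 1) n (n + m - 1)" "b = td (n + m - 1) x n" unfolding Bs_def by blast
    have xc: "x \<in> carrier (tot (n + m - 1))" using x(1) WS(1) by blast
    have "td (n + m) (td (n + m - 1) x) = \<zero>\<^bsub>tot (n + m + 1)\<^esub>" using td_td[OF xc] by (simp del: tot_simps)
    then have "td (n + m) (td (n + m - 1) x) \<in> Fil (n + int q) (n + m + 1)" using FilS(2) by metis
    moreover have "td (n + m - 1) x \<in> Fil n (n + m)" using x(1) unfolding W_iff by simp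
    ultimately have "td (n + m - 1) x \<in> W n (n + int q) (n + m)" unfolding W_iff by blast
    then show "b \<in> Zs q n m" unfolding Zs_def x(2) by blast
  qed
qed

lemma zd_B:
  assumes "a \<in> Zs r n m" shows "zd r n m a \<in> Bs (Suc r) (n + int r) (m + 1 - int r)"
proof -
  have e: "n + int r + (m + 1 - int r) - 1 = n + m" "n + int r - int (Suc r) + 1 = n" by simp_all
  show ?thesis unfolding Bs_def zd_def e using Zs_lift(1)[OF assms] by blast
qed

text \<open>Two lifts of one leading component differ in filtration \<open>n + 1\<close>. With
  target column \<open>n + r\<close>, this is precisely the source filtration
  \<open>(n + r) - r + 1\<close> of \<open>Bs r\<close>.\<close>

lemma td_diff_Bs:
  assumes "x \<in> W n (n + int r) (n + m)" "y \<in> W n (n + int r) (n + m)" "x n = y n"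
  shows "td (n + m) x (n + int r) \<ominus>\<^bsub>A (n + int r) (m + 1 - int r)\<^esub> td (n + m) y (n + int r)
    \<in> Bs r (n + int r) (m + 1 - int r)"
proof -
  have e: "n + int r + (m + 1 - int r) - 1 = n + m" "n + int r - int r + 1 = n + 1" "n + m + 1 - (n + int r) = m + 1 - int r" by simp_all
  have xy: "x \<in> carrier (tot (n + m))" "y \<in> carrier (tot (n + m))" using assms WS(1) by blast+
  have w: "x \<ominus>\<^bsub>tot (n + m)\<^esub> y \<in> W n (n + int r) (n + m)" by (rule WS(6)[OF assms(1,2)])
  interpret A: module R "A n (n + m - n)" by (rule mA)
  have "y n \<in> carrier (A n (n + m - n))" using xy(2) unfolding tot_simps by blast
  then have "(x \<ominus>\<^bsub>tot (n + m)\<^esub> y) n = \<zero>\<^bsub>A n (n + m - n)\<^esub>"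
    unfolding tot_minus[OF xy] assms(3) by (rule A.minus_self)
  then have "x \<ominus>\<^bsub>tot (n + m)\<^esub> y \<in> W (n + 1) (n + int r) (n + m)"
    using w Fil_Suc unfolding W_iff by blast
  moreover have "td (n + m) (x \<ominus>\<^bsub>tot (n + m)\<^esub> y) (n + int r) =
      td (n + m) x (n + int r) \<ominus>\<^bsub>A (n + int r) (m + 1 - int r)\<^esub> td (n + m) y (n + int r)"
    unfolding td_minus[OF xy] tot_minus[OF td_closed[OF xy(1)] td_closed[OF xy(2)]] e(3) ..
  ultimately show ?thesis unfolding Bs_def e(1,2) by (metis imageI)
qed

text \<open>If the differential of the lift has the same leading component as that of some
  \<open>y\<close> in filtration \<open>n + 1\<close>, subtracting \<open>y\<close> keeps the
  leading component \<open>a\<close> and raises the order by one. Conversely, a lift of order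
  \<open>r + 1\<close> is compared with the chosen one through \<open>td_diff_Bs\<close>.\<close>

lemma zd_ker:
  assumes "a \<in> Zs r n m"
  shows "zd r n m a \<in> Bs r (n + int r) (m + 1 - int r) \<longleftrightarrow> a \<in> Zs (Suc r) n m"
proof
  let ?x = "lift n (n + int r) (n + m) a" and ?A = "A (n + int r) (m + 1 - int r)"
  have e: "n + int r + (m + 1 - int r) - 1 = n + m" "n + int r - int r + 1 = n + 1" "n + m + 1 - (n + int r) = m + 1 - int r" by simp_all
  note x = Zs_lift[OF assms]
  have xc: "?x \<in> carrier (tot (n + m))" using x(1) WS(1) by blast
  interpret A': module R ?A by (rule mA)
  { assume "zd r n m a \<in> Bs r (n + int r) (m + 1 - int r)"
    then obtain y where y: "y \<in> W (n + 1) (n + int r) (n + m)" "td (n + m) ?x (n + int r) = td (n + m) y (n + int r)"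
      unfolding Bs_def zd_def e by blast
    have yc: "y \<in> carrier (tot (n + m))" using y(1) WS(1) by blast
    have yF: "y \<in> W n (n + int r) (n + m)" using y(1) Fil_mono[of n "n + 1"] unfolding W_iff by auto
    let ?z = "?x \<ominus>\<^bsub>tot (n + m)\<^esub> y"
    have z: "?z \<in> W n (n + int r) (n + m)" by (rule WS(6)[OF x(1) yF])
    have "td (n + m) ?z (n + int r) = \<zero>\<^bsub>A (n + int r) (n + m + 1 - (n + int r))\<^esub>"
      unfolding td_minus[OF xc yc] tot_minus[OF td_closed[OF xc] td_closed[OF yc]] y(2) e
      using td_closed[OF yc] e(3) by (metis A'.minus_self tot_simps(1))
    then have "td (n + m) ?z \<in> Fil (n + int r + 1) (n + m + 1)" using z Fil_Suc unfolding W_iff by blast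
    then have "?z \<in> W n (n + int (Suc r)) (n + m)" using z unfolding W_iff by (simp add: add.commute add.left_commute)
    moreover have "?z n = a"
    proof -
      interpret A: module R "A n (n + m - n)" by (rule mA)
      have "y n = \<zero>\<^bsub>A n (n + m - n)\<^esub>" using y(1) FilD(2)[of y "n + 1" "n + m" n] unfolding W_iff by simp
      moreover have "?x n \<in> carrier (A n (n + m - n))" using xc unfolding tot_simps by blast
      ultimately show ?thesis unfolding tot_minus[OF xc yc] using x(2) A.minus_zero_right by metis
    qed
    ultimately show "a \<in> Zs (Suc r) n m" unfolding Zs_def by (metis imageI) }
  { assume "a \<in> Zs (Suc r) n m"
    then obtain y where y: "y \<in> W n (n + int (Suc r)) (n + m)" "a = y n" unfolding Zs_def by blast
    have yc: "y \<in> carrier (tot (n + m))" using y(1) WS(1) by blast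
    have yW: "y \<in> W n (n + int r) (n + m)" using y(1) Fil_mono[of "n + int r" "n + int (Suc r)"] unfolding W_iff by auto
    have "td (n + m) y (n + int r) = \<zero>\<^bsub>?A\<^esub>"
      using y(1) FilD(2)[of "td (n + m) y" "n + int (Suc r)" "n + m + 1" "n + int r"] e(3) unfolding W_iff by simp
    moreover have "td (n + m) ?x (n + int r) \<in> carrier ?A" using td_closed[OF xc] e(3) by (metis tot_simps(1))
    ultimately show "zd r n m a \<in> Bs r (n + int r) (m + 1 - int r)"
      using td_diff_Bs[OF x(1) yW] x(2) y(2) unfolding zd_def by (metis A'.minus_zero_right) }
qed

lemma zd_surj:
  assumes "b \<in> Bs (Suc r) (n + int r) (m + 1 - int r)"
  shows "\<exists>a\<in>Zs r n m. b \<ominus>\<^bsub>A (n + int r) (m + 1 - int r)\<^esub> zd r n m a \<in> Bs r (n + int r) (m + 1 - int r)"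
proof -
  have e: "n + int r + (m + 1 - int r) - 1 = n + m" "n + int r - int (Suc r) + 1 = n" by simp_all
  obtain x where x: "x \<in> W n (n + int r) (n + m)" "b = td (n + m) x (n + int r)"
    using assms unfolding Bs_def e by blast
  have a: "x n \<in> Zs r n m" using x(1) unfolding Zs_def by blast
  show ?thesis
    using td_diff_Bs[OF x(1) Zs_lift(1)[OF a] Zs_lift(2)[OF a, symmetric]] a unfolding x(2) zd_def by blast
qed

section \<open>Explicit cycles and boundaries of the second page\<close>

definition Z2 :: "int \<Rightarrow> int \<Rightarrow> 'x set"
  where "Z2 n m = {a \<in> carrier (A n m). dv n m a = \<zero>\<^bsub>A n (m + 1)\<^esub> \<and>
    (\<exists>b\<in>carrier (A (n + 1) (m - 1)). dh n m a \<oplus>\<^bsub>A (n + 1) m\<^esub> dv (n + 1) (m - 1) b = \<zero>\<^bsub>A (n + 1) m\<^esub>)}"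

definition B2 :: "int \<Rightarrow> int \<Rightarrow> 'x set"
  where "B2 n m = {dh (n - 1) m b \<oplus>\<^bsub>A n m\<^esub> dv n (m - 1) c | b c.
    b \<in> carrier (A (n - 1) m) \<and> c \<in> carrier (A n (m - 1)) \<and> dv (n - 1) m b = \<zero>\<^bsub>A (n - 1) (m + 1)\<^esub>}"

lemma dh_zero: "dh n m \<zero>\<^bsub>A n m\<^esub> = \<zero>\<^bsub>A (n + 1) m\<^esub>" and dv_zero: "dv n m \<zero>\<^bsub>A n m\<^esub> = \<zero>\<^bsub>A n (m + 1)\<^esub>"
  by (rule linear_zero[OF mA mA dh_lin] linear_zero[OF mA mA dv_lin])+

text \<open>For \<open>r = 2\<close> two adjacent columns are all that enters, so elements of this
  shape serve as witnesses for both \<open>Zs 2\<close> and \<open>Bs 2\<close>.\<close>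

definition two :: "int \<Rightarrow> int \<Rightarrow> 'x \<Rightarrow> 'x \<Rightarrow> int \<Rightarrow> 'x"
  where "two s p a b i = (if i = p then a else if i = p + 1 then b else \<zero>\<^bsub>A i (s - i)\<^esub>)"

lemma td_at:
  assumes "i - 1 = j" "s - i = k" "s + 1 - i = l"
  shows "td s x i = dh j l (x j) \<oplus>\<^bsub>A i l\<^esub> dv i k (x i)"
  using assms unfolding td_def by blast

lemma two_closed:
  assumes "a \<in> carrier (A p (s - p))" "b \<in> carrier (A (p + 1) (s - (p + 1)))"
  shows "two s p a b \<in> carrier (tot s)"
  using assms by (simp add: two_def A_simps)

lemma td_two_low:
  assumes "a \<in> carrier (A p (s - p))" "b \<in> carrier (A (p + 1) (s - (p + 1)))" "i < p"
  shows "td s (two s p a b) i = \<zero>\<^bsub>A i (s + 1 - i)\<^esub>"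
proof -
  interpret B: module R "A i (s + 1 - i)" by (rule mA)
  have e: "s - (i - 1) = s + 1 - i" "s - i + 1 = s + 1 - i" by simp_all
  have v: "two s p a b (i - 1) = \<zero>\<^bsub>A (i - 1) (s + 1 - i)\<^esub>" "two s p a b i = \<zero>\<^bsub>A i (s - i)\<^esub>"
    unfolding two_def e using assms(3) by auto
  have "dh (i - 1) (s + 1 - i) \<zero>\<^bsub>A (i - 1) (s + 1 - i)\<^esub> = \<zero>\<^bsub>A i (s + 1 - i)\<^esub>"
    using dh_zero[of "i - 1"] by simp
  moreover have "dv i (s - i) \<zero>\<^bsub>A i (s - i)\<^esub> = \<zero>\<^bsub>A i (s + 1 - i)\<^esub>" using dv_zero[of i "s - i"] unfolding e .
  ultimately show ?thesis unfolding td_def v by simp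
qed

text \<open>The differential has to vanish in columns \<open>n\<close> and \<open>n + 1\<close>,
  which gives the two equations of \<open>Z2\<close>; the component in column \<open>n + 1\<close>
  plays the role of \<open>b\<close>.\<close>

lemma Zs_2: "Zs 2 n m = Z2 n m"
proof (intro equalityI subsetI)
  have e: "n + m - n = m" "n + m + 1 - n = m + 1" "n + 1 - 1 = n" "n + m - (n + 1) = m - 1" "n + m + 1 - (n + 1) = m"
    "n + m - (n - 1) = m + 1" by simp_all
  interpret A: module R "A n (m + 1)" by (rule mA)
  interpret A1: module R "A (n + 1) m" by (rule mA)
  { fix a assume "a \<in> Zs 2 n m"
    then obtain x where x: "x \<in> W n (n + 2) (n + m)" "a = x n" unfolding Zs_def by auto
    have xF: "x \<in> Fil n (n + m)" "td (n + m) x \<in> Fil (n + 2) (n + m + 1)" using x(1) unfolding W_iff by auto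
    have xc: "x i \<in> carrier (A i (n + m - i))" for i using FilD(1)[OF xF(1)] unfolding tot_simps by blast
    have xn: "x n \<in> carrier (A n m)" and x1: "x (n + 1) \<in> carrier (A (n + 1) (m - 1))" using xc[of n] xc[of "n + 1"] e by simp_all
    have z: "x (n - 1) = \<zero>\<^bsub>A (n - 1) (m + 1)\<^esub>" using FilD(2)[OF xF(1), of "n - 1"] unfolding e by simp
    have "\<zero>\<^bsub>A n (m + 1)\<^esub> = td (n + m) x n" using FilD(2)[OF xF(2), of n] unfolding e by simp
    also have "\<dots> = dh (n - 1) (m + 1) (x (n - 1)) \<oplus>\<^bsub>A n (m + 1)\<^esub> dv n m (x n)" by (rule td_at) simp_all
    also have "\<dots> = dv n m (x n)" unfolding z using dh_zero[of "n - 1" "m + 1"] linearD(1)[OF dv_lin xn] by simp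
    finally have 1: "dv n m (x n) = \<zero>\<^bsub>A n (m + 1)\<^esub>" by simp
    have "\<zero>\<^bsub>A (n + 1) m\<^esub> = td (n + m) x (n + 1)" using FilD(2)[OF xF(2), of "n + 1"] unfolding e by simp
    also have "\<dots> = dh n m (x n) \<oplus>\<^bsub>A (n + 1) m\<^esub> dv (n + 1) (m - 1) (x (n + 1))" by (rule td_at) simp_all
    finally show "a \<in> Z2 n m" unfolding Z2_def x(2) using 1 xn x1 by force }
  { fix a assume "a \<in> Z2 n m"
    then obtain b where a: "a \<in> carrier (A n m)" "dv n m a = \<zero>\<^bsub>A n (m + 1)\<^esub>" "b \<in> carrier (A (n + 1) (m - 1))"
      "dh n m a \<oplus>\<^bsub>A (n + 1) m\<^esub> dv (n + 1) (m - 1) b = \<zero>\<^bsub>A (n + 1) m\<^esub>" unfolding Z2_def by blast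
    let ?x = "two (n + m) n a b"
    have c: "a \<in> carrier (A n (n + m - n))" "b \<in> carrier (A (n + 1) (n + m - (n + 1)))" unfolding e using a(1,3) by auto
    have F: "?x \<in> Fil n (n + m)" by (rule FilI[OF two_closed[OF c]]) (simp add: two_def)
    have v: "?x n = a" "?x (n + 1) = b" "?x (n - 1) = \<zero>\<^bsub>A (n - 1) (m + 1)\<^esub>" unfolding two_def e by simp_all
    have "td (n + m) ?x \<in> Fil (n + 2) (n + m + 1)"
    proof (rule FilI[OF td_closed[OF two_closed[OF c]]])
      fix i assume "i < n + 2"
      then consider "i < n" | "i = n" | "i = n + 1" by linarith
      then show "td (n + m) ?x i = \<zero>\<^bsub>A i (n + m + 1 - i)\<^esub>"
      proof cases
        case 1 then show ?thesis by (rule td_two_low[OF c])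
      next
        case 2
        have "td (n + m) ?x n = dh (n - 1) (m + 1) (?x (n - 1)) \<oplus>\<^bsub>A n (m + 1)\<^esub> dv n m (?x n)" by (rule td_at) simp_all
        then show ?thesis unfolding 2 v a(2) e using dh_zero[of "n - 1" "m + 1"] by simp
      next
        case 3
        have "td (n + m) ?x (n + 1) = dh n m (?x n) \<oplus>\<^bsub>A (n + 1) m\<^esub> dv (n + 1) (m - 1) (?x (n + 1))" by (rule td_at) simp_all
        then show ?thesis unfolding 3 v a(4) e .
      qed
    qed
    then have "?x \<in> W n (n + int 2) (n + m)" using F unfolding W_iff by simp
    then show "a \<in> Zs 2 n m" unfolding Zs_def using v(1) by (metis imageI) }
qed

text \<open>The bounding element starts in column \<open>n - 1\<close>. Vanishing of its
  differential in that column is the equation for \<open>b\<close>, and columns \<open>n - 1\<close>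
  and \<open>n\<close> contribute the two summands.\<close>

lemma Bs_2: "Bs 2 n m = B2 n m"
proof (intro equalityI subsetI)
  let ?s = "n + m - 1"
  have e: "n + m - 1 - n = m - 1" "n + m - 1 + 1 - n = m" "n - int 2 + 1 = n - 1" "n + m - 1 - (n - 1) = m"
    "n + m - 1 + 1 - (n - 1) = m + 1" "n + m - 1 - (n - 1 - 1) = m + 1" "n + m - 1 + 1 = n + m" "n + m - (n - 1) = m + 1" by simp_all
  interpret A: module R "A (n - 1) (m + 1)" by (rule mA)
  { fix a assume "a \<in> Bs 2 n m"
    then obtain x where x: "x \<in> W (n - 1) n ?s" "a = td ?s x n" unfolding Bs_def e by blast
    have xF: "x \<in> Fil (n - 1) ?s" "td ?s x \<in> Fil n (n + m)" using x(1) unfolding W_iff e by auto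
    have xc: "x i \<in> carrier (A i (?s - i))" for i using FilD(1)[OF xF(1)] unfolding tot_simps by blast
    have xn: "x n \<in> carrier (A n (m - 1))" and x1: "x (n - 1) \<in> carrier (A (n - 1) m)" using xc[of n] xc[of "n - 1"] unfolding e by simp_all
    have z: "x (n - 1 - 1) = \<zero>\<^bsub>A (n - 1 - 1) (m + 1)\<^esub>" using FilD(2)[OF xF(1), of "n - 1 - 1"] unfolding e by simp
    have "\<zero>\<^bsub>A (n - 1) (m + 1)\<^esub> = td ?s x (n - 1)" using FilD(2)[OF xF(2), of "n - 1"] unfolding e by simp
    also have "\<dots> = dh (n - 1 - 1) (m + 1) (x (n - 1 - 1)) \<oplus>\<^bsub>A (n - 1) (m + 1)\<^esub> dv (n - 1) m (x (n - 1))" by (rule td_at) simp_all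
    also have "\<dots> = dv (n - 1) m (x (n - 1))"
      unfolding z using dh_zero[of "n - 1 - 1" "m + 1"] linearD(1)[OF dv_lin x1] by simp
    finally have 1: "dv (n - 1) m (x (n - 1)) = \<zero>\<^bsub>A (n - 1) (m + 1)\<^esub>" by simp
    have "a = dh (n - 1) m (x (n - 1)) \<oplus>\<^bsub>A n m\<^esub> dv n (m - 1) (x n)" unfolding x(2) by (rule td_at) simp_all
    then show "a \<in> B2 n m" unfolding B2_def using 1 xn x1 by blast }
  { fix a assume "a \<in> B2 n m"
    then obtain b c where h: "b \<in> carrier (A (n - 1) m)" "c \<in> carrier (A n (m - 1))"
      "dv (n - 1) m b = \<zero>\<^bsub>A (n - 1) (m + 1)\<^esub>" "a = dh (n - 1) m b \<oplus>\<^bsub>A n m\<^esub> dv n (m - 1) c" unfolding B2_def by blast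
    let ?x = "two ?s (n - 1) b c"
    have cl: "b \<in> carrier (A (n - 1) (?s - (n - 1)))" "c \<in> carrier (A (n - 1 + 1) (?s - (n - 1 + 1)))" using h(1,2) by simp_all
    have F: "?x \<in> Fil (n - 1) ?s" by (rule FilI[OF two_closed[OF cl]]) (simp add: two_def)
    have v: "?x n = c" "?x (n - 1) = b" "?x (n - 1 - 1) = \<zero>\<^bsub>A (n - 1 - 1) (m + 1)\<^esub>" unfolding two_def e by simp_all
    have "td ?s ?x \<in> Fil n (?s + 1)"
    proof (rule FilI[OF td_closed[OF two_closed[OF cl]]])
      fix i assume "i < n"
      then consider "i < n - 1" | "i = n - 1" by linarith
      then show "td ?s ?x i = \<zero>\<^bsub>A i (?s + 1 - i)\<^esub>"
      proof cases
        case 1 then show ?thesis by (rule td_two_low[OF cl])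
      next
        case 2
        have "td ?s ?x (n - 1) = dh (n - 1 - 1) (m + 1) (?x (n - 1 - 1)) \<oplus>\<^bsub>A (n - 1) (m + 1)\<^esub> dv (n - 1) m (?x (n - 1))"
          by (rule td_at) simp_all
        then show ?thesis unfolding 2 v h(3) e using dh_zero[of "n - 1 - 1" "m + 1"] by simp
      qed
    qed
    then have "?x \<in> W (n - int 2 + 1) n ?s" using F unfolding W_iff e by simp
    moreover have "td ?s ?x n = a"
    proof -
      have "td ?s ?x n = dh (n - 1) m (?x (n - 1)) \<oplus>\<^bsub>A n m\<^esub> dv n (m - 1) (?x n)" by (rule td_at) simp_all
      then show ?thesis unfolding v h(4) .
    qed
    ultimately show "a \<in> Bs 2 n m" unfolding Bs_def by (metis imageI) }
qed

end

section \<open>Convergence\<close>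

context field
begin

lemma linear_finsum_fun:
  assumes "module R W" "finite I" "\<And>i. i \<in> I \<Longrightarrow> f i \<in> lin V W"
  shows "(\<lambda>x. \<Oplus>\<^bsub>W\<^esub>i\<in>I. f i x) \<in> lin V W"
  using assms(2,3)
proof (induction I)
  case empty
  interpret W: module R W by fact
  show ?case using linear_const_zero[OF assms(1)] by simp
next
  case (insert i I)
  interpret W: module R W by fact
  have l: "(\<lambda>x. f i x \<oplus>\<^bsub>W\<^esub> (\<Oplus>\<^bsub>W\<^esub>i\<in>I. f i x)) \<in> lin V W"
    using insert by (intro linear_add[OF assms(1)]) auto
  have c: "f j x \<in> carrier W" if "j \<in> insert i I" "x \<in> carrier V" for j x
    using linearD(1)[OF insert.prems[OF that(1)] that(2)] .
  have eq: "(\<Oplus>\<^bsub>W\<^esub>j\<in>insert i I. f j x) = f i x \<oplus>\<^bsub>W\<^esub> (\<Oplus>\<^bsub>W\<^esub>j\<in>I. f j x)" if "x \<in> carrier V" for x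
    using insert(1,2) c[OF _ that] by (intro W.finsum_insert) auto
  note lD = linearD[OF l]
  have lI: "(\<lambda>x. \<Oplus>\<^bsub>W\<^esub>i\<in>I. f i x) \<in> lin V W" using insert by auto
  note I = linearD[OF lI] and fi = linearD[OF insert.prems[OF insertI1]]
  have e: "finsum W (\<lambda>j. f j x) (insert i I) = f i x \<oplus>\<^bsub>W\<^esub> (\<Oplus>\<^bsub>W\<^esub>j\<in>I. f j x)"
    if "\<And>j. j \<in> insert i I \<Longrightarrow> f j x \<in> carrier W" for x
    using insert(1,2) that by (intro W.finsum_insert) auto
  show ?case
  proof (rule linearI)
    show "(\<Oplus>\<^bsub>W\<^esub>j\<in>insert i I. f j x) \<in> carrier W" if "x \<in> carrier V" for x
      unfolding eq[OF that] by (rule lD(1)[OF that])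
    fix x y assume h: "x \<in> carrier V" "y \<in> carrier V"
    have "f j (x \<oplus>\<^bsub>V\<^esub> y) \<in> carrier W" if "j \<in> insert i I" for j
      using linearD(2)[OF insert.prems[OF that] h] c[OF that h(1)] c[OF that h(2)] by simp
    then show "(\<Oplus>\<^bsub>W\<^esub>j\<in>insert i I. f j (x \<oplus>\<^bsub>V\<^esub> y)) = (\<Oplus>\<^bsub>W\<^esub>j\<in>insert i I. f j x) \<oplus>\<^bsub>W\<^esub> (\<Oplus>\<^bsub>W\<^esub>j\<in>insert i I. f j y)"
      unfolding eq[OF h(1)] eq[OF h(2)] using e lD(2)[OF h] by metis
  next
    fix a x assume h: "a \<in> carrier R" "x \<in> carrier V"
    have "f j (a \<odot>\<^bsub>V\<^esub> x) \<in> carrier W" if "j \<in> insert i I" for j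
      using linearD(3)[OF insert.prems[OF that] h] c[OF that h(2)] h(1) by simp
    then show "(\<Oplus>\<^bsub>W\<^esub>j\<in>insert i I. f j (a \<odot>\<^bsub>V\<^esub> x)) = a \<odot>\<^bsub>W\<^esub> (\<Oplus>\<^bsub>W\<^esub>j\<in>insert i I. f j x)"
      unfolding eq[OF h(2)] using e lD(3)[OF h] by metis
  qed
qed

lemma finsum_submodule:
  assumes "module R V" "submodule N R V" "finite I" "\<And>i. i \<in> I \<Longrightarrow> f i \<in> N"
  shows "(\<Oplus>\<^bsub>V\<^esub>i\<in>I. f i) \<in> N"
  using assms(3,4)
proof (induction I)
  case empty
  interpret V: module R V by fact
  show ?case using submoduleD(2)[OF assms(1,2)] by simp
next
  case (insert i I)
  interpret V: module R V by fact
  have "(\<Oplus>\<^bsub>V\<^esub>j\<in>insert i I. f j) = f i \<oplus>\<^bsub>V\<^esub> (\<Oplus>\<^bsub>V\<^esub>j\<in>I. f j)"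
    using insert submoduleD(1)[OF assms(1,2)] by (intro V.finsum_insert) auto
  then show ?case using insert submoduleD(3)[OF assms(1,2)] by simp
qed

lemma module_direct_sum:
  assumes "\<And>i. module R (V i)"
  shows "module R (direct_sum V)"
proof -
  note aV = module.axioms(2)[OF assms]
  note V = abelian_monoid.a_closed[OF abelian_group.axioms(1)[OF aV]]
    abelian_monoid.zero_closed[OF abelian_group.axioms(1)[OF aV]] abelian_group.a_inv_closed[OF aV]
    module.smult_closed[OF assms]
  note m = abelian_monoid.a_assoc[OF abelian_group.axioms(1)[OF aV]]
    abelian_monoid.a_comm[OF abelian_group.axioms(1)[OF aV]]
    abelian_monoid.l_zero[OF abelian_group.axioms(1)[OF aV]]
  have ca: "(\<lambda>i. x i \<oplus>\<^bsub>V i\<^esub> y i) \<in> carrier (direct_sum V)" if "x \<in> carrier (direct_sum V)" "y \<in> carrier (direct_sum V)" for x y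
  proof -
    have "{i. x i \<oplus>\<^bsub>V i\<^esub> y i \<noteq> \<zero>\<^bsub>V i\<^esub>} \<subseteq> {i. x i \<noteq> \<zero>\<^bsub>V i\<^esub>} \<union> {i. y i \<noteq> \<zero>\<^bsub>V i\<^esub>}"
      using m(3) V(2) by auto
    then have "finite {i. x i \<oplus>\<^bsub>V i\<^esub> y i \<noteq> \<zero>\<^bsub>V i\<^esub>}"
      by (rule finite_subset) (use that in \<open>simp add: direct_sum_def\<close>)
    then show ?thesis using that V(1) by (simp add: direct_sum_def)
  qed
  have cs: "(\<lambda>i. a \<odot>\<^bsub>V i\<^esub> x i) \<in> carrier (direct_sum V)" if "a \<in> carrier R" "x \<in> carrier (direct_sum V)" for a x
  proof -
    have "{i. a \<odot>\<^bsub>V i\<^esub> x i \<noteq> \<zero>\<^bsub>V i\<^esub>} \<subseteq> {i. x i \<noteq> \<zero>\<^bsub>V i\<^esub>}"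
      using module.smult_r_null[OF assms that(1)] by auto
    then have "finite {i. a \<odot>\<^bsub>V i\<^esub> x i \<noteq> \<zero>\<^bsub>V i\<^esub>}"
      by (rule finite_subset) (use that in \<open>simp add: direct_sum_def\<close>)
    then show ?thesis using that V(4) by (simp add: direct_sum_def)
  qed
  show ?thesis
  proof (rule moduleI[OF is_cring])
    show "abelian_group (direct_sum V)"
    proof (rule abelian_groupI, goal_cases)
      case (1 x y) then show ?case using ca by (simp add: direct_sum_def)
    next
      case 2 then show ?case by (simp add: direct_sum_def V)
    next
      case (3 x y z) then show ?case using m(1) by (simp add: direct_sum_def)
    next
      case (4 x y) then show ?case using m(2) by (simp add: direct_sum_def)
    next
      case (5 x) then show ?case using m(3) by (simp add: direct_sum_def)
    next
      case (6 x)
      have xc: "x i \<in> carrier (V i)" for i using 6 by (simp add: direct_sum_def)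
      have "(\<lambda>i. (\<ominus> \<one>) \<odot>\<^bsub>V i\<^esub> x i) \<in> carrier (direct_sum V)" by (rule cs) (use 6 in simp_all)
      moreover have "(\<ominus> \<one>) \<odot>\<^bsub>V i\<^esub> x i \<oplus>\<^bsub>V i\<^esub> x i = \<zero>\<^bsub>V i\<^esub>" for i
        using module.smult_l_minus[OF assms one_closed xc[of i]] module.smult_one[OF assms xc[of i]]
          abelian_group.l_neg[OF aV xc[of i]] by simp
      ultimately show ?case by (intro bexI[of _ "\<lambda>i. (\<ominus> \<one>) \<odot>\<^bsub>V i\<^esub> x i"]) (simp_all add: direct_sum_def)
    qed
  next
    fix a x assume "a \<in> carrier R" "x \<in> carrier (direct_sum V)"
    then show "a \<odot>\<^bsub>direct_sum V\<^esub> x \<in> carrier (direct_sum V)" using cs by (simp add: direct_sum_def)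
  qed (simp_all add: direct_sum_def module.smult_l_distr[OF assms] module.smult_r_distr[OF assms]
      module.smult_assoc1[OF assms] module.smult_one[OF assms])
qed

lemma direct_sum_ev: "(\<lambda>x. x i) \<in> lin (direct_sum V) (V i)"
  by (rule linearI) (simp_all add: direct_sum_def)

lemma cocycles_eq: "cocycles C d n = {x \<in> carrier (C n). d n x = \<zero>\<^bsub>C (Suc n)\<^esub>}"
  by (simp add: cocycles_def a_kernel_def')

lemma cohomology_submodules:
  assumes "\<And>n. module R (C n)" "\<And>n. d n \<in> lin (C n) (C (Suc n))"
    "\<And>n x. x \<in> carrier (C n) \<Longrightarrow> d (Suc n) (d n x) = \<zero>\<^bsub>C (Suc (Suc n))\<^esub>"
  shows "submodule (cocycles C d n) R (C n)" "submodule (coboundaries C d n) R (C n)"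
    "coboundaries C d n \<subseteq> cocycles C d n" "submodule (coboundaries C d n) R ((C n)\<lparr>carrier := cocycles C d n\<rparr>)"
    "module R (cohomology C d n)"
proof -
  show z: "submodule (cocycles C d n) R (C n)" unfolding cocycles_eq by (rule submodule_kernel[OF assms(1,1,2)])
  show b: "submodule (coboundaries C d n) R (C n)"
  proof (cases n)
    case 0 then show ?thesis using submodule_zero[OF assms(1)] by (simp add: coboundaries_def)
  next
    case (Suc k) then show ?thesis using submodule_image[OF assms(1,1,2) submodule_carrier[OF assms(1)]] by (simp add: coboundaries_def)
  qed
  show s: "coboundaries C d n \<subseteq> cocycles C d n"
  proof (cases n)
    case 0 then show ?thesis using submoduleD(2)[OF assms(1) z] by (simp add: coboundaries_def)
  next
    case (Suc k) then show ?thesis unfolding cocycles_eq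
      using assms(3) linearD(1)[OF assms(2)] by (auto simp: coboundaries_def)
  qed
  show r: "submodule (coboundaries C d n) R ((C n)\<lparr>carrier := cocycles C d n\<rparr>)" by (rule submodule_restrict[OF assms(1) z b s])
  show "module R (cohomology C d n)" unfolding cohomology_def
    by (rule module_quotient[OF module_submodule[OF assms(1) z] r])
qed

end

text \<open>\<open>E\<close> with \<open>\<psi>\<close> is a prescribed model of the second page, so
  that the page obtained equals it. \<open>u\<close> embeds \<open>Co\<close> as the horizontal
  kernel in column zero, and rows are exact from column one on.\<close>

locale augmented_double_complex = double_complex R A dh dv
  for R :: "('a, 'b) ring_scheme" (structure) and A :: "int \<Rightarrow> int \<Rightarrow> ('a, 'x, 'c) module_scheme"
    and dh dv :: "int \<Rightarrow> int \<Rightarrow> 'x \<Rightarrow> 'x" +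
  fixes E :: "int \<Rightarrow> int \<Rightarrow> ('a, 'e, 'd) module_scheme" and \<psi> :: "int \<Rightarrow> int \<Rightarrow> 'x \<Rightarrow> 'e"
    and Co :: "nat \<Rightarrow> ('a, 'y, 'f) module_scheme" and dC :: "nat \<Rightarrow> 'y \<Rightarrow> 'y" and u :: "nat \<Rightarrow> 'y \<Rightarrow> 'x"
  assumes mE: "module R (E n m)"
    and E_zero: "n < 0 \<or> m < 0 \<Longrightarrow> carrier (E n m) = {\<zero>\<^bsub>E n m\<^esub>}"
    and \<psi>_lin: "\<psi> n m \<in> lin ((A n m)\<lparr>carrier := Z2 n m\<rparr>) (E n m)"
    and \<psi>_surj: "e \<in> carrier (E n m) \<Longrightarrow> \<exists>z\<in>Z2 n m. e = \<psi> n m z"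
    and \<psi>_ker: "z \<in> Z2 n m \<Longrightarrow> \<psi> n m z = \<zero>\<^bsub>E n m\<^esub> \<longleftrightarrow> z \<in> B2 n m"
    and row_exact: "\<lbrakk>1 \<le> n; x \<in> carrier (A n m); dh n m x = \<zero>\<^bsub>A (n + 1) m\<^esub>\<rbrakk> \<Longrightarrow>
      \<exists>y\<in>carrier (A (n - 1) m). x = dh (n - 1) m y"
    and mC: "module R (Co s)" and dC_lin: "dC s \<in> lin (Co s) (Co (Suc s))"
    and dC_dC: "v \<in> carrier (Co s) \<Longrightarrow> dC (Suc s) (dC s v) = \<zero>\<^bsub>Co (Suc (Suc s))\<^esub>"
    and u_lin: "u s \<in> lin (Co s) (A 0 (int s))"
    and u_inj: "\<lbrakk>v \<in> carrier (Co s); u s v = \<zero>\<^bsub>A 0 (int s)\<^esub>\<rbrakk> \<Longrightarrow> v = \<zero>\<^bsub>Co s\<^esub>"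
    and u_ker: "v \<in> carrier (Co s) \<Longrightarrow> dh 0 (int s) (u s v) = \<zero>\<^bsub>A 1 (int s)\<^esub>"
    and u_surj: "\<lbrakk>a \<in> carrier (A 0 (int s)); dh 0 (int s) a = \<zero>\<^bsub>A 1 (int s)\<^esub>\<rbrakk> \<Longrightarrow> \<exists>v\<in>carrier (Co s). a = u s v"
    and u_dv: "v \<in> carrier (Co s) \<Longrightarrow> dv 0 (int s) (u s v) = u (Suc s) (dC s v)"

sublocale augmented_double_complex \<subseteq> CC: cycle_chains R A E Zs Bs \<psi> zd
  by (rule cycle_chains.intro[OF field_axioms cycle_chains_axioms.intro])
     (assumption | rule mA mE E_zero sZs sBs Z_B_mono \<psi>_lin[folded Zs_2] \<psi>_surj[folded Zs_2]
        \<psi>_ker[folded Zs_2 Bs_2] zd_lin zd_B zd_ker zd_surj)+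

context augmented_double_complex
begin

section \<open>Stabilisation of the pages\<close>

lemma W_high:
  assumes "s + 1 < q" shows "W p q s = {x \<in> Fil p s. td s x = \<zero>\<^bsub>tot (s + 1)\<^esub>}"
proof (intro equalityI subsetI)
  fix x assume "x \<in> W p q s"
  then show "x \<in> {x \<in> Fil p s. td s x = \<zero>\<^bsub>tot (s + 1)\<^esub>}" using Fil_above[OF assms, of "td s x"] unfolding W_iff by blast
next
  fix x assume "x \<in> {x \<in> Fil p s. td s x = \<zero>\<^bsub>tot (s + 1)\<^esub>}"
  then have x: "x \<in> Fil p s" "td s x = \<zero>\<^bsub>tot (s + 1)\<^esub>" by blast+
  show "x \<in> W p q s" unfolding W_iff x(2) by (rule conjI[OF x(1) FilS(2)])
qed

lemma W_low: assumes "p \<le> 0" shows "W p q s = W 0 q s"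
  unfolding W_def Fil_nonpos[OF assms] Fil_nonpos[OF order_refl] ..

text \<open>For \<open>r \<ge> m + 2\<close> the target row \<open>m + 1 - r\<close> is negative, so
  cycles no longer change; for \<open>r \<ge> n + 1\<close> the source filtration
  \<open>n - r + 1\<close> is not positive, so boundaries no longer change. Pages begin at
  two.\<close>

definition lim :: "int \<Rightarrow> int \<Rightarrow> nat"
  where "lim n m = nat (max 2 (max (m + 2) (n + 1)))"

lemma lim: "2 \<le> lim n m" "m + 1 < int (lim n m)" "n < int (lim n m)"
  unfolding lim_def by linarith+

lemma page_stable:
  assumes "lim n m \<le> r" shows "CC.page r n m = CC.page (lim n m) n m"
proof (rule CC.page_cong)
  have "W n (n + int r) (n + m) = W n (n + int (lim n m)) (n + m)"
    using W_high[of "n + m" "n + int r" n] W_high[of "n + m" "n + int (lim n m)" n] lim(2)[of m n] assms by simp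
  then show "Zs r n m = Zs (lim n m) n m" unfolding Zs_def by simp
  have "W (n - int r + 1) n (n + m - 1) = W (n - int (lim n m) + 1) n (n + m - 1)"
    using W_low[of "n - int r + 1"] W_low[of "n - int (lim n m) + 1"] lim(3)[of n m] assms by simp
  then show "Bs r n m = Bs (lim n m) n m" unfolding Bs_def by simp
qed

definition Einf :: "int \<Rightarrow> int \<Rightarrow> ('a, 'e, 'd) module_scheme"
  where "Einf n m = CC.page (lim n m) n m"

lemma limit_page_Einf: "limit_page R CC.page Einf"
  unfolding limit_page_def
proof (intro allI conjI exI impI)
  fix n m
  show "module R (Einf n m)" unfolding Einf_def by (rule CC.module_page[OF lim(1)])
  fix r assume "lim n m \<le> r"
  then have "CC.page r n m = Einf n m" unfolding Einf_def by (rule page_stable)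
  then show "linearly_isomorphic R (CC.page r n m) (Einf n m)" using linearly_isomorphic_refl[of "Einf n m"] by simp
qed

section \<open>The limit page as a splitting of the total cohomology\<close>

definition ZT :: "int \<Rightarrow> (int \<Rightarrow> 'x) set"
  where "ZT s = {x \<in> carrier (tot s). td s x = \<zero>\<^bsub>tot (s + 1)\<^esub>}"

definition BT :: "int \<Rightarrow> (int \<Rightarrow> 'x) set"
  where "BT s = td (s - 1) ` carrier (tot (s - 1))"

lemma sZT: "submodule (ZT s) R (tot s)"
  unfolding ZT_def by (rule submodule_kernel[OF m_tot m_tot td_lin])

lemma sBT0: "submodule (BT s) R (tot s)"
  unfolding BT_def by (rule submodule_image[OF m_tot m_tot td_lin' submodule_carrier[OF m_tot]])

lemma BT_sub_ZT: "BT s \<subseteq> ZT s"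
proof
  fix x assume "x \<in> BT s"
  then obtain y where y: "y \<in> carrier (tot (s - 1))" "x = td (s - 1) y" unfolding BT_def by blast
  have "td s (td (s - 1) y) = \<zero>\<^bsub>tot (s + 1)\<^esub>" using td_td[OF y(1)] by (simp del: tot_simps)
  then show "x \<in> ZT s" unfolding ZT_def y(2) using linearD(1)[OF td_lin' y(1)] by blast
qed

abbreviation "HT s \<equiv> (tot s)\<lparr>carrier := ZT s\<rparr>"

lemma mHT: "module R (HT s)"
  by (rule module_submodule[OF m_tot sZT])

lemma sBT: "submodule (BT s) R (HT s)"
  by (rule submodule_restrict[OF m_tot sZT sBT0 BT_sub_ZT])

lemmas ZTS = submoduleD[OF m_tot sZT]
lemmas BTS = submoduleD[OF m_tot sBT0]

text \<open>The chosen representative of a limit class is lifted to an approximate cycle whose order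
  \<open>lim\<close> exceeds every filtration step of degree \<open>s + 1\<close>, which makes it a
  total cocycle.\<close>

definition om :: "int \<Rightarrow> int \<Rightarrow> 'e \<Rightarrow> int \<Rightarrow> 'x"
  where "om s i e = lift i (i + int (lim i (s - i))) s (CC.\<chi> (lim i (s - i)) i (s - i) e)"

lemma om_lin: "om s i \<in> lin (E i (s - i)) (tot s)"
  unfolding om_def by (rule linear_comp[OF lift_lin CC.\<chi>_lin])

lemma om_C:
  assumes "c \<in> CC.C (lim i (s - i)) i (s - i)"
  shows "om s i (\<psi> i (s - i) c) \<in> Fil i s" "om s i (\<psi> i (s - i) c) \<in> ZT s" "om s i (\<psi> i (s - i) c) i = c"
proof -
  let ?r = "lim i (s - i)"
  have c: "c \<in> Zs ?r i (s - i)" using CC.C_iff[OF lim(1)] assms by blast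
  have e: "om s i (\<psi> i (s - i) c) = lift i (i + int ?r) s c"
    unfolding om_def CC.\<chi>_\<psi>[OF lim(1) assms] ..
  have si: "i + (s - i) = s" by simp
  have "s + 1 < i + int ?r" using lim(2)[of "s - i" i] by linarith
  from W_high[OF this] Zs_lift[OF c] show "om s i (\<psi> i (s - i) c) \<in> Fil i s" "om s i (\<psi> i (s - i) c) \<in> ZT s"
    "om s i (\<psi> i (s - i) c) i = c"
    unfolding e si ZT_def using FilD(1)[of _ i s] by blast+
qed

lemma Einf_elem:
  assumes "e \<in> carrier (Einf i j)"
  obtains c where "c \<in> CC.C (lim i j) i j" "e = \<psi> i j c"
  using assms unfolding Einf_def CC.page_def by auto

lemma Einf_carrier: "e \<in> carrier (Einf i j) \<Longrightarrow> e \<in> carrier (E i j)"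
  using submoduleD(1)[OF mE CC.submodule_page[OF lim(1)]] unfolding Einf_def CC.page_def by simp

lemma Einf_zero: "\<zero>\<^bsub>Einf i j\<^esub> = \<zero>\<^bsub>E i j\<^esub>"
  unfolding Einf_def CC.page_def by simp

lemma mEinf: "module R (Einf i j)"
  unfolding Einf_def by (rule CC.module_page[OF lim(1)])

lemma om_lin': "om s i \<in> lin (Einf i (s - i)) (tot s)"
proof (rule linearI)
  note l = linearD[OF om_lin[of s i]] and c = Einf_carrier
  show "om s i x \<in> carrier (tot s)" if "x \<in> carrier (Einf i (s - i))" for x by (rule l(1)[OF c[OF that]])
  show "om s i (x \<oplus>\<^bsub>Einf i (s - i)\<^esub> y) = om s i x \<oplus>\<^bsub>tot s\<^esub> om s i y"
    if "x \<in> carrier (Einf i (s - i))" "y \<in> carrier (Einf i (s - i))" for x y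
    using l(2)[OF c[OF that(1)] c[OF that(2)]] unfolding Einf_def CC.page_def by simp
  show "om s i (a \<odot>\<^bsub>Einf i (s - i)\<^esub> x) = a \<odot>\<^bsub>tot s\<^esub> om s i x"
    if "a \<in> carrier R" "x \<in> carrier (Einf i (s - i))" for a x
    using l(3)[OF that(1) c[OF that(2)]] unfolding Einf_def CC.page_def by simp
qed

text \<open>The linear choice of representatives splits the filtration of the total cohomology, so
  no extension problem remains. Columns outside \<open>0..s\<close> carry zero spaces and are
  omitted from the sum.\<close>

definition Om :: "int \<Rightarrow> (int \<Rightarrow> 'e) \<Rightarrow> int \<Rightarrow> 'x"
  where "Om s e = (\<Oplus>\<^bsub>tot s\<^esub>i\<in>{0..s}. om s i (e i))"

abbreviation "DS s \<equiv> direct_sum (\<lambda>i. Einf i (s - i))"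

lemma mDS: "module R (DS s)"
  by (rule module_direct_sum[OF mEinf])

lemma DS_carrier: "e \<in> carrier (DS s) \<Longrightarrow> e i \<in> carrier (Einf i (s - i))"
  by (simp add: direct_sum_def)

lemma om_Fil_ZT:
  assumes "e \<in> carrier (Einf i (s - i))"
  shows "om s i e \<in> Fil i s" "om s i e \<in> ZT s"
proof -
  obtain c where c: "c \<in> CC.C (lim i (s - i)) i (s - i)" "e = \<psi> i (s - i) c" using Einf_elem[OF assms] .
  show "om s i e \<in> Fil i s" "om s i e \<in> ZT s" unfolding c(2) by (rule om_C[OF c(1)])+
qed

lemma Om_lin0: "Om s \<in> lin (DS s) (tot s)"
proof -
  have "(\<lambda>e. om s i (e i)) \<in> lin (DS s) (tot s)" for i
    by (rule linear_comp[OF om_lin' direct_sum_ev[where V = "\<lambda>i. Einf i (s - i)" and i = i]])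
  then show ?thesis unfolding Om_def by (intro linear_finsum_fun[OF m_tot finite_atLeastAtMost_int])
qed

lemma Om_ZT: "e \<in> carrier (DS s) \<Longrightarrow> Om s e \<in> ZT s"
  unfolding Om_def by (rule finsum_submodule[OF m_tot sZT finite_atLeastAtMost_int om_Fil_ZT(2)[OF DS_carrier]])

lemma Om_lin: "Om s \<in> lin (DS s) (HT s)"
  using linearD[OF Om_lin0] Om_ZT by (intro linearI) simp_all

lemma E_outside: "\<lbrakk>i \<notin> {0..s}; x \<in> carrier (E i (s - i))\<rbrakk> \<Longrightarrow> x = \<zero>\<^bsub>E i (s - i)\<^esub>"
  using E_zero[of i "s - i"] by auto

lemma Om_single:
  assumes "e \<in> carrier (DS s)" "p \<in> {0..s}" "\<And>i. i < p \<Longrightarrow> e i = \<zero>\<^bsub>E i (s - i)\<^esub>"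
  shows "\<exists>x\<in>Fil (p + 1) s. Om s e = om s p (e p) \<oplus>\<^bsub>tot s\<^esub> x"
proof -
  interpret T: module R "tot s" by (rule m_tot)
  have cl: "om s i (e i) \<in> carrier (tot s)" for i using FilD(1)[OF om_Fil_ZT(1)[OF DS_carrier[OF assms(1)]]] .
  have "Om s e = (\<Oplus>\<^bsub>tot s\<^esub>i\<in>insert p ({0..s} - {p}). om s i (e i))" unfolding Om_def using assms(2) by (simp add: insert_absorb)
  also have "\<dots> = om s p (e p) \<oplus>\<^bsub>tot s\<^esub> (\<Oplus>\<^bsub>tot s\<^esub>i\<in>{0..s} - {p}. om s i (e i))"
    by (rule T.finsum_insert) (use cl in \<open>simp_all del: tot_simps\<close>)
  moreover have "(\<Oplus>\<^bsub>tot s\<^esub>i\<in>{0..s} - {p}. om s i (e i)) \<in> Fil (p + 1) s"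
  proof (rule finsum_submodule[OF m_tot sFil])
    fix i assume i: "i \<in> {0..s} - {p}"
    show "om s i (e i) \<in> Fil (p + 1) s"
    proof (cases "i < p")
      case True
      then show ?thesis unfolding assms(3)[OF True] linear_zero[OF mE m_tot om_lin] by (intro FilS(2))
    next
      case False
      then have "p + 1 \<le> i" using i by auto
      then show ?thesis using Fil_mono om_Fil_ZT(1)[OF DS_carrier[OF assms(1)], of i] by blast
    qed
  qed simp
  ultimately show ?thesis by auto
qed

text \<open>In the least column \<open>p\<close> with nonzero \<open>e p\<close>, the leading
  component of \<open>Om s e\<close> is the representative \<open>c\<close>. If
  \<open>Om s e\<close> is a boundary, the bounding element has filtration at most
  \<open>p - r + 1\<close> because this index is not positive, so \<open>c\<close> lies in
  \<open>Bs\<close> and is zero.\<close>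

lemma Om_BT:
  assumes "e \<in> carrier (DS s)" "Om s e \<in> BT s" shows "e = \<zero>\<^bsub>DS s\<^esub>"
proof (rule ccontr)
  assume "e \<noteq> \<zero>\<^bsub>DS s\<^esub>"
  then obtain j where j: "e j \<noteq> \<zero>\<^bsub>E j (s - j)\<^esub>" unfolding direct_sum_def Einf_zero by auto
  note eE = Einf_carrier[OF DS_carrier[OF assms(1)]]
  define N where "N = {i \<in> {0..s}. e i \<noteq> \<zero>\<^bsub>E i (s - i)\<^esub>}"
  have fN: "finite N" by (rule finite_subset[of _ "{0..s}"]) (auto simp: N_def)
  have jN: "j \<in> N" unfolding N_def using j E_outside[OF _ eE] by blast
  define p where "p = Min N"
  have p: "p \<in> N" unfolding p_def using fN jN by (intro Min_in) auto
  have low: "e i = \<zero>\<^bsub>E i (s - i)\<^esub>" if "i < p" for i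
  proof (rule ccontr)
    assume "e i \<noteq> \<zero>\<^bsub>E i (s - i)\<^esub>"
    then have "i \<in> N" unfolding N_def using E_outside[OF _ eE] by blast
    then show False using Min_le[OF fN] that unfolding p_def by fastforce
  qed
  have ps: "p \<in> {0..s}" "e p \<noteq> \<zero>\<^bsub>E p (s - p)\<^esub>" using p unfolding N_def by auto
  let ?r = "lim p (s - p)"
  obtain c where c: "c \<in> CC.C ?r p (s - p)" "e p = \<psi> p (s - p) c" using Einf_elem[OF DS_carrier[OF assms(1)]] .
  obtain x where x: "x \<in> Fil (p + 1) s" "Om s e = om s p (e p) \<oplus>\<^bsub>tot s\<^esub> x" using Om_single[OF assms(1) ps(1) low] by blast
  obtain y where y: "y \<in> carrier (tot (s - 1))" "Om s e = td (s - 1) y" using assms(2) unfolding BT_def by blast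
  have xF: "x \<in> Fil p s" using x(1) Fil_mono[of p "p + 1" s] by auto
  have F: "Om s e \<in> Fil p s" unfolding x(2) by (rule FilS(3)[OF om_Fil_ZT(1)[OF DS_carrier[OF assms(1)]] xF])
  interpret Ap: module R "A p (s - p)" by (rule mA)
  have "x p = \<zero>\<^bsub>A p (s - p)\<^esub>" by (rule FilD(2)[OF x(1)]) simp
  then have val: "td (s - 1) y p = c"
    unfolding y(2)[symmetric] x(2) tot_simps(3) c(2) om_C(3)[OF c(1)] using CC.CD(1)[OF c(1)] by simp
  have e: "p + (s - p) - 1 = s - 1" by simp
  have "p - int ?r + 1 \<le> 0" using lim(3)[of p "s - p"] by linarith
  then have "y \<in> Fil (p - int ?r + 1) (s - 1)" using Fil_nonpos y(1) by blast
  then have "y \<in> W (p - int ?r + 1) p (s - 1)" unfolding W_iff using F y(2) by simp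
  then have "c \<in> Bs ?r p (s - p)" unfolding Bs_def e using val by (metis imageI)
  then have "c = \<zero>\<^bsub>A p (s - p)\<^esub>" using CC.\<pi>_B CC.C_iff[OF lim(1)] c(1) by metis
  then show False using ps(2) c(2) CC.\<psi>_zero by simp
qed

text \<open>The filtration step of \<open>x\<close> is raised one at a time: the leading component
  of a cocycle is matched by one term of \<open>Om\<close> together with a boundary, and the
  remainder lies one step higher, until nothing is left.\<close>

lemma Om_surj:
  assumes "x \<in> ZT s" shows "\<exists>e\<in>carrier (DS s). x \<ominus>\<^bsub>tot s\<^esub> Om s e \<in> BT s"
proof -
  interpret T: module R "tot s" by (rule m_tot)
  interpret S: module R "DS s" by (rule mDS)
  have "\<exists>e\<in>carrier (DS s). x \<ominus>\<^bsub>tot s\<^esub> Om s e \<in> BT s" if "x \<in> ZT s" "x \<in> Fil (s + 1 - int k) s" for k x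
    using that
  proof (induction k arbitrary: x)
    case 0
    then have "x = \<zero>\<^bsub>tot s\<^esub>" using Fil_above[of s "s + 1"] by simp
    moreover have "Om s \<zero>\<^bsub>DS s\<^esub> = \<zero>\<^bsub>tot s\<^esub>" by (rule linear_zero[OF mDS m_tot Om_lin0])
    ultimately have "x \<ominus>\<^bsub>tot s\<^esub> Om s \<zero>\<^bsub>DS s\<^esub> = \<zero>\<^bsub>tot s\<^esub>" using T.minus_self[OF T.zero_closed] by (simp del: tot_simps)
    then show ?case using BTS(2) S.zero_closed by metis
  next
    case (Suc k)
    define p where "p = s - int k"
    have p: "s + 1 - int (Suc k) = p" "s + 1 - int k = p + 1" unfolding p_def by simp_all
    let ?r = "lim p (s - p)" and ?E = "E p (s - p)" and ?A = "A p (s - p)"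
    interpret Ap: module R ?A by (rule mA)
    have xF: "x \<in> Fil p s" using Suc.prems(2) unfolding p .
    have xc: "x \<in> carrier (tot s)" by (rule FilD(1)[OF xF])
    have e1: "p + (s - p) = s" "p + (s - p) - 1 = s - 1" "s - 1 + 1 = s" by simp_all
    have hi: "s + 1 < p + int ?r" using lim(2)[of "s - p" p] by linarith
    have "x \<in> W p (p + int ?r) s" unfolding W_high[OF hi] using xF Suc.prems(1) unfolding ZT_def by blast
    then have xZ: "x p \<in> Zs ?r p (s - p)" unfolding Zs_def e1 by blast
    define c where "c = CC.\<pi> ?r p (s - p) (x p)"
    have c: "c \<in> CC.C ?r p (s - p)" unfolding c_def CC.C_def using xZ by blast
    have xpc: "x p \<in> carrier ?A" by (rule CC.ZD(1)[OF xZ])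
    have "x p \<ominus>\<^bsub>?A\<^esub> c \<in> Bs ?r p (s - p)" unfolding c_def by (rule CC.diff_\<pi>[OF xpc])
    \<comment> \<open>\<open>Om\<close> only realises the projected component \<open>c\<close>. The
      difference \<open>x p - c\<close> is the leading component of a boundary, which has to be
      subtracted as well.\<close>
    then obtain y where y: "y \<in> W (p - int ?r + 1) p (s - 1)" "x p \<ominus>\<^bsub>?A\<^esub> c = td (s - 1) y p"
      unfolding Bs_def e1 by blast
    have yc: "y \<in> carrier (tot (s - 1))" and dyF: "td (s - 1) y \<in> Fil p s" using y(1) FilD(1) unfolding W_iff e1 by blast+
    have dyB: "td (s - 1) y \<in> BT s" unfolding BT_def using yc by blast
    have dyZ: "td (s - 1) y \<in> ZT s" using dyB BT_sub_ZT by blast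
    define e0 where "e0 = (\<lambda>i. if i = p then \<psi> p (s - p) c else \<zero>\<^bsub>E i (s - i)\<^esub>)"
    have "{i. e0 i \<noteq> \<zero>\<^bsub>Einf i (s - i)\<^esub>} \<subseteq> {p}" unfolding Einf_zero e0_def by auto
    then have fin: "finite {i. e0 i \<noteq> \<zero>\<^bsub>Einf i (s - i)\<^esub>}" by (rule finite_subset) simp
    have e0p: "\<psi> p (s - p) c \<in> carrier (Einf p (s - p))" unfolding Einf_def CC.page_def using c by simp
    have zE: "\<zero>\<^bsub>E i j\<^esub> \<in> carrier (Einf i j)" for i j
      unfolding Einf_zero[symmetric] by (rule abelian_monoid.zero_closed[OF abelian_group.axioms(1)[OF module.axioms(2)[OF mEinf]]])
    have e0: "e0 \<in> carrier (DS s)" unfolding direct_sum_def using fin e0p zE by (simp add: e0_def)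
    let ?o = "om s p (\<psi> p (s - p) c)"
    note o = om_C[OF c]
    \<comment> \<open>If \<open>p\<close> lies outside the range of summation,
      \<open>E p (s - p)\<close> is zero and both sides vanish.\<close>
    have Om0: "Om s e0 = ?o"
    proof (cases "p \<in> {0..s}")
      case True
      have "(\<Oplus>\<^bsub>tot s\<^esub>i\<in>{0..s}. om s i (e0 i)) = (\<Oplus>\<^bsub>tot s\<^esub>i\<in>{0..s}. if p = i then om s i (e0 i) else \<zero>\<^bsub>tot s\<^esub>)"
        by (rule arg_cong[where f = "\<lambda>f. finsum (tot s) f {0..s}"])
           (auto simp: e0_def linear_zero[OF mE m_tot om_lin] simp del: tot_simps)
      also have "\<dots> = om s p (e0 p)"
        by (rule T.finsum_singleton[OF True]) (use FilD(1)[OF om_Fil_ZT(1)[OF DS_carrier[OF e0]]] in \<open>simp_all del: tot_simps\<close>)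
      finally show ?thesis unfolding Om_def by (simp add: e0_def)
    next
      case False
      then have "\<psi> p (s - p) c = \<zero>\<^bsub>?E\<^esub>" using E_outside Einf_carrier[OF e0p] by blast
      then have "e0 = \<zero>\<^bsub>DS s\<^esub>" "?o = \<zero>\<^bsub>tot s\<^esub>" unfolding e0_def direct_sum_def Einf_zero
        using linear_zero[OF mE m_tot om_lin] by (auto simp del: tot_simps)
      then show ?thesis using linear_zero[OF mDS m_tot Om_lin0] by (simp del: tot_simps)
    qed
    define z where "z = x \<ominus>\<^bsub>tot s\<^esub> ?o \<ominus>\<^bsub>tot s\<^esub> td (s - 1) y"
    have oc: "?o \<in> carrier (tot s)" and dyc: "td (s - 1) y \<in> carrier (tot s)"
      using FilD(1)[OF o(1)] FilD(1)[OF dyF] .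
    have xo: "x \<ominus>\<^bsub>tot s\<^esub> ?o \<in> carrier (tot s)" by (rule T.minus_closed[OF xc oc])
    have zZ: "z \<in> ZT s" unfolding z_def by (rule ZTS(6)[OF ZTS(6)[OF Suc.prems(1) o(2)] dyZ])
    have zF: "z \<in> Fil p s" unfolding z_def by (rule FilS(6)[OF FilS(6)[OF xF o(1)] dyF])
    have "z p = \<zero>\<^bsub>?A\<^esub>"
      unfolding z_def tot_minus[OF xo dyc] tot_minus[OF xc oc] o(3) y(2)
      by (rule Ap.minus_self) (use dyc in simp)
    then have "z \<in> Fil (s + 1 - int k) s" unfolding p by (rule Fil_Suc[OF zF])
    then obtain e where e: "e \<in> carrier (DS s)" "z \<ominus>\<^bsub>tot s\<^esub> Om s e \<in> BT s" using Suc.IH[OF zZ] by blast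
    have Oc: "Om s e \<in> carrier (tot s)" by (rule ZTS(1)[OF Om_ZT[OF e(1)]])
    have "x \<ominus>\<^bsub>tot s\<^esub> Om s (e0 \<oplus>\<^bsub>DS s\<^esub> e) =
        (z \<ominus>\<^bsub>tot s\<^esub> Om s e) \<oplus>\<^bsub>tot s\<^esub> td (s - 1) y"
      unfolding linearD(2)[OF Om_lin0 e0 e(1)] Om0 z_def
      using xc oc dyc Oc
      by (simp add: a_minus_def T.minus_add T.a_ac T.r_neg1 T.r_neg2 T.r_neg T.l_neg del: tot_simps)
    moreover have "\<dots> \<in> BT s" by (rule BTS(3)[OF e(2) dyB])
    ultimately show ?case using S.a_closed[OF e0 e(1)] by metis
  qed
  note main = this
  \<comment> \<open>This many steps lead from filtration \<open>s + 1\<close> down to the whole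
    space, also when \<open>s\<close> is negative.\<close>
  have "s + 1 - int (nat (s + 1)) \<le> 0" by simp
  then have "x \<in> Fil (s + 1 - int (nat (s + 1))) s" using Fil_nonpos ZTS(1)[OF assms] by blast
  then show ?thesis by (rule main[OF assms])
qed

lemma DS_iso: "linearly_isomorphic R (DS s) (quotient_module (HT s) (BT s))"
proof (rule linearly_isomorphic_quotientI[OF mDS mHT sBT Om_lin])
  show "x = \<zero>\<^bsub>DS s\<^esub>" if "x \<in> carrier (DS s)" "Om s x \<in> BT s" for x by (rule Om_BT[OF that])
  interpret T: module R "tot s" by (rule m_tot)
  interpret H: module R "HT s" by (rule mHT)
  fix y assume "y \<in> carrier (HT s)"
  then have y: "y \<in> ZT s" by simp
  obtain e where e: "e \<in> carrier (DS s)" "y \<ominus>\<^bsub>tot s\<^esub> Om s e \<in> BT s" using Om_surj[OF y] by blast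
  note id = linear_restrict_dom[OF linear_id, of "ZT s" "tot s"]
  have "y \<ominus>\<^bsub>HT s\<^esub> Om s e = y \<ominus>\<^bsub>tot s\<^esub> Om s e"
    by (rule linear_minus[OF mHT m_tot id]) (use ZTS(1) y Om_ZT[OF e(1)] in auto)
  then have "y \<ominus>\<^bsub>HT s\<^esub> Om s e \<in> BT s" using e(2) by (simp only:)
  then show "\<exists>x\<in>carrier (DS s). y \<ominus>\<^bsub>HT s\<^esub> Om s x \<in> BT s" by (rule bexI[OF _ e(1)])
qed

section \<open>Collapse onto column zero by row exactness\<close>

lemma row_reduction:
  assumes "x \<in> carrier (tot s)" "\<And>i. 1 \<le> i \<Longrightarrow> td s x i = \<zero>\<^bsub>A i (s + 1 - i)\<^esub>"
  shows "\<exists>z\<in>carrier (tot (s - 1)). \<forall>i\<ge>1. (x \<ominus>\<^bsub>tot s\<^esub> td (s - 1) z) i = \<zero>\<^bsub>A i (s - i)\<^esub>"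
proof -
  interpret T: module R "tot s" by (rule m_tot)
  interpret T1: module R "tot (s - 1)" by (rule m_tot)
  \<comment> \<open>Induction on a bound \<open>k\<close> for the last nonzero column. A bound
    exists because columns beyond \<open>s\<close> are zero.\<close>
  have "\<exists>z\<in>carrier (tot (s - 1)). \<forall>i\<ge>1. (x \<ominus>\<^bsub>tot s\<^esub> td (s - 1) z) i = \<zero>\<^bsub>A i (s - i)\<^esub>"
    if "x \<in> carrier (tot s)" "\<And>i. 1 \<le> i \<Longrightarrow> td s x i = \<zero>\<^bsub>A i (s + 1 - i)\<^esub>"
      "\<And>i. int k < i \<Longrightarrow> x i = \<zero>\<^bsub>A i (s - i)\<^esub>" for k x
    using that
  proof (induction k arbitrary: x)
    case 0
    have "x \<ominus>\<^bsub>tot s\<^esub> td (s - 1) \<zero>\<^bsub>tot (s - 1)\<^esub> = x"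
      unfolding linear_zero[OF m_tot m_tot td_lin'] by (rule T.minus_zero_right[OF 0(1)])
    then show ?case using 0(3) T1.zero_closed by (intro bexI[of _ "\<zero>\<^bsub>tot (s - 1)\<^esub>"]) auto
  next
    case (Suc k)
    let ?k = "int k" and ?j = "s - 1 - int k"
    interpret B: module R "A (?k + 1) ?j" by (rule mA)
    interpret B2: module R "A (?k + 2) ?j" by (rule mA)
    have e: "s - (?k + 1) = ?j" "s + 1 - (?k + 2) = ?j" by simp_all
    have q1: "s - (?k + 2) + 1 = ?j" and q2: "s - 1 - (?k + 1) + 1 = ?j" by simp_all
    have xk: "x (?k + 1) \<in> carrier (A (?k + 1) ?j)" using Suc.prems(1) e(1) by (metis tot_simps(1))
    have xk2: "x (?k + 2) = \<zero>\<^bsub>A (?k + 2) (s - (?k + 2))\<^esub>" by (rule Suc.prems(3)) simp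
    have dz: "dv (?k + 2) (s - (?k + 2)) \<zero>\<^bsub>A (?k + 2) (s - (?k + 2))\<^esub> = \<zero>\<^bsub>A (?k + 2) ?j\<^esub>"
      by (rule dv_zero[of "?k + 2" "s - (?k + 2)", unfolded q1])
    \<comment> \<open>Column \<open>k + 2\<close> of the differential contains only the horizontal
      image of the last component, so that component is a horizontal cocycle and row exactness
      provides \<open>y\<close>. Subtracting the total differential of \<open>y\<close> removes it
      and affects otherwise only column \<open>k\<close>.\<close>
    have "td s x (?k + 2) = dh (?k + 1) ?j (x (?k + 1)) \<oplus>\<^bsub>A (?k + 2) ?j\<^esub> dv (?k + 2) (s - (?k + 2)) (x (?k + 2))"
      by (rule td_at) simp_all
    then have "dh (?k + 1) ?j (x (?k + 1)) = \<zero>\<^bsub>A (?k + 2) ?j\<^esub>"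
      using Suc.prems(2)[of "?k + 2"] linearD(1)[OF dh_lin xk] unfolding xk2 dz e(2) by (simp add: add.assoc)
    then have "dh (?k + 1) ?j (x (?k + 1)) = \<zero>\<^bsub>A (?k + 1 + 1) ?j\<^esub>" by (simp add: add.assoc)
    then obtain y where y: "y \<in> carrier (A ?k ?j)" "x (?k + 1) = dh ?k ?j y"
      using row_exact[of "?k + 1" "x (?k + 1)" ?j] xk by auto
    let ?z = "two (s - 1) ?k y \<zero>\<^bsub>A (?k + 1) (s - 1 - (?k + 1))\<^esub>"
    have cl: "y \<in> carrier (A ?k (s - 1 - ?k))" "\<zero>\<^bsub>A (?k + 1) (s - 1 - (?k + 1))\<^esub> \<in> carrier (A (?k + 1) (s - 1 - (?k + 1)))"
      using y(1) A_simps(2) by auto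
    note zc = two_closed[OF cl]
    have dzc: "td (s - 1) ?z \<in> carrier (tot s)" by (rule linearD(1)[OF td_lin' zc])
    define w where "w = x \<ominus>\<^bsub>tot s\<^esub> td (s - 1) ?z"
    have wc: "w \<in> carrier (tot s)" unfolding w_def by (rule T.minus_closed[OF Suc.prems(1) dzc])
    have "td (s - 1 + 1) (td (s - 1) ?z) = \<zero>\<^bsub>tot (s - 1 + 1 + 1)\<^esub>" by (rule td_td[OF zc])
    then have dd: "td s (td (s - 1) ?z) = \<zero>\<^bsub>tot (s + 1)\<^esub>" by (simp del: tot_simps)
    interpret TS: module R "tot (s + 1)" by (rule m_tot)
    have "td s w = td s x" unfolding w_def td_minus[OF Suc.prems(1) dzc] dd
      by (rule TS.minus_zero_right[OF td_closed[OF Suc.prems(1)]])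
    then have w1: "td s w i = \<zero>\<^bsub>A i (s + 1 - i)\<^esub>" if "1 \<le> i" for i using Suc.prems(2)[OF that] by simp
    have w2: "w i = \<zero>\<^bsub>A i (s - i)\<^esub>" if "?k < i" for i
    proof (cases "i = ?k + 1")
      case True
      have d0: "dv (?k + 1) (s - 1 - (?k + 1)) \<zero>\<^bsub>A (?k + 1) (s - 1 - (?k + 1))\<^esub> = \<zero>\<^bsub>A (?k + 1) ?j\<^esub>"
        by (rule dv_zero[of "?k + 1" "s - 1 - (?k + 1)", unfolded q2])
      have "td (s - 1) ?z (?k + 1) = dh ?k ?j (?z ?k) \<oplus>\<^bsub>A (?k + 1) ?j\<^esub> dv (?k + 1) (s - 1 - (?k + 1)) (?z (?k + 1))"
        by (rule td_at) simp_all
      also have "\<dots> = x (?k + 1)" unfolding y(2) using linearD(1)[OF dh_lin y(1)] d0 by (simp add: two_def)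
      finally have d1: "td (s - 1) ?z (?k + 1) = x (?k + 1)" .
      show ?thesis unfolding True w_def tot_minus[OF Suc.prems(1) dzc] d1 e(1) by (rule B.minus_self[OF xk])
    next
      case False
      then have i: "?k + 1 < i" using that by simp
      interpret Bi: module R "A i (s - i)" by (rule mA)
      have xi: "x i = \<zero>\<^bsub>A i (s - i)\<^esub>" by (rule Suc.prems(3)) (use i in simp)
      have v0: "?z l = \<zero>\<^bsub>A l (s - 1 - l)\<^esub>" if "?k < l" for l using that by (simp add: two_def)
      have "s - 1 - (i - 1) = s - i" by simp
      then have v: "?z (i - 1) = \<zero>\<^bsub>A (i - 1) (s - i)\<^esub>" "?z i = \<zero>\<^bsub>A i (s - 1 - i)\<^esub>"
        using v0[of "i - 1"] v0[of i] i by simp_all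
      have "td (s - 1) ?z i = dh (i - 1) (s - i) (?z (i - 1)) \<oplus>\<^bsub>A i (s - i)\<^esub> dv i (s - 1 - i) (?z i)"
        by (rule td_at) simp_all
      also have "\<dots> = \<zero>\<^bsub>A i (s - i)\<^esub>" unfolding v using dh_zero[of "i - 1" "s - i"] dv_zero[of i "s - 1 - i"] by (simp add: algebra_simps)
      finally have di: "td (s - 1) ?z i = \<zero>\<^bsub>A i (s - i)\<^esub>" .
      show ?thesis unfolding w_def tot_minus[OF Suc.prems(1) dzc] xi di by (rule Bi.minus_self[OF Bi.zero_closed])
    qed
    obtain z where z: "z \<in> carrier (tot (s - 1))" "\<forall>i\<ge>1. (w \<ominus>\<^bsub>tot s\<^esub> td (s - 1) z) i = \<zero>\<^bsub>A i (s - i)\<^esub>"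
      using Suc.IH[OF wc w1 w2] by blast
    have dc: "td (s - 1) z \<in> carrier (tot s)" by (rule linearD(1)[OF td_lin' z(1)])
    have "x \<ominus>\<^bsub>tot s\<^esub> td (s - 1) (?z \<oplus>\<^bsub>tot (s - 1)\<^esub> z) = w \<ominus>\<^bsub>tot s\<^esub> td (s - 1) z"
      unfolding linearD(2)[OF td_lin' zc z(1)] w_def
      using Suc.prems(1) dzc dc by (simp add: a_minus_def T.minus_add T.a_assoc del: tot_simps)
    then show ?case using z(2) T1.a_closed[OF zc z(1)] by metis
  qed
  note main = this
  show ?thesis
  proof (rule main[OF assms, of "nat s"])
    fix i assume "int (nat s) < i"
    then have "s - i < 0" by linarith
    then show "x i = \<zero>\<^bsub>A i (s - i)\<^esub>" using A_zero[of i "s - i"] assms(1) by auto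
  qed
qed

definition inj0 :: "nat \<Rightarrow> 'y \<Rightarrow> int \<Rightarrow> 'x"
  where "inj0 s v i = (if i = 0 then u s v else \<zero>\<^bsub>A i (int s - i)\<^esub>)"

lemma inj0_lin: "inj0 s \<in> lin (Co s) (tot (int s))"
proof (rule linearI)
  note l = linearD[OF u_lin[of s]]
  show "inj0 s v \<in> carrier (tot (int s))" if "v \<in> carrier (Co s)" for v
    using l(1)[OF that] A_simps(2) by (simp add: inj0_def)
  show "inj0 s (v \<oplus>\<^bsub>Co s\<^esub> w) = inj0 s v \<oplus>\<^bsub>tot (int s)\<^esub> inj0 s w" if "v \<in> carrier (Co s)" "w \<in> carrier (Co s)" for v w
    using l(2)[OF that] abelian_monoid.l_zero[OF abelian_group.axioms(1)[OF aA] A_simps(2)]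
    by (auto simp: inj0_def)
  show "inj0 s (a \<odot>\<^bsub>Co s\<^esub> v) = a \<odot>\<^bsub>tot (int s)\<^esub> inj0 s v" if "a \<in> carrier R" "v \<in> carrier (Co s)" for a v
    using l(3)[OF that] module.smult_r_null[OF mA that(1)] by (auto simp: inj0_def)
qed

text \<open>Column one contains \<open>dh\<close> applied to the image of \<open>u\<close>, which
  vanishes; column zero contains \<open>dv\<close>, which \<open>u\<close> translates into
  \<open>dC\<close>; all other columns receive zeros.\<close>

lemma td_inj0:
  assumes "v \<in> carrier (Co s)" shows "td (int s) (inj0 s v) = inj0 (Suc s) (dC s v)"
proof
  fix i :: int
  have uc: "u s v \<in> carrier (A 0 (int s))" by (rule linearD(1)[OF u_lin assms])
  interpret B: module R "A i (int s + 1 - i)" by (rule mA)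
  have e: "int s - (i - 1) = int s + 1 - i" "int (Suc s) - i = int s + 1 - i" by simp_all
  have dvz: "dv i (int s - i) \<zero>\<^bsub>A i (int s - i)\<^esub> = \<zero>\<^bsub>A i (int s + 1 - i)\<^esub>"
    using dv_zero[of i "int s - i"] by (simp add: algebra_simps)
  have dhz: "dh (i - 1) (int s + 1 - i) \<zero>\<^bsub>A (i - 1) (int s + 1 - i)\<^esub> = \<zero>\<^bsub>A i (int s + 1 - i)\<^esub>"
    using dh_zero[of "i - 1"] by simp
  consider "i = 0" | "i = 1" | "i \<noteq> 0" "i \<noteq> 1" by blast
  then show "td (int s) (inj0 s v) i = inj0 (Suc s) (dC s v) i"
  proof cases
    case 1
    interpret C: module R "A 0 (int s + 1)" by (rule mA)
    have "td (int s) (inj0 s v) 0 = dh (0 - 1) (int s + 1) \<zero>\<^bsub>A (0 - 1) (int s + 1)\<^esub> \<oplus>\<^bsub>A 0 (int s + 1)\<^esub> dv 0 (int s) (u s v)"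
      unfolding td_def inj0_def by simp
    also have "\<dots> = u (Suc s) (dC s v)"
      using dh_zero[of "0 - 1" "int s + 1"] linearD(1)[OF dv_lin uc] u_dv[OF assms] by simp
    finally show ?thesis unfolding 1 inj0_def by simp
  next
    case 2
    interpret C: module R "A 1 (int s)" by (rule mA)
    have "td (int s) (inj0 s v) 1 = dh 0 (int s) (u s v) \<oplus>\<^bsub>A 1 (int s)\<^esub> dv 1 (int s - 1) \<zero>\<^bsub>A 1 (int s - 1)\<^esub>"
      unfolding td_def inj0_def by simp
    also have "\<dots> = \<zero>\<^bsub>A 1 (int s)\<^esub>" using u_ker[OF assms] dv_zero[of 1 "int s - 1"] by simp
    finally show ?thesis unfolding 2 inj0_def by simp
  next
    case 3
    have "inj0 s v (i - 1) = \<zero>\<^bsub>A (i - 1) (int s + 1 - i)\<^esub>" "inj0 s v i = \<zero>\<^bsub>A i (int s - i)\<^esub>"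
      "inj0 (Suc s) (dC s v) i = \<zero>\<^bsub>A i (int s + 1 - i)\<^esub>"
      unfolding inj0_def e using 3 by simp_all
    then show ?thesis unfolding td_def using dhz dvz by simp
  qed
qed

text \<open>By row exactness a total cochain whose differential lives in column zero can be moved into
  column zero; applied to cocycles and to cochains bounding column zero this compares the total
  cohomology with the cohomology of the augmentation.\<close>

lemma column_zero:
  assumes "x \<in> carrier (tot (int s))" "\<And>i. 1 \<le> i \<Longrightarrow> td (int s) x i = \<zero>\<^bsub>A i (int s + 1 - i)\<^esub>"
  shows "\<exists>v\<in>carrier (Co s). x \<ominus>\<^bsub>tot (int s)\<^esub> inj0 s v \<in> BT (int s)"
proof -
  let ?s = "int s"
  interpret T: module R "tot ?s" by (rule m_tot)
  obtain z where z: "z \<in> carrier (tot (?s - 1))" "\<forall>i\<ge>1. (x \<ominus>\<^bsub>tot ?s\<^esub> td (?s - 1) z) i = \<zero>\<^bsub>A i (?s - i)\<^esub>"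
    using row_reduction[OF assms] by blast
  define y where "y = x \<ominus>\<^bsub>tot ?s\<^esub> td (?s - 1) z"
  have dzc: "td (?s - 1) z \<in> carrier (tot ?s)" by (rule linearD(1)[OF td_lin' z(1)])
  have yc: "y \<in> carrier (tot ?s)" unfolding y_def by (rule T.minus_closed[OF assms(1) dzc])
  have "td (?s - 1 + 1) (td (?s - 1) z) = \<zero>\<^bsub>tot (?s - 1 + 1 + 1)\<^esub>" by (rule td_td[OF z(1)])
  then have dd: "td ?s (td (?s - 1) z) = \<zero>\<^bsub>tot (?s + 1)\<^esub>" by (simp del: tot_simps)
  interpret TS: module R "tot (?s + 1)" by (rule m_tot)
  have "td ?s y = td ?s x" unfolding y_def td_minus[OF assms(1) dzc] dd
    by (rule TS.minus_zero_right[OF td_closed[OF assms(1)]])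
  then have dy1: "td ?s y 1 = \<zero>\<^bsub>A 1 ?s\<^esub>" using assms(2)[of 1] by simp
  have y0: "y 0 \<in> carrier (A 0 ?s)" using yc[unfolded tot_simps, rule_format, of 0] by simp
  have y1: "y 1 = \<zero>\<^bsub>A 1 (?s - 1)\<^esub>" using z(2) unfolding y_def by simp
  interpret C: module R "A 1 ?s" by (rule mA)
  have "td ?s y 1 = dh 0 ?s (y 0) \<oplus>\<^bsub>A 1 ?s\<^esub> dv 1 (?s - 1) (y 1)" by (rule td_at) simp_all
  then have "dh 0 ?s (y 0) = \<zero>\<^bsub>A 1 ?s\<^esub>"
    using dy1 dv_zero[of 1 "?s - 1"] linearD(1)[OF dh_lin y0] unfolding y1 by simp
  then obtain v where v: "v \<in> carrier (Co s)" "y 0 = u s v" using u_surj[OF y0] by blast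
  have "y = inj0 s v"
  proof
    fix i :: int
    consider "i < 0" | "i = 0" | "1 \<le> i" by linarith
    then show "y i = inj0 s v i"
    proof cases
      case 1
      have "y i \<in> carrier (A i (?s - i))" using yc unfolding tot_simps by blast
      then show ?thesis using A_zero[of i "?s - i"] 1 unfolding inj0_def by simp
    next
      case 2 then show ?thesis using v(2) unfolding inj0_def by simp
    next
      case 3 then show ?thesis using z(2) unfolding y_def inj0_def by simp
    qed
  qed
  then have "x \<ominus>\<^bsub>tot ?s\<^esub> inj0 s v = x \<ominus>\<^bsub>tot ?s\<^esub> (x \<ominus>\<^bsub>tot ?s\<^esub> td (?s - 1) z)" unfolding y_def by simp
  also have "\<dots> = td (?s - 1) z"
    using assms(1) dzc by (simp add: a_minus_def T.minus_add T.r_neg1 T.r_neg2 del: tot_simps)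
  finally show ?thesis using z(1) v(1) unfolding BT_def by blast
qed

lemmas co = cohomology_submodules[where C = Co and d = dC, OF mC dC_lin dC_dC]

lemma cohomology_iso: "linearly_isomorphic R (cohomology Co dC s) (quotient_module (HT (int s)) (BT (int s)))"
  unfolding cohomology_def
proof (rule linearly_isomorphic_quotients)
  let ?V = "(Co s)\<lparr>carrier := cocycles Co dC s\<rparr>"
  show "module R ?V" by (rule module_submodule[OF mC co(1)])
  show "submodule (coboundaries Co dC s) R ?V" by (rule co(4))
  show "module R (HT (int s))" "submodule (BT (int s)) R (HT (int s))" by (rule mHT sBT)+
  have zc: "v \<in> carrier (Co s)" "dC s v = \<zero>\<^bsub>Co (Suc s)\<^esub>" if "v \<in> cocycles Co dC s" for v
    using that unfolding cocycles_eq by simp_all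
  have i0: "inj0 (Suc s) \<zero>\<^bsub>Co (Suc s)\<^esub> = \<zero>\<^bsub>tot (int s + 1)\<^esub>"
    using linear_zero[OF mC m_tot inj0_lin, of "Suc s"] by (simp add: add.commute)
  have iZ: "inj0 s v \<in> ZT (int s)" if "v \<in> cocycles Co dC s" for v
    using td_inj0[OF zc(1)[OF that]] i0 linearD(1)[OF inj0_lin zc(1)[OF that]] unfolding ZT_def zc(2)[OF that] by simp
  show "inj0 s \<in> lin ?V (HT (int s))"
    by (rule linear_restrict[OF inj0_lin]) (use zc(1) iZ in auto)
  fix v assume "v \<in> carrier ?V"
  then have v: "v \<in> cocycles Co dC s" by simp
  note vc = zc(1)[OF v]
  show "inj0 s v \<in> BT (int s) \<longleftrightarrow> v \<in> coboundaries Co dC s"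
  proof (cases s)
    case 0
    \<comment> \<open>In degree zero, coboundaries are zero by convention; on the total side this is
      the vanishing of \<open>tot (- 1)\<close>.\<close>
    have "x \<in> carrier (tot (- 1)) \<longleftrightarrow> x = \<zero>\<^bsub>tot (- 1)\<^esub>" for x
    proof
      assume "x \<in> carrier (tot (- 1))"
      then have "x \<in> Fil 0 (- 1)" unfolding Fil_nonpos[OF order_refl] .
      then show "x = \<zero>\<^bsub>tot (- 1)\<^esub>" using Fil_above[of "- 1" 0 x] by (simp del: tot_simps)
    next
      assume "x = \<zero>\<^bsub>tot (- 1)\<^esub>"
      then show "x \<in> carrier (tot (- 1))" using FilD(1)[OF FilS(2)] by (simp only:)
    qed
    then have "carrier (tot (- 1)) = {\<zero>\<^bsub>tot (- 1)\<^esub>}" by blast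
    then have B: "BT (int s) = {\<zero>\<^bsub>tot (int s)\<^esub>}"
      unfolding BT_def 0 using linear_zero[OF m_tot m_tot td_lin'[of 0]] by (simp del: tot_simps)
    have "inj0 s v = \<zero>\<^bsub>tot (int s)\<^esub> \<longleftrightarrow> v = \<zero>\<^bsub>Co s\<^esub>"
    proof
      assume "inj0 s v = \<zero>\<^bsub>tot (int s)\<^esub>"
      from fun_cong[OF this, of 0] show "v = \<zero>\<^bsub>Co s\<^esub>" using u_inj[OF vc] by (simp add: inj0_def)
    next
      assume "v = \<zero>\<^bsub>Co s\<^esub>"
      then show "inj0 s v = \<zero>\<^bsub>tot (int s)\<^esub>" using linear_zero[OF mC m_tot inj0_lin] by simp
    qed
    then show ?thesis unfolding B singleton_iff coboundaries_def by (simp only: 0 nat.case singleton_iff)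
  next
    case (Suc k)
    have sk: "int s - 1 = int k" "int k + 1 = int s" unfolding Suc by simp_all
    show ?thesis
    proof
      assume "inj0 s v \<in> BT (int s)"
      then obtain y where y: "y \<in> carrier (tot (int k))" "inj0 s v = td (int k) y" unfolding BT_def sk by blast
      have "td (int k) y i = \<zero>\<^bsub>A i (int k + 1 - i)\<^esub>" if "1 \<le> i" for i
        unfolding y(2)[symmetric] sk(2) inj0_def using that by simp
      \<comment> \<open>The bounding cochain has its differential in column zero, so up to a
        boundary, which does not affect that differential, it comes from \<open>Co k\<close>.
        Injectivity of \<open>u\<close> then carries the equation back to \<open>Co\<close>.\<close>
      then obtain w where w: "w \<in> carrier (Co k)" "y \<ominus>\<^bsub>tot (int k)\<^esub> inj0 k w \<in> BT (int k)"
        using column_zero[OF y(1)] by blast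
      have wc: "inj0 k w \<in> carrier (tot (int k))" by (rule linearD(1)[OF inj0_lin w(1)])
      have "td (int k) (y \<ominus>\<^bsub>tot (int k)\<^esub> inj0 k w) = \<zero>\<^bsub>tot (int k + 1)\<^esub>" using w(2) BT_sub_ZT unfolding ZT_def by blast
      then have "td (int k) y \<ominus>\<^bsub>tot (int k + 1)\<^esub> td (int k) (inj0 k w) = \<zero>\<^bsub>tot (int k + 1)\<^esub>"
        unfolding td_minus[OF y(1) wc] .
      then have "td (int k) y = td (int k) (inj0 k w)"
        using abelian_group.minus_eq_zero_iff[OF module.axioms(2)[OF m_tot] td_closed[OF y(1)] td_closed[OF wc]] by blast
      then have "inj0 s v = inj0 s (dC k w)" using y(2) td_inj0[OF w(1)] by (simp only: Suc)
      from fun_cong[OF this, of 0] have us: "u s v = u s (dC k w)" by (simp add: inj0_def)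
      have dw: "dC k w \<in> carrier (Co s)" using linearD(1)[OF dC_lin w(1)] unfolding Suc .
      have "u s (v \<ominus>\<^bsub>Co s\<^esub> dC k w) = \<zero>\<^bsub>A 0 (int s)\<^esub>"
        unfolding linear_minus[OF mC mA u_lin vc dw] us
        by (rule abelian_group.minus_self[OF aA linearD(1)[OF u_lin dw]])
      then have "v \<ominus>\<^bsub>Co s\<^esub> dC k w = \<zero>\<^bsub>Co s\<^esub>"
        using u_inj[OF abelian_group.minus_closed[OF module.axioms(2)[OF mC] vc dw]] by blast
      then have "v = dC k w" using abelian_group.minus_eq_zero_iff[OF module.axioms(2)[OF mC] vc dw] by blast
      then show "v \<in> coboundaries Co dC s" unfolding coboundaries_def Suc using w(1) by simp
    next
      assume "v \<in> coboundaries Co dC s"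
      then obtain w where w: "w \<in> carrier (Co k)" "v = dC k w" unfolding coboundaries_def Suc by auto
      have "inj0 s v = td (int k) (inj0 k w)" unfolding w(2) Suc by (rule td_inj0[OF w(1), symmetric])
      then show "inj0 s v \<in> BT (int s)" unfolding BT_def sk using linearD(1)[OF inj0_lin w(1)] by blast
    qed
  qed
next
  fix x assume "x \<in> carrier (HT (int s))"
  then have x: "x \<in> ZT (int s)" by simp
  have xc: "x \<in> carrier (tot (int s))" by (rule ZTS(1)[OF x])
  have dx: "td (int s) x = \<zero>\<^bsub>tot (int s + 1)\<^esub>" using x unfolding ZT_def by blast
  obtain v where v: "v \<in> carrier (Co s)" "x \<ominus>\<^bsub>tot (int s)\<^esub> inj0 s v \<in> BT (int s)"
    using column_zero[OF xc] unfolding dx tot_simps by blast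
  have vc: "inj0 s v \<in> carrier (tot (int s))" by (rule linearD(1)[OF inj0_lin v(1)])
  have "td (int s) x \<ominus>\<^bsub>tot (int s + 1)\<^esub> td (int s) (inj0 s v) = \<zero>\<^bsub>tot (int s + 1)\<^esub>"
    using v(2) BT_sub_ZT unfolding ZT_def td_minus[OF xc vc, symmetric] by blast
  then have "td (int s) x = td (int s) (inj0 s v)"
    using abelian_group.minus_eq_zero_iff[OF module.axioms(2)[OF m_tot] td_closed[OF xc] td_closed[OF vc]] by blast
  then have z: "inj0 (Suc s) (dC s v) = \<zero>\<^bsub>tot (int s + 1)\<^esub>" unfolding dx td_inj0[OF v(1)] by (rule sym)
  from fun_cong[OF z, of 0] have "u (Suc s) (dC s v) = \<zero>\<^bsub>A 0 (int (Suc s))\<^esub>" by (simp add: inj0_def add.commute)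
  then have "dC s v = \<zero>\<^bsub>Co (Suc s)\<^esub>" by (rule u_inj[OF linearD(1)[OF dC_lin v(1)]])
  then have vz: "v \<in> cocycles Co dC s" unfolding cocycles_eq using v(1) by simp
  have iZ: "inj0 s v \<in> ZT (int s)"
    unfolding ZT_def using vc td_inj0[OF v(1), unfolded z] by (intro CollectI conjI)
  note id = linear_restrict_dom[OF linear_id, of "ZT (int s)" "tot (int s)"]
  have "x \<ominus>\<^bsub>HT (int s)\<^esub> inj0 s v = x \<ominus>\<^bsub>tot (int s)\<^esub> inj0 s v"
    by (rule linear_minus[OF mHT m_tot id]) (use ZTS(1) x iZ in auto)
  then have "x \<ominus>\<^bsub>HT (int s)\<^esub> inj0 s v \<in> BT (int s)" using v(2) by (simp only:)
  moreover have "v \<in> carrier ((Co s)\<lparr>carrier := cocycles Co dC s\<rparr>)" using vz by simp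
  ultimately show "\<exists>v\<in>carrier ((Co s)\<lparr>carrier := cocycles Co dC s\<rparr>). x \<ominus>\<^bsub>HT (int s)\<^esub> inj0 s v \<in> BT (int s)" by (rule bexI)
qed

theorem converges: "converges_to R CC.page (cohomology Co dC)"
  unfolding converges_to_def
proof (intro exI conjI allI)
  show "limit_page R CC.page Einf" by (rule limit_page_Einf)
  fix s :: nat
  show "linearly_isomorphic R (DS (int s)) (cohomology Co dC s)"
    by (rule linearly_isomorphic_trans[OF DS_iso linearly_isomorphic_sym[OF co(5) cohomology_iso]])
qed

end

section \<open>Augmented double complexes in the first quadrant\<close>

text \<open>\<open>\<kappa>\<close> identifies the vertical cohomology of \<open>A\<close> with \<open>C\<close>, and \<open>u\<close> identifies \<open>Co\<close> with the kernel of \<open>h\<close> in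
  column zero. The data are extended by zero to integer indices, and the sign \<open>sg\<close> turns the
  commuting squares into anticommuting ones.\<close>

locale quadrant_complex = field R for R :: "('a, 'b) ring_scheme" (structure) +
  fixes A :: "nat \<Rightarrow> nat \<Rightarrow> ('a, 'x, 'c) module_scheme" and h v :: "nat \<Rightarrow> nat \<Rightarrow> 'x \<Rightarrow> 'x"
    and C :: "nat \<Rightarrow> nat \<Rightarrow> ('a, 'e, 'd) module_scheme" and \<delta> :: "nat \<Rightarrow> nat \<Rightarrow> 'e \<Rightarrow> 'e"
    and \<kappa> :: "nat \<Rightarrow> nat \<Rightarrow> 'x \<Rightarrow> 'e"
    and Co :: "nat \<Rightarrow> ('a, 'y, 'f) module_scheme" and dC :: "nat \<Rightarrow> 'y \<Rightarrow> 'y" and u :: "nat \<Rightarrow> 'y \<Rightarrow> 'x"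
  assumes mA: "module R (A n m)"
    and h_lin: "h n m \<in> lin (A n m) (A (Suc n) m)"
    and v_lin: "v n m \<in> lin (A n m) (A n (Suc m))"
    and h_h: "x \<in> carrier (A n m) \<Longrightarrow> h (Suc n) m (h n m x) = \<zero>\<^bsub>A (Suc (Suc n)) m\<^esub>"
    and v_v: "x \<in> carrier (A n m) \<Longrightarrow> v n (Suc m) (v n m x) = \<zero>\<^bsub>A n (Suc (Suc m))\<^esub>"
    and commute: "x \<in> carrier (A n m) \<Longrightarrow> h n (Suc m) (v n m x) = v (Suc n) m (h n m x)"
    and mC: "module R (C n m)" and \<delta>_lin: "\<delta> n m \<in> lin (C n m) (C (Suc n) m)"
    and \<delta>_\<delta>: "c \<in> carrier (C n m) \<Longrightarrow> \<delta> (Suc n) m (\<delta> n m c) = \<zero>\<^bsub>C (Suc (Suc n)) m\<^esub>"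
    and \<kappa>_lin: "\<kappa> n m \<in> lin ((A n m)\<lparr>carrier := cocycles (A n) (v n) m\<rparr>) (C n m)"
    and \<kappa>_surj: "c \<in> carrier (C n m) \<Longrightarrow> \<exists>z\<in>cocycles (A n) (v n) m. c = \<kappa> n m z"
    and \<kappa>_ker: "z \<in> cocycles (A n) (v n) m \<Longrightarrow> \<kappa> n m z = \<zero>\<^bsub>C n m\<^esub> \<longleftrightarrow> z \<in> coboundaries (A n) (v n) m"
    and \<kappa>_h: "z \<in> cocycles (A n) (v n) m \<Longrightarrow> \<kappa> (Suc n) m (h n m z) = \<delta> n m (\<kappa> n m z)"
    and row_exact: "\<lbrakk>x \<in> carrier (A (Suc n) m); h (Suc n) m x = \<zero>\<^bsub>A (Suc (Suc n)) m\<^esub>\<rbrakk> \<Longrightarrow>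
      \<exists>y\<in>carrier (A n m). x = h n m y"
    and mCo: "module R (Co s)" and dC_lin: "dC s \<in> lin (Co s) (Co (Suc s))"
    and dC_dC: "w \<in> carrier (Co s) \<Longrightarrow> dC (Suc s) (dC s w) = \<zero>\<^bsub>Co (Suc (Suc s))\<^esub>"
    and u_lin: "u s \<in> lin (Co s) (A 0 s)"
    and u_inj: "\<lbrakk>w \<in> carrier (Co s); u s w = \<zero>\<^bsub>A 0 s\<^esub>\<rbrakk> \<Longrightarrow> w = \<zero>\<^bsub>Co s\<^esub>"
    and u_h: "w \<in> carrier (Co s) \<Longrightarrow> h 0 s (u s w) = \<zero>\<^bsub>A (Suc 0) s\<^esub>"
    and u_surj: "\<lbrakk>x \<in> carrier (A 0 s); h 0 s x = \<zero>\<^bsub>A (Suc 0) s\<^esub>\<rbrakk> \<Longrightarrow> \<exists>w\<in>carrier (Co s). x = u s w"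
    and u_v: "w \<in> carrier (Co s) \<Longrightarrow> v 0 s (u s w) = u (Suc s) (dC s w)"
begin

abbreviation "ZV n m \<equiv> cocycles (A n) (v n) m"
abbreviation "BV n m \<equiv> coboundaries (A n) (v n) m"

lemma vs:
  "submodule (ZV n m) R (A n m)" "submodule (BV n m) R (A n m)" "BV n m \<subseteq> ZV n m"
  by (rule cohomology_submodules[of "A n" "v n", OF mA v_lin v_v]; assumption)+

lemmas hs = cohomology_submodules[where C = "\<lambda>n. C n m" and d = "\<lambda>n. \<delta> n m" for m, OF mC \<delta>_lin \<delta>_\<delta>]

lemma ZV_iff: "x \<in> ZV n m \<longleftrightarrow> x \<in> carrier (A n m) \<and> v n m x = \<zero>\<^bsub>A n (Suc m)\<^esub>"
  unfolding cocycles_eq by simp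

lemma h_ZV: assumes "z \<in> ZV n m" shows "h n m z \<in> ZV (Suc n) m"
proof -
  note z = assms[unfolded ZV_iff]
  have "v (Suc n) m (h n m z) = \<zero>\<^bsub>A (Suc n) (Suc m)\<^esub>"
    using commute[OF conjunct1[OF z]] linear_zero[OF mA mA h_lin] conjunct2[OF z] by simp
  then show ?thesis unfolding ZV_iff using linearD(1)[OF h_lin conjunct1[OF z]] by simp
qed

text \<open>Outside the quadrant the module with truncated indices is reduced to its zero element,
  which gives a zero space of the required type together with the operations needed for
  \<open>module\<close>.\<close>

definition Ai :: "int \<Rightarrow> int \<Rightarrow> ('a, 'x, 'c) module_scheme"
  where "Ai n m = (if 0 \<le> n \<and> 0 \<le> m then A (nat n) (nat m) else (A (nat n) (nat m))\<lparr>carrier := {\<zero>\<^bsub>A (nat n) (nat m)\<^esub>}\<rparr>)"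

definition hi :: "int \<Rightarrow> int \<Rightarrow> 'x \<Rightarrow> 'x"
  where "hi n m x = (if 0 \<le> n \<and> 0 \<le> m then h (nat n) (nat m) x else \<zero>\<^bsub>Ai (n + 1) m\<^esub>)"

definition sg :: "nat \<Rightarrow> 'a" where "sg n = (if even n then \<one> else \<ominus> \<one>)"

definition vi :: "int \<Rightarrow> int \<Rightarrow> 'x \<Rightarrow> 'x"
  where "vi n m x = (if 0 \<le> n \<and> 0 \<le> m then sg (nat n) \<odot>\<^bsub>A (nat n) (Suc (nat m))\<^esub> v (nat n) (nat m) x else \<zero>\<^bsub>Ai n (m + 1)\<^esub>)"

definition Ei :: "int \<Rightarrow> int \<Rightarrow> ('a, 'e set) module"
  where "Ei n m = (let H = cohomology (\<lambda>n. C n (nat m)) (\<lambda>n. \<delta> n (nat m)) (nat n) in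
    if 0 \<le> n \<and> 0 \<le> m then H else H\<lparr>carrier := {\<zero>\<^bsub>H\<^esub>}\<rparr>)"

abbreviation "BH n m \<equiv> coboundaries (\<lambda>n. C n m) (\<lambda>n. \<delta> n m) n"

definition \<psi> :: "int \<Rightarrow> int \<Rightarrow> 'x \<Rightarrow> 'e set"
  where "\<psi> n m x = (if 0 \<le> n \<and> 0 \<le> m then BH (nat n) (nat m) +>\<^bsub>C (nat n) (nat m)\<^esub> \<kappa> (nat n) (nat m) x else \<zero>\<^bsub>Ei n m\<^esub>)"

lemma quadrant_cases:
  obtains (nonneg) i k where "n = int i" "m = int k" | (neg) "\<not> (0 \<le> n \<and> 0 \<le> m)"
  using nonneg_int_cases by metis

lemma i_nat [simp]:
  "Ai (int n) (int m) = A n m" "hi (int n) (int m) = h n m"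
  "vi (int n) (int m) = (\<lambda>x. sg n \<odot>\<^bsub>A n (Suc m)\<^esub> v n m x)"
  "Ei (int n) (int m) = cohomology (\<lambda>n. C n m) (\<lambda>n. \<delta> n m) n"
  "\<psi> (int n) (int m) = (\<lambda>x. BH n m +>\<^bsub>C n m\<^esub> \<kappa> n m x)"
  by (auto simp: Ai_def hi_def vi_def Ei_def \<psi>_def Let_def)

lemma i_Suc [simp]: "int n + 1 = int (Suc n)" "int (Suc n) - 1 = int n" by simp_all

lemma i_one [simp]: "Ai 0 (int m) = A 0 m" "Ai 1 (int m) = A (Suc 0) m" "hi 0 (int m) = h 0 m"
  using i_nat(1)[of 0 m] i_nat(1)[of 1 m] i_nat(2)[of 0 m] by (simp_all add: One_nat_def)

lemma i_neg:
  assumes "\<not> (0 \<le> n \<and> 0 \<le> m)"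
  shows "carrier (Ai n m) = {\<zero>\<^bsub>Ai n m\<^esub>}" "hi n m = (\<lambda>x. \<zero>\<^bsub>Ai (n + 1) m\<^esub>)" "vi n m = (\<lambda>x. \<zero>\<^bsub>Ai n (m + 1)\<^esub>)"
    "carrier (Ei n m) = {\<zero>\<^bsub>Ei n m\<^esub>}" "\<psi> n m = (\<lambda>x. \<zero>\<^bsub>Ei n m\<^esub>)"
  using assms by (auto simp: Ai_def hi_def vi_def Ei_def \<psi>_def Let_def)

lemma sg: "sg n \<in> carrier R" "sg n \<otimes> sg n = \<one>" "sg n \<oplus> sg (Suc n) = \<zero>"
  by (auto simp: sg_def r_neg l_neg l_minus r_minus)

lemma sg_smult:
  assumes "module R V" "x \<in> carrier V"
  shows "sg n \<odot>\<^bsub>V\<^esub> (sg n \<odot>\<^bsub>V\<^esub> x) = x" "sg n \<odot>\<^bsub>V\<^esub> x = \<zero>\<^bsub>V\<^esub> \<longleftrightarrow> x = \<zero>\<^bsub>V\<^esub>"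
proof -
  interpret V: module R V by fact
  show 1: "sg n \<odot>\<^bsub>V\<^esub> (sg n \<odot>\<^bsub>V\<^esub> x) = x" using V.smult_assoc1[OF sg(1) sg(1) assms(2), of n n] sg(2) assms(2) by simp
  show "sg n \<odot>\<^bsub>V\<^esub> x = \<zero>\<^bsub>V\<^esub> \<longleftrightarrow> x = \<zero>\<^bsub>V\<^esub>"
  proof
    assume "sg n \<odot>\<^bsub>V\<^esub> x = \<zero>\<^bsub>V\<^esub>"
    then show "x = \<zero>\<^bsub>V\<^esub>" using 1 V.smult_r_null[OF sg(1)] by metis
  qed (simp add: sg(1))
qed

lemma mAi: "module R (Ai n m)"
  unfolding Ai_def using mA module_submodule[OF mA submodule_zero[OF mA]] by simp

lemma mEi: "module R (Ei n m)"
  unfolding Ei_def Let_def using hs(5) module_submodule[OF hs(5) submodule_zero[OF hs(5)]] by simp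

lemma hi_lin: "hi n m \<in> lin (Ai n m) (Ai (n + 1) m)"
proof (cases n m rule: quadrant_cases)
  case (nonneg i k) then show ?thesis unfolding nonneg i_Suc i_nat using h_lin[of i k] by simp
next
  case neg then show ?thesis unfolding i_neg(2)[OF neg] by (intro linear_const_zero mAi)
qed

lemma vi_lin: "vi n m \<in> lin (Ai n m) (Ai n (m + 1))"
proof (cases n m rule: quadrant_cases)
  case (nonneg i k) then show ?thesis unfolding nonneg i_Suc i_nat using linear_smult[OF mA v_lin sg(1), of i k i] by simp
next
  case neg then show ?thesis unfolding i_neg(3)[OF neg] by (intro linear_const_zero mAi)
qed

lemmas hv_zero = linear_zero[OF mAi mAi hi_lin] linear_zero[OF mAi mAi vi_lin]

end

sublocale quadrant_complex \<subseteq> DX: double_complex R Ai hi vi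
proof (rule double_complex.intro[OF field_axioms double_complex_axioms.intro])
  fix n m x
  show "module R (Ai n m)" by (rule mAi)
  show "n < 0 \<or> m < 0 \<Longrightarrow> carrier (Ai n m) = {\<zero>\<^bsub>Ai n m\<^esub>}" by (rule i_neg) linarith
  show "hi n m \<in> lin (Ai n m) (Ai (n + 1) m)" "vi n m \<in> lin (Ai n m) (Ai n (m + 1))"
    by (rule hi_lin vi_lin)+
  assume x: "x \<in> carrier (Ai n m)"
  show "hi (n + 1) m (hi n m x) = \<zero>\<^bsub>Ai (n + 1 + 1) m\<^esub>"
  proof (cases n m rule: quadrant_cases)
    case (nonneg i k) then show ?thesis using h_h[of x i k] x by (simp del: of_nat_Suc)
  next
    case neg then show ?thesis unfolding i_neg(2)[OF neg] by (intro hv_zero)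
  qed
  show "vi n (m + 1) (vi n m x) = \<zero>\<^bsub>Ai n (m + 1 + 1)\<^esub>"
  proof (cases n m rule: quadrant_cases)
    case (nonneg i k)
    then have x': "x \<in> carrier (A i k)" using x by simp
    have "v i (Suc k) (sg i \<odot>\<^bsub>A i (Suc k)\<^esub> v i k x) = \<zero>\<^bsub>A i (Suc (Suc k))\<^esub>"
      using linearD(3)[OF v_lin sg(1) linearD(1)[OF v_lin x']] v_v[OF x'] module.smult_r_null[OF mA sg(1)] by simp
    then show ?thesis using nonneg module.smult_r_null[OF mA sg(1)] by (simp del: of_nat_Suc)
  next
    case neg then show ?thesis unfolding i_neg(3)[OF neg] by (intro hv_zero)
  qed
  show "hi n (m + 1) (vi n m x) \<oplus>\<^bsub>Ai (n + 1) (m + 1)\<^esub> vi (n + 1) m (hi n m x) = \<zero>\<^bsub>Ai (n + 1) (m + 1)\<^esub>"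
  proof (cases n m rule: quadrant_cases)
    case (nonneg i k)
    then have x': "x \<in> carrier (A i k)" using x by simp
    interpret V: module R "A (Suc i) (Suc k)" by (rule mA)
    let ?y = "v (Suc i) k (h i k x)"
    have y: "?y \<in> carrier (A (Suc i) (Suc k))" by (rule linearD(1)[OF v_lin linearD(1)[OF h_lin x']])
    have "h i (Suc k) (sg i \<odot>\<^bsub>A i (Suc k)\<^esub> v i k x) = sg i \<odot>\<^bsub>A (Suc i) (Suc k)\<^esub> ?y"
      using linearD(3)[OF h_lin sg(1) linearD(1)[OF v_lin x']] commute[OF x'] by simp
    moreover have "sg i \<odot>\<^bsub>A (Suc i) (Suc k)\<^esub> ?y \<oplus>\<^bsub>A (Suc i) (Suc k)\<^esub> sg (Suc i) \<odot>\<^bsub>A (Suc i) (Suc k)\<^esub> ?y = \<zero>\<^bsub>A (Suc i) (Suc k)\<^esub>"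
      using V.smult_l_distr[OF sg(1) sg(1) y, of i "Suc i"] sg(3) y by simp
    ultimately show ?thesis using nonneg by (simp del: of_nat_Suc)
  next
    case neg
    show ?thesis unfolding i_neg(2,3)[OF neg] hv_zero
      by (rule abelian_monoid.l_zero[OF abelian_group.axioms(1)[OF module.axioms(2)[OF mAi]] abelian_monoid.zero_closed[OF abelian_group.axioms(1)[OF module.axioms(2)[OF mAi]]]])
  qed
qed

section \<open>The second page as iterated cohomology\<close>

context quadrant_complex
begin

lemma vi_zero_iff:
  assumes "x \<in> carrier (A n m)"
  shows "vi (int n) (int m) x = \<zero>\<^bsub>A n (Suc m)\<^esub> \<longleftrightarrow> v n m x = \<zero>\<^bsub>A n (Suc m)\<^esub>"
  unfolding i_nat by (rule sg_smult(2)[OF mA linearD(1)[OF v_lin assms]])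

text \<open>Multiplication by the sign is invertible and does not change the image. For
  \<open>m = 0\<close> the source is the zero space in row \<open>-1\<close>, in agreement with
  \<open>coboundaries\<close> in degree zero.\<close>

lemma vi_image: "vi (int n) (int m - 1) ` carrier (Ai (int n) (int m - 1)) = BV n m"
proof (cases m)
  case 0
  have neg: "\<not> (0 \<le> int n \<and> 0 \<le> int m - 1)" using 0 by simp
  have "Ai (int n) (int m - 1 + 1) = A n 0" using 0 i_nat(1)[of n 0] by simp
  then show ?thesis unfolding i_neg(1,3)[OF neg] using 0 by (simp add: coboundaries_def)
next
  case (Suc k)
  have s: "sg n \<odot>\<^bsub>A n (Suc k)\<^esub> v n k x = v n k (sg n \<odot>\<^bsub>A n k\<^esub> x)" if "x \<in> carrier (A n k)" for x
    by (rule linearD(3)[OF v_lin sg(1) that, symmetric])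
  have c: "sg n \<odot>\<^bsub>A n k\<^esub> x \<in> carrier (A n k)" if "x \<in> carrier (A n k)" for x
    by (rule module.smult_closed[OF mA sg(1) that])
  have "(\<lambda>x. sg n \<odot>\<^bsub>A n (Suc k)\<^esub> v n k x) ` carrier (A n k) = v n k ` carrier (A n k)"
  proof (intro equalityI image_subsetI)
    fix x assume x: "x \<in> carrier (A n k)"
    show "sg n \<odot>\<^bsub>A n (Suc k)\<^esub> v n k x \<in> v n k ` carrier (A n k)" unfolding s[OF x] by (rule imageI[OF c[OF x]])
    have "v n k x = sg n \<odot>\<^bsub>A n (Suc k)\<^esub> v n k (sg n \<odot>\<^bsub>A n k\<^esub> x)"
      unfolding s[OF c[OF x]] sg_smult(1)[OF mA x] ..
    then show "v n k x \<in> (\<lambda>x. sg n \<odot>\<^bsub>A n (Suc k)\<^esub> v n k x) ` carrier (A n k)" by (rule image_eqI[OF _ c[OF x]])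
  qed
  then show ?thesis unfolding Suc i_Suc i_nat by (simp add: coboundaries_def)
qed

lemma Z2_iff: "z \<in> DX.Z2 (int n) (int m) \<longleftrightarrow> z \<in> ZV n m \<and> h n m z \<in> BV (Suc n) m"
proof (cases "z \<in> carrier (A n m)")
  case z: True
  interpret V: module R "A (Suc n) m" by (rule mA)
  have hz: "h n m z \<in> carrier (A (Suc n) m)" by (rule linearD(1)[OF h_lin z])
  note Bs = submoduleD[OF mA vs(2)]
  have "(\<exists>b\<in>carrier (Ai (int n + 1) (int m - 1)). hi (int n) (int m) z \<oplus>\<^bsub>Ai (int n + 1) (int m)\<^esub> vi (int n + 1) (int m - 1) b = \<zero>\<^bsub>Ai (int n + 1) (int m)\<^esub>)
      \<longleftrightarrow> (\<exists>y\<in>BV (Suc n) m. h n m z \<oplus>\<^bsub>A (Suc n) m\<^esub> y = \<zero>\<^bsub>A (Suc n) m\<^esub>)"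
    unfolding vi_image[symmetric] bex_simps i_Suc i_nat ..
  also have "\<dots> \<longleftrightarrow> h n m z \<in> BV (Suc n) m"
  proof
    assume "\<exists>y\<in>BV (Suc n) m. h n m z \<oplus>\<^bsub>A (Suc n) m\<^esub> y = \<zero>\<^bsub>A (Suc n) m\<^esub>"
    then obtain y where y: "y \<in> BV (Suc n) m" "h n m z \<oplus>\<^bsub>A (Suc n) m\<^esub> y = \<zero>\<^bsub>A (Suc n) m\<^esub>" by blast
    have "h n m z = \<ominus>\<^bsub>A (Suc n) m\<^esub> y" using V.minus_equality[OF y(2) Bs(1)[OF y(1)] hz] by simp
    then show "h n m z \<in> BV (Suc n) m" using Bs(5)[OF y(1)] by simp
  next
    assume "h n m z \<in> BV (Suc n) m"
    then show "\<exists>y\<in>BV (Suc n) m. h n m z \<oplus>\<^bsub>A (Suc n) m\<^esub> y = \<zero>\<^bsub>A (Suc n) m\<^esub>"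
      by (intro bexI[where x = "\<ominus>\<^bsub>A (Suc n) m\<^esub> h n m z"] V.r_neg[OF hz] Bs(5))
  qed
  finally have eq: "(\<exists>b\<in>carrier (Ai (int n + 1) (int m - 1)). hi (int n) (int m) z \<oplus>\<^bsub>Ai (int n + 1) (int m)\<^esub> vi (int n + 1) (int m - 1) b = \<zero>\<^bsub>Ai (int n + 1) (int m)\<^esub>)
      \<longleftrightarrow> h n m z \<in> BV (Suc n) m" .
  have eq2: "vi (int n) (int m) z = \<zero>\<^bsub>Ai (int n) (int m + 1)\<^esub> \<longleftrightarrow> v n m z = \<zero>\<^bsub>A n (Suc m)\<^esub>"
    using vi_zero_iff[OF z] by (simp only: i_Suc i_nat)
  have c: "z \<in> carrier (Ai (int n) (int m))" using z by simp
  show ?thesis unfolding DX.Z2_def mem_Collect_eq eq eq2 ZV_iff using z c by simp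
next
  case False then show ?thesis unfolding DX.Z2_def ZV_iff by simp
qed

text \<open>Column \<open>-1\<close> is zero, so in column zero only the vertical boundary survives;
  this accounts for the case distinction.\<close>

lemma B2_iff:
  "z \<in> DX.B2 (int n) (int m) \<longleftrightarrow>
    (\<exists>x\<in>(case n of 0 \<Rightarrow> {\<zero>\<^bsub>A 0 m\<^esub>} | Suc k \<Rightarrow> h k m ` ZV k m). \<exists>y\<in>BV n m. z = x \<oplus>\<^bsub>A n m\<^esub> y)"
proof -
  have im: "hi (int n - 1) (int m) ` {b \<in> carrier (Ai (int n - 1) (int m)). vi (int n - 1) (int m) b = \<zero>\<^bsub>Ai (int n - 1) (int m + 1)\<^esub>} =
    (case n of 0 \<Rightarrow> {\<zero>\<^bsub>A 0 m\<^esub>} | Suc k \<Rightarrow> h k m ` ZV k m)"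
  proof (cases n)
    case 0
    have neg: "\<not> (0 \<le> int n - 1 \<and> 0 \<le> int m)" using 0 by simp
    have e: "Ai (int n - 1 + 1) (int m) = A 0 m" using 0 i_nat(1)[of 0 m] by simp
    have "{b \<in> carrier (Ai (int n - 1) (int m)). vi (int n - 1) (int m) b = \<zero>\<^bsub>Ai (int n - 1) (int m + 1)\<^esub>} = {\<zero>\<^bsub>Ai (int n - 1) (int m)\<^esub>}"
      unfolding i_neg(1,3)[OF neg] by simp
    then show ?thesis unfolding i_neg(2)[OF neg] e using 0 by simp
  next
    case (Suc k)
    have "{b \<in> carrier (A k m). vi (int k) (int m) b = \<zero>\<^bsub>A k (Suc m)\<^esub>} = ZV k m"
      unfolding cocycles_eq by (rule Collect_cong) (rule conj_cong[OF refl vi_zero_iff])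
    then show ?thesis unfolding Suc i_Suc i_nat(1,2) by simp
  qed
  show ?thesis unfolding DX.B2_def im[symmetric] vi_image[symmetric] i_nat(1) mem_Collect_eq by blast
qed

text \<open>A class that is a horizontal coboundary is \<open>\<delta>\<close> of the class of some
  vertical cocycle \<open>b\<close>, and then \<open>z - h b\<close> is a vertical boundary. In
  column zero both conditions say that the class of \<open>z\<close> vanishes.\<close>

lemma \<psi>_iff:
  assumes "z \<in> ZV n m" "h n m z \<in> BV (Suc n) m"
  shows "\<kappa> n m z \<in> BH n m \<longleftrightarrow> z \<in> DX.B2 (int n) (int m)"
proof -
  note zc = assms(1)[unfolded ZV_iff, THEN conjunct1]
  interpret V: module R "A n m" by (rule mA)
  note Bs = submoduleD[OF mA vs(2)] and ZVs = submoduleD[OF mA vs(1)] and mZ = module_submodule[OF mA vs(1)]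
  show ?thesis
  proof (cases n)
    case 0
    have "\<kappa> n m z \<in> BH n m \<longleftrightarrow> \<kappa> n m z = \<zero>\<^bsub>C n m\<^esub>" using 0 by (simp add: coboundaries_def)
    also have "\<dots> \<longleftrightarrow> z \<in> BV n m" by (rule \<kappa>_ker[OF assms(1)])
    also have "\<dots> \<longleftrightarrow> z \<in> DX.B2 (int n) (int m)"
    proof
      assume "z \<in> BV n m"
      then show "z \<in> DX.B2 (int n) (int m)" unfolding B2_iff using 0 V.l_zero[OF zc] by force
    next
      assume "z \<in> DX.B2 (int n) (int m)"
      then obtain y where "y \<in> BV n m" "z = \<zero>\<^bsub>A n m\<^esub> \<oplus>\<^bsub>A n m\<^esub> y" unfolding B2_iff using 0 by auto
      then show "z \<in> BV n m" using V.l_zero[OF Bs(1)] by simp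
    qed
    finally show ?thesis .
  next
    case (Suc k)
    show ?thesis
    proof
      assume "\<kappa> n m z \<in> BH n m"
      then obtain c where c: "c \<in> carrier (C k m)" "\<kappa> n m z = \<delta> k m c" unfolding coboundaries_def Suc by auto
      obtain b where b: "b \<in> ZV k m" "c = \<kappa> k m b" using \<kappa>_surj[OF c(1)] by blast
      have hb: "h k m b \<in> ZV n m" using h_ZV[OF b(1)] unfolding Suc .
      have eq: "\<kappa> n m z = \<kappa> n m (h k m b)" using c(2) \<kappa>_h[OF b(1)] unfolding b(2) Suc by simp
      have d: "z \<ominus>\<^bsub>A n m\<^esub> h k m b \<in> ZV n m" by (rule ZVs(6)[OF assms(1) hb])
      have zz: "z \<ominus>\<^bsub>(A n m)\<lparr>carrier := ZV n m\<rparr>\<^esub> h k m b = z \<ominus>\<^bsub>A n m\<^esub> h k m b"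
        by (rule linear_minus[OF mZ mA linear_restrict_dom[OF linear_id]])
           (use ZVs(1) assms(1) hb in auto)
      have "\<kappa> n m (z \<ominus>\<^bsub>A n m\<^esub> h k m b) = \<kappa> n m z \<ominus>\<^bsub>C n m\<^esub> \<kappa> n m (h k m b)"
        unfolding zz[symmetric] by (rule linear_minus[OF mZ mC \<kappa>_lin]) (use assms(1) hb in simp_all)
      also have "\<dots> = \<zero>\<^bsub>C n m\<^esub>" unfolding eq
        by (rule abelian_group.minus_self[OF module.axioms(2)[OF mC] linearD(1)[OF \<kappa>_lin]]) (use hb in simp)
      finally have B: "z \<ominus>\<^bsub>A n m\<^esub> h k m b \<in> BV n m" using \<kappa>_ker[OF d] by blast
      have hbc: "h k m b \<in> carrier (A n m)" by (rule ZVs(1)[OF hb])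
      have "z = h k m b \<oplus>\<^bsub>A n m\<^esub> (z \<ominus>\<^bsub>A n m\<^esub> h k m b)"
        using V.minus_add_cancel[OF zc hbc] V.a_comm[OF hbc V.minus_closed[OF zc hbc]] by simp
      then show "z \<in> DX.B2 (int n) (int m)" unfolding B2_iff using B b(1) Suc by auto
    next
      assume "z \<in> DX.B2 (int n) (int m)"
      then obtain b y where b: "b \<in> ZV k m" and y: "y \<in> BV n m" and z: "z = h k m b \<oplus>\<^bsub>A n m\<^esub> y"
        unfolding B2_iff using Suc by auto
      have hb: "h k m b \<in> ZV n m" using h_ZV[OF b(1)] unfolding Suc .
      have yZ: "y \<in> ZV n m" using vs(3) y by blast
      have "\<kappa> n m z = \<kappa> n m (h k m b) \<oplus>\<^bsub>C n m\<^esub> \<kappa> n m y"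
        unfolding z using linearD(2)[OF \<kappa>_lin, of "h k m b" n m y] hb yZ by simp
      also have "\<dots> = \<kappa> n m (h k m b)"
        unfolding iffD2[OF \<kappa>_ker[OF yZ] y]
        by (rule abelian_monoid.r_zero[OF abelian_group.axioms(1)[OF module.axioms(2)[OF mC]] linearD(1)[OF \<kappa>_lin]]) (use hb in simp)
      also have "\<dots> = \<delta> k m (\<kappa> k m b)" using \<kappa>_h[OF b] unfolding Suc .
      also have "\<dots> \<in> BH n m" unfolding coboundaries_def Suc
        using linearD(1)[OF \<kappa>_lin, of b k m] b by simp
      finally show "\<kappa> n m z \<in> BH n m" .
    qed
  qed
qed

lemma \<kappa>_closed: "z \<in> ZV n m \<Longrightarrow> \<kappa> n m z \<in> carrier (C n m)"
  using linearD(1)[OF \<kappa>_lin, of z n m] by simp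

lemma \<kappa>_cocycle:
  assumes "z \<in> ZV n m"
  shows "\<kappa> n m z \<in> cocycles (\<lambda>n. C n m) (\<lambda>n. \<delta> n m) n \<longleftrightarrow> h n m z \<in> BV (Suc n) m"
  unfolding cocycles_eq mem_Collect_eq \<kappa>_h[OF assms, symmetric] \<kappa>_ker[OF h_ZV[OF assms]]
  using \<kappa>_closed[OF assms] by simp

lemma Z2_neg: "\<not> (0 \<le> n \<and> 0 \<le> m) \<Longrightarrow> z \<in> DX.Z2 n m \<Longrightarrow> z = \<zero>\<^bsub>Ai n m\<^esub>"
  using i_neg(1)[of n m] unfolding DX.Z2_def by auto

end

sublocale quadrant_complex \<subseteq> ADX: augmented_double_complex R Ai hi vi Ei \<psi> Co dC u
proof (rule augmented_double_complex.intro[OF DX.double_complex_axioms augmented_double_complex_axioms.intro])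
  fix n m :: int
  show "module R (Ei n m)" by (rule mEi)
  show "carrier (Ei n m) = {\<zero>\<^bsub>Ei n m\<^esub>}" if "n < 0 \<or> m < 0" by (rule i_neg) (use that in linarith)
  show "\<psi> n m \<in> lin ((Ai n m)\<lparr>carrier := DX.Z2 n m\<rparr>) (Ei n m)"
  proof (cases n m rule: quadrant_cases)
    case (nonneg i k)
    let ?V = "(C i k)\<lparr>carrier := cocycles (\<lambda>n. C n k) (\<lambda>n. \<delta> n k) i\<rparr>"
    have l1: "\<kappa> i k \<in> lin ((A i k)\<lparr>carrier := DX.Z2 n m\<rparr>) ?V"
      using linear_restrict[OF \<kappa>_lin, of "DX.Z2 n m" i k "carrier ?V"] \<kappa>_cocycle[of _ i k] Z2_iff[of _ i k]
      unfolding nonneg by auto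
    have l2: "(\<lambda>x. BH i k +>\<^bsub>C i k\<^esub> x) \<in> lin ?V (cohomology (\<lambda>n. C n k) (\<lambda>n. \<delta> n k) i)"
      using quotient_map_linear[OF module_submodule[OF mC hs(1)] hs(4), of k i] unfolding cohomology_def by simp
    show ?thesis using linear_comp[OF l2 l1] unfolding nonneg i_nat .
  next
    case neg then show ?thesis unfolding i_neg(5)[OF neg] by (intro linear_const_zero mEi)
  qed
  show "\<exists>z\<in>DX.Z2 n m. e = \<psi> n m z" if e: "e \<in> carrier (Ei n m)" for e
  proof (cases n m rule: quadrant_cases)
    case (nonneg i k)
    obtain c where c: "c \<in> cocycles (\<lambda>n. C n k) (\<lambda>n. \<delta> n k) i" "e = BH i k +>\<^bsub>C i k\<^esub> c"
      using e unfolding nonneg i_nat cohomology_def quotient_carrier by auto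
    have cc: "c \<in> carrier (C i k)" using c(1) unfolding cocycles_eq by simp
    obtain z where z: "z \<in> ZV i k" "c = \<kappa> i k z" using \<kappa>_surj[OF cc] by blast
    have "z \<in> DX.Z2 n m" unfolding nonneg Z2_iff using z(1) c(1) \<kappa>_cocycle[OF z(1)] unfolding z(2) by simp
    then show ?thesis using c(2) unfolding z(2) nonneg i_nat by blast
  next
    case neg
    have "\<zero>\<^bsub>Ai n m\<^esub> \<in> DX.Z2 n m" unfolding DX.Zs_2[symmetric] by (rule submoduleD(2)[OF mAi DX.sZs])
    then show ?thesis using e unfolding i_neg(4,5)[OF neg] by blast
  qed
  show "\<psi> n m z = \<zero>\<^bsub>Ei n m\<^esub> \<longleftrightarrow> z \<in> DX.B2 n m" if z: "z \<in> DX.Z2 n m" for z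
  proof (cases n m rule: quadrant_cases)
    case (nonneg i k)
    have z': "z \<in> ZV i k" "h i k z \<in> BV (Suc i) k" using z unfolding nonneg Z2_iff by blast+
    have "\<psi> n m z = \<zero>\<^bsub>Ei n m\<^esub> \<longleftrightarrow> \<kappa> i k z \<in> BH i k"
      unfolding nonneg i_nat cohomology_def quotient_zero by (rule coset_eq_self_iff[OF mC hs(2) \<kappa>_closed[OF z'(1)]])
    then show ?thesis unfolding \<psi>_iff[OF z'] nonneg .
  next
    case neg
    have "\<zero>\<^bsub>Ai n m\<^esub> \<in> DX.B2 n m" unfolding DX.Bs_2[symmetric] by (rule submoduleD(2)[OF mAi DX.sBs])
    then show ?thesis unfolding i_neg(5)[OF neg] Z2_neg[OF neg z] by simp
  qed
  show "\<exists>y\<in>carrier (Ai (n - 1) m). x = hi (n - 1) m y"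
    if n: "1 \<le> n" and x: "x \<in> carrier (Ai n m)" "hi n m x = \<zero>\<^bsub>Ai (n + 1) m\<^esub>" for x
  proof (cases n m rule: quadrant_cases)
    case (nonneg i k)
    obtain j where j: "i = Suc j" using n nonneg by (cases i) auto
    show ?thesis using row_exact[of x j k] x unfolding nonneg j i_Suc i_nat by blast
  next
    case neg
    then have neg': "\<not> (0 \<le> n - 1 \<and> 0 \<le> m)" using n by simp
    have "x = \<zero>\<^bsub>Ai (n - 1 + 1) m\<^esub>" using x(1) unfolding i_neg(1)[OF neg] by simp
    then show ?thesis unfolding i_neg(1,2)[OF neg'] by blast
  qed
  fix s w
  show "module R (Co s)" "dC s \<in> lin (Co s) (Co (Suc s))" "u s \<in> lin (Co s) (Ai 0 (int s))"
    unfolding i_one by (rule mCo dC_lin u_lin)+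
  assume w: "w \<in> carrier (Co s)"
  show "dC (Suc s) (dC s w) = \<zero>\<^bsub>Co (Suc (Suc s))\<^esub>" by (rule dC_dC[OF w])
  show "w = \<zero>\<^bsub>Co s\<^esub>" if "u s w = \<zero>\<^bsub>Ai 0 (int s)\<^esub>" using u_inj[OF w] that unfolding i_one .
  show "hi 0 (int s) (u s w) = \<zero>\<^bsub>Ai 1 (int s)\<^esub>" unfolding i_one by (rule u_h[OF w])
  have "vi (int 0) (int s) (u s w) = u (Suc s) (dC s w)"
    unfolding i_nat u_v[OF w] using module.smult_one[OF mA linearD(1)[OF u_lin linearD(1)[OF dC_lin w]]]
    by (simp add: sg_def)
  then show "vi 0 (int s) (u s w) = u (Suc s) (dC s w)" by simp
next
  fix s a assume "a \<in> carrier (Ai 0 (int s))" "hi 0 (int s) a = \<zero>\<^bsub>Ai 1 (int s)\<^esub>"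
  then show "\<exists>w\<in>carrier (Co s). a = u s w" unfolding i_one by (rule u_surj)
qed

theorem (in quadrant_complex) spectral_sequence_exists:
  "\<exists>(E :: nat \<Rightarrow> int \<Rightarrow> int \<Rightarrow> ('a, 'e set) module) D. spectral_sequence R E D \<and>
    (\<forall>n m. E 2 (int n) (int m) = cohomology (\<lambda>n. C n m) (\<lambda>n. \<delta> n m) n) \<and> converges_to R E (cohomology Co dC)"
proof (intro exI conjI allI)
  show "spectral_sequence R ADX.CC.page ADX.CC.D" by (rule ADX.CC.spectral_sequence_page)
  show "ADX.CC.page 2 (int n) (int m) = cohomology (\<lambda>n. C n m) (\<lambda>n. \<delta> n m) n" for n m
    unfolding ADX.CC.page_2 i_nat ..
  show "converges_to R ADX.CC.page (cohomology Co dC)" by (rule ADX.converges)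
qed

section \<open>Complexes of comodules\<close>

context hopf_algebra
begin

text \<open>Coassociativity on \<open>W\<close> needs \<open>\<rho>W (\<kappa> v)\<close> for the
  vectors \<open>v\<close> occurring in \<open>\<rho>V z\<close>, and \<open>eq\<close> computes it
  from \<open>\<rho>V (e v)\<close>. The condition \<open>tmap V 1 e (\<rho>V z) = \<rho>V z\<close>
  permits inserting \<open>e\<close> there, although \<open>e\<close> is not equivariant.\<close>

lemma left_comodule_image:
  assumes com: "left_comodule K P V \<rho>V" and W: "module K W" and \<rho>W: "\<rho>W \<in> lin W (T 1 W)"
    and \<kappa>: "\<kappa> \<in> lin V W" and e: "e \<in> lin V V"
    and eq: "\<And>v. v \<in> carrier V \<Longrightarrow> \<rho>W (\<kappa> v) = tmap W 1 \<kappa> (\<rho>V (e v))"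
    and surj: "\<And>w. w \<in> carrier W \<Longrightarrow> \<exists>z\<in>carrier V. w = \<kappa> z \<and> e z = z \<and> tmap V 1 e (\<rho>V z) = \<rho>V z"
  shows "left_comodule K P W \<rho>W"
proof -
  note V = left_comoduleD[OF com]
  have \<rho>Wl: "g \<in> lin U W \<Longrightarrow> (\<lambda>u. \<rho>W (g u)) \<in> lin U (T 1 W)" for g and U :: "('k, 'u, 'x) module_scheme"
    by (rule K.linear_comp[OF \<rho>W])
  note \<rho>Wc = K.linearD(1)[OF \<rho>W]
  note t2 = lin_tri[OF trilinear_pure2[OF W]] and m2 = module_T[OF W, of 2]
  note kl = K.linear_comp[OF \<kappa>] and kc = K.linearD(1)[OF \<kappa>]
    and el = K.linear_comp[OF e] and ec = K.linearD(1)[OF e]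
  have tri: "trilinear V (T 2 W) (\<lambda>p q v. pt W [p, q] (\<kappa> v))"
    by (rule trilinearI) (assumption | rule \<kappa> kc t2 K.linear_id)+
  show ?thesis unfolding left_comodule_def
  proof (intro conjI ballI W \<rho>W)
    fix w assume "w \<in> carrier W"
    then obtain z where z: "z \<in> carrier V" "w = \<kappa> z" "e z = z" "tmap V 1 e (\<rho>V z) = \<rho>V z" using surj by blast
    note rz = V(3)[OF z(1)]
    have rw: "\<rho>W w = tmap W 1 \<kappa> (\<rho>V z)" using eq[OF z(1)] z(2,3) by simp
    let ?i = "\<lambda>p v. sw (T 2 W) (\<rho>V v) (\<lambda>q u. pt W [p, q] (\<kappa> u))"
    have "sw (T 2 W) (\<rho>W w) (\<lambda>p x. sw (T 2 W) (\<Delta> p) (\<lambda>p1 p2. pt W [p1, p2] x)) =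
        sw (T 2 W) (\<rho>V z) (\<lambda>p v. sw (T 2 W) (\<Delta> p) (\<lambda>p1 p2. pt W [p1, p2] (\<kappa> v)))"
      unfolding rw by (rule sw_tmap[OF V(1) W m2 \<kappa> _ rz]) (assumption | rule W lins t2)+
    also have "\<dots> = sw (T 2 W) (\<rho>V z) ?i"
      by (rule comodule_coassoc[OF com m2 tri z(1)])
    also have "\<dots> = sw (T 2 W) (tmap V 1 e (\<rho>V z)) ?i" unfolding z(4) ..
    also have "\<dots> = sw (T 2 W) (\<rho>V z) (\<lambda>p v. ?i p (e v))"
      by (rule sw_tmap[OF V(1,1) m2 e _ rz]) (assumption | rule V W kl kc lins t2)+
    also have "\<dots> = sw (T 2 W) (\<rho>V z) (\<lambda>p v. sw (T 2 W) (\<rho>W (\<kappa> v)) (\<lambda>q u. pt W [p, q] u))"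
    proof (rule sw_cong[OF V(1) m2 _ rz], (assumption | rule V W e ec kl kc lins t2)+)
      fix p v assume h: "p \<in> carrier P" "v \<in> carrier V"
      show "?i p (e v) = sw (T 2 W) (\<rho>W (\<kappa> v)) (\<lambda>q u. pt W [p, q] u)"
        unfolding eq[OF h(2)]
        by (rule sw_tmap[OF V(1) W m2 \<kappa> _ V(3)[OF ec[OF h(2)]], symmetric]) (assumption | rule h lins t2)+
    qed
    also have "\<dots> = sw (T 2 W) (\<rho>W w) (\<lambda>p x. sw (T 2 W) (\<rho>W x) (\<lambda>q u. pt W [p, q] u))"
      unfolding rw by (rule sw_tmap[OF V(1) W m2 \<kappa> _ rz, symmetric]) (assumption | rule W \<rho>Wl \<rho>Wc lins t2)+
    finally show "sw (T 2 W) (\<rho>W w) (\<lambda>p x. sw (T 2 W) (\<Delta> p) (\<lambda>p1 p2. pt W [p1, p2] x)) =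
      sw (T 2 W) (\<rho>W w) (\<lambda>p x. sw (T 2 W) (\<rho>W x) (\<lambda>q u. pt W [p, q] u))" .
    have "sw W (\<rho>W w) (\<lambda>p x. \<epsilon> p \<odot>\<^bsub>W\<^esub> x) = sw W (\<rho>V z) (\<lambda>p v. \<epsilon> p \<odot>\<^bsub>W\<^esub> \<kappa> v)"
      unfolding rw by (rule sw_tmap[OF V(1) W W \<kappa> _ rz]) (assumption | rule W lins counit_closed)+
    also have "\<dots> = w" unfolding comodule_counit[OF com W \<kappa> z(1)] z(2) ..
    finally show "sw W (\<rho>W w) (\<lambda>p x. \<epsilon> p \<odot>\<^bsub>W\<^esub> x) = w" .
  qed
qed

end

locale comodule_complex = hopf_algebra K P
  for K :: "('k, 'a) ring_scheme" (structure) and P :: "('k, 'p, 'b) hopf_structure_scheme" (structure) +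
  fixes F :: "nat \<Rightarrow> ('k, 'f, 'c) module_scheme" and \<rho>F :: "nat \<Rightarrow> 'f \<Rightarrow> ('k, 'p, 'f) tensors"
    and d :: "nat \<Rightarrow> 'f \<Rightarrow> 'f"
  assumes com: "left_comodule K P (F n) (\<rho>F n)"
    and d_equivariant: "equivariant (F n) (\<rho>F n) (F (Suc n)) (\<rho>F (Suc n)) (d n)"
    and d_d: "x \<in> carrier (F n) \<Longrightarrow> d (Suc n) (d n x) = \<zero>\<^bsub>F (Suc (Suc n))\<^esub>"
begin

lemmas mF = left_comoduleD(1)[OF com]
lemmas \<rho>F_closed = left_comoduleD(3)[OF com]
lemmas d_lin = equivariantD(1)[OF d_equivariant]
lemmas d_coaction = equivariantD(2)[OF d_equivariant]
lemmas d_closed = K.linearD(1)[OF d_lin]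

abbreviation "Z m \<equiv> cocycles F d m"
abbreviation "B m \<equiv> coboundaries F d m"
abbreviation "H m \<equiv> cohomology F d m"
abbreviation "\<rho>H m \<equiv> cohomology_coaction K P F \<rho>F d m"

lemma FH:
  "submodule (Z m) K (F m)" "submodule (B m) K (F m)" "B m \<subseteq> Z m" "submodule (B m) K ((F m)\<lparr>carrier := Z m\<rparr>)"
  "module K (H m)"
  by (rule K.cohomology_submodules[of F d, OF mF d_lin d_d]; assumption)+

lemmas mH = FH(5)
lemmas ZD = K.submoduleD[OF mF FH(1)]
lemmas BD = K.submoduleD[OF mF FH(2)]
lemmas mZ = K.module_submodule[OF mF FH(1)]

lemma Z_iff: "z \<in> Z m \<longleftrightarrow> z \<in> carrier (F m) \<and> d m z = \<zero>\<^bsub>F (Suc m)\<^esub>"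
  unfolding K.cocycles_eq by simp

section \<open>Linear splittings of the complex\<close>

definition dinv :: "nat \<Rightarrow> 'f \<Rightarrow> 'f"
  where "dinv m = (SOME g. g \<in> lin (F (Suc m)) (F m) \<and> (\<forall>x\<in>carrier (F m). d m (g (d m x)) = d m x))"

lemma dinv: "dinv m \<in> lin (F (Suc m)) (F m)" "x \<in> carrier (F m) \<Longrightarrow> d m (dinv m (d m x)) = d m x"
proof -
  have "\<exists>g. g \<in> lin (F (Suc m)) (F m) \<and> (\<forall>x\<in>carrier (F m). d m (g (d m x)) = d m x)"
    using K.exists_pseudo_inverse[OF mF mF d_lin, of m] unfolding Bex_def .
  from someI_ex[OF this] show "dinv m \<in> lin (F (Suc m)) (F m)" "x \<in> carrier (F m) \<Longrightarrow> d m (dinv m (d m x)) = d m x"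
    unfolding dinv_def by blast+
qed

lemmas dinv_d_lin = K.linear_comp[OF dinv(1) d_lin]

text \<open>A linear projection onto the cocycles. It need not be a comodule map.\<close>

definition e :: "nat \<Rightarrow> 'f \<Rightarrow> 'f"
  where "e m x = x \<ominus>\<^bsub>F m\<^esub> dinv m (d m x)"

lemma e_lin: "e m \<in> lin (F m) (F m)"
  unfolding e_def by (rule K.linear_minus_fun[OF mF K.linear_id dinv_d_lin])

lemmas e_closed = K.linearD(1)[OF e_lin]

lemma e_Z: assumes "x \<in> carrier (F m)" shows "e m x \<in> Z m"
proof -
  have dx: "dinv m (d m x) \<in> carrier (F m)" by (rule K.linearD(1)[OF dinv_d_lin assms])
  have "d m (e m x) = \<zero>\<^bsub>F (Suc m)\<^esub>"
    unfolding e_def K.linear_minus[OF mF mF d_lin assms dx] dinv(2)[OF assms]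
    by (rule abelian_group.minus_self[OF module.axioms(2)[OF mF] d_closed[OF assms]])
  then show ?thesis unfolding Z_iff using e_closed[OF assms] by simp
qed

lemma e_fix: assumes "z \<in> Z m" shows "e m z = z"
  using assms unfolding Z_iff e_def
  by (simp add: K.linear_zero[OF mF mF dinv(1)] abelian_group.minus_zero_right[OF module.axioms(2)[OF mF]])

text \<open>\<open>e\<close> is the identity minus \<open>dinv d\<close>, so tensors killed by
  \<open>id \<otimes> d\<close> are fixed by \<open>id \<otimes> e\<close>. This is exactness of
  tensoring with powers of \<open>P\<close>: such tensors have their last factor in the
  cocycles.\<close>

lemma tmap_e_fix:
  assumes "t \<in> carrier (T n (F m))" "tmap (F (Suc m)) n (d m) t = \<zero>\<^bsub>T n (F (Suc m))\<^esub>"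
  shows "tmap (F m) n (e m) t = t"
proof -
  have "tmap (F m) n (e m) t = tmap (F m) n (\<lambda>x. x) t \<ominus>\<^bsub>T n (F m)\<^esub> tmap (F m) n (\<lambda>x. dinv m (d m x)) t"
    unfolding e_def by (rule tmap_minus[OF mF mF K.linear_id dinv_d_lin assms(1)])
  also have "tmap (F m) n (\<lambda>x. dinv m (d m x)) t = tmap (F m) n (dinv m) (tmap (F (Suc m)) n (d m) t)"
    by (rule tmap_comp[OF mF mF mF d_lin dinv(1) assms(1), symmetric])
  also have "\<dots> = \<zero>\<^bsub>T n (F m)\<^esub>" unfolding assms(2)
    by (rule K.linear_zero[OF module_T[OF mF] module_T[OF mF] tmap_lin[OF mF mF dinv(1)]])
  finally show ?thesis unfolding tmap_id[OF mF assms(1)]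
    using abelian_group.minus_zero_right[OF module.axioms(2)[OF module_T[OF mF]] assms(1)] by simp
qed

section \<open>The coaction induced on cohomology\<close>

lemma tmap_d_coaction:
  assumes "z \<in> Z m" shows "tmap (F (Suc m)) 1 (d m) (\<rho>F m z) = \<zero>\<^bsub>T 1 (F (Suc m))\<^esub>"
proof -
  note z = assms[unfolded Z_iff]
  have "tmap (F (Suc m)) 1 (d m) (\<rho>F m z) = \<rho>F (Suc m) (d m z)" by (rule d_coaction[OF conjunct1[OF z], symmetric])
  also have "\<dots> = \<zero>\<^bsub>T 1 (F (Suc m))\<^esub>" unfolding conjunct2[OF z]
    by (rule K.linear_zero[OF mF module_T[OF mF] left_comoduleD(2)[OF com]])
  finally show ?thesis .
qed

lemma tmap_e_coaction: "z \<in> Z m \<Longrightarrow> tmap (F m) 1 (e m) (\<rho>F m z) = \<rho>F m z"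
  by (rule tmap_e_fix[OF \<rho>F_closed tmap_d_coaction]) (simp_all add: Z_iff)

text \<open>The class map is extended through \<open>e\<close> to all of \<open>F m\<close>. It is
  then a linear map between ambient spaces, to which \<open>tmap\<close> applies without passing to
  tensor products of subspaces.\<close>

definition \<kappa> :: "nat \<Rightarrow> 'f \<Rightarrow> 'f set"
  where "\<kappa> m x = B m +>\<^bsub>F m\<^esub> e m x"

lemma coset_lin: "(\<lambda>x. B m +>\<^bsub>F m\<^esub> x) \<in> lin ((F m)\<lparr>carrier := Z m\<rparr>) (H m)"
  using K.quotient_map_linear[OF mZ FH(4)] unfolding cohomology_def by simp

lemma \<kappa>_lin: "\<kappa> m \<in> lin (F m) (H m)"
proof -
  have "e m \<in> lin (F m) ((F m)\<lparr>carrier := Z m\<rparr>)"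
    using K.linearD[OF e_lin[of m]] e_Z by (intro K.linearI) simp_all
  then show ?thesis unfolding \<kappa>_def by (rule K.linear_comp[OF coset_lin])
qed

lemmas \<kappa>_closed = K.linearD(1)[OF \<kappa>_lin]

lemma \<kappa>_Z: "z \<in> Z m \<Longrightarrow> \<kappa> m z = B m +>\<^bsub>F m\<^esub> z"
  unfolding \<kappa>_def by (simp add: e_fix)

lemma H_elem: assumes "x \<in> carrier (H m)" obtains z where "z \<in> Z m" "x = \<kappa> m z"
proof -
  obtain z where "z \<in> Z m" "x = B m +>\<^bsub>F m\<^esub> z"
    using assms unfolding cohomology_def K.quotient_carrier by auto
  then show ?thesis using that \<kappa>_Z by blast
qed

lemma \<kappa>_zero_iff: "z \<in> Z m \<Longrightarrow> \<kappa> m z = \<zero>\<^bsub>H m\<^esub> \<longleftrightarrow> z \<in> B m"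
  unfolding \<kappa>_Z cohomology_def K.quotient_zero by (rule K.coset_eq_self_iff[OF mF FH(2) ZD(1)])

lemma \<kappa>_d: assumes "x \<in> carrier (F m)" shows "\<kappa> (Suc m) (d m x) = \<zero>\<^bsub>H (Suc m)\<^esub>"
proof -
  have B: "d m x \<in> B (Suc m)" unfolding coboundaries_def using assms by simp
  then show ?thesis using \<kappa>_zero_iff FH(3) by blast
qed

lemma tmap_\<kappa>_d:
  assumes "t \<in> carrier (T n (F m))"
  shows "tmap (H (Suc m)) n (\<kappa> (Suc m)) (tmap (F (Suc m)) n (d m) t) = \<zero>\<^bsub>T n (H (Suc m))\<^esub>"
proof -
  have "tmap (H (Suc m)) n (\<kappa> (Suc m)) (tmap (F (Suc m)) n (d m) t) = tmap (H (Suc m)) n (\<lambda>x. \<kappa> (Suc m) (d m x)) t"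
    by (rule tmap_comp[OF mF mF mH d_lin \<kappa>_lin assms])
  also have "\<dots> = tmap (H (Suc m)) n (\<lambda>x. \<zero>\<^bsub>H (Suc m)\<^esub>) t"
    by (rule tmap_cong[OF mF mH K.linear_comp[OF \<kappa>_lin d_lin] assms \<kappa>_d])
  also have "\<dots> = \<zero>\<^bsub>T n (H (Suc m))\<^esub>" by (rule tmap_zero[OF mF mH assms])
  finally show ?thesis .
qed

text \<open>A coboundary in positive degree is \<open>d w\<close>; covariance moves \<open>d\<close>
  past the coaction, where \<open>\<kappa>\<close> annihilates it. In degree zero only the zero
  vector occurs.\<close>

lemma tmap_\<kappa>_B:
  assumes "b \<in> B m" shows "tmap (H m) 1 (\<kappa> m) (\<rho>F m b) = \<zero>\<^bsub>T 1 (H m)\<^esub>"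
proof (cases m)
  case 0
  then have b: "b = \<zero>\<^bsub>F m\<^esub>" using assms by (simp add: coboundaries_def)
  show ?thesis unfolding b K.linear_zero[OF mF module_T[OF mF] left_comoduleD(2)[OF com]]
    by (rule K.linear_zero[OF module_T[OF mF] module_T[OF mH] tmap_lin[OF mF mH \<kappa>_lin]])
next
  case (Suc k)
  then obtain w where w: "w \<in> carrier (F k)" "b = d k w" using assms by (auto simp: coboundaries_def)
  show ?thesis unfolding w(2) Suc d_coaction[OF w(1)] by (rule tmap_\<kappa>_d[OF \<rho>F_closed[OF w(1)]])
qed

text \<open>Evaluates the \<open>THE\<close> of \<open>cohomology_coaction\<close>. A preimage in
  \<open>P \<otimes> Z\<close> is the image of \<open>\<rho>F m z\<close> under
  \<open>id \<otimes> e\<close>; and any representative \<open>z'\<close> with any preimage leads to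
  \<open>id \<otimes> \<kappa>\<close> of \<open>\<rho>F m z'\<close>, which by
  \<open>tmap_\<kappa>_B\<close> depends only on the class.\<close>

lemma \<rho>H_coset:
  assumes z: "z \<in> Z m"
  shows "\<rho>H m (B m +>\<^bsub>F m\<^esub> z) = tmap (H m) 1 (\<kappa> m) (\<rho>F m z)"
proof -
  let ?Z = "(F m)\<lparr>carrier := Z m\<rparr>"
  have incl: "(\<lambda>x. x) \<in> lin ?Z (F m)"
    by (rule K.linear_restrict_dom[OF K.linear_id]) (use ZD(1) in auto)
  have eZ: "e m \<in> lin (F m) ?Z"
    using K.linearD[OF e_lin[of m]] e_Z by (intro K.linearI) simp_all
  have uniq: "id_tensor K P (H m) (\<lambda>z. B m +>\<^bsub>F m\<^esub> z) y = tmap (H m) 1 (\<kappa> m) (\<rho>F m z)"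
    if z': "z' \<in> B m +>\<^bsub>F m\<^esub> z" and y: "y \<in> carrier (T 1 ?Z)" "id_tensor K P (F m) (\<lambda>z. z) y = \<rho>F m z'" for z' y
  proof -
    have y': "tmap (F m) 1 (\<lambda>z. z) y = \<rho>F m z'" using y(2) id_tensor_eq_tmap[OF mZ mF incl y(1)] by simp
    have "id_tensor K P (H m) (\<lambda>z. B m +>\<^bsub>F m\<^esub> z) y = tmap (H m) 1 (\<lambda>z. B m +>\<^bsub>F m\<^esub> z) y"
      by (rule id_tensor_eq_tmap[OF mZ mH coset_lin y(1)])
    also have "\<dots> = tmap (H m) 1 (\<lambda>z. \<kappa> m z) y"
      by (rule tmap_cong[OF mZ mH coset_lin y(1)]) (simp add: \<kappa>_Z)
    also have "\<dots> = tmap (H m) 1 (\<kappa> m) (tmap (F m) 1 (\<lambda>z. z) y)"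
      by (rule tmap_comp[OF mZ mF mH incl \<kappa>_lin y(1), symmetric])
    finally have 1: "id_tensor K P (H m) (\<lambda>z. B m +>\<^bsub>F m\<^esub> z) y = tmap (H m) 1 (\<kappa> m) (\<rho>F m z')" unfolding y' .
    have z'': "z' \<in> carrier (F m)" "z' \<ominus>\<^bsub>F m\<^esub> z \<in> B m"
      using z' unfolding K.mem_coset_iff[OF mF FH(2) ZD(1)[OF z]] by blast+
    have l: "(\<lambda>x. tmap (H m) 1 (\<kappa> m) (\<rho>F m x)) \<in> lin (F m) (T 1 (H m))"
      by (rule K.linear_comp[OF tmap_lin[OF mF mH \<kappa>_lin] left_comoduleD(2)[OF com]])
    have "tmap (H m) 1 (\<kappa> m) (\<rho>F m z') \<ominus>\<^bsub>T 1 (H m)\<^esub> tmap (H m) 1 (\<kappa> m) (\<rho>F m z) = \<zero>\<^bsub>T 1 (H m)\<^esub>"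
      unfolding K.linear_minus[OF mF module_T[OF mH] l z''(1) ZD(1)[OF z], symmetric] by (rule tmap_\<kappa>_B[OF z''(2)])
    then have "tmap (H m) 1 (\<kappa> m) (\<rho>F m z') = tmap (H m) 1 (\<kappa> m) (\<rho>F m z)"
      by (rule iffD1[OF abelian_group.minus_eq_zero_iff[OF module.axioms(2)[OF module_T[OF mH]]
          K.linearD(1)[OF l z''(1)] K.linearD(1)[OF l ZD(1)[OF z]]]])
    then show ?thesis unfolding 1 .
  qed
  define y where "y = tmap ?Z 1 (e m) (\<rho>F m z)"
  have rz: "\<rho>F m z \<in> carrier (T 1 (F m))" by (rule \<rho>F_closed[OF ZD(1)[OF z]])
  have y: "y \<in> carrier (T 1 ?Z)" unfolding y_def by (rule tmap_closed[OF mF mZ eZ rz])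
  have "id_tensor K P (F m) (\<lambda>z. z) y = tmap (F m) 1 (\<lambda>z. z) y"
    by (rule id_tensor_eq_tmap[OF mZ mF incl y])
  also have "\<dots> = tmap (F m) 1 (e m) (\<rho>F m z)" unfolding y_def by (rule tmap_comp[OF mF mZ mF eZ incl rz])
  also have "\<dots> = \<rho>F m z" by (rule tmap_e_coaction[OF z])
  finally have yz: "id_tensor K P (F m) (\<lambda>z. z) y = \<rho>F m z" .
  note zz = K.mem_coset_self[OF mF FH(2) ZD(1)[OF z]]
  show ?thesis unfolding cohomology_coaction_def Let_def
  proof (rule the_equality)
    show "\<exists>z'\<in>B m +>\<^bsub>F m\<^esub> z. \<exists>y\<in>carrier (T 1 ?Z). id_tensor K P (F m) (\<lambda>z. z) y = \<rho>F m z' \<and>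
        tmap (H m) 1 (\<kappa> m) (\<rho>F m z) = id_tensor K P (H m) (\<lambda>z. B m +>\<^bsub>F m\<^esub> z) y"
      by (intro bexI[where x = z] bexI[where x = y] conjI yz uniq[OF zz y yz, symmetric] y zz)
    fix t
    assume "\<exists>z'\<in>B m +>\<^bsub>F m\<^esub> z. \<exists>y\<in>carrier (T 1 ?Z). id_tensor K P (F m) (\<lambda>z. z) y = \<rho>F m z' \<and>
        t = id_tensor K P (H m) (\<lambda>z. B m +>\<^bsub>F m\<^esub> z) y"
    then show "t = tmap (H m) 1 (\<kappa> m) (\<rho>F m z)" by (elim bexE conjE) (simp only: uniq)
  qed
qed

lemma \<rho>H_\<kappa>: "x \<in> carrier (F m) \<Longrightarrow> \<rho>H m (\<kappa> m x) = tmap (H m) 1 (\<kappa> m) (\<rho>F m (e m x))"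
  unfolding \<kappa>_def[of m x] by (rule \<rho>H_coset[OF e_Z])

text \<open>A linear section of the class map. The outer \<open>e\<close> moves its values into the
  cocycles and leaves the classes unchanged.\<close>

definition j :: "nat \<Rightarrow> 'f set \<Rightarrow> 'f"
  where "j m = (\<lambda>x. e m ((SOME g. g \<in> lin (H m) (F m) \<and> (\<forall>x\<in>carrier (F m). \<kappa> m (g (\<kappa> m x)) = \<kappa> m x)) x))"

lemma \<kappa>_e: assumes "x \<in> carrier (F m)" shows "\<kappa> m (e m x) = \<kappa> m x"
  unfolding \<kappa>_def e_fix[OF e_Z[OF assms]] ..

lemma j: "j m \<in> lin (H m) (F m)" "x \<in> carrier (H m) \<Longrightarrow> j m x \<in> Z m" "x \<in> carrier (H m) \<Longrightarrow> \<kappa> m (j m x) = x"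
proof -
  let ?P = "\<lambda>g. g \<in> lin (H m) (F m) \<and> (\<forall>x\<in>carrier (F m). \<kappa> m (g (\<kappa> m x)) = \<kappa> m x)"
  have "\<exists>g. ?P g" using K.exists_pseudo_inverse[OF mF mH \<kappa>_lin, of m] unfolding Bex_def .
  from someI_ex[OF this] have g: "(SOME g. ?P g) \<in> lin (H m) (F m)"
    "\<And>x. x \<in> carrier (F m) \<Longrightarrow> \<kappa> m ((SOME g. ?P g) (\<kappa> m x)) = \<kappa> m x" by blast+
  show "j m \<in> lin (H m) (F m)" unfolding j_def by (rule K.linear_comp[OF e_lin g(1)])
  assume x: "x \<in> carrier (H m)"
  note gx = K.linearD(1)[OF g(1) x]
  show "j m x \<in> Z m" unfolding j_def by (rule e_Z[OF gx])
  obtain z where z: "z \<in> Z m" "x = \<kappa> m z" using H_elem[OF x] .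
  show "\<kappa> m (j m x) = x" unfolding j_def \<kappa>_e[OF gx] unfolding z(2) by (rule g(2)[OF ZD(1)[OF z(1)]])
qed

lemmas j_closed = K.linearD(1)[OF j(1)]

text \<open>This exhibits the identity, \<open>j m\<close> and \<open>\<kappa> m\<close> as a triple
  for \<open>tiota_tmap\<close>, although the section \<open>j m\<close> is merely linear.\<close>

lemma \<rho>H_j: assumes "x \<in> carrier (H m)" shows "\<rho>H m x = tmap (H m) 1 (\<kappa> m) (\<rho>F m (j m x))"
  using \<rho>H_\<kappa>[OF j_closed[OF assms]] unfolding j(3)[OF assms] e_fix[OF j(2)[OF assms]] .

lemma \<rho>H_lin: "\<rho>H m \<in> lin (H m) (T 1 (H m))"
  by (rule iffD2[OF K.linear_cong[OF mH \<rho>H_j]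
        K.linear_comp[OF tmap_lin[OF mF mH \<kappa>_lin] left_comoduleD(4)[OF com j(1)]]])

lemma comH: "left_comodule K P (H m) (\<rho>H m)"
proof (rule left_comodule_image[OF com mH \<rho>H_lin \<kappa>_lin e_lin \<rho>H_\<kappa>])
  fix x assume "x \<in> carrier (H m)"
  then obtain z where z: "z \<in> Z m" "x = \<kappa> m z" using H_elem by blast
  show "\<exists>z\<in>carrier (F m). x = \<kappa> m z \<and> e m z = z \<and> tmap (F m) 1 (e m) (\<rho>F m z) = \<rho>F m z"
    by (intro bexI[where x = z] conjI z(2) e_fix[OF z(1)] tmap_e_coaction[OF z(1)] ZD(1)[OF z(1)])
qed

end

context hopf_algebra
begin

lemma coinvariants_tensor:
  assumes "left_comodule K P V \<rho>"
  shows "coinvariants K P (T n V) (tensor_coaction K P n V \<rho>) = (T n V)\<lparr>carrier := coinv (T n V) (cact V \<rho> n)\<rparr>"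
proof -
  note V = left_comoduleD[OF assms]
  have "coinv (T n V) (tensor_coaction K P n V \<rho>) = coinv (T n V) (cact V \<rho> n)"
    unfolding coinv_def by (rule Collect_cong) (rule conj_cong[OF refl], simp only: tensor_coaction_eq[OF V(1,2)])
  then show ?thesis unfolding coinvariants_eq by simp
qed

lemma coinv_lin:
  assumes "module K V" "module K W" "equivariant V \<rho>V W \<rho>W f"
  shows "f \<in> lin (V\<lparr>carrier := coinv V \<rho>V\<rparr>) (W\<lparr>carrier := coinv W \<rho>W\<rparr>)"
  by (rule K.linear_restrict[OF equivariantD(1)[OF assms(3)] _ equivariant_coinv[OF assms]]) (auto simp: coinv_def)

lemma coinvD: "v \<in> coinv V \<rho> \<Longrightarrow> v \<in> carrier V"
  by (simp add: coinv_def)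

end

section \<open>Vertical cohomology of the coinvariants\<close>

context comodule_complex
begin

abbreviation "I n m \<equiv> coinv (T (Suc n) (F m)) (cact (F m) (\<rho>F m) (Suc n))"
abbreviation "J n m \<equiv> coinv (T (Suc n) (H m)) (cact (H m) (\<rho>H m) (Suc n))"
abbreviation "v n m \<equiv> tmap (F (Suc m)) (Suc n) (d m)"
abbreviation "kap n m \<equiv> tmap (H m) (Suc n) (\<kappa> m)"

text \<open>\<open>\<rho>H_\<kappa>\<close> describes the coaction of \<open>\<kappa> m x\<close>
  only through \<open>e m x\<close>. A vertical cocycle is unchanged by
  \<open>id \<otimes> e\<close>, so its coinvariance passes to its image.\<close>

lemma kap_coinv:
  assumes "t \<in> I n m" "v n m t = \<zero>\<^bsub>T (Suc n) (F (Suc m))\<^esub>"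
  shows "kap n m t \<in> J n m"
proof -
  note tc = coinvD[OF assms(1)]
  have "cact (H m) (\<rho>H m) (Suc n) (kap n m t) =
      tmap (T (Suc n) (H m)) 1 (kap n m) (cact (F m) (\<rho>F m) (Suc n) (tmap (F m) (Suc n) (e m) t))"
    by (rule cact_tmap[OF com comH mF \<kappa>_lin e_lin \<kappa>_lin \<rho>H_\<kappa> tc])
  also have "\<dots> = tmap (T (Suc n) (H m)) 1 (kap n m) (pt (T (Suc n) (F m)) [\<one>\<^bsub>P\<^esub>] t)"
    unfolding tmap_e_fix[OF tc assms(2)] using assms(1) by (simp add: coinv_def)
  also have "\<dots> = pt (T (Suc n) (H m)) [\<one>\<^bsub>P\<^esub>] (kap n m t)"
    by (rule tmap_pure1[OF module_T[OF mF] module_T[OF mH] tmap_lin[OF mF mH \<kappa>_lin] P.one_closed tc])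
  finally show ?thesis unfolding coinv_def using tmap_closed[OF mF mH \<kappa>_lin tc] by simp
qed

text \<open>A coinvariant is \<open>tiota\<close> of its reduction \<open>s\<close>, and
  \<open>s\<close> is lifted linearly by \<open>j\<close>. Naturality of \<open>tiota\<close> for
  the triple (identity, \<open>j\<close>, \<open>\<kappa>\<close>) shows that the lift maps to
  \<open>t\<close>, and for the triple (zero, \<open>j\<close>, \<open>d\<close>) that it is a
  vertical cocycle.\<close>

lemma kap_surj:
  assumes t: "t \<in> J n m"
  shows "\<exists>x\<in>I n m. v n m x = \<zero>\<^bsub>T (Suc n) (F (Suc m))\<^esub> \<and> kap n m x = t"
proof -
  define s where "s = tev (H m) n t"
  have s: "s \<in> carrier (T n (H m))" unfolding s_def by (rule tev_closed[OF comH coinvD[OF t]])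
  define x where "x = tiota (F m) (\<rho>F m) n (tmap (F m) n (j m) s)"
  have x: "x \<in> I n m" unfolding x_def by (rule tiota_coinv[OF com tmap_closed[OF mH mF j(1) s]])
  have "kap n m x = tiota (H m) (\<rho>H m) n (tmap (H m) n (\<lambda>y. y) s)"
    unfolding x_def by (rule tiota_tmap[OF com comH mH K.linear_id j(1) \<kappa>_lin \<rho>H_j s, symmetric])
  also have "\<dots> = t" unfolding tmap_id[OF mH s] unfolding s_def by (rule coinv_eq_tiota[OF comH t, symmetric])
  finally have k: "kap n m x = t" .
  have z: "\<rho>F (Suc m) \<zero>\<^bsub>F (Suc m)\<^esub> = tmap (F (Suc m)) 1 (d m) (\<rho>F m (j m y))" if "y \<in> carrier (H m)" for y
    unfolding tmap_d_coaction[OF j(2)[OF that]]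
    by (rule K.linear_zero[OF mF module_T[OF mF] left_comoduleD(2)[OF com]])
  have "v n m x = tiota (F (Suc m)) (\<rho>F (Suc m)) n (tmap (F (Suc m)) n (\<lambda>y. \<zero>\<^bsub>F (Suc m)\<^esub>) s)"
    unfolding x_def by (rule tiota_tmap[OF com com mH K.linear_const_zero[OF mF] j(1) d_lin z s, symmetric])
  also have "\<dots> = \<zero>\<^bsub>T (Suc n) (F (Suc m))\<^esub>" unfolding tmap_zero[OF mH mF s]
    by (rule K.linear_zero[OF module_T[OF mF] module_T[OF mF] tiota_lin[OF com]])
  finally show ?thesis using x k by blast
qed

lemma v_v: assumes "t \<in> carrier (T (Suc n) (F m))" shows "v n (Suc m) (v n m t) = \<zero>\<^bsub>T (Suc n) (F (Suc (Suc m)))\<^esub>"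
proof -
  have "v n (Suc m) (v n m t) = tmap (F (Suc (Suc m))) (Suc n) (\<lambda>x. d (Suc m) (d m x)) t"
    by (rule tmap_comp[OF mF mF mF d_lin d_lin assms])
  also have "\<dots> = tmap (F (Suc (Suc m))) (Suc n) (\<lambda>x. \<zero>\<^bsub>F (Suc (Suc m))\<^esub>) t"
    by (rule tmap_cong[OF mF mF K.linear_comp[OF d_lin d_lin] assms d_d])
  also have "\<dots> = \<zero>\<^bsub>T (Suc n) (F (Suc (Suc m)))\<^esub>" by (rule tmap_zero[OF mF mF assms])
  finally show ?thesis .
qed

text \<open>The map \<open>r = e - j \<kappa>\<close> takes values in the coboundaries, and
  \<open>id \<otimes> r\<close> fixes \<open>t\<close>; composing with \<open>dinv\<close> yields a
  preimage \<open>y\<close> of \<open>t\<close> that need not be coinvariant. Reducing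
  \<open>y\<close> by \<open>tev\<close> and returning by \<open>tiota\<close> gives a coinvariant
  preimage, since both are natural and \<open>t\<close> itself is recovered.\<close>

lemma kap_zero:
  assumes t: "t \<in> I n m" "v n m t = \<zero>\<^bsub>T (Suc n) (F (Suc m))\<^esub>" "kap n m t = \<zero>\<^bsub>T (Suc n) (H m)\<^esub>"
  shows "case m of 0 \<Rightarrow> t = \<zero>\<^bsub>T (Suc n) (F m)\<^esub> | Suc k \<Rightarrow> \<exists>x\<in>I n k. t = v n k x"
proof -
  note tc = coinvD[OF t(1)]
  define r where "r x = e m x \<ominus>\<^bsub>F m\<^esub> j m (\<kappa> m x)" for x
  have jk: "(\<lambda>x. j m (\<kappa> m x)) \<in> lin (F m) (F m)" by (rule K.linear_comp[OF j(1) \<kappa>_lin])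
  have r_lin: "r \<in> lin (F m) (F m)" unfolding r_def[abs_def] by (rule K.linear_minus_fun[OF mF e_lin jk])
  have r_B: "r x \<in> B m" if x: "x \<in> carrier (F m)" for x
  proof -
    note jx = j(2)[OF \<kappa>_closed[OF x]] and ex = e_Z[OF x]
    have rZ: "r x \<in> Z m" unfolding r_def by (rule ZD(6)[OF ex jx])
    have "\<kappa> m (r x) = \<kappa> m (e m x) \<ominus>\<^bsub>H m\<^esub> \<kappa> m (j m (\<kappa> m x))"
      unfolding r_def by (rule K.linear_minus[OF mF mH \<kappa>_lin ZD(1)[OF ex] ZD(1)[OF jx]])
    also have "\<dots> = \<zero>\<^bsub>H m\<^esub>" unfolding \<kappa>_e[OF x] j(3)[OF \<kappa>_closed[OF x]]
      by (rule abelian_group.minus_self[OF module.axioms(2)[OF mH] \<kappa>_closed[OF x]])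
    finally show ?thesis by (rule iffD1[OF \<kappa>_zero_iff[OF rZ]])
  qed
  have "tmap (F m) (Suc n) r t = tmap (F m) (Suc n) (e m) t \<ominus>\<^bsub>T (Suc n) (F m)\<^esub> tmap (F m) (Suc n) (\<lambda>x. j m (\<kappa> m x)) t"
    unfolding r_def[abs_def] by (rule tmap_minus[OF mF mF e_lin jk tc])
  also have "tmap (F m) (Suc n) (\<lambda>x. j m (\<kappa> m x)) t = tmap (F m) (Suc n) (j m) (kap n m t)"
    by (rule tmap_comp[OF mF mH mF \<kappa>_lin j(1) tc, symmetric])
  also have "\<dots> = \<zero>\<^bsub>T (Suc n) (F m)\<^esub>" unfolding t(3)
    by (rule K.linear_zero[OF module_T[OF mH] module_T[OF mF] tmap_lin[OF mH mF j(1)]])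
  finally have tr: "tmap (F m) (Suc n) r t = t" unfolding tmap_e_fix[OF tc t(2)]
    using abelian_group.minus_zero_right[OF module.axioms(2)[OF module_T[OF mF]] tc] by simp
  show ?thesis
  proof (cases m)
    case 0
    have "tmap (F m) (Suc n) r t = tmap (F m) (Suc n) (\<lambda>x. \<zero>\<^bsub>F m\<^esub>) t"
      by (rule tmap_cong[OF mF mF r_lin tc]) (use r_B 0 in \<open>simp add: coboundaries_def\<close>)
    then have "t = \<zero>\<^bsub>T (Suc n) (F m)\<^esub>" unfolding tr tmap_zero[OF mF mF tc] .
    then show ?thesis using 0 by simp
  next
    case (Suc k)
    have rd: "r x = d k (dinv k (r x))" if x: "x \<in> carrier (F m)" for x
    proof -
      obtain w where w: "w \<in> carrier (F k)" "r x = d k w" using r_B[OF x] by (auto simp: coboundaries_def Suc)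
      show ?thesis unfolding w(2) by (rule dinv(2)[OF w(1), symmetric])
    qed
    have bl: "(\<lambda>x. dinv k (r x)) \<in> lin (F m) (F k)"
      using K.linear_comp[OF dinv(1), of r "F m" k] r_lin unfolding Suc by blast
    have tS: "t \<in> carrier (T (Suc n) (F (Suc k)))" and tI: "t \<in> I n (Suc k)" using tc t(1) unfolding Suc by simp_all
    define y where "y = tmap (F k) (Suc n) (\<lambda>x. dinv k (r x)) t"
    have y: "y \<in> carrier (T (Suc n) (F k))" unfolding y_def by (rule tmap_closed[OF mF mF bl tc])
    have "v n k y = tmap (F (Suc k)) (Suc n) (\<lambda>x. d k (dinv k (r x))) t"
      unfolding y_def by (rule tmap_comp[OF mF mF mF bl d_lin tc])
    also have "\<dots> = tmap (F m) (Suc n) r t"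
      unfolding Suc[symmetric] by (rule tmap_cong[OF mF mF r_lin tc rd, symmetric])
    finally have ty: "t = v n k y" unfolding tr by simp
    have ev: "tev (F k) n y \<in> carrier (T n (F k))" by (rule tev_closed[OF com y])
    have "t = tiota (F (Suc k)) (\<rho>F (Suc k)) n (tev (F (Suc k)) n t)" by (rule coinv_eq_tiota[OF com tI])
    also have "tev (F (Suc k)) n t = tmap (F (Suc k)) n (d k) (tev (F k) n y)"
      unfolding ty by (rule tev_tmap[OF com com d_lin y])
    also have "tiota (F (Suc k)) (\<rho>F (Suc k)) n \<dots> = v n k (tiota (F k) (\<rho>F k) n (tmap (F k) n (\<lambda>x. x) (tev (F k) n y)))"
      by (rule tiota_tmap[OF com com mF d_lin K.linear_id d_lin d_coaction ev])
    finally have "t = v n k (tiota (F k) (\<rho>F k) n (tev (F k) n y))" unfolding tmap_id[OF mF ev] .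
    then show ?thesis using tiota_coinv[OF com ev] Suc by auto
  qed
qed

end

section \<open>Exact rows from the action\<close>

locale acted_comodule_complex = comodule_complex K P F \<rho>F d
  for K :: "('k, 'a) ring_scheme" (structure) and P :: "('k, 'p, 'b) hopf_structure_scheme" (structure)
    and F :: "nat \<Rightarrow> ('k, 'f, 'c) module_scheme" and \<rho>F d +
  fixes act :: "nat \<Rightarrow> ('k, 'p, 'f) tensors \<Rightarrow> 'f"
  assumes act_one: "x \<in> carrier (F n) \<Longrightarrow> act n (pt (F n) [\<one>\<^bsub>P\<^esub>] x) = x"
    and act_equivariant: "equivariant (T 1 (F n)) (cact (F n) (\<rho>F n) 1) (F n) (\<rho>F n) (act n)"
begin

lemmas act_lin = equivariantD(1)[OF act_equivariant]

abbreviation "u s x \<equiv> tdiff (F s) 0 (pt (F s) [] x)"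

lemma u_equivariant: "equivariant (F s) (\<rho>F s) (T (Suc 0) (F s)) (cact (F s) (\<rho>F s) (Suc 0)) (u s)"
  by (rule equivariant_comp[OF mF module_T[OF mF] module_T[OF mF] \<rho>F_closed equivariant_pure0[OF com] tdiff_equivariant[OF com]])

text \<open>By unitality the action is a left inverse of the augmentation
  \<open>x \<mapsto> 1 \<otimes> x\<close>, which is therefore injective.\<close>

lemma act_u: "x \<in> carrier (F s) \<Longrightarrow> act s (u s x) = x"
  by (simp add: tcons_pure0[OF mF] act_one)

text \<open>The preimage from \<open>tdiff_exact\<close> is a scalar multiple of the value of an
  equivariant map at \<open>x\<close>, hence again coinvariant.\<close>

lemma tdiff_coinv_exact:
  assumes "x \<in> I (Suc n) m" "tdiff (F m) (Suc (Suc n)) x = \<zero>\<^bsub>T (Suc (Suc (Suc n))) (F m)\<^esub>"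
  shows "\<exists>y\<in>I n m. x = tdiff (F m) (Suc n) y"
proof -
  obtain c where c: "c \<in> carrier K" "x = tdiff (F m) (Suc n) (c \<odot>\<^bsub>T (Suc n) (F m)\<^esub> hcontr (F m) (act m) (Suc n) x)"
    using tdiff_exact[OF mF act_lin act_one coinvD[OF assms(1)] assms(2)] by blast
  have "hcontr (F m) (act m) (Suc n) x \<in> I n m"
    by (rule equivariant_coinv[OF module_T[OF mF] module_T[OF mF] hcontr_equivariant[OF com act_equivariant] assms(1)])
  then have "c \<odot>\<^bsub>T (Suc n) (F m)\<^esub> hcontr (F m) (act m) (Suc n) x \<in> I n m"
    by (rule K.submoduleD(4)[OF module_T[OF mF] submodule_coinv[OF module_T[OF mF] cact_lin[OF mF left_comoduleD(2)[OF com]]] c(1)])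
  then show ?thesis using c(2) by blast
qed

text \<open>At column zero the homotopy is the action itself, landing in \<open>F s\<close>;
  covariance makes \<open>act s a\<close> coinvariant, so the cocycle \<open>a\<close> is the
  augmentation of a coinvariant.\<close>

lemma u_surj:
  assumes "a \<in> I 0 s" "tdiff (F s) (Suc 0) a = \<zero>\<^bsub>T (Suc (Suc 0)) (F s)\<^esub>"
  shows "\<exists>x\<in>coinv (F s) (\<rho>F s). a = u s x"
proof -
  obtain c where c: "c \<in> carrier K" "a = tdiff (F s) 0 (c \<odot>\<^bsub>T 0 (F s)\<^esub> hcontr (F s) (act s) 0 a)"
    using tdiff_exact[OF mF act_lin act_one coinvD[OF assms(1)] assms(2)] by blast
  have a: "a \<in> coinv (T 1 (F s)) (cact (F s) (\<rho>F s) 1)" using assms(1) by (simp add: One_nat_def)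
  have x: "act s a \<in> coinv (F s) (\<rho>F s)"
    by (rule equivariant_coinv[OF module_T[OF mF] mF act_equivariant a])
  have "c \<odot>\<^bsub>F s\<^esub> act s a \<in> coinv (F s) (\<rho>F s)"
    by (rule K.submoduleD(4)[OF mF submodule_coinv[OF mF left_comoduleD(2)[OF com]] c(1) x])
  moreover have "c \<odot>\<^bsub>T 0 (F s)\<^esub> hcontr (F s) (act s) 0 a = pt (F s) [] (c \<odot>\<^bsub>F s\<^esub> act s a)"
    using K.linearD(3)[OF pure_lin[OF mF] c(1) coinvD[OF x]] by simp
  ultimately show ?thesis using c(2) by metis
qed

abbreviation "A n m \<equiv> (T (Suc n) (F m))\<lparr>carrier := I n m\<rparr>"
abbreviation "C n m \<equiv> (T (Suc n) (H m))\<lparr>carrier := J n m\<rparr>"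

lemma cocycles_A: "cocycles (A n) (v n) m = {x \<in> I n m. v n m x = \<zero>\<^bsub>T (Suc n) (F (Suc m))\<^esub>}"
  unfolding K.cocycles_eq by simp

text \<open>Joins the two directions: rows are exact and augmented by the coinvariants of
  \<open>F\<close>, while the vertical cohomology is \<open>C\<close>, the complex of coinvariants
  that defines the Hopf cohomology of \<open>H m\<close>.\<close>

lemma quadrant: "quadrant_complex K A (\<lambda>n m. tdiff (F m) (Suc n)) v C (\<lambda>n m. hopf_differential K P (H m) n) kap
    (\<lambda>s. (F s)\<lparr>carrier := coinv (F s) (\<rho>F s)\<rparr>) d u"
proof (rule quadrant_complex.intro[OF K.field_axioms quadrant_complex_axioms.intro])
  have sI: "submodule (I n m) K (T (Suc n) (F m))" for n m
    by (rule submodule_coinv[OF module_T[OF mF] cact_lin[OF mF left_comoduleD(2)[OF com]]])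
  have sJ: "submodule (J n m) K (T (Suc n) (H m))" for n m
    by (rule submodule_coinv[OF module_T[OF mH] cact_lin[OF mH left_comoduleD(2)[OF comH]]])
  fix n m s
  show mA: "module K (A n m)" by (rule K.module_submodule[OF module_T[OF mF] sI])
  show mC: "module K (C n m)" by (rule K.module_submodule[OF module_T[OF mH] sJ])
  show "tdiff (F m) (Suc n) \<in> lin (A n m) (A (Suc n) m)"
    by (rule coinv_lin[OF module_T[OF mF] module_T[OF mF] tdiff_equivariant[OF com]])
  show "v n m \<in> lin (A n m) (A n (Suc m))"
    by (rule coinv_lin[OF module_T[OF mF] module_T[OF mF] equivariant_tmap[OF com com d_equivariant]])
  \<comment> \<open>The horizontal differential on \<open>C\<close> keeps its original form, so that
    the second page is the Hopf cohomology by unfolding; its properties are imported from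
    \<open>tdiff\<close>.\<close>
  have hd: "hopf_differential K P (H m) n c = tdiff (H m) (Suc n) c" if "c \<in> carrier (C n m)" for c n
    by (rule hopf_differential_eq[OF mH coinvD]) (use that in simp)
  have tl: "tdiff (H m) (Suc n) \<in> lin (C n m) (C (Suc n) m)" for n
    by (rule coinv_lin[OF module_T[OF mH] module_T[OF mH] tdiff_equivariant[OF comH]])
  show "hopf_differential K P (H m) n \<in> lin (C n m) (C (Suc n) m)"
    by (rule iffD2[OF K.linear_cong[OF mC hd] tl])
  show "hopf_differential K P (H m) (Suc n) (hopf_differential K P (H m) n c) = \<zero>\<^bsub>C (Suc (Suc n)) m\<^esub>"
    if c: "c \<in> carrier (C n m)" for c
    unfolding hd[OF c] hd[OF K.linearD(1)[OF tl c]]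
    using tdiff_tdiff[OF mH coinvD, of c] c by (simp del: tdiff.simps cact.simps)
  have vk: "kap n m \<in> lin ((T (Suc n) (F m))\<lparr>carrier := cocycles (A n) (v n) m\<rparr>) (C n m)"
  proof (rule K.linear_restrict[OF tmap_lin[OF mF mH \<kappa>_lin]])
    show "cocycles (A n) (v n) m \<subseteq> carrier (T (Suc n) (F m))" unfolding cocycles_A by (rule subsetI, erule CollectE, erule conjE, erule coinvD)
    show "x \<in> cocycles (A n) (v n) m \<Longrightarrow> kap n m x \<in> J n m" for x unfolding cocycles_A using kap_coinv by blast
  qed
  then show "kap n m \<in> lin ((A n m)\<lparr>carrier := cocycles (A n) (v n) m\<rparr>) (C n m)" by simp
  show "\<exists>z\<in>cocycles (A n) (v n) m. c = kap n m z" if "c \<in> carrier (C n m)" for c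
    using kap_surj[of c n m] that unfolding cocycles_A by auto
  show "module K ((F s)\<lparr>carrier := coinv (F s) (\<rho>F s)\<rparr>)"
    by (rule K.module_submodule[OF mF submodule_coinv[OF mF left_comoduleD(2)[OF com]]])
  show "d s \<in> lin ((F s)\<lparr>carrier := coinv (F s) (\<rho>F s)\<rparr>) ((F (Suc s))\<lparr>carrier := coinv (F (Suc s)) (\<rho>F (Suc s))\<rparr>)"
    by (rule coinv_lin[OF mF mF d_equivariant])
  show "u s \<in> lin ((F s)\<lparr>carrier := coinv (F s) (\<rho>F s)\<rparr>) (A 0 s)"
    by (rule coinv_lin[OF mF module_T[OF mF] u_equivariant])
  {
    fix z assume "z \<in> cocycles (A n) (v n) m"
    then have z: "z \<in> I n m" "v n m z = \<zero>\<^bsub>T (Suc n) (F (Suc m))\<^esub>" unfolding cocycles_A by blast+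
    have "kap n m z = \<zero>\<^bsub>T (Suc n) (H m)\<^esub> \<longleftrightarrow> z \<in> coboundaries (A n) (v n) m"
    proof
      assume "kap n m z = \<zero>\<^bsub>T (Suc n) (H m)\<^esub>"
      from kap_zero[OF z this] show "z \<in> coboundaries (A n) (v n) m"
        by (cases m) (auto simp: coboundaries_def)
    next
      assume b: "z \<in> coboundaries (A n) (v n) m"
      show "kap n m z = \<zero>\<^bsub>T (Suc n) (H m)\<^esub>"
      proof (cases m)
        case 0
        then have "z = \<zero>\<^bsub>T (Suc n) (F m)\<^esub>" using b by (simp add: coboundaries_def)
        then show ?thesis using K.linear_zero[OF module_T[OF mF] module_T[OF mH] tmap_lin[OF mF mH \<kappa>_lin]] by simp
      next
        case (Suc k)
        then obtain x where x: "x \<in> I n k" "z = v n k x" using b by (auto simp: coboundaries_def)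
        show ?thesis unfolding x(2) Suc by (rule tmap_\<kappa>_d[OF coinvD[OF x(1)]])
      qed
    qed
    then show "kap n m z = \<zero>\<^bsub>C n m\<^esub> \<longleftrightarrow> z \<in> coboundaries (A n) (v n) m" by simp
    have "kap n m z \<in> carrier (C n m)" using kap_coinv[OF z] by simp
    then show "kap (Suc n) m (tdiff (F m) (Suc n) z) = hopf_differential K P (H m) n (kap n m z)"
      using hd tdiff_tmap[OF mF mH \<kappa>_lin coinvD[OF z(1)]] by simp
  next
    fix x assume "x \<in> carrier (A n m)"
    then have x: "x \<in> carrier (T (Suc n) (F m))" using coinvD by auto
    show "tdiff (F m) (Suc (Suc n)) (tdiff (F m) (Suc n) x) = \<zero>\<^bsub>A (Suc (Suc n)) m\<^esub>" using tdiff_tdiff[OF mF x] by simp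
    show "v n (Suc m) (v n m x) = \<zero>\<^bsub>A n (Suc (Suc m))\<^esub>" using v_v[OF x] by simp
    show "tdiff (F (Suc m)) (Suc n) (v n m x) = v (Suc n) m (tdiff (F m) (Suc n) x)"
      by (rule tdiff_tmap[OF mF mF d_lin x])
  next
    fix x assume "x \<in> carrier (A (Suc n) m)" "tdiff (F m) (Suc (Suc n)) x = \<zero>\<^bsub>A (Suc (Suc n)) m\<^esub>"
    then show "\<exists>y\<in>carrier (A n m). x = tdiff (F m) (Suc n) y" using tdiff_coinv_exact[of x n m] by simp
  next
    fix w assume "w \<in> carrier ((F s)\<lparr>carrier := coinv (F s) (\<rho>F s)\<rparr>)"
    then have w: "w \<in> carrier (F s)" using coinvD by auto
    have p: "pt (F s) [] w \<in> carrier (T 0 (F s))" by (rule pure0_closed[OF mF w])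
    show "d (Suc s) (d s w) = \<zero>\<^bsub>(F (Suc (Suc s)))\<lparr>carrier := coinv (F (Suc (Suc s))) (\<rho>F (Suc (Suc s)))\<rparr>\<^esub>" using d_d[OF w] by simp
    show "tdiff (F s) (Suc 0) (u s w) = \<zero>\<^bsub>A (Suc 0) s\<^esub>" using tdiff_tdiff[OF mF p] by simp
    have "v 0 s (u s w) = tdiff (F (Suc s)) 0 (tmap (F (Suc s)) 0 (d s) (pt (F s) [] w))"
      by (rule tdiff_tmap[OF mF mF d_lin p, symmetric])
    also have "tmap (F (Suc s)) 0 (d s) (pt (F s) [] w) = pt (F (Suc s)) [] (d s w)"
      by (rule tmap_pure[OF mF mF d_lin]) (simp add: tuples_0 w)
    finally show "v 0 s (u s w) = u (Suc s) (d s w)" .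
    assume "u s w = \<zero>\<^bsub>A 0 s\<^esub>"
    then have "u s w = \<zero>\<^bsub>T 1 (F s)\<^esub>" by (simp add: One_nat_def)
    then show "w = \<zero>\<^bsub>(F s)\<lparr>carrier := coinv (F s) (\<rho>F s)\<rparr>\<^esub>"
      using act_u[OF w] K.linear_zero[OF module_T[OF mF] mF act_lin] by simp
  next
    fix a assume "a \<in> carrier (A 0 s)" "tdiff (F s) (Suc 0) a = \<zero>\<^bsub>A (Suc 0) s\<^esub>"
    then show "\<exists>w\<in>carrier ((F s)\<lparr>carrier := coinv (F s) (\<rho>F s)\<rparr>). a = u s w" using u_surj[of a s] by simp
  }
qed

end

theorem theorem6p3:
  fixes K :: "('k, 'a) ring_scheme"
    and P :: "('k, 'p, 'b) hopf_structure_scheme"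
    and F :: "nat \<Rightarrow> ('k, 'f, 'c) module_scheme"
    and \<rho>F :: "nat \<Rightarrow> 'f \<Rightarrow> ('p list \<times> 'f \<Rightarrow> 'k) set"
    and dbar :: "nat \<Rightarrow> 'f \<Rightarrow> 'f"
    and act :: "nat \<Rightarrow> ('p list \<times> 'f \<Rightarrow> 'k) set \<Rightarrow> 'f"
  assumes "field K"
    and "hopf_algebra K P"
    and "\<And>n. left_comodule K P (F n) (\<rho>F n)"
    and "\<And>n. comodule_map K P (F n) (\<rho>F n) (F (Suc n)) (\<rho>F (Suc n)) (dbar n)"
    and "\<And>n x. x \<in> carrier (F n) \<Longrightarrow> dbar (Suc n) (dbar n x) = \<zero>\<^bsub>F (Suc (Suc n))\<^esub>"
    and "\<And>n. left_action K P (F n) (act n)"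
    and "\<And>n. comodule_map K P (tensor K P 1 (F n)) (tensor_coaction K P 1 (F n) (\<rho>F n))
               (F n) (\<rho>F n) (act n)"
  shows "\<exists>(E :: nat \<Rightarrow> int \<Rightarrow> int \<Rightarrow> ('k, ('p list \<times> 'f set \<Rightarrow> 'k) set set) module) D.
    spectral_sequence K E D \<and>
    (\<forall>n m. E 2 (int n) (int m) =
       hopf_cohomology K P (cohomology F dbar m) (cohomology_coaction K P F \<rho>F dbar m) n) \<and>
    converges_to K E
      (cohomology (\<lambda>s. coinvariants K P (F s) (\<rho>F s)) dbar)"
proof -
  interpret hopf_algebra K P by fact
  note com = assms(3)
  note mF = left_comoduleD(1)[OF com]
  have one: "act n (pt (F n) [\<one>\<^bsub>P\<^esub>] x) = x" if "x \<in> carrier (F n)" for n x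
    using assms(6)[of n] that unfolding left_action_def by blast
  \<comment> \<open>The covariance hypothesis speaks of \<open>tensor_coaction\<close> and
    \<open>id_tensor\<close>; it is restated with the recursive \<open>cact\<close> and
    \<open>tmap\<close>.\<close>
  have eqv: "equivariant (T 1 (F n)) (cact (F n) (\<rho>F n) 1) (F n) (\<rho>F n) (act n)" for n
  proof (rule equivariantI)
    have l: "act n \<in> lin (T 1 (F n)) (F n)"
      and q: "\<forall>t\<in>carrier (T 1 (F n)). \<rho>F n (act n t) = id_tensor K P (F n) (act n) (tensor_coaction K P 1 (F n) (\<rho>F n) t)"
      using assms(7)[of n] unfolding comodule_map_def by blast+
    show "act n \<in> lin (T 1 (F n)) (F n)" by (rule l)
    fix t assume t: "t \<in> carrier (T 1 (F n))"
    show "\<rho>F n (act n t) = tmap (F n) 1 (act n) (cact (F n) (\<rho>F n) 1 t)"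
      unfolding bspec[OF q t] tensor_coaction_eq[OF mF left_comoduleD(2)[OF com] t]
      by (rule id_tensor_eq_tmap[OF module_T[OF mF] mF l cact_closed[OF mF left_comoduleD(2)[OF com] t]])
  qed
  interpret acted_comodule_complex K P F \<rho>F dbar act
    by unfold_locales (use assms(3,4,5) one eqv comodule_map_equivariant[OF com com] in blast)+
  interpret Q: quadrant_complex K A "\<lambda>n m. tdiff (F m) (Suc n)" v C "\<lambda>n m. hopf_differential K P (H m) n" kap
    "\<lambda>s. (F s)\<lparr>carrier := coinv (F s) (\<rho>F s)\<rparr>" dbar u by (rule quadrant)
  \<comment> \<open>The coinvariants for \<open>tensor_coaction\<close> and for \<open>cact\<close>
    are equal as records, so the second page equals the Hopf cohomology and is not only isomorphic
    to it.\<close>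
  have "hopf_cohomology K P (H m) (\<rho>H m) = cohomology (\<lambda>n. C n m) (hopf_differential K P (H m))" for m
    unfolding hopf_cohomology_def coinvariants_tensor[OF comH] Suc_eq_plus1[symmetric] ..
  then show ?thesis using Q.spectral_sequence_exists by (simp add: coinvariants_eq)
qed

end
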